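(* Let $(\Gamma_n)_n$ be any sequence of finite index subgroups of a finitely generated group $\Gamma$, and let $\mathfrak u$ be a non-principal ultrafilter on $\mathbb N$. Assume $\Gamma$ acts freely cocompactly on a simplicial complex $\Sigma$ such that $\Gamma\backslash\Sigma$ is a simplicial complex. Let $a_{\mathfrak u}:\Gamma\curvearrowright X_{\mathfrak u}$ be the ultraproduct of the actions $a_n:\Gamma\curvearrowright\Gamma/\Gamma_n$, let $\mathcal G_{\mathfrak u}$ be the groupoid of $a_{\mathfrak u}$, let $\mathcal N_{\mathfrak u}:=\{(x,\gamma)\in X_{\mathfrak u}\times\Gamma:\gamma x=x\}$ be its maximal totally isotropic subgroupoid, and let $\mathcal R_{\mathfrak u}=\mathcal G_{\mathfrak u}/\mathcal N_{\mathfrak u}$ be the p.m.p. orbit equivalence relation of $a_{\mathfrak u}$. Then for every $i\geq 0$ $$\lim_{n\in\mathfrak u}\frac{b_i(\Gamma_n\backslash\Sigma)}{[\Gamma:\Gamma_n]}=\beta^{(2)}_i\big(\mathcal N_{\mathfrak u}\backslash(X_{\mathfrak u}\times\Sigma),\mathcal R_{\mathfrak u}\big).$$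
   Context: $b_i$ is the usual $i$-th Betti number. $\Gamma/\Gamma_n$ carries the uniform probability measure. $X_{\mathfrak u}=\prod_n(\Gamma/\Gamma_n)/\!\sim_{\mathfrak u}$ (sequences equal for $\mathfrak u$-almost every $n$ identified, classes written $[x_n]_{\mathfrak u}$), with the Loeb probability measure: $\mu_{\mathfrak u}([A_n]_{\mathfrak u})=\lim_{n\in\mathfrak u}|A_n|/[\Gamma:\Gamma_n]$ for $A_n\subset\Gamma/\Gamma_n$, every measurable set being of the form $[A_n]_{\mathfrak u}$ up to a null set. The action is $\gamma[x_n]_{\mathfrak u}=[\gamma x_n]_{\mathfrak u}$. The groupoid $\mathcal G_{\mathfrak u}$ is $X_{\mathfrak u}\times\Gamma$ with $s(x,\gamma)=x$, $t(x,\gamma)=\gamma x$, composition given by multiplication in $\Gamma$, and the product of $\mu_{\mathfrak u}$ and counting measure. Fixed-point sets $\{x:\gamma x=x\}$ are measurable (up to null sets), so $\mathcal N_{\mathfrak u}$ is a measurable normal subgroupoid and $\mathcal R_{\mathfrak u}=\{(x,\gamma x)\}$ is a p.m.p. equivalence relation, with source $s(x,y)=x$, target $t(x,y)=y$, whose $\sigma$-algebra is that of countable unions of sets $\{(x,\gamma x):x\in A\}$, $A\subset X_{\mathfrak u}$ measurable, and whose measure is $\tilde\mu(E)=\int|\{y:(x,y)\in E\}|\,d\mu_{\mathfrak u}(x)$. The $\mathcal R_{\mathfrak u}$-simplicial complex $\Xi:=\mathcal N_{\mathfrak u}\backslash(X_{\mathfrak u}\times\Sigma)$ is the measurable field of simplicial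 complexes over $X_{\mathfrak u}$ whose fibre at $x$ is $\mathrm{Stab}_\Gamma(x)\backslash\Sigma$ (its space $\Xi^{(i)}$ of ordered $i$-simplices with distinct vertices being a quotient of $X_{\mathfrak u}\times\Sigma^{(i)}$, fibred over $X_{\mathfrak u}$ with countable fibres and with measure obtained by integrating counting measure on the fibres). $\mathcal R_{\mathfrak u}$ acts by letting $(x,\gamma x)$ send $\mathrm{Stab}_\Gamma(x)\sigma$ to $\mathrm{Stab}_\Gamma(\gamma x)\gamma\sigma$. $\ell^2$-Betti numbers. A bisection of $\mathcal R_{\mathfrak u}$ is a measurable subset on which $s$ and $t$ are injective. A bisection $\varphi$ acts on $L^2(\Xi^{(i)})$ by $(\varphi f)(v)=f(h^{-1}v)$ if $v$ lies over $t(h)$ with $h\in\varphi$, and $(\varphi f)(v)=0$ if there is no such $h$. The same formula defines an action on $L^2(\mathcal R_{\mathfrak u},\tilde\mu)$ by left multiplication, generating the von Neumann algebra $\mathcal L(\mathcal R_{\mathfrak u})$ with trace $\langle\cdot\,\mathbf 1_{X_{\mathfrak u}},\mathbf 1_{X_{\mathfrak u}}\rangle$, where $X_{\mathfrak u}$ is identified with the diagonal. $C_i^{(2)}(\Xi)$ is the Hilbert $\mathcal L(\mathcal R_{\mathfrak u})$-module of $f\in L^2(\Xi^{(i)})$ antisymmetric under permutations of vertices, $(\partial_if)(v_0,\dots,v_{i-1})=\sum_{v_i:(v_0,\dots,v_i)\in\Xi^{(i)}}f(v_0,\dots,v_i)$, and $\beta_i^{(2)}(\Xi,\mathcal R_{\mathfrak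 u})=\dim_{\mathcal L(\mathcal R_{\mathfrak u})}(\ker\partial_i/\overline{\mathrm{Im}\,\partial_{i+1}})$. *)

theory Defs
  imports
    "HOL-Analysis.Analysis"
    "HOL-Algebra.Group_Action"
    "HOL-Algebra.Left_Coset"
    "HOL-Algebra.Generated_Groups"
    "HOL-Combinatorics.Permutations"
    "HOL-Library.Function_Algebras"
begin

section \<open>Simplicial complexes, chains and Betti numbers\<close>

text \<open>Abstract simplicial complexes, in contrast to the geometric ones of \<open>HOL-Analysis.Polytope\<close>.
  The vertex set of a complex \<open>K\<close> is \<open>\<Union>K\<close>.\<close>

definition abstract_complex :: "'v set set \<Rightarrow> bool" where
  "abstract_complex K \<longleftrightarrow>
     (\<forall>\<sigma>\<in>K. finite \<sigma> \<and> \<sigma> \<noteq> {} \<and> (\<forall>\<tau>. \<tau> \<subseteq> \<sigma> \<and> \<tau> \<noteq> {} \<longrightarrow> \<tau> \<in> K))"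

definition ordered_simplices :: "'v set set \<Rightarrow> nat \<Rightarrow> 'v list set" where
  "ordered_simplices K i = {vs. length vs = Suc i \<and> distinct vs \<and> set vs \<in> K}"

text \<open>Chains are antisymmetric functions on ordered simplices, so each \<open>i\<close>-simplex contributes
  one dimension. The sum below has finite support for the chains of this section and on locally
  finite complexes. Homology is not reduced: the boundary of a \<open>0\<close>-chain is \<open>0\<close>.\<close>

definition simplicial_boundary :: "'v set set \<Rightarrow> nat \<Rightarrow> ('v list \<Rightarrow> complex) \<Rightarrow> 'v list \<Rightarrow> complex" where
  "simplicial_boundary K i f ws =
     (if i = 0 then 0 else (\<Sum>\<^sub>\<infinity>v | ws @ [v] \<in> ordered_simplices K i. f (ws @ [v])))"

definition simplicial_chains :: "'v set set \<Rightarrow> nat \<Rightarrow> ('v list \<Rightarrow> complex) set" where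
  "simplicial_chains K i = {f. finite {vs. f vs \<noteq> 0} \<and> {vs. f vs \<noteq> 0} \<subseteq> ordered_simplices K i \<and>
     (\<forall>\<pi> vs. \<pi> permutes {..<Suc i} \<and> vs \<in> ordered_simplices K i \<longrightarrow>
        f (permute_list \<pi> vs) = of_int (sign \<pi>) * f vs)}"

definition simplicial_cycles :: "'v set set \<Rightarrow> nat \<Rightarrow> ('v list \<Rightarrow> complex) set" where
  "simplicial_cycles K i = {f \<in> simplicial_chains K i. simplicial_boundary K i f = (\<lambda>_. 0)}"

definition simplicial_boundaries :: "'v set set \<Rightarrow> nat \<Rightarrow> ('v list \<Rightarrow> complex) set" where
  "simplicial_boundaries K i = simplicial_boundary K (Suc i) ` simplicial_chains K (Suc i)"

text \<open>The dimension of the \<open>i\<close>-th simplicial homology with complex coefficients of a finite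
  complex (\<open>simplicial_boundaries K i \<subseteq> simplicial_cycles K i\<close>, both finite dimensional).\<close>

definition betti :: "nat \<Rightarrow> 'v set set \<Rightarrow> nat" where
  "betti i K = vector_space.dim (\<lambda>(c::complex) f vs. c * f vs) (simplicial_cycles K i)
             - vector_space.dim (\<lambda>(c::complex) f vs. c * f vs) (simplicial_boundaries K i)"

section \<open>Simplicial actions and quotients\<close>

definition simplicial_action :: "('g, 'm) monoid_scheme \<Rightarrow> 'v set set \<Rightarrow> ('g \<Rightarrow> 'v \<Rightarrow> 'v) \<Rightarrow> bool" where
  "simplicial_action G K act \<longleftrightarrow>
     group_action G (\<Union>K) act \<and> (\<forall>g\<in>carrier G. \<forall>\<sigma>\<in>K. act g ` \<sigma> \<in> K)"

text \<open>Freeness on the geometric realization: a point is fixed by \<open>g\<close> in the realization of some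
  invariant simplex, and every invariant simplex has its barycentre fixed.\<close>

definition free_action :: "('g, 'm) monoid_scheme \<Rightarrow> 'v set set \<Rightarrow> ('g \<Rightarrow> 'v \<Rightarrow> 'v) \<Rightarrow> bool" where
  "free_action G K act \<longleftrightarrow> (\<forall>\<sigma>\<in>K. stabilizer G (\<lambda>g \<tau>. act g ` \<tau>) \<sigma> = {\<one>\<^bsub>G\<^esub>})"

definition cocompact_action :: "('g, 'm) monoid_scheme \<Rightarrow> 'v set set \<Rightarrow> ('g \<Rightarrow> 'v \<Rightarrow> 'v) \<Rightarrow> bool" where
  "cocompact_action G K act \<longleftrightarrow> finite (orbits G K (\<lambda>g \<tau>. act g ` \<tau>))"

text \<open>The cells of the quotient by the whole group are the orbits of simplices. They form a
  simplicial complex if each has as many vertices as its dimension requires and is determined by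
  its vertices. For a free action both properties are inherited by quotients by subgroups.\<close>

definition quotient_is_complex :: "('g, 'm) monoid_scheme \<Rightarrow> 'v set set \<Rightarrow> ('g \<Rightarrow> 'v \<Rightarrow> 'v) \<Rightarrow> bool" where
  "quotient_is_complex G K act \<longleftrightarrow>
     (\<forall>\<sigma>\<in>K. inj_on (orbit G act) \<sigma>) \<and>
     (\<forall>\<sigma>\<in>K. \<forall>\<tau>\<in>K. orbit G act ` \<sigma> = orbit G act ` \<tau> \<longrightarrow> \<tau> \<in> orbit G (\<lambda>g \<rho>. act g ` \<rho>) \<sigma>)"

text \<open>\<open>quotient_complex G L K act\<close> is the quotient of \<open>K\<close> by the subgroup \<open>L\<close>; its vertices
  are \<open>L\<close>-orbits of vertices.\<close>

definition quotient_complex ::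
    "('g, 'm) monoid_scheme \<Rightarrow> 'g set \<Rightarrow> 'v set set \<Rightarrow> ('g \<Rightarrow> 'v \<Rightarrow> 'v) \<Rightarrow> 'v set set set" where
  "quotient_complex G L K act = (\<lambda>\<sigma>. orbit (G\<lparr>carrier := L\<rparr>) act ` \<sigma>) ` K"

section \<open>The ultraproduct of the actions on cosets\<close>

definition nonprincipal_ultrafilter :: "nat filter \<Rightarrow> bool" where
  "nonprincipal_ultrafilter \<U> \<longleftrightarrow> \<U> \<noteq> bot \<and>
     (\<forall>P. eventually P \<U> \<or> eventually (\<lambda>n. \<not> P n) \<U>) \<and>
     (\<forall>k. \<not> eventually (\<lambda>n. n = k) \<U>)"

definition coset_seqs :: "('g, 'm) monoid_scheme \<Rightarrow> (nat \<Rightarrow> 'g set) \<Rightarrow> (nat \<Rightarrow> 'g set) set" where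
  "coset_seqs G H = (\<Pi>\<^sub>E n\<in>UNIV. lcosets\<^bsub>G\<^esub> (H n))"

definition ultra_rel ::
    "('g, 'm) monoid_scheme \<Rightarrow> (nat \<Rightarrow> 'g set) \<Rightarrow> nat filter \<Rightarrow> ((nat \<Rightarrow> 'g set) \<times> (nat \<Rightarrow> 'g set)) set" where
  "ultra_rel G H \<U> = {(x, y). x \<in> coset_seqs G H \<and> y \<in> coset_seqs G H \<and> (\<forall>\<^sub>F n in \<U>. x n = y n)}"

definition ultraproduct ::
    "('g, 'm) monoid_scheme \<Rightarrow> (nat \<Rightarrow> 'g set) \<Rightarrow> nat filter \<Rightarrow> (nat \<Rightarrow> 'g set) set set" where
  "ultraproduct G H \<U> = coset_seqs G H // ultra_rel G H \<U>"

definition ultra_action ::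
    "('g, 'm) monoid_scheme \<Rightarrow> (nat \<Rightarrow> 'g set) \<Rightarrow> nat filter \<Rightarrow> 'g \<Rightarrow> (nat \<Rightarrow> 'g set) set \<Rightarrow> (nat \<Rightarrow> 'g set) set" where
  "ultra_action G H \<U> g c = (\<Union>x\<in>c. ultra_rel G H \<U> `` {\<lambda>n. g <#\<^bsub>G\<^esub> x n})"

definition internal_set ::
    "('g, 'm) monoid_scheme \<Rightarrow> (nat \<Rightarrow> 'g set) \<Rightarrow> nat filter \<Rightarrow> (nat \<Rightarrow> 'g set set) \<Rightarrow> (nat \<Rightarrow> 'g set) set set" where
  "internal_set G H \<U> A =
     {ultra_rel G H \<U> `` {x} | x. x \<in> coset_seqs G H \<and> (\<forall>\<^sub>F n in \<U>. x n \<in> A n)}"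

definition loeb_measure ::
    "('g, 'm) monoid_scheme \<Rightarrow> (nat \<Rightarrow> 'g set) \<Rightarrow> nat filter \<Rightarrow> (nat \<Rightarrow> 'g set) set measure" where
  "loeb_measure G H \<U> =
     completion (extend_measure (ultraproduct G H \<U>)
       {A. \<forall>n. A n \<subseteq> lcosets\<^bsub>G\<^esub> (H n)}
       (internal_set G H \<U>)
       (\<lambda>A. ennreal (Lim \<U> (\<lambda>n. real (card (A n)) / real (card (lcosets\<^bsub>G\<^esub> (H n)))))))"

section \<open>The orbit equivalence relation of an action on a measure space\<close>

definition action_groupoid :: "('g, 'm) monoid_scheme \<Rightarrow> 'x measure \<Rightarrow> ('x \<times> 'g) set" where
  "action_groupoid G M = space M \<times> carrier G"

definition isotropy_groupoid :: "('g, 'm) monoid_scheme \<Rightarrow> 'x measure \<Rightarrow> ('g \<Rightarrow> 'x \<Rightarrow> 'x) \<Rightarrow> ('x \<times> 'g) set" where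
  "isotropy_groupoid G M a = {(x, g) \<in> action_groupoid G M. a g x = x}"

definition orbit_relation :: "('g, 'm) monoid_scheme \<Rightarrow> 'x measure \<Rightarrow> ('g \<Rightarrow> 'x \<Rightarrow> 'x) \<Rightarrow> ('x \<times> 'x) set" where
  "orbit_relation G M a = (\<lambda>(x, g). (x, a g x)) ` action_groupoid G M"

text \<open>The relation as a measure space; \<open>(x, y)\<close> has source \<open>x\<close> and target \<open>y\<close>.\<close>

definition orbit_relation_measure ::
    "('g, 'm) monoid_scheme \<Rightarrow> 'x measure \<Rightarrow> ('g \<Rightarrow> 'x \<Rightarrow> 'x) \<Rightarrow> ('x \<times> 'x) measure" where
  "orbit_relation_measure G M a =
     measure_of (orbit_relation G M a)
       {\<Union>k::nat. (\<lambda>x. (x, a (g k) x)) ` A k | g A. \<forall>k. g k \<in> carrier G \<and> A k \<in> sets M}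
       (\<lambda>E. \<integral>\<^sup>+x. emeasure (count_space UNIV) {y. (x, y) \<in> E} \<partial>M)"

text \<open>A simplicial complex over an equivalence relation: the fibre over each point, the measure
  spaces of ordered simplices, and the action \<open>translate (x, y)\<close> mapping the vertices of the fibre
  over \<open>x\<close> to those of the fibre over \<open>y\<close>.\<close>

record ('x, 'w) rel_complex =
  fibre :: "'x \<Rightarrow> 'w set set"
  simplices :: "nat \<Rightarrow> ('x \<times> 'w list) measure"
  translate :: "'x \<times> 'x \<Rightarrow> 'w \<Rightarrow> 'w"

definition isotropy_fibre ::
    "('g, 'm) monoid_scheme \<Rightarrow> 'x measure \<Rightarrow> ('g \<Rightarrow> 'x \<Rightarrow> 'x) \<Rightarrow> 'v set set \<Rightarrow> ('g \<Rightarrow> 'v \<Rightarrow> 'v) \<Rightarrow> 'x \<Rightarrow> 'v set set set" where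
  "isotropy_fibre G M a K act x = quotient_complex G (isotropy_groupoid G M a `` {x}) K act"

definition isotropy_projection ::
    "('g, 'm) monoid_scheme \<Rightarrow> 'x measure \<Rightarrow> ('g \<Rightarrow> 'x \<Rightarrow> 'x) \<Rightarrow> ('g \<Rightarrow> 'v \<Rightarrow> 'v) \<Rightarrow> 'x \<times> 'v list \<Rightarrow> 'x \<times> 'v set list" where
  "isotropy_projection G M a act =
     (\<lambda>(x, vs). (x, map (orbit (G\<lparr>carrier := isotropy_groupoid G M a `` {x}\<rparr>) act) vs))"

definition isotropy_simplices ::
    "('g, 'm) monoid_scheme \<Rightarrow> 'x measure \<Rightarrow> ('g \<Rightarrow> 'x \<Rightarrow> 'x) \<Rightarrow> 'v set set \<Rightarrow> ('g \<Rightarrow> 'v \<Rightarrow> 'v) \<Rightarrow> nat \<Rightarrow> ('x \<times> 'v set list) measure" where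
  "isotropy_simplices G M a K act i =
     (let Y = M \<Otimes>\<^sub>M count_space (ordered_simplices K i);
          \<Xi> = (SIGMA x:space M. ordered_simplices (isotropy_fibre G M a K act x) i)
      in measure_of \<Xi>
           {E. E \<subseteq> \<Xi> \<and> isotropy_projection G M a act -` E \<inter> space Y \<in> sets Y}
           (\<lambda>E. \<integral>\<^sup>+x. emeasure (count_space UNIV) {vs. (x, vs) \<in> E} \<partial>M))"

text \<open>The translation does not depend on the choice of a group element mapping \<open>x\<close> to \<open>y\<close>.\<close>

definition isotropy_quotient ::
    "('g, 'm) monoid_scheme \<Rightarrow> 'x measure \<Rightarrow> ('g \<Rightarrow> 'x \<Rightarrow> 'x) \<Rightarrow> 'v set set \<Rightarrow> ('g \<Rightarrow> 'v \<Rightarrow> 'v) \<Rightarrow> ('x, 'v set) rel_complex" where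
  "isotropy_quotient G M a K act =
     \<lparr>fibre = isotropy_fibre G M a K act,
      simplices = isotropy_simplices G M a K act,
      translate = (\<lambda>(x, y) w. act (SOME g. g \<in> carrier G \<and> a g x = y) ` w)\<rparr>"

section \<open>Square integrable functions\<close>

text \<open>Elements of the Hilbert space are represented by functions, equality being equality almost
  everywhere. All sets of square integrable functions below are closed under it.\<close>

definition L2 :: "'p measure \<Rightarrow> ('p \<Rightarrow> complex) set" where
  "L2 M = {f \<in> borel_measurable M. integrable M (\<lambda>v. (cmod (f v))\<^sup>2)}"

definition L2_inner :: "'p measure \<Rightarrow> ('p \<Rightarrow> complex) \<Rightarrow> ('p \<Rightarrow> complex) \<Rightarrow> complex" where
  "L2_inner M f g = (\<integral>v. f v * cnj (g v) \<partial>M)"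

definition L2_norm :: "'p measure \<Rightarrow> ('p \<Rightarrow> complex) \<Rightarrow> real" where
  "L2_norm M f = sqrt (\<integral>v. (cmod (f v))\<^sup>2 \<partial>M)"

definition L2_closure :: "'p measure \<Rightarrow> ('p \<Rightarrow> complex) set \<Rightarrow> ('p \<Rightarrow> complex) set" where
  "L2_closure M A = {f \<in> L2 M. \<forall>e>0. \<exists>g\<in>A. L2_norm M (\<lambda>v. f v - g v) < e}"

definition L2_operator :: "'p measure \<Rightarrow> (('p \<Rightarrow> complex) \<Rightarrow> 'p \<Rightarrow> complex) \<Rightarrow> bool" where
  "L2_operator M T \<longleftrightarrow>
     (\<forall>f\<in>L2 M. T f \<in> L2 M) \<and>
     (\<forall>f\<in>L2 M. \<forall>g\<in>L2 M. \<forall>c. AE v in M. T (\<lambda>w. f w + c * g w) v = T f v + c * T g v) \<and>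
     (\<exists>C. \<forall>f\<in>L2 M. L2_norm M (T f) \<le> C * L2_norm M f)"

definition commutant ::
    "'p measure \<Rightarrow> (('p \<Rightarrow> complex) \<Rightarrow> 'p \<Rightarrow> complex) set \<Rightarrow> (('p \<Rightarrow> complex) \<Rightarrow> 'p \<Rightarrow> complex) set" where
  "commutant M \<A> =
     {T. L2_operator M T \<and> (\<forall>S\<in>\<A>. \<forall>f\<in>L2 M. AE v in M. T (S f) v = S (T f) v)}"

section \<open>The von Neumann algebra of an equivalence relation and its modules\<close>

text \<open>From here on \<open>R\<close> is an equivalence relation together with its measure.\<close>

definition bisections :: "('x \<times> 'x) measure \<Rightarrow> ('x \<times> 'x) set set" where
  "bisections R = {\<phi> \<in> sets R. inj_on fst \<phi> \<and> inj_on snd \<phi>}"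

text \<open>\<open>anchor\<close> is the fibration over the base and \<open>tr h\<close> the action of \<open>h\<close>; the inverse of \<open>h\<close> is
  \<open>prod.swap h\<close>.\<close>

definition bisection_operator ::
    "('p \<Rightarrow> 'x) \<Rightarrow> ('x \<times> 'x \<Rightarrow> 'p \<Rightarrow> 'p) \<Rightarrow> ('x \<times> 'x) set \<Rightarrow> ('p \<Rightarrow> complex) \<Rightarrow> 'p \<Rightarrow> complex" where
  "bisection_operator anchor tr \<phi> f v =
     (if \<exists>h\<in>\<phi>. snd h = anchor v
      then f (tr (prod.swap (THE h. h \<in> \<phi> \<and> snd h = anchor v)) v) else 0)"

text \<open>Left multiplication: \<open>(y, z)\<close> maps \<open>(x, y)\<close> to \<open>(x, z)\<close>.\<close>

definition left_mult :: "('x \<times> 'x) set \<Rightarrow> ('x \<times> 'x \<Rightarrow> complex) \<Rightarrow> 'x \<times> 'x \<Rightarrow> complex" where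
  "left_mult = bisection_operator snd (\<lambda>h v. (fst v, snd h))"

definition simplex_op ::
    "('x, 'w) rel_complex \<Rightarrow> ('x \<times> 'x) set \<Rightarrow> ('x \<times> 'w list \<Rightarrow> complex) \<Rightarrow> 'x \<times> 'w list \<Rightarrow> complex" where
  "simplex_op \<Xi> = bisection_operator fst (\<lambda>h v. (snd h, map (translate \<Xi> h) (snd v)))"

text \<open>The left multiplications form a self-adjoint set containing the identity, so the von Neumann
  algebra they generate is their double commutant.\<close>

definition rel_algebra :: "('x \<times> 'x) measure \<Rightarrow> (('x \<times> 'x \<Rightarrow> complex) \<Rightarrow> 'x \<times> 'x \<Rightarrow> complex) set" where
  "rel_algebra R = commutant R (commutant R (left_mult ` bisections R))"

text \<open>The vector state of the indicator function of the diagonal; it is a trace on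
  \<open>rel_algebra R\<close> and on its commutant.\<close>

definition rel_trace :: "('x \<times> 'x) measure \<Rightarrow> (('x \<times> 'x \<Rightarrow> complex) \<Rightarrow> 'x \<times> 'x \<Rightarrow> complex) \<Rightarrow> complex" where
  "rel_trace R T = L2_inner R (T (indicator Id)) (indicator Id)"

text \<open>The direct sum of countably many copies of \<open>L2 R\<close> is \<open>L2 (rel_direct_sum R)\<close>, on which an operator
  on \<open>L2 R\<close> acts diagonally.\<close>

definition rel_direct_sum :: "('x \<times> 'x) measure \<Rightarrow> (('x \<times> 'x) \<times> nat) measure" where
  "rel_direct_sum R = R \<Otimes>\<^sub>M count_space UNIV"

definition diagonal_op ::
    "(('p \<Rightarrow> complex) \<Rightarrow> 'p \<Rightarrow> complex) \<Rightarrow> ('p \<times> nat \<Rightarrow> complex) \<Rightarrow> 'p \<times> nat \<Rightarrow> complex" where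
  "diagonal_op T F = (\<lambda>(v, k). T (\<lambda>w. F (w, k)) v)"

definition diagonal_entry ::
    "nat \<Rightarrow> (('p \<times> nat \<Rightarrow> complex) \<Rightarrow> 'p \<times> nat \<Rightarrow> complex) \<Rightarrow> ('p \<Rightarrow> complex) \<Rightarrow> 'p \<Rightarrow> complex" where
  "diagonal_entry k P f v = P (\<lambda>(w, l). if l = k then f w else 0) (v, k)"

text \<open>\<open>V\<close> induces an isometric isomorphism from \<open>Z / B\<close>, with the quotient norm, to an
  \<open>rel_algebra R\<close>-submodule of the direct sum. Here \<open>B \<subseteq> Z \<subseteq> L2 M\<close> are closed subspaces and the
  bisections act on \<open>L2 M\<close> by \<open>opr\<close>. As the bisections generate the algebra, the module structure
  of the submodule is the only normal one that extends their action on \<open>Z / B\<close>.\<close>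

definition module_embedding ::
    "('x \<times> 'x) measure \<Rightarrow> 'p measure \<Rightarrow> (('x \<times> 'x) set \<Rightarrow> ('p \<Rightarrow> complex) \<Rightarrow> 'p \<Rightarrow> complex) \<Rightarrow>
     ('p \<Rightarrow> complex) set \<Rightarrow> ('p \<Rightarrow> complex) set \<Rightarrow> (('p \<Rightarrow> complex) \<Rightarrow> ('x \<times> 'x) \<times> nat \<Rightarrow> complex) \<Rightarrow> bool" where
  "module_embedding R M opr Z B V \<longleftrightarrow>
     (\<forall>f\<in>Z. V f \<in> L2 (rel_direct_sum R)) \<and>
     (\<forall>f\<in>Z. \<forall>g\<in>Z. \<forall>c. AE v in rel_direct_sum R. V (\<lambda>w. f w + c * g w) v = V f v + c * V g v) \<and>
     (\<forall>f\<in>Z. L2_norm (rel_direct_sum R) (V f) = (INF g\<in>B. L2_norm M (\<lambda>v. f v - g v))) \<and>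
     (\<forall>\<phi>\<in>bisections R. \<forall>f\<in>Z. AE v in rel_direct_sum R. V (opr \<phi> f) v = diagonal_op (left_mult \<phi>) (V f) v) \<and>
     (\<forall>T\<in>rel_algebra R. \<forall>f\<in>Z. \<exists>g\<in>Z. AE v in rel_direct_sum R. V g v = diagonal_op T (V f) v)"

definition orthogonal_projection_onto ::
    "'p measure \<Rightarrow> ('p \<Rightarrow> complex) set \<Rightarrow> (('p \<Rightarrow> complex) \<Rightarrow> 'p \<Rightarrow> complex) \<Rightarrow> bool" where
  "orthogonal_projection_onto M A P \<longleftrightarrow>
     (\<forall>F\<in>L2 M. P F \<in> L2 M \<and> (\<exists>E\<in>A. AE v in M. P F v = E v) \<and>
        (\<forall>E\<in>A. L2_inner M (\<lambda>v. F v - P F v) E = 0))"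

text \<open>The dimension over \<open>rel_algebra R\<close> of the Hilbert module \<open>Z / B\<close>: the trace of the orthogonal
  projection onto a copy of the module in the direct sum, which does not depend on the copy. The
  diagonal entries of the projection lie in the commutant of \<open>rel_algebra R\<close>.\<close>

definition rel_dim ::
    "('x \<times> 'x) measure \<Rightarrow> 'p measure \<Rightarrow> (('x \<times> 'x) set \<Rightarrow> ('p \<Rightarrow> complex) \<Rightarrow> 'p \<Rightarrow> complex) \<Rightarrow>
     ('p \<Rightarrow> complex) set \<Rightarrow> ('p \<Rightarrow> complex) set \<Rightarrow> ennreal" where
  "rel_dim R M opr Z B =
     (THE d. \<exists>V P. module_embedding R M opr Z B V \<and>
        orthogonal_projection_onto (rel_direct_sum R) (V ` Z) P \<and>
        d = suminf (\<lambda>k. ennreal (Re (rel_trace R (diagonal_entry k P)))))"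

section \<open>\<open>L2\<close>-Betti numbers\<close>

definition l2_chains :: "('x, 'w) rel_complex \<Rightarrow> nat \<Rightarrow> ('x \<times> 'w list \<Rightarrow> complex) set" where
  "l2_chains \<Xi> i = {f \<in> L2 (simplices \<Xi> i).
     \<forall>\<pi>. \<pi> permutes {..<Suc i} \<longrightarrow>
       (AE v in simplices \<Xi> i. f (fst v, permute_list \<pi> (snd v)) = of_int (sign \<pi>) * f v)}"

definition l2_boundary ::
    "('x, 'w) rel_complex \<Rightarrow> nat \<Rightarrow> ('x \<times> 'w list \<Rightarrow> complex) \<Rightarrow> 'x \<times> 'w list \<Rightarrow> complex" where
  "l2_boundary \<Xi> i f = (\<lambda>(x, ws). simplicial_boundary (fibre \<Xi> x) i (\<lambda>vs. f (x, vs)) ws)"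

definition l2_cycles :: "('x, 'w) rel_complex \<Rightarrow> nat \<Rightarrow> ('x \<times> 'w list \<Rightarrow> complex) set" where
  "l2_cycles \<Xi> i = {f \<in> l2_chains \<Xi> i. i = 0 \<or> (AE v in simplices \<Xi> (i - 1). l2_boundary \<Xi> i f v = 0)}"

definition l2_boundaries :: "('x, 'w) rel_complex \<Rightarrow> nat \<Rightarrow> ('x \<times> 'w list \<Rightarrow> complex) set" where
  "l2_boundaries \<Xi> i = L2_closure (simplices \<Xi> i) (l2_boundary \<Xi> (Suc i) ` l2_chains \<Xi> (Suc i))"

definition l2_betti :: "nat \<Rightarrow> ('x, 'w) rel_complex \<Rightarrow> ('x \<times> 'x) measure \<Rightarrow> ennreal" where
  "l2_betti i \<Xi> R = rel_dim R (simplices \<Xi> i) (simplex_op \<Xi>) (l2_cycles \<Xi> i) (l2_boundaries \<Xi> i)"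

end

theory Submission imports Defs "Jordan_Normal_Form.Schur_Decomposition" begin

text \<open>The complex \<open>\<Xi>\<close> is handled through functions on \<open>\<R> \<times> \<nat>\<close>: choosing representatives of the
  \<open>\<Gamma>\<close>-orbits of ordered simplices, an invariant integer kernel on the simplices of \<open>\<Sigma>\<close> induces an integer matrix
  on every \<open>\<Gamma>\<^sub>n\<backslash>\<Sigma>\<close> and a bounded operator on \<open>L\<^sup>2\<close> of the orbit relation, and the traces of powers of both are
  given by one formula in the densities of the fixed point sets of the elements of \<open>\<Gamma>\<close>, which converge along the
  ultrafilter. Take the kernel \<open>D\<^sup>*D\<close>, where \<open>D\<close> collects all equations defining harmonic chains (antisymmetry included).
  With \<open>T = 1 - D\<^sup>*D/C\<close>, the trace of \<open>T\<^sup>k\<close> tends to the dimension of the harmonic chains as \<open>k \<rightarrow> \<infinity>\<close>, and for the finite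
  quotients it does so uniformly in \<open>n\<close>: the nonzero eigenvalues of an integer matrix have nonzero integer product, so few of
  them are small (Lueck's argument). On the side of the relation, the harmonic chains represent the reduced homology.\<close>

section \<open>Square integrable functions\<close>

text \<open>The ultraproduct action need not be free, so a simplex over \<open>x\<close> is a class
  modulo the stabilizer of \<open>x\<close>. A simplex of \<open>\<Sigma>\<close> is uniquely
  \<open>g\<close> times a representative; recording \<open>inv g\<close> applied to
  \<open>x\<close> and the number of the representative forgets exactly the stabilizer, and
  identifies the fibre of \<open>\<Xi>\<close> at \<open>x\<close> with labelled points of the
  relation with target \<open>x\<close>. Two commuting structures thereby separate: bisections move
  the target, kernels move the source. The dimension is defined through an arbitrary embedding, so
  its uniqueness is proved first; it is the trace property for the partial isometry between two
  embeddings. Projections arise as limits of even powers, by norm computations alone. On cycles each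
  application of \<open>T\<close> subtracts a boundary; hence the limit has the quotient norm. The
  order of choices is decisive. The exponent depends only on \<open>C\<close> and the error, and is
  fixed before the ultralimit; for a fixed exponent finitely many group elements contribute to the
  traces. One row sum bound of the kernel serves as \<open>C\<close> for all finite quotients and
  for the relation.\<close>

abbreviation nsq :: "complex \<Rightarrow> ennreal" where "nsq z \<equiv> ennreal ((cmod z)\<^sup>2)"

lemma L2_measurable: "f \<in> L2 M ==> f \<in> borel_measurable M" by (simp add: L2_def)

lemma L2_square_integrable: "f \<in> L2 M ==> integrable M (%v. (cmod (f v))^2)" by (simp add: L2_def)

lemma L2_iff_nn_integral: "f \<in> borel_measurable M ==> f \<in> L2 M \<longleftrightarrow> (nn_integral M (%v. nsq (f v))) < \<infinity>"
 by (auto simp: L2_def integrable_iff_bounded)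

lemma L2_norm_nn_integral: "f \<in> L2 M ==> ennreal ((L2_norm M f)^2) = nn_integral M (%v. nsq (f v))"
 unfolding L2_norm_def by (subst nn_integral_eq_integral) (auto simp: L2_def)

lemma L2_norm_nonneg [simp]: "0 \<le> L2_norm M f" by (simp add: L2_norm_def)

lemma L2_lin:
 assumes "f \<in> L2 M" "g \<in> L2 M" shows "(%v. f v + c * g v) \<in> L2 M"
proof -
 have [measurable]: "f \<in> borel_measurable M" "g \<in> borel_measurable M" using assms by (auto simp: L2_def)
 have "integrable M (%v. (cmod (f v + c * g v))^2)"
 proof (rule Bochner_Integration.integrable_bound)
  show "integrable M (%v. 2 * (cmod (f v))^2 + 2 * (cmod c)^2 * (cmod (g v))^2)"
   using assms by (auto simp: L2_def)
  show "AE v in M. norm ((cmod (f v + c * g v))^2)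
    \<le> norm (2 * (cmod (f v))^2 + 2 * (cmod c)^2 * (cmod (g v))^2)"
  proof (rule AE_I2)
   fix v
   have "cmod (f v + c * g v) \<le> cmod (f v) + cmod c * cmod (g v)" by (metis norm_mult norm_triangle_ineq)
   then have "(cmod (f v + c * g v))^2 \<le> (cmod (f v) + cmod c * cmod (g v))^2" by simp
   also have "... \<le> 2 * (cmod (f v))^2 + 2 * (cmod c * cmod (g v))^2"
    using sum_squares_bound[of "cmod (f v)" "cmod c * cmod (g v)"] by (simp add: power2_sum)
   finally show "norm ((cmod (f v + c * g v))^2)
    \<le> norm (2 * (cmod (f v))^2 + 2 * (cmod c)^2 * (cmod (g v))^2)" by (simp add: power_mult_distrib)
  qed
 qed simp
 then show ?thesis by (simp add: L2_def)
qed

lemma L2_zero: "(%v. 0) \<in> L2 M" by (simp add: L2_def)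

lemma L2_scale: "f \<in> L2 M ==> (%v. c * f v) \<in> L2 M" using L2_lin[OF L2_zero, of f M c] by simp

lemma L2_add: "f \<in> L2 M ==> g \<in> L2 M ==> (%v. f v + g v) \<in> L2 M" using L2_lin[of f M g 1] by simp

lemma L2_diff: "f \<in> L2 M ==> g \<in> L2 M ==> (%v. f v - g v) \<in> L2 M" using L2_lin[of f M g "-1"] by simp

lemma L2_sum: "(\<And>j. j \<in> A ==> f j \<in> L2 M) ==> (%v. \<Sum>j\<in>A. f j v) \<in> L2 M"
 by (induction A rule: infinite_finite_induct) (auto simp: L2_zero intro: L2_add)

lemma L2_cong_AE:
 assumes "f \<in> L2 M" "g \<in> borel_measurable M" "AE v in M. f v = g v" shows "g \<in> L2 M"
proof -
 have [measurable]: "f \<in> borel_measurable M" "g \<in> borel_measurable M" using assms by (auto simp: L2_def)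
 have "integrable M (%v. (cmod (g v))^2)"
  by (rule integrable_cong_AE_imp[OF L2_square_integrable[OF assms(1)]]) (use assms in auto)
 then show ?thesis by (simp add: L2_def)
qed

lemma borel_measurable_cnj [measurable]: "f \<in> borel_measurable M ==> (%v. cnj (f v)) \<in> borel_measurable M"
 by (rule measurable_compose[OF _ borel_measurable_continuous_onI]) (auto)

lemma L2_inner_integrable:
 assumes "f \<in> L2 M" "g \<in> L2 M" shows "integrable M (%v. f v * cnj (g v))"
proof (rule Bochner_Integration.integrable_bound)
 show "(%v. f v * cnj (g v)) \<in> borel_measurable M" using assms by (auto simp: L2_def)
 show "integrable M (%v. (cmod (f v))^2 + (cmod (g v))^2)" using assms by (auto simp: L2_def)
 show "AE v in M. norm (f v * cnj (g v)) \<le> norm ((cmod (f v))^2 + (cmod (g v))^2)"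
 proof (rule AE_I2)
  fix v
  have "cmod (f v) * cmod (g v) * 2 \<le> (cmod (f v))^2 + (cmod (g v))^2"
   using sum_squares_bound[of "cmod (f v)" "cmod (g v)"] by simp
  moreover have "0 \<le> cmod (f v) * cmod (g v)" by simp
  ultimately have "cmod (f v) * cmod (g v) \<le> (cmod (f v))^2 + (cmod (g v))^2" by linarith
  then show "norm (f v * cnj (g v)) \<le> norm ((cmod (f v))^2 + (cmod (g v))^2)" by (simp add: norm_mult)
 qed
qed

lemma L2_inner_lin:
 assumes "f \<in> L2 M" "g \<in> L2 M" "h \<in> L2 M"
 shows "L2_inner M (%v. f v + c * g v) h = L2_inner M f h + c * L2_inner M g h"
 using L2_inner_integrable[OF assms(1,3)] L2_inner_integrable[OF assms(2,3)]
 unfolding L2_inner_def by (simp add: distrib_right mult.assoc)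

lemma L2_inner_cnj: "cnj (L2_inner M f g) = L2_inner M g f"
 unfolding L2_inner_def by (subst Bochner_Integration.integral_cnj[symmetric]) (simp add: mult.commute)

lemma L2_inner_lin_right:
 assumes "f \<in> L2 M" "g \<in> L2 M" "h \<in> L2 M"
 shows "L2_inner M h (%v. f v + c * g v) = L2_inner M h f + cnj c * L2_inner M h g"
 using L2_inner_lin[OF assms, of c] L2_inner_cnj[of M _ h] by (metis complex_cnj_add complex_cnj_mult)

lemma L2_inner_zero [simp]: "L2_inner M (%v. 0) g = 0" "L2_inner M f (%v. 0) = 0" by (auto simp: L2_inner_def)

lemma L2_inner_scale:
 assumes "g \<in> L2 M" "h \<in> L2 M"
 shows "L2_inner M (%v. c * g v) h = c * L2_inner M g h"
  "L2_inner M h (%v. c * g v) = cnj c * L2_inner M h g"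
 using L2_inner_lin[OF L2_zero assms, of c] L2_inner_lin_right[OF L2_zero assms, of c] by auto

lemma L2_inner_diff:
 assumes "f \<in> L2 M" "g \<in> L2 M" "h \<in> L2 M"
 shows "L2_inner M (%v. f v - g v) h = L2_inner M f h - L2_inner M g h"
  "L2_inner M h (%v. f v - g v) = L2_inner M h f - L2_inner M h g"
 using L2_inner_lin[OF assms, of "-1"] L2_inner_lin_right[OF assms, of "-1"] by auto

lemma L2_inner_sum:
 assumes "\<And>j. j \<in> A ==> f j \<in> L2 M" "h \<in> L2 M"
 shows "L2_inner M (%v. \<Sum>j\<in>A. f j v) h = (\<Sum>j\<in>A. L2_inner M (f j) h)" using assms(1)
proof (induction A rule: infinite_finite_induct)
 case (insert x F)
 then show ?case using L2_inner_lin[of "f x" M "%v. \<Sum>j\<in>F. f j v" h 1] L2_sum[of F f M] assms(2) by auto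
qed auto

lemma L2_inner_self: "L2_inner M f f = of_real ((L2_norm M f)^2)"
proof -
 have "L2_inner M f f = (\<integral>v. of_real ((cmod (f v))^2) \<partial>M)"
  unfolding L2_inner_def by (simp only: complex_norm_square)
 then show ?thesis by (simp only: integral_complex_of_real) (simp add: L2_norm_def)
qed

lemma L2_inner_cong_AE:
 assumes "f \<in> L2 M" "f' \<in> L2 M" "g \<in> L2 M" "g' \<in> L2 M" "AE v in M. f v = f' v" "AE v in M. g v = g' v"
 shows "L2_inner M f g = L2_inner M f' g'"
proof -
 have [measurable]: "f \<in> borel_measurable M" "g \<in> borel_measurable M"
   "f' \<in> borel_measurable M" "g' \<in> borel_measurable M" using assms by (auto simp: L2_def)
 show ?thesis unfolding L2_inner_def by (rule integral_cong_AE) (use assms in auto)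
qed

lemma L2_norm_cong_AE:
 assumes "f \<in> L2 M" "g \<in> L2 M" "AE v in M. f v = g v" shows "L2_norm M f = L2_norm M g"
proof -
 have [measurable]: "f \<in> borel_measurable M" "g \<in> borel_measurable M" using assms by (auto simp: L2_def)
 show ?thesis
  unfolding L2_norm_def by (subst integral_cong_AE[of _ M "%v. (cmod (g v))^2"]) (use assms in auto)
qed

lemma L2_norm_eq_0_iff:
 assumes "f \<in> L2 M" shows "L2_norm M f = 0 \<longleftrightarrow> (AE v in M. f v = 0)"
 unfolding L2_norm_def using integral_nonneg_eq_0_iff_AE[OF L2_square_integrable[OF assms]] by simp

lemma L2_norm_scale: "L2_norm M (%v. c * f v) = cmod c * L2_norm M f"
 by (simp add: L2_norm_def norm_mult power_mult_distrib real_sqrt_mult)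

lemma L2_norm_lin_square:
 assumes "f \<in> L2 M" "g \<in> L2 M"
 shows "(L2_norm M (%v. f v + c * g v))^2
  = (L2_norm M f)^2 + 2 * Re (cnj c * L2_inner M f g) + (cmod c)^2 * (L2_norm M g)^2"
proof -
 let ?i = "L2_inner M"
 have *: "Re (?i f f) = (L2_norm M f)^2" for f by (simp only: L2_inner_self Re_complex_of_real)
 have "Re (?i (%v. f v + c * g v) (%v. f v + c * g v))
   = Re (?i f f) + Re (cnj c * ?i f g) + Re (c * ?i g f) + Re ((c * cnj c) * ?i g g)" using assms
  by (simp add: L2_inner_lin L2_inner_lin_right L2_lin algebra_simps)
 moreover have "Re (c * ?i g f) = Re (cnj c * ?i f g)"
  using L2_inner_cnj[of M f g] by (metis complex_cnj_cnj complex_cnj_mult cnj.simps(1))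
 ultimately show ?thesis by (simp only: L2_inner_self complex_norm_square[symmetric] of_real_mult[symmetric] Re_complex_of_real)
qed

lemma L2_norm_diff_square:
 assumes "f \<in> L2 M" "g \<in> L2 M"
 shows "(L2_norm M (%v. f v - g v))^2 = (L2_norm M f)^2 - 2 * Re (L2_inner M f g) + (L2_norm M g)^2"
 using L2_norm_lin_square[OF assms, of "-1"] by simp

lemma L2_Cauchy_Schwarz:
 assumes "f \<in> L2 M" "g \<in> L2 M" shows "cmod (L2_inner M f g) \<le> L2_norm M f * L2_norm M g"
proof (cases "L2_norm M g = 0")
 case True
 then have "L2_inner M f g = L2_inner M f (%v. 0)"
  using assms by (intro L2_inner_cong_AE) (auto simp: L2_norm_eq_0_iff L2_zero)
 then show ?thesis by simp
next
 case False
 let ?n = "(L2_norm M g)^2" and ?i = "L2_inner M f g"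
 \<comment> \<open>This coefficient minimises the norm of \<open>f + c * g\<close>; nonnegativity at
   the minimum is the inequality.\<close>
 define c where "c = - ?i / of_real ?n"
 have n: "?n > 0" using False by simp
 have a: "(cmod c)^2 * ?n = (cmod ?i)^2 / ?n" by (simp add: c_def norm_divide norm_power) (simp add: power2_eq_square)
 have "cnj c * ?i = - of_real ((cmod ?i)^2 / ?n)" using complex_norm_square[of ?i] by (simp add: c_def)
 then have b: "Re (cnj c * ?i) = - ((cmod ?i)^2 / ?n)" by simp
 have "0 \<le> (L2_norm M (%v. f v + c * g v))^2" by simp
 also have "... = (L2_norm M f)^2 - (cmod ?i)^2 / ?n" by (simp only: L2_norm_lin_square[OF assms] a b)
 finally have "(cmod ?i)^2 \<le> (L2_norm M f * L2_norm M g)^2" using n by (simp add: field_simps)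
 then show ?thesis by simp
qed

lemma L2_norm_triangle:
 assumes "f \<in> L2 M" "g \<in> L2 M" shows "L2_norm M (%v. f v + g v) \<le> L2_norm M f + L2_norm M g"
proof (rule power2_le_imp_le)
 show "(L2_norm M (%v. f v + g v))^2 \<le> (L2_norm M f + L2_norm M g)^2"
  using L2_Cauchy_Schwarz[OF assms] complex_Re_le_cmod order_trans
  using L2_norm_lin_square[OF assms, of 1] by (auto simp: power2_sum)
qed auto

lemma L2_norm_minus: "L2_norm M (%v. f v - g v) = L2_norm M (%v. g v - f v)"
 by (simp add: L2_norm_def norm_minus_commute)

lemma L2_norm_diff_triangle:
 assumes "f \<in> L2 M" "g \<in> L2 M" "h \<in> L2 M"
 shows "L2_norm M (%v. f v - h v) \<le> L2_norm M (%v. f v - g v) + L2_norm M (%v. g v - h v)"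
 using L2_norm_triangle[OF L2_diff[OF assms(1,2)] L2_diff[OF assms(2,3)]] by simp

lemma L2_norm_triangle_rev:
 assumes "f \<in> L2 M" "g \<in> L2 M"
 shows "\<bar>L2_norm M f - L2_norm M g\<bar> \<le> L2_norm M (%v. f v - g v)"
 using L2_norm_triangle[OF assms(2) L2_diff[OF assms]] L2_norm_triangle[OF assms(1) L2_diff[OF assms(2,1)]]
  L2_norm_minus[of M f g] by simp

lemma L2_norm_sum_le:
 assumes "\<And>j. j \<in> A ==> f j \<in> L2 M"
 shows "L2_norm M (%v. \<Sum>j\<in>A. f j v) \<le> (\<Sum>j\<in>A. L2_norm M (f j))" using assms
proof (induction A rule: infinite_finite_induct)
 case (insert x F)
 have "L2_norm M (%v. \<Sum>j\<in>insert x F. f j v) = L2_norm M (%v. f x v + (\<Sum>j\<in>F. f j v))"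
  using insert.hyps by simp
 also have "... \<le> L2_norm M (f x) + L2_norm M (%v. \<Sum>j\<in>F. f j v)"
  using insert.prems by (intro L2_norm_triangle L2_sum) auto
 finally show ?case using insert by simp
qed (auto simp: L2_norm_def)

lemma L2_inner_tendsto:
 assumes "\<And>k. f k \<in> L2 M" "g \<in> L2 M" "h \<in> L2 M" "(%k. L2_norm M (%v. f k v - g v)) \<longlonglongrightarrow> 0"
 shows "(%k. L2_inner M (f k) h) \<longlonglongrightarrow> L2_inner M g h"
proof -
 have "(%k. L2_inner M (f k) h - L2_inner M g h) \<longlonglongrightarrow> 0"
 proof (rule Lim_null_comparison)
  show "\<forall>\<^sub>F k in sequentially. norm (L2_inner M (f k) h - L2_inner M g h)
    \<le> L2_norm M (%v. f k v - g v) * L2_norm M h"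
   using assms by (auto simp flip: L2_inner_diff intro!: always_eventually L2_Cauchy_Schwarz L2_diff)
  show "(%k. L2_norm M (%v. f k v - g v) * L2_norm M h) \<longlonglongrightarrow> 0" using tendsto_mult_right[OF assms(4)] by simp
 qed
 then show ?thesis by (simp add: LIM_zero_iff)
qed

lemma L2_norm_tendsto:
 assumes "\<And>k. f k \<in> L2 M" "g \<in> L2 M" "(%k. L2_norm M (%v. f k v - g v)) \<longlonglongrightarrow> 0"
 shows "(%k. L2_norm M (f k)) \<longlonglongrightarrow> L2_norm M g"
proof -
 have "(%k. L2_norm M (f k) - L2_norm M g) \<longlonglongrightarrow> 0" by (rule Lim_null_comparison[OF _ assms(3)])
   (use assms in \<open>auto intro!: always_eventually L2_norm_triangle_rev\<close>)
 then show ?thesis by (simp add: LIM_zero_iff)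
qed

text \<open>If \<open>\<parallel>f (r (k+1)) - f (r k)\<parallel> < 2\<^sup>-\<^sup>k\<close>, then \<open>\<Sum>k. 2\<^sup>k |f (r (k+1)) - f (r k)|^2\<close> has finite
 integral, so the subsequence converges almost everywhere.\<close>

theorem L2_complete:
 assumes f: "\<And>k. f k \<in> L2 M"
  and cauchy: "\<And>e. e > 0 ==> \<exists>N. \<forall>m\<ge>N. \<forall>n\<ge>N. L2_norm M (%v. f m v - f n v) < e"
 shows "\<exists>g\<in>L2 M. (%k. L2_norm M (%v. f k v - g v)) \<longlonglongrightarrow> 0"
proof -
 have [measurable]: "f k \<in> borel_measurable M" for k using f by (auto simp: L2_def)
 have "\<exists>r::nat => nat. \<forall>k. (\<forall>m\<ge>r k. \<forall>n\<ge>r k. L2_norm M (%v. f m v - f n v) < (1/2)^k) \<and> r k < r (Suc k)"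
 proof (rule dependent_nat_choice)
  show "\<exists>x. \<forall>m\<ge>x. \<forall>n\<ge>x. L2_norm M (%v. f m v - f n v) < (1/2)^0" using cauchy[of 1] by simp
  fix x n
  obtain N where "\<forall>m\<ge>N. \<forall>k\<ge>N. L2_norm M (%v. f m v - f k v) < (1/2)^(Suc n)"
   using cauchy[of "(1/2)^(Suc n)"] by auto
  then show "\<exists>y. (\<forall>m\<ge>y. \<forall>k\<ge>y. L2_norm M (%v. f m v - f k v) < (1 / 2) ^ Suc n) \<and> x < y"
   by (intro exI[of _ "max N (Suc x)"]) auto
 qed
 then obtain r where r: "\<And>k m n. m \<ge> r k ==> n \<ge> r k ==> L2_norm M (%v. f m v - f n v) < (1/2)^k"
  and mono: "\<And>k. r k < r (Suc k)" by blast
 define d where "d k v = cmod (f (r (Suc k)) v - f (r k) v)" for k v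
 have d2: "nn_integral M (%v. ennreal (2^k * (d k v)^2)) \<le> ennreal ((1/2)^k)" for k
 proof -
  have "2^k * (L2_norm M (%v. f (r (Suc k)) v - f (r k) v))^2 \<le> 2^k * ((1/2)^k)^2"
   using r[of k "r (Suc k)" "r k"] mono[of k] by simp
  also have "... = (1/2)^k" by (simp add: power2_eq_square flip: power_mult_distrib)
  finally have "ennreal (2^k) * ennreal ((L2_norm M (%v. f (r (Suc k)) v - f (r k) v))^2) \<le> ennreal ((1/2)^k)"
   by (simp flip: ennreal_mult)
  also have "ennreal ((L2_norm M (%v. f (r (Suc k)) v - f (r k) v))^2) = nn_integral M (%v. ennreal ((d k v)^2))"
   unfolding d_def by (intro L2_norm_nn_integral L2_diff f)
  finally show ?thesis unfolding d_def by (simp add: ennreal_mult nn_integral_cmult)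
 qed
 have "nn_integral M (%v. (\<Sum>k. ennreal (2^k * (d k v)^2))) = (\<Sum>k. \<integral>\<^sup>+v. ennreal (2^k * (d k v)^2) \<partial>M)"
  unfolding d_def by (intro nn_integral_suminf) measurable
 also have "... \<le> (\<Sum>k. ennreal ((1/2)^k))" by (intro suminf_le d2) auto
 also have "... < \<infinity>" by (simp add: ennreal_suminf_neq_top)
 finally have "AE v in M. (\<Sum>k. ennreal (2^k * (d k v)^2)) \<noteq> \<infinity>"
  unfolding d_def by (intro nn_integral_PInf_AE) auto
 then have conv: "AE v in M. convergent (%k. f (r k) v)"
 proof (rule AE_mp, intro AE_I2 impI)
  fix v assume fin: "(\<Sum>k. ennreal (2^k * (d k v)^2)) \<noteq> \<infinity>"
  define S where "S = enn2real (\<Sum>k. ennreal (2^k * (d k v)^2))"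
  have S: "ennreal S = (\<Sum>k. ennreal (2^k * (d k v)^2))" "S \<ge> 0" using fin by (auto simp: S_def)
  have "2^k * (d k v)^2 \<le> S" for k
  proof -
   have "ennreal (2^k * (d k v)^2) = (\<Sum>j\<in>{k}. ennreal (2^j * (d j v)^2))" by simp
   also have "... \<le> ennreal S" unfolding S by (rule sum_le_suminf) auto
   finally show ?thesis using S(2) by simp
  qed
  then have bound: "d k v \<le> sqrt S * (sqrt (1/2))^k" for k
  proof -
   assume le: "\<And>k. 2^k * (d k v)^2 \<le> S"
   have "(d k v)^2 \<le> S * (1/2)^k" using le[of k] by (simp add: field_simps)
   also have "... = (sqrt S * (sqrt (1/2))^k)^2"
   proof -
    have "((sqrt (1/2))^k)^2 = ((sqrt (1/2))^2)^k" by (metis mult.commute power_mult)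
    then show ?thesis using S(2) by (simp add: power_mult_distrib)
   qed
   finally show ?thesis by (rule power2_le_imp_le) (use S(2) in auto)
  qed
  have "summable (%k. sqrt S * (sqrt (1/2))^k)" by simp
  then have "summable (%k. f (r (Suc k)) v - f (r k) v)"
   by (rule summable_comparison_test'[where N=0]) (use bound in \<open>auto simp: d_def\<close>)
  then have "convergent (%n. f (r n) v - f (r 0) v)"
   using sum_lessThan_telescope[of "%n. f (r n) v"] by (simp add: summable_iff_convergent)
  then show "convergent (%k. f (r k) v)"
   using convergent_add[OF _ convergent_const[of "f (r 0) v"]] by fastforce
 qed
 define g where "g v = lim (%k. f (r k) v)" for v
 have [measurable]: "g \<in> borel_measurable M" unfolding g_def[abs_def] by simp
 have lim: "AE v in M. (%k. f (r k) v) \<longlonglongrightarrow> g v" using conv by (auto simp: g_def convergent_LIMSEQ_iff)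
 \<comment> \<open>Fatou's lemma carries the bound from \<open>f n - f (r j)\<close> to
   \<open>f n - g\<close>. This puts \<open>g\<close> into \<open>L2 M\<close> and upgrades
   convergence of the subsequence to convergence of the whole sequence.\<close>
 have est: "nn_integral M (%v. nsq (f n v - g v)) \<le> ennreal (((1/2)^k)^2)" if "n \<ge> r k" for n k
 proof -
  have "(nn_integral M (%v. nsq (f n v - g v)))
    = nn_integral M (%v. liminf (%j. nsq (f n v - f (r j) v)))"
  proof (rule nn_integral_cong_AE)
   show "AE v in M. nsq (f n v - g v) = liminf (%j. nsq (f n v - f (r j) v))" using lim
   proof eventually_elim
    case (elim v)
    have "(%j. nsq (f n v - f (r j) v)) \<longlonglongrightarrow> nsq (f n v - g v)" using elim by (intro tendsto_intros)
    from lim_imp_Liminf[OF _ this] show ?case by simp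
   qed
  qed
  also have "... \<le> liminf (%j. \<integral>\<^sup>+v. nsq (f n v - f (r j) v) \<partial>M)" by (rule nn_integral_liminf) measurable
  also have "... \<le> ennreal (((1/2)^k)^2)"
  proof (rule Liminf_le)
   have "r k \<le> r j" if "k \<le> j" for j using lift_Suc_mono_le[of r, OF less_imp_le[OF mono] that] .
   then have "nn_integral M (%v. nsq (f n v - f (r j) v)) \<le> ennreal (((1/2)^k)^2)" if "k \<le> j" for j
    using r[of k n "r j"] \<open>n \<ge> r k\<close> that by (simp flip: L2_norm_nn_integral[OF L2_diff[OF f f]])
   then show "\<forall>\<^sub>F j in sequentially. (nn_integral M (%v. nsq (f n v - f (r j) v))) \<le> ennreal (((1/2)^k)^2)"
    by (intro eventually_sequentiallyI[of k])
  qed simp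
  finally show ?thesis .
 qed
 have fg: "(%v. f (r 0) v - g v) \<in> L2 M"
  using est[of 0 "r 0"] by (simp add: L2_iff_nn_integral le_less_trans[OF _ ennreal_one_less_top])
 have g: "g \<in> L2 M" using L2_diff[OF f[of "r 0"] fg] by simp
 have "L2_norm M (%v. f n v - g v) \<le> (1/2)^k" if "n \<ge> r k" for n k
 proof -
  have "ennreal ((L2_norm M (%v. f n v - g v))^2) \<le> ennreal (((1/2)^k)^2)"
   using est[OF that] by (simp only: L2_norm_nn_integral[OF L2_diff[OF f g]])
  then show ?thesis by simp
 qed
 note le = this
 have "(%n. L2_norm M (%v. f n v - g v)) \<longlonglongrightarrow> 0"
 proof (rule LIMSEQ_I)
  fix e :: real assume "e > 0"
  then obtain k where "(1/2)^k < e" using real_arch_pow_inv[of e "1/2"] by auto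
  then show "\<exists>N. \<forall>n\<ge>N. norm (L2_norm M (%v. f n v - g v) - 0) < e"
   using le[of k] by (intro exI[of _ "r k"]) (auto intro: le_less_trans)
 qed
 with g show ?thesis by blast
qed

section \<open>Limits of powers of a symmetric contraction\<close>

text \<open>The even powers of a symmetric contraction \<open>T\<close> converge strongly, since
 \<open>\<parallel>T^2\<^sup>m f - T^2\<^sup>n f\<parallel>^2 = \<parallel>T^2\<^sup>m f\<parallel>^2 - 2 \<parallel>T\<^sup>m\<^sup>+\<^sup>n f\<parallel>^2 + \<parallel>T^2\<^sup>n f\<parallel>^2\<close> and the norms decrease.\<close>

locale symmetric_contraction =
 fixes M :: "'p measure" and T :: "('p => complex) => 'p => complex"
 assumes lin: "\<And>f g c. T (%v. f v + c * g v) = (%v. T f v + c * T g v)"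
  and L2: "\<And>f. f \<in> L2 M ==> T f \<in> L2 M"
  and sym: "\<And>f g. f \<in> L2 M ==> g \<in> L2 M ==> L2_inner M (T f) g = L2_inner M f (T g)"
  and contr: "\<And>f. f \<in> L2 M ==> L2_norm M (T f) \<le> L2_norm M f"
begin

lemma pow_L2: "f \<in> L2 M ==> (T ^^ n) f \<in> L2 M" by (induction n) (auto intro: L2)

lemma pow_lin: "(T ^^ n) (%v. f v + c * g v) = (%v. (T ^^ n) f v + c * (T ^^ n) g v)"
 by (induction n) (auto simp: lin)

lemma pow_diff: "(T ^^ n) (%v. f v - g v) = (%v. (T ^^ n) f v - (T ^^ n) g v)"
 using pow_lin[of n f "-1" g] by simp

lemma pow_sym: "f \<in> L2 M ==> g \<in> L2 M ==> L2_inner M ((T ^^ n) f) g = L2_inner M f ((T ^^ n) g)"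
proof (induction n arbitrary: g)
 case (Suc n)
 have "L2_inner M ((T ^^ Suc n) f) g = L2_inner M ((T ^^ n) f) (T g)"
  using Suc.prems by (simp add: sym pow_L2)
 also have "... = L2_inner M f ((T ^^ n) (T g))" using Suc.prems by (intro Suc.IH L2)
 finally show ?case by (simp add: funpow_swap1)
qed simp

lemma pow_contr: "f \<in> L2 M ==> L2_norm M ((T ^^ n) f) \<le> L2_norm M f"
 by (induction n) (auto intro: order_trans[OF contr] pow_L2)

lemma pow_diff_norm:
 assumes f: "f \<in> L2 M"
 shows "(L2_norm M (%v. (T ^^ (2*m)) f v - (T ^^ (2*n)) f v))^2
  = (L2_norm M ((T ^^ (2*m)) f))^2 - 2 * (L2_norm M ((T ^^ (m+n)) f))^2 + (L2_norm M ((T ^^ (2*n)) f))^2"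
proof -
 \<comment> \<open>Symmetry moves powers across the inner product, so the mixed term is a squared
   norm at the mean exponent \<open>m+n\<close>, which is an integer because both exponents are
   even.\<close>
 have "(T ^^ (2*n)) ((T ^^ (2*m)) f) = (T ^^ (m+n)) ((T ^^ (m+n)) f)"
  by (simp add: mult_2 flip: funpow_add comp_apply[of "(^^) T _" "(^^) T _"]) (simp add: algebra_simps)
 then have "L2_inner M ((T ^^ (2*m)) f) ((T ^^ (2*n)) f) = L2_inner M ((T ^^ (m+n)) f) ((T ^^ (m+n)) f)"
  using pow_sym[of "(T ^^ (2*m)) f" f "2*n"] pow_sym[of "(T ^^ (m+n)) f" f "m+n"] f by (simp add: pow_L2)
 then show ?thesis using L2_norm_diff_square[OF pow_L2[OF f] pow_L2[OF f], of "2*m" "2*n"]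
  by (simp only: L2_inner_self Re_complex_of_real)
qed

lemma pow_limit:
 assumes f: "f \<in> L2 M"
 shows "\<exists>g\<in>L2 M. (%k. L2_norm M (%v. (T ^^ (2*k)) f v - g v)) \<longlonglongrightarrow> 0"
proof (rule L2_complete)
 show "(T ^^ (2*k)) f \<in> L2 M" for k by (rule pow_L2[OF f])
 define b where "b n = (L2_norm M ((T ^^ n) f))^2" for n
 have dec: "decseq b" unfolding decseq_Suc_iff b_def by (auto intro!: contr pow_L2 f)
 obtain L where L: "b \<longlonglongrightarrow> L" by (rule decseq_convergent[OF dec, of 0]) (auto simp: b_def)
 have bL: "L \<le> b n" for n by (rule decseq_ge[OF dec L])
 fix e :: real assume e: "e > 0"
 obtain N where N: "\<And>n. n \<ge> N ==> b n < L + e^2 / 2"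
  using order_tendstoD(2)[OF L, of "L + e^2 / 2"] e by (auto simp: eventually_sequentially)
 have "L2_norm M (%v. (T ^^ (2*m)) f v - (T ^^ (2*n)) f v) < e" if "m \<ge> N" "n \<ge> N" for m n
 proof -
  have "(L2_norm M (%v. (T ^^ (2*m)) f v - (T ^^ (2*n)) f v))^2 = b (2*m) - 2 * b (m+n) + b (2*n)"
   unfolding b_def by (rule pow_diff_norm[OF f])
  also have "... < e^2" using N[of "2*m"] N[of "2*n"] bL[of "m+n"] that by simp
  finally show ?thesis using e by (simp add: power_less_imp_less_base)
 qed
 then show "\<exists>N. \<forall>m\<ge>N. \<forall>n\<ge>N. L2_norm M (%v. (T ^^ (2*m)) f v - (T ^^ (2*n)) f v) < e" by blast
qed

text \<open>Odd powers would see an eigenvalue -1; along even powers the limit is the projection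
  onto the fixed space of the square of \<open>T\<close>. The chosen function is determined up to
  null sets.\<close>

definition proj :: "('p => complex) => 'p => complex" where
 "proj f = (SOME g. g \<in> L2 M \<and> (%k. L2_norm M (%v. (T ^^ (2*k)) f v - g v)) \<longlonglongrightarrow> 0)"

lemma
 assumes "f \<in> L2 M"
 shows proj_L2: "proj f \<in> L2 M" and proj_lim: "(%k. L2_norm M (%v. (T ^^ (2*k)) f v - proj f v)) \<longlonglongrightarrow> 0"
 using someI_ex[of "%g. g \<in> L2 M \<and> (%k. L2_norm M (%v. (T ^^ (2*k)) f v - g v)) \<longlonglongrightarrow> 0"]
  pow_limit[OF assms] unfolding proj_def by auto

lemma proj_unique:
 assumes f: "f \<in> L2 M" and g: "g \<in> L2 M"
  and lim: "(%k. L2_norm M (%v. (T ^^ (2*k)) f v - g v)) \<longlonglongrightarrow> 0"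
 shows "AE v in M. proj f v = g v"
proof -
 have "(%k. L2_norm M (%v. proj f v - g v)) \<longlonglongrightarrow> 0"
 proof (rule Lim_null_comparison)
  show "\<forall>\<^sub>F k in sequentially. norm (L2_norm M (%v. proj f v - g v))
    \<le> L2_norm M (%v. (T ^^ (2*k)) f v - proj f v) + L2_norm M (%v. (T ^^ (2*k)) f v - g v)"
  proof (intro always_eventually allI)
   fix k
   show "norm (L2_norm M (%v. proj f v - g v))
    \<le> L2_norm M (%v. (T ^^ (2*k)) f v - proj f v) + L2_norm M (%v. (T ^^ (2*k)) f v - g v)"
    using L2_norm_diff_triangle[OF proj_L2[OF f] pow_L2[OF f] g, of "2*k"]
     L2_norm_minus[of M "proj f" "(T ^^ (2*k)) f"] by simp
  qed
  show "(%k. L2_norm M (%v. (T ^^ (2*k)) f v - proj f v) + L2_norm M (%v. (T ^^ (2*k)) f v - g v)) \<longlonglongrightarrow> 0"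
   using tendsto_add[OF proj_lim[OF f] lim] by simp
 qed
 then show ?thesis using L2_norm_eq_0_iff[OF L2_diff[OF proj_L2[OF f] g]] by (simp add: LIMSEQ_const_iff)
qed

lemma proj_lin:
 assumes f: "f \<in> L2 M" and g: "g \<in> L2 M"
 shows "AE v in M. proj (%v. f v + c * g v) v = proj f v + c * proj g v"
proof (rule proj_unique)
 show "(%v. f v + c * g v) \<in> L2 M" "(%v. proj f v + c * proj g v) \<in> L2 M" by (intro L2_lin f g proj_L2)+
 let ?d = "%f k v. (T ^^ (2*k)) f v - proj f v"
 show "(%k. L2_norm M (%v. (T ^^ (2 * k)) (%v. f v + c * g v) v - (proj f v + c * proj g v))) \<longlonglongrightarrow> 0"
 proof (rule Lim_null_comparison)
  show "\<forall>\<^sub>F k in sequentially. norm (L2_norm M (%v. (T ^^ (2 * k)) (%v. f v + c * g v) v - (proj f v + c * proj g v)))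
    \<le> L2_norm M (?d f k) + cmod c * L2_norm M (?d g k)"
  proof (intro always_eventually allI)
   fix k
   have "(%v. (T ^^ (2 * k)) (%v. f v + c * g v) v - (proj f v + c * proj g v)) = (%v. ?d f k v + c * ?d g k v)"
    by (simp add: pow_lin algebra_simps)
   moreover have "L2_norm M (%v. ?d f k v + c * ?d g k v) \<le> L2_norm M (?d f k) + cmod c * L2_norm M (?d g k)"
    using L2_norm_triangle[OF L2_diff[OF pow_L2[OF f] proj_L2[OF f]] L2_scale[OF L2_diff[OF pow_L2[OF g] proj_L2[OF g]]], of "2*k" c "2*k"]
    by (simp add: L2_norm_scale)
   ultimately show "norm (L2_norm M (%v. (T ^^ (2 * k)) (%v. f v + c * g v) v - (proj f v + c * proj g v)))
    \<le> L2_norm M (?d f k) + cmod c * L2_norm M (?d g k)" by simp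
  qed
  show "(%k. L2_norm M (?d f k) + cmod c * L2_norm M (?d g k)) \<longlonglongrightarrow> 0"
   using tendsto_add[OF proj_lim[OF f] tendsto_mult_left[OF proj_lim[OF g], of "cmod c"]] by simp
 qed
qed

lemma pow_zero: "(T ^^ n) (%v. 0) = (%v. 0)" using pow_diff[of n "%v. 0" "%v. 0"] by simp

text \<open>\<open>T\<close> acts on functions rather than on classes; the norm bound makes it
  respect null sets.\<close>

lemma pow_cong_AE:
 assumes "f \<in> L2 M" "g \<in> L2 M" "AE v in M. f v = g v" shows "AE v in M. (T ^^ n) f v = (T ^^ n) g v"
proof -
 have "L2_norm M (%v. f v - g v) = 0" using assms by (simp add: L2_norm_eq_0_iff L2_diff)
 then have "L2_norm M ((T ^^ n) (%v. f v - g v)) = 0"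
  using pow_contr[OF L2_diff[OF assms(1,2)], of n] by (simp add: antisym)
 then show ?thesis using assms by (simp add: pow_diff L2_norm_eq_0_iff L2_diff pow_L2)
qed

lemma proj_cong_AE:
 assumes "f \<in> L2 M" "g \<in> L2 M" "AE v in M. f v = g v" shows "AE v in M. proj f v = proj g v"
proof (rule proj_unique[OF assms(1) proj_L2[OF assms(2)]])
 have "L2_norm M (%v. (T ^^ (2*k)) f v - proj g v) = L2_norm M (%v. (T ^^ (2*k)) g v - proj g v)" for k
  using pow_cong_AE[OF assms] assms by (intro L2_norm_cong_AE) (auto intro: L2_diff pow_L2 proj_L2)
 then show "(%k. L2_norm M (%v. (T ^^ (2*k)) f v - proj g v)) \<longlonglongrightarrow> 0" using proj_lim[OF assms(2)] by simp
qed

lemma proj_fix: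
 assumes f: "f \<in> L2 M" and fx: "AE v in M. T f v = f v" shows "AE v in M. proj f v = f v"
proof (rule proj_unique[OF f f])
 have "AE v in M. (T ^^ n) f v = f v" for n
 proof (induction n)
  case (Suc n)
  then have "AE v in M. (T ^^ 1) ((T ^^ n) f) v = (T ^^ 1) f v" by (intro pow_cong_AE pow_L2 f)
  with fx show ?case by auto
 qed simp
 then have "L2_norm M (%v. (T ^^ (2*k)) f v - f v) = 0" for k
  by (subst L2_norm_eq_0_iff) (auto intro: L2_diff pow_L2 f)
 then show "(%k. L2_norm M (%v. (T ^^ (2*k)) f v - f v)) \<longlonglongrightarrow> 0" by simp
qed

text \<open>Applying the square of \<open>T\<close> shifts the sequence of even powers by one place,
  and it is a contraction, so it fixes the limit.\<close>

lemma proj_TT: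
 assumes f: "f \<in> L2 M" shows "AE v in M. T (T (proj f)) v = proj f v"
proof -
 have TT: "T (T h) = (T ^^ 2) h" for h by (simp add: numeral_2_eq_2)
 have "AE v in M. proj f v = (T ^^ 2) (proj f) v"
 proof (rule proj_unique[OF f pow_L2[OF proj_L2[OF f]]])
  have "(%k. L2_norm M (%v. (T ^^ (2*Suc k)) f v - (T ^^ 2) (proj f) v)) \<longlonglongrightarrow> 0"
  proof (rule Lim_null_comparison[OF _ proj_lim[OF f]], intro always_eventually allI)
   fix k
   have "L2_norm M ((T ^^ 2) (%v. (T ^^ (2*k)) f v - proj f v)) \<le> L2_norm M (%v. (T ^^ (2*k)) f v - proj f v)"
    by (intro pow_contr L2_diff pow_L2 proj_L2 f)
   moreover have "(T ^^ 2) (%v. (T ^^ (2*k)) f v - proj f v) = (%v. (T ^^ (2*Suc k)) f v - (T ^^ 2) (proj f) v)" by (simp add: TT pow_diff)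
   ultimately show "norm (L2_norm M (%v. (T ^^ (2*Suc k)) f v - (T ^^ 2) (proj f) v))
     \<le> L2_norm M (%v. (T ^^ (2*k)) f v - proj f v)" by simp
  qed
  then show "(%k. L2_norm M (%v. (T ^^ (2*k)) f v - (T ^^ 2) (proj f) v)) \<longlonglongrightarrow> 0"
   by (subst (asm) filterlim_sequentially_Suc)
 qed
 then show ?thesis by (auto simp: TT)
qed

lemma proj_sym:
 assumes f: "f \<in> L2 M" and g: "g \<in> L2 M" shows "L2_inner M (proj f) g = L2_inner M f (proj g)"
proof (rule LIMSEQ_unique)
 show "(%k. L2_inner M ((T ^^ (2*k)) f) g) \<longlonglongrightarrow> L2_inner M (proj f) g"
  by (rule L2_inner_tendsto[OF pow_L2[OF f] proj_L2[OF f] g proj_lim[OF f]])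
 have "(%k. cnj (L2_inner M ((T ^^ (2*k)) g) f)) \<longlonglongrightarrow> cnj (L2_inner M (proj g) f)"
  by (intro tendsto_cnj L2_inner_tendsto pow_L2 proj_L2 f g proj_lim)
 then show "(%k. L2_inner M ((T ^^ (2*k)) f) g) \<longlonglongrightarrow> L2_inner M f (proj g)"
  by (simp add: L2_inner_cnj pow_sym f g)
qed

lemma proj_orthogonal:
 assumes f: "f \<in> L2 M" and h: "h \<in> L2 M" and hx: "AE v in M. T h v = h v"
 shows "L2_inner M (%v. f v - proj f v) h = 0"
proof -
 have "L2_inner M (proj f) h = L2_inner M f h" unfolding proj_sym[OF f h]
  by (rule L2_inner_cong_AE) (auto intro: f h proj_L2 proj_fix[OF h hx])
 then show ?thesis by (simp add: L2_inner_diff f h proj_L2)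
qed

end

section \<open>Measures fibred over a base with countable fibres\<close>

text \<open>Several indices may name the same point, for instance when a group element fixes it.
  Keeping the index that comes first in an enumeration turns a sum over points into a sum over
  indices, which is visibly measurable in the parameter.\<close>

definition first_index :: "'i set => ('i => 'p) => 'i => bool" where
 "first_index I q b \<longleftrightarrow> (\<forall>b'\<in>I. to_nat_on I b' < to_nat_on I b --> q b' \<noteq> q b)"

lemma bij_betw_first_index:
 assumes "countable I" shows "bij_betw q {b\<in>I. first_index I q b} (q ` I)"
proof (rule bij_betwI')
 fix b b' assume b: "b \<in> {b\<in>I. first_index I q b}" "b' \<in> {b\<in>I. first_index I q b}"
 show "(q b = q b') = (b = b')"
 proof
  assume eq: "q b = q b'"
  have "to_nat_on I b = to_nat_on I b'" using b eq by (fastforce simp: first_index_def)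
  then show "b = b'" using inj_on_to_nat_on[OF assms] b by (auto dest: inj_onD)
 qed simp
next
 fix w assume "w \<in> q ` I"
 then obtain b0 where b0: "b0 \<in> I" "w = q b0" by auto
 define b where "b = (ARG_MIN (to_nat_on I) b. b \<in> I \<and> q b = w)"
 have b: "b \<in> I" "q b = w"
  using arg_min_natI[of "%b. b \<in> I \<and> q b = w" b0 "to_nat_on I"] b0 by (auto simp: b_def)
 moreover have "first_index I q b" unfolding first_index_def
 proof (intro ballI impI notI)
  fix b' assume "b' \<in> I" "to_nat_on I b' < to_nat_on I b" "q b' = q b"
  then show False using arg_min_nat_le[of "%b. b \<in> I \<and> q b = w" b' "to_nat_on I"] b by (auto simp: b_def)
 qed
 ultimately show "\<exists>x\<in>{b\<in>I. first_index I q b}. w = q x" by auto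
qed auto

lemma nn_integral_count_space_image:
 assumes "countable I"
 shows "(nn_integral (count_space (q ` I)) (%w. f w))
  = nn_integral (count_space I) (%b. f (q b) * indicator {b. first_index I q b} b)"
proof -
 have "nn_integral (count_space (q ` I)) (%w. f w) = nn_integral (count_space {b\<in>I. first_index I q b}) (%b. f (q b))"
  by (rule nn_integral_bij_count_space[symmetric, OF bij_betw_first_index[OF assms]])
 also have "... = nn_integral (count_space I) (%b. f (q b) * indicator {b. first_index I q b} b)"
  by (subst (1 2) nn_integral_count_space_indicator) (auto intro!: nn_integral_cong split: split_indicator)
 finally show ?thesis .
qed

text \<open>Countably many sections \<open>p x b\<close> sweep out the fibre over \<open>x\<close>,
  with repetitions. Measurable coincidence sets make the selection of first indices measurable;
  \<open>base\<close> keeps different fibres disjoint.\<close>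

locale fibre_coords =
 fixes M :: "'x measure" and I :: "'i set" and p :: "'x => 'i => 'p"
 assumes countable: "countable I"
  and base: "\<And>x x' b b'. x \<in> space M ==> x' \<in> space M ==> b \<in> I ==> b' \<in> I ==> p x b = p x' b' ==> x = x'"
  and coincide: "\<And>b b'. b \<in> I ==> b' \<in> I ==> {x\<in>space M. p x b = p x b'} \<in> sets M"
begin

definition total :: "'p set" where "total = {p x b |x b. x \<in> space M \<and> b \<in> I}"
definition fsets :: "'p set set" where "fsets = {E. E \<subseteq> total \<and> (\<forall>b\<in>I. {x\<in>space M. p x b \<in> E} \<in> sets M)}"

lemma first_sets: "b \<in> I ==> {x\<in>space M. first_index I (p x) b} \<in> sets M"
proof -
 assume b: "b \<in> I"
 have "{x\<in>space M. first_index I (p x) b}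
  = space M - (\<Union>b'\<in>{b'\<in>I. to_nat_on I b' < to_nat_on I b}. {x\<in>space M. p x b' = p x b})"
  by (auto simp: first_index_def)
 also have "... \<in> sets M"
 proof -
  have "(\<Union>b'\<in>{b'\<in>I. to_nat_on I b' < to_nat_on I b}. {x\<in>space M. p x b' = p x b}) \<in> sets M"
   by (rule sets.countable_UN'[OF countable_subset[OF _ countable]]) (auto simp: coincide b)
  then show ?thesis by auto
 qed
 finally show ?thesis .
qed

lemma fibre_sum_measurable:
 assumes "\<And>b. b \<in> I ==> (%x. f (p x b)) \<in> borel_measurable M"
 shows "(%x. \<integral>\<^sup>+w. f w \<partial>count_space (p x ` I)) \<in> borel_measurable M"
proof -
 interpret c: sigma_finite_measure "count_space I"
  by (rule sigma_finite_measure_count_space_countable[OF countable])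
 have "(%x. f (p x b) * indicator {b. first_index I (p x) b} b) \<in> borel_measurable M" if "b \<in> I" for b
   using assms[OF that] first_sets[OF that] by simp
 then have "(%z. f (p (snd z) (fst z)) * indicator {b. first_index I (p (snd z)) b} (fst z))
   \<in> borel_measurable (count_space I \<Otimes>\<^sub>M M)"
  by (intro measurable_pair_measure_countable1[OF countable]) simp
 from measurable_compose[OF measurable_pair_swap' this]
 have "(%z. f (p (fst z) (snd z)) * indicator {b. first_index I (p (fst z)) b} (snd z))
   \<in> borel_measurable (M \<Otimes>\<^sub>M count_space I)" by (simp add: case_prod_beta)
 from c.borel_measurable_nn_integral_fst[OF this] show ?thesis
  by (simp add: nn_integral_count_space_image[OF countable])
qed

lemma fibre_card:
 "emeasure (count_space UNIV) (E \<inter> p x ` I) = nn_integral (count_space (p x ` I)) (%w. indicator E w)"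
 by (subst nn_integral_count_space_indicator)
  (auto simp flip: nn_integral_indicator intro!: nn_integral_cong split: split_indicator)

lemma fibre_card_measurable:
 "E \<in> fsets ==> (%x. emeasure (count_space UNIV) (E \<inter> p x ` I)) \<in> borel_measurable M" unfolding fibre_card
by (rule fibre_sum_measurable) (auto simp: fsets_def)

lemma sigma_algebra_fsets: "sigma_algebra total fsets" unfolding sigma_algebra_iff2
proof (intro conjI ballI allI impI)
 show "fsets \<subseteq> Pow total" "{} \<in> fsets" by (auto simp: fsets_def)
 fix E assume E: "E \<in> fsets"
 have "{x\<in>space M. p x b \<in> total - E} = space M - {x\<in>space M. p x b \<in> E}" if "b \<in> I" for b
  using that by (auto simp: total_def)
 then show "total - E \<in> fsets" using E by (auto simp: fsets_def)
next
 fix A :: "nat => 'p set" assume A: "range A \<subseteq> fsets"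
 moreover have "{x\<in>space M. p x b \<in> A i} \<in> sets M" if "b \<in> I" for b i using A that by (auto simp: fsets_def)
 ultimately show "\<Union>(range A) \<in> fsets" by (auto simp: fsets_def)
qed

end

text \<open>The orbit relation (by source and by target), the direct sum of its copies and the
  simplices of the quotient complex are all of this form, so integration and null sets are treated
  once for all of them.\<close>

locale fibred = fibre_coords M I p for M :: "'x measure" and I :: "'i set" and p :: "'x => 'i => 'p" +
 fixes W :: "'p measure"
 assumes space: "space W = total"
  and sets: "sets W = fsets"
  and emeasure: "\<And>E. E \<in> fsets ==> emeasure W E = nn_integral M (%x. emeasure (count_space UNIV) (E \<inter> p x ` I))"

context fibre_coords begin

lemma fibred_measure_of:
 assumes S: "S \<subseteq> Pow total" "sigma_sets total S = fsets"
  and nu: "\<And>E. E \<in> fsets ==> \<nu> E = nn_integral M (%x. emeasure (count_space UNIV) (E \<inter> p x ` I))"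
 shows "fibred M I p (measure_of total S \<nu>)"
proof
 let ?W = "measure_of total S \<nu>"
 show "space ?W = total" using S(1) by simp
 show sets: "sets ?W = fsets" using S by simp
 fix E assume E: "E \<in> fsets"
 have "emeasure ?W E = \<nu> E"
 proof (rule emeasure_measure_of[OF refl S(1)])
  show "positive (sets ?W) \<nu>" using nu[of "{}"] by (auto simp: positive_def fsets_def)
  show "countably_additive (sets ?W) \<nu>"
  proof (rule countably_additiveI)
   fix A :: "nat => 'p set" assume A: "range A \<subseteq> sets ?W" "disjoint_family A" "\<Union>(range A) \<in> sets ?W"
   have "\<nu> (\<Union>(range A)) = nn_integral M (%x. emeasure (count_space UNIV) (\<Union>i. A i \<inter> p x ` I))"
    using A by (simp add: nu sets)
   also have "... = nn_integral M (%x. (\<Sum>i. emeasure (count_space UNIV) (A i \<inter> p x ` I)))"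
    using A(2) by (intro nn_integral_cong suminf_emeasure[symmetric]) (auto simp: disjoint_family_on_def)
   also have "... = (\<Sum>i. \<integral>\<^sup>+x. emeasure (count_space UNIV) (A i \<inter> p x ` I) \<partial>M)"
    using A(1) by (intro nn_integral_suminf fibre_card_measurable) (auto simp: sets)
   also have "... = (\<Sum>i. \<nu> (A i))" using A(1) by (intro suminf_cong nu[symmetric]) (auto simp: sets)
   finally show "(\<Sum>i. \<nu> (A i)) = \<nu> (\<Union>(range A))" by simp
  qed
 qed (use E sets in auto)
 with nu[OF E] show "emeasure ?W E = nn_integral M (%x. emeasure (count_space UNIV) (E \<inter> p x ` I))" by simp
qed

end

context fibred begin

lemma p_space: "x \<in> space M ==> b \<in> I ==> p x b \<in> space W" by (auto simp: space total_def)

lemma p_measurable: "b \<in> I ==> (%x. p x b) \<in> M \<rightarrow>\<^sub>M W"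
by (rule measurableI) (auto simp: sets fsets_def p_space)

lemma measurable_iff: "f \<in> W \<rightarrow>\<^sub>M K \<longleftrightarrow> (\<forall>b\<in>I. (%x. f (p x b)) \<in> M \<rightarrow>\<^sub>M K)"
proof
 show "f \<in> W \<rightarrow>\<^sub>M K ==> \<forall>b\<in>I. (%x. f (p x b)) \<in> M \<rightarrow>\<^sub>M K" using measurable_compose[OF p_measurable] by blast
 assume f: "\<forall>b\<in>I. (%x. f (p x b)) \<in> M \<rightarrow>\<^sub>M K"
 show "f \<in> W \<rightarrow>\<^sub>M K"
 proof (rule measurableI)
  fix w assume "w \<in> space W"
  then obtain x b where "w = p x b" "x \<in> space M" "b \<in> I" by (auto simp: space total_def)
  then show "f w \<in> space K" using measurable_space[of "%x. f (p x b)" M K] f by auto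
 next
  fix A assume A: "A \<in> sets K"
  have "{x\<in>space M. p x b \<in> f -` A \<inter> space W} \<in> sets M" if b: "b \<in> I" for b
  proof -
   have "{x\<in>space M. p x b \<in> f -` A \<inter> space W} = (%x. f (p x b)) -` A \<inter> space M" using b p_space by auto
   then show ?thesis using f b A by auto
  qed
  then show "f -` A \<inter> space W \<in> sets W" by (auto simp: sets fsets_def space)
 qed
qed

lemma fibre_sum_borel:
 "f \<in> borel_measurable W ==> (%x. \<integral>\<^sup>+w. f w \<partial>count_space (p x ` I)) \<in> borel_measurable M"
 by (rule fibre_sum_measurable) (use measurable_iff in blast)

lemma nn_integral:
 assumes "f \<in> borel_measurable W"
 shows "nn_integral W (%w. f w) = nn_integral M (%x. (nn_integral (count_space (p x ` I)) (%w. f w)))"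
 using assms
proof (induction f)
 case (cong f g)
 have "nn_integral W (%w. f w) = nn_integral W (%w. g w)" using cong by (intro nn_integral_cong)
 moreover have "nn_integral M (%x. (nn_integral (count_space (p x ` I)) (%w. f w))) = nn_integral M (%x. (nn_integral (count_space (p x ` I)) (%w. g w)))"
  using cong p_space by (intro nn_integral_cong) auto
 ultimately show ?case using cong by simp
next
 case (set A)
 then show ?case using emeasure[of A] by (simp add: sets fibre_card)
next
 case (mult u c)
 then show ?case by (simp add: nn_integral_cmult fibre_sum_borel)
next
 case (add u v)
 then show ?case by (simp add: nn_integral_add fibre_sum_borel)
next
 case (seq U)
 have "(nn_integral M (%x. (nn_integral (count_space (p x ` I)) (%w. (SUP i. U i w)))))
   = nn_integral M (%x. (SUP i. \<integral>\<^sup>+w. U i w \<partial>count_space (p x ` I)))"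
  using seq by (intro nn_integral_cong nn_integral_monotone_convergence_SUP) auto
 also have "... = (SUP i. \<integral>\<^sup>+x. (nn_integral (count_space (p x ` I)) (%w. U i w)) \<partial>M)"
 proof (rule nn_integral_monotone_convergence_SUP)
  show "incseq (%i x. \<integral>\<^sup>+w. U i w \<partial>count_space (p x ` I))"
   using \<open>incseq U\<close> by (auto simp: incseq_def le_fun_def intro!: nn_integral_mono)
 qed (use seq fibre_sum_borel in auto)
 also have "... = (SUP i. \<integral>\<^sup>+w. U i w \<partial>W)" using seq by simp
 also have "... = nn_integral W (%w. (SUP i. U i w))"
  using seq by (intro nn_integral_monotone_convergence_SUP[symmetric])
 finally show ?case by (simp add: SUP_apply[abs_def])
qed

text \<open>Counting measure charges every point, so a null set misses almost every fibre entirely;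
  conversely all the fibres over a null set of the base form a null set.\<close>

lemma AE_iff: "(AE w in W. Q w) \<longleftrightarrow> (AE x in M. \<forall>b\<in>I. Q (p x b))"
proof
 assume "AE w in W. Q w"
 then obtain N where N: "{w\<in>space W. \<not> Q w} \<subseteq> N" "emeasure W N = 0" "N \<in> sets W" by (auto elim: AE_E)
 have "nn_integral M (%x. emeasure (count_space UNIV) (N \<inter> p x ` I)) = 0"
  using emeasure N by (simp add: sets)
 then have "AE x in M. emeasure (count_space UNIV) (N \<inter> p x ` I) = 0"
  using N by (subst (asm) nn_integral_0_iff_AE) (auto simp: sets fibre_card_measurable)
 then show "AE x in M. \<forall>b\<in>I. Q (p x b)" using N p_space by (fastforce simp: emeasure_count_space_eq_0)
next
 assume "AE x in M. \<forall>b\<in>I. Q (p x b)"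
 then obtain N where N: "{x\<in>space M. \<not> (\<forall>b\<in>I. Q (p x b))} \<subseteq> N" "emeasure M N = 0" "N \<in> sets M"
  by (auto elim: AE_E)
 define E where "E = {p x b |x b. x \<in> N \<and> b \<in> I}"
 have Ns: "N \<subseteq> space M" using N sets.sets_into_space by blast
 have "{x\<in>space M. p x b \<in> E} = N" if "b \<in> I" for b using that base Ns by (fastforce simp: E_def)
 then have E: "E \<in> fsets" using N by (fastforce simp: fsets_def E_def total_def)
 have "emeasure W E = nn_integral M (%x. emeasure (count_space UNIV) (E \<inter> p x ` I))" by (rule emeasure[OF E])
 also have "... = nn_integral M (%x. 0)"
 proof (rule nn_integral_cong_AE)
  have "AE x in M. x \<notin> N" using N by (intro AE_not_in) auto
  then show "AE x in M. emeasure (count_space UNIV) (E \<inter> p x ` I) = 0"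
  proof (rule AE_mp, intro AE_I2 impI)
   fix x assume x: "x \<in> space M" "x \<notin> N"
   then have "E \<inter> p x ` I = {}" using base Ns by (fastforce simp: E_def)
   then show "emeasure (count_space UNIV) (E \<inter> p x ` I) = 0" by simp
  qed
 qed
 finally show "AE w in W. Q w" using N E by (intro AE_I[of _ _ E]) (auto simp: sets E_def space total_def)
qed

end

lemma fibred_nn_integral_bij:
 assumes "fibred M I p W" "fibred M J q W'" and [measurable]: "\<Phi> \<in> W \<rightarrow>\<^sub>M W'" "f \<in> borel_measurable W'"
  and bij: "\<And>x. x \<in> space M ==> bij_betw \<Phi> (p x ` I) (q x ` J)"
 shows "nn_integral W (%w. f (\<Phi> w)) = nn_integral W' (%w. f w)"
 by (subst fibred.nn_integral[OF assms(1)], measurable, subst fibred.nn_integral[OF assms(2)], measurable)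
  (auto intro!: nn_integral_cong nn_integral_bij_count_space bij)

lemma fibred_distr:
 assumes "fibred M I p W" "fibred M J q W'" and [measurable]: "\<Phi> \<in> W \<rightarrow>\<^sub>M W'"
  and bij: "\<And>x. x \<in> space M ==> bij_betw \<Phi> (p x ` I) (q x ` J)"
 shows "distr W W' \<Phi> = W'"
proof (rule measure_eqI)
 fix A assume "A \<in> sets (distr W W' \<Phi>)"
 then have [measurable]: "A \<in> sets W'" by simp
 have "emeasure (distr W W' \<Phi>) A = nn_integral (distr W W' \<Phi>) (%w. indicator A w)" by simp
 also have "... = nn_integral W (%w. indicator A (\<Phi> w))" by (subst nn_integral_distr) auto
 also have "... = nn_integral W' (%w. indicator A w)" by (rule fibred_nn_integral_bij[OF assms(1,2)]) (auto intro: bij)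
 finally show "emeasure (distr W W' \<Phi>) A = emeasure W' A" by simp
qed simp

section \<open>The Loeb measure of an ultraproduct of coset spaces\<close>

text \<open>Compactness provides a cluster point of the image filter, and an ultrafilter that
  clusters at a point converges to it.\<close>

lemma ultrafilter_bounded_convergent:
 fixes f :: "nat => real"
 assumes U: "nonprincipal_ultrafilter \<U>" and f: "\<And>n. f n \<in> {a..b}"
 shows "(f \<longlongrightarrow> Lim \<U> f) \<U>"
proof -
 have nb: "\<U> \<noteq> bot" and ult: "\<And>P. eventually P \<U> \<or> eventually (%n. \<not> P n) \<U>"
  using U by (auto simp: nonprincipal_ultrafilter_def)
 have "filtermap f \<U> \<noteq> bot" "eventually (%x. x \<in> {a..b}) (filtermap f \<U>)"
  using nb f by (auto simp: filtermap_bot_iff eventually_filtermap)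
 then obtain l where l: "inf (nhds l) (filtermap f \<U>) \<noteq> bot"
  using compact_Icc[of a b] unfolding compact_filter by blast
 have "(f \<longlongrightarrow> l) \<U>" unfolding filterlim_iff
 proof (intro allI impI)
  fix P assume P: "eventually P (nhds l)"
  show "\<forall>\<^sub>F x in \<U>. P (f x)"
  proof (rule ccontr)
   assume "\<not> (\<forall>\<^sub>F x in \<U>. P (f x))"
   with P have "eventually (%_. False) (inf (nhds l) (filtermap f \<U>))"
    using ult[of "%x. P (f x)"] by (auto simp: eventually_inf eventually_filtermap)
   then show False using l by simp
  qed
 qed
 then show ?thesis using tendsto_Lim[OF nb] by metis
qed

locale coset_sequence = group G for G :: "('g, 'm) monoid_scheme" (structure) +
 fixes H :: "nat => 'g set" and \<U> :: "nat filter"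
 assumes subgroups: "\<And>n. subgroup (H n) G"
  and finite_index: "\<And>n. finite (lcosets (H n))"
  and ultra: "nonprincipal_ultrafilter \<U>"
begin

lemma nontrivial: "\<U> \<noteq> bot" using ultra by (simp add: nonprincipal_ultrafilter_def)

lemma ultra_not: "(\<forall>\<^sub>F n in \<U>. \<not> P n) \<longleftrightarrow> \<not> (\<forall>\<^sub>F n in \<U>. P n)"
proof
 assume 1: "\<forall>\<^sub>F n in \<U>. \<not> P n"
 show "\<not> (\<forall>\<^sub>F n in \<U>. P n)"
 proof
  assume "\<forall>\<^sub>F n in \<U>. P n"
  with 1 have "\<forall>\<^sub>F n in \<U>. False" by eventually_elim simp
  then show False using nontrivial by simp
 qed
qed (use ultra in \<open>auto simp: nonprincipal_ultrafilter_def\<close>)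

text \<open>The form in which nonprincipality enters the saturation argument.\<close>

lemma ultra_ge: "\<forall>\<^sub>F n in \<U>. k \<le> n"
proof -
 have "\<forall>\<^sub>F n in \<U>. n \<noteq> j" for j using ultra by (simp add: nonprincipal_ultrafilter_def ultra_not)
 then have "\<forall>\<^sub>F n in \<U>. \<forall>j\<in>{..<k}. n \<noteq> j" by (intro eventually_ball_finite) auto
 then show ?thesis by eventually_elim (auto)
qed

abbreviation "C n \<equiv> lcosets (H n)"
abbreviation "X \<equiv> ultraproduct G H \<U>"
abbreviation "internal \<equiv> internal_set G H \<U>"
definition cls where "cls x = ultra_rel G H \<U> `` {x}"
definition ldensity :: "(nat => 'g set set) => real" where
 "ldensity A = Lim \<U> (%n. real (card (A n)) / real (card (C n)))"

lemma coset_carrier: "c \<in> C n ==> c \<subseteq> carrier G" using subgroup.lcosets_carrier[OF subgroups is_group] .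

lemma translate_coset: "g \<in> carrier G ==> c \<in> C n ==> g <# c \<in> C n"
 using lcos_m_assoc[OF subgroup.subset[OF subgroups]] by (fastforce simp: LCOSETS_def)

lemma translate_mult: "g \<in> carrier G ==> h \<in> carrier G ==> c \<in> C n ==> g <# (h <# c) = (g \<otimes> h) <# c"
 using lcos_m_assoc coset_carrier by blast

lemma translate_one: "c \<in> C n ==> \<one> <# c = c" using lcos_mult_one coset_carrier by blast

lemma C_nonempty: "C n \<noteq> {}" by (auto simp: LCOSETS_def)

lemma card_C_pos: "card (C n) > 0" using finite_index C_nonempty by (simp add: card_gt_0_iff)

lemma in_seqs: "x \<in> coset_seqs G H \<longleftrightarrow> (\<forall>n. x n \<in> C n)" by (auto simp: coset_seqs_def)

lemma cls_eq_iff: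
 assumes "x \<in> coset_seqs G H" "y \<in> coset_seqs G H"
 shows "cls x = cls y \<longleftrightarrow> (\<forall>\<^sub>F n in \<U>. x n = y n)"
proof
 assume "cls x = cls y"
 moreover have "y \<in> cls y" using assms by (auto simp: cls_def ultra_rel_def)
 ultimately have "y \<in> cls x" by simp
 then show "\<forall>\<^sub>F n in \<U>. x n = y n" by (auto simp: cls_def ultra_rel_def)
next
 assume *: "\<forall>\<^sub>F n in \<U>. x n = y n"
 have "(\<forall>\<^sub>F n in \<U>. x n = z n) \<longleftrightarrow> (\<forall>\<^sub>F n in \<U>. y n = z n)" for z
  by (rule eventually_subst[OF eventually_mono[OF *]]) auto
 then show "cls x = cls y" using assms by (auto simp: cls_def ultra_rel_def)
qed

lemma X_eq: "X = cls ` coset_seqs G H" by (auto simp: ultraproduct_def quotient_def cls_def)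

lemma internal_eq: "internal A = {cls x | x. x \<in> coset_seqs G H \<and> (\<forall>\<^sub>F n in \<U>. x n \<in> A n)}"
 by (simp add: internal_set_def cls_def)

lemma cls_internal_iff:
 assumes x: "x \<in> coset_seqs G H" shows "cls x \<in> internal A \<longleftrightarrow> (\<forall>\<^sub>F n in \<U>. x n \<in> A n)"
proof
 assume "cls x \<in> internal A"
 then obtain y where y: "y \<in> coset_seqs G H" "\<forall>\<^sub>F n in \<U>. y n \<in> A n" "cls x = cls y"
  by (auto simp: internal_eq)
 from y(2) y(3)[unfolded cls_eq_iff[OF x y(1)]] show "\<forall>\<^sub>F n in \<U>. x n \<in> A n" by eventually_elim auto
qed (use x in \<open>auto simp: internal_eq\<close>)

lemma internal_subset: "internal A \<subseteq> X" by (auto simp: internal_eq X_eq)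

lemma X_internal: "internal C = X" by (auto simp: internal_eq X_eq in_seqs)

lemma internal_Int: "internal A \<inter> internal B = internal (%n. A n \<inter> B n)" using internal_subset
 by (fastforce simp: X_eq cls_internal_iff eventually_conj_iff)

lemma internal_Diff: "internal A - internal B = internal (%n. A n - B n)" using internal_subset
by (fastforce simp: X_eq cls_internal_iff eventually_conj_iff ultra_not)

lemma internal_Un: "internal A \<union> internal B = internal (%n. A n \<union> B n)"
proof -
 have "(\<forall>\<^sub>F n in \<U>. P n \<or> Q n) \<longleftrightarrow> (\<forall>\<^sub>F n in \<U>. P n) \<or> (\<forall>\<^sub>F n in \<U>. Q n)" for P Q
  using ultra_not[of "%n. P n \<or> Q n"] ultra_not[of P] ultra_not[of Q] by (auto simp: eventually_conj_iff)
 then have "c \<in> internal A \<union> internal B \<longleftrightarrow> c \<in> internal (%n. A n \<union> B n)" if "c \<in> X" for c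
  using that by (auto simp: X_eq cls_internal_iff)
 then show ?thesis using internal_subset by blast
qed

lemma internal_empty_iff:
 assumes "\<And>n. A n \<subseteq> C n" shows "internal A = {} \<longleftrightarrow> (\<forall>\<^sub>F n in \<U>. A n = {})"
proof
 assume e: "internal A = {}"
 \<comment> \<open>Falling back on an arbitrary coset where \<open>A n\<close> is empty keeps
   \<open>x\<close> a sequence of cosets.\<close>
 define x where "x n = (SOME c. c \<in> C n \<and> (A n \<noteq> {} --> c \<in> A n))" for n
 have x: "x n \<in> C n \<and> (A n \<noteq> {} --> x n \<in> A n)" for n
  unfolding x_def by (rule someI_ex) (use assms[of n] C_nonempty[of n] in auto)
 then have "cls x \<notin> internal A" "x \<in> coset_seqs G H" using e by (auto simp: in_seqs)
 then have "\<forall>\<^sub>F n in \<U>. x n \<notin> A n" by (simp add: cls_internal_iff ultra_not)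
 then show "\<forall>\<^sub>F n in \<U>. A n = {}" by eventually_elim (use x in auto)
next
 assume e: "\<forall>\<^sub>F n in \<U>. A n = {}"
 have "\<not> (\<forall>\<^sub>F n in \<U>. x n \<in> A n)" for x
 proof
  assume "\<forall>\<^sub>F n in \<U>. x n \<in> A n"
  with e have "\<forall>\<^sub>F n in \<U>. False" by eventually_elim auto
  then show False using nontrivial by simp
 qed
 then show "internal A = {}" by (auto simp: internal_eq)
qed

text \<open>Countable saturation of the ultraproduct, by a diagonal choice: at stage
  \<open>n\<close> a point is taken in the deepest nonempty \<open>D k n\<close> with
  \<open>k \<le> n\<close>.\<close>

lemma saturation:
 assumes sub: "\<And>k n. D k n \<subseteq> C n" and dec: "\<And>k n. D (Suc k) n \<subseteq> D k n"
  and ne: "\<And>k. internal (D k) \<noteq> {}"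
 shows "(\<Inter>k. internal (D k)) \<noteq> {}"
proof -
 have anti: "D l n \<subseteq> D k n" if "k \<le> l" for k l n using lift_Suc_antimono_le[of "%k. D k n", OF dec that] .
 \<comment> \<open>The cap \<open>k \<le> n\<close> makes the maximum exist. By nonprincipality any
   fixed \<open>k\<close> obeys the cap for almost all \<open>n\<close>.\<close>
 define m where "m n = (GREATEST k. k \<le> n \<and> D k n \<noteq> {})" for n
 define x where "x n = (SOME c. c \<in> C n \<and> (D (m n) n \<noteq> {} --> c \<in> D (m n) n))" for n
 have x: "x n \<in> C n \<and> (D (m n) n \<noteq> {} --> x n \<in> D (m n) n)" for n
  unfolding x_def by (rule someI_ex) (use sub[of "m n" n] C_nonempty[of n] in auto)
 have "cls x \<in> internal (D k)" for k
 proof -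
  have "\<forall>\<^sub>F n in \<U>. k \<le> n \<and> D k n \<noteq> {}"
   using ne[of k] by (simp add: internal_empty_iff sub ultra_not eventually_conj_iff ultra_ge)
  then have "\<forall>\<^sub>F n in \<U>. x n \<in> D k n"
  proof eventually_elim
   case (elim n)
   have "m n \<le> n \<and> D (m n) n \<noteq> {}" unfolding m_def by (rule GreatestI_nat[of "%k. k \<le> n \<and> D k n \<noteq> {}" k n]) (use elim in auto)
   moreover have "k \<le> m n" unfolding m_def by (rule Greatest_le_nat[of "%k. k \<le> n \<and> D k n \<noteq> {}" k n]) (use elim in auto)
   ultimately show ?case using x[of n] anti[of k "m n" n] by auto
  qed
  then show ?thesis using x by (simp add: cls_internal_iff in_seqs)
 qed
 then show ?thesis by blast
qed

section \<open>Densities as a countably additive premeasure on internal sets\<close>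

abbreviation subs where "subs \<equiv> {A. \<forall>n. A n \<subseteq> C n}"

lemma density_tendsto:
 assumes "A \<in> subs" shows "((%n. real (card (A n)) / real (card (C n))) \<longlongrightarrow> ldensity A) \<U>"
proof -
 have "real (card (A n)) / real (card (C n)) \<in> {0..1}" for n using assms finite_index
  using card_C_pos[of n] by (auto intro: card_mono)
 from ultrafilter_bounded_convergent[OF ultra, of "%n. real (card (A n)) / real (card (C n))", OF this]
 show ?thesis by (simp add: ldensity_def)
qed

lemma density_nonneg: "A \<in> subs ==> 0 \<le> ldensity A"
 by (rule tendsto_lowerbound[OF density_tendsto _ nontrivial]) auto

text \<open>An internal set determines its components for almost every \<open>n\<close>, so the
  density is a function of the set and not of the sequence representing it.\<close>

lemma density_cong:
 assumes "A \<in> subs" "B \<in> subs" "internal A = internal B" shows "ldensity A = ldensity B"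
proof -
 have "\<forall>\<^sub>F n in \<U>. A n - B n = {}" "\<forall>\<^sub>F n in \<U>. B n - A n = {}"
  using assms internal_Diff[of A B] internal_Diff[of B A] by (subst internal_empty_iff[symmetric]; force)+
 then have "\<forall>\<^sub>F n in \<U>. real (card (A n)) / real (card (C n)) = real (card (B n)) / real (card (C n))"
 by eventually_elim auto
 then have "((%n. real (card (B n)) / real (card (C n))) \<longlongrightarrow> ldensity A) \<U>"
  using density_tendsto[OF assms(1)] by (rule Lim_transform_eventually[rotated])
 then show ?thesis using density_tendsto[OF assms(2)] tendsto_unique[OF nontrivial] by blast
qed

lemma density_empty: "A \<in> subs ==> internal A = {} ==> ldensity A = 0"
proof -
 assume A: "A \<in> subs" "internal A = {}"
 have "internal (%n. {}) = {}" by (subst internal_empty_iff) auto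
 then have "ldensity A = ldensity (%n. {})" using A by (intro density_cong) auto
 also have "... = 0" using density_tendsto[of "%n. {}"] tendsto_unique[OF nontrivial _ tendsto_const] by simp
 finally show ?thesis .
qed

lemma density_Un:
 assumes "A \<in> subs" "B \<in> subs" "internal A \<inter> internal B = {}"
 shows "ldensity (%n. A n \<union> B n) = ldensity A + ldensity B"
proof -
 have "\<forall>\<^sub>F n in \<U>. A n \<inter> B n = {}"
  using assms internal_Int[of A B] by (subst internal_empty_iff[symmetric]) auto
 then have "\<forall>\<^sub>F n in \<U>. real (card (A n)) / real (card (C n)) + real (card (B n)) / real (card (C n))
   = real (card (A n \<union> B n)) / real (card (C n))"
 proof eventually_elim
  case (elim n)
  have "A n \<subseteq> C n" "B n \<subseteq> C n" using assms by auto
  then have "finite (A n)" "finite (B n)" by (auto intro: finite_subset[OF _ finite_index])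
  then show ?case using elim by (simp add: card_Un_disjoint add_divide_distrib)
 qed
 then have "((%n. real (card (A n \<union> B n)) / real (card (C n))) \<longlongrightarrow> ldensity A + ldensity B) \<U>"
  using tendsto_add[OF density_tendsto[OF assms(1)] density_tendsto[OF assms(2)]]
  by (rule Lim_transform_eventually[rotated])
 then show ?thesis using density_tendsto[of "%n. A n \<union> B n"] assms tendsto_unique[OF nontrivial] by blast
qed

lemma density_finite_UN:
 fixes A :: "nat => nat => 'g set set"
 assumes "\<And>i. A i \<in> subs" "disjoint_family (%i. internal (A i))"
 shows "internal (%n. \<Union>i<k. A i n) = (\<Union>i<k. internal (A i))"
  and "ldensity (%n. \<Union>i<k. A i n) = (\<Sum>i<k. ldensity (A i))"
proof (induction k)
 case 0
 have e: "internal (%n. {}) = {}" by (subst internal_empty_iff) auto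
 case 1 then show ?case by (simp add: e)
 case 2 then show ?case using density_empty[OF _ e] by simp
next
 case (Suc k)
 have eq: "(%n. \<Union>i<Suc k. A i n) = (%n. (\<Union>i<k. A i n) \<union> A k n)" by (auto simp: lessThan_Suc)
 case 1 show ?case using Suc(1) by (simp only: eq internal_Un[symmetric]) (auto simp: lessThan_Suc)
 case 2
 have "internal (%n. \<Union>i<k. A i n) \<inter> internal (A k) = {}"
 proof -
  have "internal (A l) \<inter> internal (A k) = {}" if "l < k" for l
   using assms(2) that by (simp add: disjoint_family_on_def)
  then show ?thesis unfolding Suc(1) by blast
 qed
 then have "ldensity (%n. (\<Union>i<k. A i n) \<union> A k n) = ldensity (%n. \<Union>i<k. A i n) + ldensity (A k)"
  using assms(1) by (intro density_Un) blast+
 then show ?case using Suc(2) by (simp only: eq) simp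
qed

text \<open>By saturation a countable disjoint union of internal sets can be internal only if all
  but finitely many of them are empty, so countable additivity reduces to finite additivity.\<close>

lemma density_UN:
 assumes A: "\<And>i::nat. A i \<in> subs" and B: "B \<in> subs" and dis: "disjoint_family (%i. internal (A i))"
  and un: "(\<Union>i. internal (A i)) = internal B"
 shows "(\<Sum>i. ennreal (ldensity (A i))) = ennreal (ldensity B)"
proof -
 define D where "D k n = B n - (\<Union>i<k. A i n)" for k n
 have D: "internal (D k) = internal B - (\<Union>i<k. internal (A i))" for k
  unfolding D_def by (simp flip: internal_Diff density_finite_UN(1)[OF A dis])
 have "\<exists>k. internal (D k) = {}"
 proof (rule ccontr)
  assume "\<nexists>k. internal (D k) = {}"
  then have "(\<Inter>k. internal (D k)) \<noteq> {}" by (intro saturation) (use B in \<open>auto simp: D_def\<close>)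
  then obtain c where c: "\<And>k. c \<in> internal (D k)" by blast
  then obtain i where "c \<in> internal (A i)" using D[of 0] using un by blast
  then show False using c[of "Suc i"] unfolding D by auto
 qed
 then obtain k where k: "internal (D k) = {}" by blast
 have eq: "internal B = internal (%n. \<Union>i<k. A i n)"
  using k un unfolding D density_finite_UN(1)[OF A dis] by blast
 have "internal (A i) = {}" if "i \<ge> k" for i
 proof -
  have "internal (A i) \<subseteq> (\<Union>i<k. internal (A i))" using eq un density_finite_UN(1)[OF A dis] by auto
  moreover have "internal (A i) \<inter> internal (A l) = {}" if "l < k" for l
   using dis that \<open>i \<ge> k\<close> by (simp add: disjoint_family_on_def)
  ultimately show ?thesis by blast
 qed
 then have "ldensity (A i) = 0" if "i \<notin> {..<k}" for i using that A by (intro density_empty) auto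
 then have "(\<Sum>i. ennreal (ldensity (A i))) = (\<Sum>i<k. ennreal (ldensity (A i)))" by (intro suminf_finite) auto
 also have "... = ennreal (\<Sum>i<k. ldensity (A i))" using A by (intro sum_ennreal density_nonneg)
 also have "(\<Sum>i<k. ldensity (A i)) = ldensity (%n. \<Union>i<k. A i n)"
  by (rule density_finite_UN(2)[OF A dis, symmetric])
 also have "... = ldensity B"
 proof (rule density_cong)
  show "(%n. \<Union>i<k. A i n) \<in> subs" using A by blast
 qed (use B eq in auto)
 finally show ?thesis .
qed

definition preloeb where "preloeb = extend_measure X subs internal (%A. ennreal (ldensity A))"

lemma loeb_completion: "loeb_measure G H \<U> = completion preloeb"
 by (simp add: loeb_measure_def preloeb_def ldensity_def)

lemma internal_Pow: "internal ` subs \<subseteq> Pow X" using internal_subset by auto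

lemma algebra_internal: "Sigma_Algebra.algebra X (internal ` subs)" unfolding algebra_iff_Un
proof (intro conjI ballI)
 show "internal ` subs \<subseteq> Pow X" by (rule internal_Pow)
 have "internal (%n. {}) = {}" by (subst internal_empty_iff) auto
 moreover have "(%n. {}) \<in> subs" by simp
 ultimately show "{} \<in> internal ` subs" by auto
next
 fix a assume "a \<in> internal ` subs"
 then obtain A where "a = internal A" "A \<in> subs" by auto
 then have "X - a = internal (%n. C n - A n)" by (simp flip: X_internal internal_Diff)
 then show "X - a \<in> internal ` subs" by force
next
 fix a b assume "a \<in> internal ` subs" "b \<in> internal ` subs"
 then obtain A B where "a = internal A" "A \<in> subs" "b = internal B" "B \<in> subs" by auto
 then show "a \<union> b \<in> internal ` subs" by (auto simp: internal_Un)
qed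

lemma space_preloeb: "space preloeb = X" unfolding preloeb_def by (rule space_extend_measure[OF internal_Pow])

lemma sets_preloeb: "sets preloeb = sigma_sets X (internal ` subs)"
 unfolding preloeb_def by (rule sets_extend_measure[OF internal_Pow])

lemma emeasure_preloeb:
 assumes "A \<in> subs" shows "emeasure preloeb (internal A) = ennreal (ldensity A)"
proof (rule extend_measure_caratheodory[OF preloeb_def assms])
 interpret Sigma_Algebra.algebra X "internal ` subs" by (rule algebra_internal)
 show "semiring_of_sets X (internal ` subs)" ..
 show "(\<Sum>n. ennreal (ldensity (A n))) = ennreal (ldensity j)"
  if "A \<in> UNIV \<rightarrow> subs" "j \<in> subs" "disjoint_family (internal \<circ> A)" "(\<Union>i. internal (A i)) = internal j" for A j
  using that by (intro density_UN) (auto simp: comp_def)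
qed (auto simp: density_empty intro: arg_cong[where f=ennreal] density_cong)

lemma internal_sets: "A \<in> subs ==> internal A \<in> sets preloeb" unfolding sets_preloeb by simp

lemma preloeb_space: "emeasure preloeb X = 1"
proof -
 have "ldensity C = 1"
  using density_tendsto[of C] card_C_pos using tendsto_unique[OF nontrivial _ tendsto_const] by (simp add: less_imp_neq[THEN not_sym])
 then show ?thesis using emeasure_preloeb[of C] by (simp add: X_internal)
qed

abbreviation "loeb \<equiv> loeb_measure G H \<U>"

lemma space_loeb: "space loeb = X" by (simp add: loeb_completion space_preloeb)

lemma emeasure_loeb_space: "emeasure loeb (space loeb) = 1"
 using preloeb_space sets.top[of preloeb] by (simp add: loeb_completion space_preloeb)

lemma internal_loeb:
 assumes "A \<in> subs" shows "internal A \<in> sets loeb" "emeasure loeb (internal A) = ennreal (ldensity A)"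
 using internal_sets[OF assms] emeasure_preloeb[OF assms] by (auto simp: loeb_completion)

section \<open>The action on the ultraproduct\<close>

abbreviation "act \<equiv> ultra_action G H \<U>"

lemma seqs_translate: "g \<in> carrier G ==> x \<in> coset_seqs G H ==> (%n. g <# x n) \<in> coset_seqs G H"
 by (auto simp: in_seqs translate_coset)

text \<open>The action is defined as a union over all representatives of a class; they all yield the
  same class, so the union collapses.\<close>

lemma act_cls:
 assumes "g \<in> carrier G" "x \<in> coset_seqs G H" shows "act g (cls x) = cls (%n. g <# x n)"
proof -
 have "cls (%n. g <# y n) = cls (%n. g <# x n)" if "y \<in> cls x" for y
 proof -
  have y: "y \<in> coset_seqs G H" "\<forall>\<^sub>F n in \<U>. x n = y n" using that by (auto simp: cls_def ultra_rel_def)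
  show ?thesis by (subst cls_eq_iff) (use assms y in \<open>auto intro: seqs_translate elim: eventually_mono\<close>)
 qed
 moreover have "x \<in> cls x" using assms by (auto simp: cls_def ultra_rel_def)
 ultimately show ?thesis unfolding ultra_action_def cls_def[symmetric] by blast
qed

lemma act_in: "g \<in> carrier G ==> c \<in> X ==> act g c \<in> X" by (auto simp: X_eq act_cls seqs_translate)

lemma X_cases: assumes "c \<in> X" obtains x where "x \<in> coset_seqs G H" "c = cls x"
 using assms unfolding X_eq by blast

lemma act_mult:
 assumes "g \<in> carrier G" "h \<in> carrier G" "c \<in> X" shows "act (g \<otimes> h) c = act g (act h c)"
proof -
 obtain x where x: "x \<in> coset_seqs G H" "c = cls x" by (rule X_cases[OF assms(3)])
 have "(%n. g <# (h <# x n)) = (%n. (g \<otimes> h) <# x n)"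
 proof
  fix n
  have "x n \<in> C n" using x by (simp add: in_seqs)
  then show "g <# (h <# x n) = (g \<otimes> h) <# x n" by (rule translate_mult[OF assms(1,2)])
 qed
 then show ?thesis using assms x by (simp add: act_cls seqs_translate)
qed

lemma act_one: "c \<in> X ==> act \<one> c = c"
proof -
 assume "c \<in> X"
 then obtain x where x: "x \<in> coset_seqs G H" "c = cls x" by (rule X_cases)
 have "(%n. \<one> <# x n) = x" using x by (auto simp: in_seqs intro!: translate_one)
 then show ?thesis using x by (simp add: act_cls)
qed

lemma fix_internal:
 assumes "g \<in> carrier G" shows "{c \<in> X. act g c = c} = internal (%n. {y \<in> C n. g <# y = y})"
proof -
 have *: "act g (cls x) = cls x \<longleftrightarrow> cls x \<in> internal (%n. {y \<in> C n. g <# y = y})" if x: "x \<in> coset_seqs G H" for x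
  using assms x in_seqs[of x] by (simp add: act_cls cls_eq_iff[OF seqs_translate] cls_internal_iff)
 show ?thesis
 proof (intro Set.set_eqI iffI)
  fix c assume c: "c \<in> {c \<in> X. act g c = c}"
  then obtain x where "x \<in> coset_seqs G H" "c = cls x" using X_cases by blast
  then show "c \<in> internal (%n. {y \<in> C n. g <# y = y})" using *[of x] c by simp
 next
  fix c assume c: "c \<in> internal (%n. {y \<in> C n. g <# y = y})"
  then have "c \<in> X" using internal_subset by blast
  moreover then obtain x where "x \<in> coset_seqs G H" "c = cls x" using X_cases by blast
  ultimately show "c \<in> {c \<in> X. act g c = c}" using *[of x] c by simp
 qed
qed

lemma fix_sets: "g \<in> carrier G ==> {c \<in> X. act g c = c} \<in> sets loeb" by (simp add: fix_internal internal_loeb)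

text \<open>The bridge between the two sides of the theorem: densities of fixed cosets are the only
  data of the finite quotients that enter the traces, and here they converge to the data of the
  limit action.\<close>

lemma fix_measure:
 assumes "g \<in> carrier G"
 shows "((%n. real (card {y \<in> C n. g <# y = y}) / real (card (C n))) \<longlongrightarrow> measure loeb {c \<in> X. act g c = c}) \<U>"
 using density_tendsto[of "%n. {y \<in> C n. g <# y = y}"] density_nonneg[of "%n. {y \<in> C n. g <# y = y}"]
  internal_loeb(2)[of "%n. {y \<in> C n. g <# y = y}"] by (simp add: fix_internal[OF assms] measure_def)

lemma act_vimage:
 assumes "g \<in> carrier G" "A \<in> subs"
 shows "act g -` internal A \<inter> X = internal (%n. {y \<in> C n. g <# y \<in> A n})"
proof -
 have *: "act g (cls x) \<in> internal A \<longleftrightarrow> cls x \<in> internal (%n. {y \<in> C n. g <# y \<in> A n})" if x: "x \<in> coset_seqs G H" for x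
  using assms x in_seqs[of x] by (simp add: act_cls cls_internal_iff[OF seqs_translate] cls_internal_iff)
 show ?thesis
 proof (intro Set.set_eqI iffI)
  fix c assume c: "c \<in> act g -` internal A \<inter> X"
  then obtain x where "x \<in> coset_seqs G H" "c = cls x" using X_cases by blast
  then show "c \<in> internal (%n. {y \<in> C n. g <# y \<in> A n})" using *[of x] c by simp
 next
  fix c assume c: "c \<in> internal (%n. {y \<in> C n. g <# y \<in> A n})"
  then have "c \<in> X" using internal_subset by blast
  moreover then obtain x where "x \<in> coset_seqs G H" "c = cls x" using X_cases by blast
  ultimately show "c \<in> act g -` internal A \<inter> X" using *[of x] c by simp
 qed
qed

lemma act_density:
 assumes "g \<in> carrier G" "A \<in> subs" shows "ldensity (%n. {y \<in> C n. g <# y \<in> A n}) = ldensity A"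
proof -
 have "card {y \<in> C n. g <# y \<in> A n} = card (A n)" for n
 proof (rule bij_betw_same_card[of "%y. g <# y"], rule bij_betw_byWitness[where f'="%y. inv g <# y"])
  have gi: "inv g <# (g <# y) = y \<and> g <# (inv g <# y) = y" if "y \<in> C n" for y
   using assms(1) that by (simp add: translate_mult translate_one)
  show "\<forall>y\<in>{y \<in> C n. g <# y \<in> A n}. inv g <# (g <# y) = y" using gi by blast
  show "\<forall>y\<in>A n. g <# (inv g <# y) = y" using gi assms(2) by blast
  show "(%y. inv g <# y) ` A n \<subseteq> {y \<in> C n. g <# y \<in> A n}" using assms
  by (fastforce simp: translate_coset translate_mult translate_one)
 qed auto
 then show ?thesis by (simp add: ldensity_def)
qed

lemma act_preloeb_measurable: "g \<in> carrier G ==> act g \<in> preloeb \<rightarrow>\<^sub>M preloeb"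
proof (rule measurable_sigma_sets[OF sets_preloeb internal_Pow])
 assume g: "g \<in> carrier G"
 show "act g \<in> space preloeb \<rightarrow> X" using g by (auto simp: space_preloeb act_in)
 fix y assume "y \<in> internal ` subs"
 then show "act g -` y \<inter> space preloeb \<in> sets preloeb"
  using g by (auto simp: space_preloeb act_vimage intro!: internal_sets)
qed

lemma act_preloeb_distr:
 assumes g: "g \<in> carrier G" shows "distr preloeb preloeb (act g) = preloeb"
proof (rule measure_eqI_generator_eq[where E="internal ` subs" and \<Omega>=X and A="%_. X"])
 interpret Sigma_Algebra.algebra X "internal ` subs" by (rule algebra_internal)
 note m = act_preloeb_measurable[OF g]
 show "Int_stable (internal ` subs)" by (auto simp: Int_stable_def)
 show "internal ` subs \<subseteq> Pow X" by (rule internal_Pow)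
 show "sets (distr preloeb preloeb (act g)) = sigma_sets X (internal ` subs)"
  "sets preloeb = sigma_sets X (internal ` subs)" by (auto simp: sets_preloeb)
 show "range (%_. X) \<subseteq> internal ` subs" by auto
 show "(\<Union>i. X) = X" by simp
 show "emeasure (distr preloeb preloeb (act g)) X \<noteq> \<infinity>"
 proof -
  have "act g -` X \<inter> X = X" using act_in[OF g] by auto
  then show ?thesis using preloeb_space m sets.top[of preloeb] by (simp add: emeasure_distr space_preloeb)
 qed
 fix a assume "a \<in> internal ` subs"
 then show "emeasure (distr preloeb preloeb (act g)) a = emeasure preloeb a"
  using g m by (auto simp: emeasure_distr internal_sets space_preloeb act_vimage emeasure_preloeb act_density)
qed

lemma act_preloeb_null: "g \<in> carrier G ==> null_sets (distr (completion preloeb) preloeb (act g)) = null_sets preloeb"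
 by (simp add: distr_completion act_preloeb_measurable act_preloeb_distr)

text \<open>Measurability passes to the completion because invariance makes preimages of null sets
  null.\<close>

lemma act_measurable: "g \<in> carrier G ==> act g \<in> loeb \<rightarrow>\<^sub>M loeb" unfolding loeb_completion
 by (rule completion.measurable_completion2)
  (auto simp: measurable_completion act_preloeb_measurable act_preloeb_null)

lemma act_distr: "g \<in> carrier G ==> distr loeb loeb (act g) = loeb" unfolding loeb_completion
 using completion.completion_distr_eq[OF measurable_completion[OF act_preloeb_measurable] act_preloeb_null]
 by (simp add: distr_completion act_preloeb_measurable act_preloeb_distr)

end

section \<open>The orbit relation of a measure preserving action\<close>

lemma emeasure_count_space_bij:
 fixes f :: "'z => 'y"
 assumes "bij_betw f A B"
 shows "emeasure (count_space UNIV) A = emeasure (count_space UNIV) B"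
proof -
 have "emeasure (count_space UNIV) S = nn_integral (count_space S) (%x. 1)" for S :: "'z set"
  by (subst nn_integral_count_space_indicator) (auto simp flip: nn_integral_indicator)
 moreover have "emeasure (count_space UNIV) S = nn_integral (count_space S) (%x. 1)" for S :: "'y set"
  by (subst nn_integral_count_space_indicator) (auto simp flip: nn_integral_indicator)
 ultimately show ?thesis using nn_integral_bij_count_space[OF assms, of "%_. 1"] by simp
qed

text \<open>Applied to a copy of the relation inside the direct sum, and to the graph of a group
  element inside the relation.\<close>

lemma integral_section:
 fixes f :: "'b => 'c :: {banach, second_countable_topology}"
 assumes i [measurable]: "\<iota> \<in> M1 \<rightarrow>\<^sub>M M2" and S [measurable]: "S \<in> sets M2" and f [measurable]: "f \<in> borel_measurable M2"
  and em: "\<And>A. A \<in> sets M2 ==> emeasure M1 (\<iota> -` A \<inter> space M1) = emeasure M2 (A \<inter> S)"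
 shows "(\<integral>x. f (\<iota> x) \<partial>M1) = (\<integral>y. indicator S y *\<^sub>R f y \<partial>M2)"
proof -
 have "distr M1 M2 \<iota> = density M2 (%y. ennreal (indicator S y))"
 proof (rule measure_eqI)
  fix A assume "A \<in> sets (distr M1 M2 \<iota>)"
  then have [measurable]: "A \<in> sets M2" by simp
  have "emeasure (density M2 (%y. ennreal (indicator S y))) A = nn_integral M2 (%y. indicator (A \<inter> S) y)"
  proof -
   have "nn_integral M2 (%y. ennreal (indicator S y) * indicator A y) = nn_integral M2 (%y. indicator (A \<inter> S) y)"
    by (rule nn_integral_cong) (simp split: split_indicator)
   then show ?thesis by (simp add: emeasure_density)
  qed
  also have "... = emeasure M2 (A \<inter> S)" by simp
  finally show "emeasure (distr M1 M2 \<iota>) A = emeasure (density M2 (%y. ennreal (indicator S y))) A"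
   by (subst emeasure_distr) (auto simp: em)
 qed simp
 then have "(\<integral>x. f (\<iota> x) \<partial>M1) = (\<integral>y. f y \<partial>density M2 (%y. ennreal (indicator S y)))"
  by (subst integral_distr[OF i f, symmetric]) simp
 also have "... = (\<integral>y. indicator S y *\<^sub>R f y \<partial>M2)" by (rule integral_density) auto
 finally show ?thesis .
qed

locale pmp_action = group G for G :: "('g, 'm) monoid_scheme" (structure) +
 fixes M :: "'x measure" and a :: "'g => 'x => 'x"
 assumes countable_carrier: "countable (carrier G)"
  and prob: "emeasure M (space M) = 1"
  and a_in: "\<And>g x. g \<in> carrier G ==> x \<in> space M ==> a g x \<in> space M"
  and a_mult: "\<And>g h x. g \<in> carrier G ==> h \<in> carrier G ==> x \<in> space M ==> a (g \<otimes> h) x = a g (a h x)"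
  and a_one: "\<And>x. x \<in> space M ==> a \<one> x = x"
  and a_measurable: "\<And>g. g \<in> carrier G ==> a g \<in> M \<rightarrow>\<^sub>M M"
  and a_distr: "\<And>g. g \<in> carrier G ==> distr M M (a g) = M"
  and a_fix: "\<And>g. g \<in> carrier G ==> {x \<in> space M. a g x = x} \<in> sets M"
begin

lemma finite_M: "finite_measure M" by (rule) (simp add: prob)

abbreviation "R \<equiv> orbit_relation_measure G M a"
abbreviation "N \<equiv> rel_direct_sum R"
text \<open>Coordinates by source and by target. The direct sum uses target coordinates because the
  fibre of the complex over \<open>x\<close> is modelled on the points with target
  \<open>x\<close>.\<close>

definition "pS x g = (x, a g x)"
definition "pT x g = (a g x, x)"
definition "pN x gk = ((a (fst gk) x, x), snd gk :: nat)"

lemma a_inv [simp]: "g \<in> carrier G ==> x \<in> space M ==> a (inv g) (a g x) = x"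
  "g \<in> carrier G ==> x \<in> space M ==> a g (a (inv g) x) = x" by (auto simp: a_one simp flip: a_mult)

lemma a_coincide:
 assumes "g \<in> carrier G" "h \<in> carrier G" shows "{x \<in> space M. a g x = a h x} \<in> sets M"
proof -
 have "a g x = a h x \<longleftrightarrow> a (inv h \<otimes> g) x = x" if "x \<in> space M" for x
  using assms that by (metis a_in a_inv a_mult inv_closed)
 then have "{x \<in> space M. a g x = a h x} = {x \<in> space M. a (inv h \<otimes> g) x = x}" by auto
 then show ?thesis using assms a_fix by simp
qed

lemma coords_S: "fibre_coords M (carrier G) pS" by standard (auto simp: pS_def countable_carrier a_coincide)

lemma coords_T: "fibre_coords M (carrier G) pT" by standard (auto simp: pT_def countable_carrier a_coincide)

lemma total_S: "fibre_coords.total M (carrier G) pS = orbit_relation G M a"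
 by (auto simp: fibre_coords.total_def[OF coords_S] orbit_relation_def action_groupoid_def pS_def)

lemma total_T: "fibre_coords.total M (carrier G) pT = orbit_relation G M a"
proof -
 have "\<exists>y h. (a g x, x) = (y, a h y) \<and> y \<in> space M \<and> h \<in> carrier G"
  "\<exists>y h. (x, a g x) = (a h y, y) \<and> y \<in> space M \<and> h \<in> carrier G" if "x \<in> space M" "g \<in> carrier G" for x g
  using that by (auto intro!: exI[of _ "inv g"] simp: a_in)
 then show ?thesis
  unfolding total_S[symmetric] fibre_coords.total_def[OF coords_S] fibre_coords.total_def[OF coords_T] pS_def pT_def
  by blast
qed

text \<open>The generating family in the definition is already a sigma-algebra: the set where a
  fixed group element lands in \<open>E\<close> cuts \<open>E\<close> into countably many
  graphs.\<close>

lemma R_fibred_S: "fibred M (carrier G) pS R"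
proof -
 interpret fibre_coords M "carrier G" pS by (rule coords_S)
 let ?S = "{\<Union>k::nat. (%x. (x, a (g k) x)) ` A k | g A. \<forall>k. g k \<in> carrier G \<and> A k \<in> sets M}"
 have 1: "?S \<subseteq> fsets"
 proof
  fix E assume "E \<in> ?S"
  then obtain g A where E: "E = (\<Union>k::nat. (%x. (x, a (g k) x)) ` A k)"
   and gA: "\<And>k. g k \<in> carrier G" "\<And>k. A k \<in> sets M" by auto
  have A: "A k \<subseteq> space M" for k using gA(2) sets.sets_into_space by blast
  have "{x \<in> space M. pS x b \<in> E} = (\<Union>k. A k \<inter> {x \<in> space M. a b x = a (g k) x})" for b by (auto simp: E pS_def)
  moreover have "(\<Union>k. A k \<inter> {x \<in> space M. a b x = a (g k) x}) \<in> sets M" if "b \<in> carrier G" for b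
   by (rule) (use gA a_coincide that in auto)
  moreover have "E \<subseteq> total" using A gA by (fastforce simp: E total_def pS_def)
  ultimately show "E \<in> fsets" by (simp add: fsets_def)
 qed
 have 2: "fsets \<subseteq> ?S"
 proof
  fix E assume E: "E \<in> fsets"
  define g where "g = from_nat_into (carrier G)"
  have ne: "carrier G \<noteq> {}" by blast
  have g: "range g = carrier G" unfolding g_def by (rule range_from_nat_into[OF ne countable_carrier])
  have "E = (\<Union>k. (%x. (x, a (g k) x)) ` {x \<in> space M. pS x (g k) \<in> E})"
  proof
   show "E \<subseteq> (\<Union>k. (%x. (x, a (g k) x)) ` {x \<in> space M. pS x (g k) \<in> E})"
   proof
    fix w assume w: "w \<in> E"
    then obtain x h where "w = pS x h" "x \<in> space M" "h \<in> carrier G" using E by (auto simp: fsets_def total_def)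
    moreover then obtain k where "h = g k" using g by blast
    ultimately show "w \<in> (\<Union>k. (%x. (x, a (g k) x)) ` {x \<in> space M. pS x (g k) \<in> E})"
     using w by (auto simp: pS_def)
   qed
  qed (auto simp: pS_def)
  moreover have "g k \<in> carrier G" "{x \<in> space M. pS x (g k) \<in> E} \<in> sets M" for k
   using E g by (auto simp: fsets_def)
  ultimately show "E \<in> ?S"
   by (intro CollectI exI[of _ g] exI[of _ "%k. {x \<in> space M. pS x (g k) \<in> E}"] conjI allI)
 qed
 have "fibred M (carrier G) pS (measure_of total ?S
    (%E. \<integral>\<^sup>+x. emeasure (count_space UNIV) {y. (x, y) \<in> E} \<partial>M))"
 proof (rule fibred_measure_of)
  have S: "?S = fsets" using 1 2 by simp
  show "?S \<subseteq> Pow total" using 1 by (auto simp: fsets_def)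
  show "sigma_sets total ?S = fsets" unfolding S by (rule sigma_algebra.sigma_sets_eq[OF sigma_algebra_fsets])
  fix E assume "E \<in> fsets"
  then have "bij_betw (Pair x) {y. (x, y) \<in> E} (E \<inter> pS x ` carrier G)" if "x \<in> space M" for x
   by (intro bij_betwI') (auto simp: fsets_def total_def pS_def)
  then show "(nn_integral M (%x. emeasure (count_space UNIV) {y. (x, y) \<in> E}))
    = nn_integral M (%x. emeasure (count_space UNIV) (E \<inter> pS x ` carrier G))"
   by (intro nn_integral_cong emeasure_count_space_bij)
 qed
 then show ?thesis by (simp add: orbit_relation_measure_def total_S)
qed

lemma space_R: "space R = orbit_relation G M a" using fibred.space[OF R_fibred_S] total_S by simp

lemma a_nn_integral:
 "g \<in> carrier G ==> f \<in> borel_measurable M ==> nn_integral M (%x. f (a g x)) = nn_integral M (%x. f x)"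
 using nn_integral_distr[OF a_measurable, of g f] by (simp add: a_distr)

text \<open>Counting over sources and over targets gives the same measure. \<open>E\<close> is split
  into graphs over the sets \<open>A g\<close> of first indices, and invariance of \<open>M\<close>
  moves each graph from its source to its target.\<close>

lemma R_fibred_T: "fibred M (carrier G) pT R"
proof -
 interpret T: fibre_coords M "carrier G" pT by (rule coords_T)
 interpret S: fibred M "carrier G" pS R by (rule R_fibred_S)
 have sets_eq: "T.fsets = S.fsets"
 proof -
  have *: "{x \<in> space M. pT x g \<in> E} = a g -` {x \<in> space M. pS x (inv g) \<in> E} \<inter> space M"
   "{x \<in> space M. pS x g \<in> E} = a g -` {x \<in> space M. pT x (inv g) \<in> E} \<inter> space M"
   if "g \<in> carrier G" for g E using that by (auto simp: pT_def pS_def a_in)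
  show ?thesis unfolding T.fsets_def S.fsets_def total_S total_T
  proof (intro Collect_cong conj_cong refl iffI ballI)
   fix E g assume E: "\<forall>b\<in>carrier G. {x \<in> space M. pT x b \<in> E} \<in> sets M" and g: "g \<in> carrier G"
   show "{x \<in> space M. pS x g \<in> E} \<in> sets M"
    unfolding *(2)[OF g] by (rule measurable_sets[OF a_measurable[OF g]]) (use E g in blast)
  next
   fix E g assume E: "\<forall>b\<in>carrier G. {x \<in> space M. pS x b \<in> E} \<in> sets M" and g: "g \<in> carrier G"
   show "{x \<in> space M. pT x g \<in> E} \<in> sets M"
    unfolding *(1)[OF g] by (rule measurable_sets[OF a_measurable[OF g]]) (use E g in blast)
  qed
 qed
 show ?thesis
 proof
  show "space R = T.total" "sets R = T.fsets" by (simp_all add: space_R total_T S.sets sets_eq)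
  fix E assume "E \<in> T.fsets"
  then have E: "E \<in> S.fsets" by (simp add: sets_eq)
  define A where "A g = {x \<in> space M. pS x g \<in> E \<and> first_index (carrier G) (pS x) g}" for g
  have A: "A g \<in> sets M" if "g \<in> carrier G" for g using S.first_sets E that
  by (auto simp: A_def S.fsets_def)
  have "emeasure R E = nn_integral M (%x. (nn_integral (count_space (pS x ` carrier G)) (%w. indicator E w)))"
   using S.emeasure[OF E] by (simp add: S.fibre_card)
  also have "... = nn_integral M (%x. (nn_integral (count_space (carrier G)) (%g. indicator (A g) x)))"
   unfolding nn_integral_count_space_image[OF countable_carrier]
   by (intro nn_integral_cong) (auto simp: A_def split: split_indicator)
  also have "... = nn_integral (count_space (carrier G)) (%g. (nn_integral M (%x. indicator (A g) x)))"
   by (rule nn_integral_count_space_nn_integral[OF countable_carrier]) (intro borel_measurable_indicator A)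
  \<comment> \<open>The use of invariance: the base set of each graph is replaced by its image under
    the group element.\<close>
  also have "... = nn_integral (count_space (carrier G)) (%g. (nn_integral M (%x. indicator (A g) (a (inv g) x))))"
  proof (rule nn_integral_cong)
   fix g assume "g \<in> space (count_space (carrier G))"
   then have g: "g \<in> carrier G" by simp
   show "nn_integral M (%x. indicator (A g) x) = nn_integral M (%x. indicator (A g) (a (inv g) x))"
    by (rule a_nn_integral[OF inv_closed[OF g], symmetric]) (rule borel_measurable_indicator[OF A[OF g]])
  qed
  also have "... = nn_integral M (%x. (nn_integral (count_space (carrier G)) (%g. indicator (A g) (a (inv g) x))))"
  proof (rule nn_integral_count_space_nn_integral[symmetric, OF countable_carrier])
   fix g assume "g \<in> carrier G"
   then show "(%x. indicator (A g) (a (inv g) x) :: ennreal) \<in> borel_measurable M"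
    using measurable_compose[OF a_measurable borel_measurable_indicator[OF A]] by auto
  qed
  also have "... = nn_integral M (%x. emeasure (count_space UNIV) (E \<inter> pT x ` carrier G))"
  proof (rule nn_integral_cong)
   fix x assume x: "x \<in> space M"
   let ?J = "{g \<in> carrier G. a (inv g) x \<in> A g}"
   have bij: "bij_betw (%g. (a (inv g) x, x)) ?J (E \<inter> pT x ` carrier G)"
   proof (rule bij_betwI')
    fix g h assume gh: "g \<in> ?J" "h \<in> ?J"
    show "((a (inv g) x, x) = (a (inv h) x, x)) = (g = h)"
    proof
     assume eq: "(a (inv g) x, x) = (a (inv h) x, x)"
     let ?y = "a (inv g) x"
     have "pS ?y g = pS ?y h" using gh eq x by (simp add: pS_def) (metis a_inv(2))
     then show "g = h"
      using bij_betw_imp_inj_on[OF bij_betw_first_index[OF countable_carrier, of "pS ?y"]] gh eq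
      by (auto simp: A_def inj_on_def)
    qed simp
   next
    fix g assume "g \<in> ?J"
    then show "(a (inv g) x, x) \<in> E \<inter> pT x ` carrier G" using x by (auto simp: A_def pS_def pT_def)
   next
    fix w assume "w \<in> E \<inter> pT x ` carrier G"
    then obtain k where w: "w = (a k x, x)" "w \<in> E" "k \<in> carrier G" by (auto simp: pT_def)
    let ?y = "a k x"
    have y: "?y \<in> space M" using w x a_in by auto
    have "(?y, x) \<in> pS ?y ` carrier G" using w x by (auto simp: pS_def intro!: image_eqI[of _ _ "inv k"])
    then obtain g where g: "g \<in> carrier G" "first_index (carrier G) (pS ?y) g" "(?y, x) = pS ?y g"
     using bij_betw_imp_surj_on[OF bij_betw_first_index[OF countable_carrier, of "pS ?y"]] by blast
    then have "a (inv g) x = ?y" using a_inv(1)[OF g(1) y] by (simp add: pS_def)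
    have "g \<in> ?J" using y g w using \<open>a (inv g) x = ?y\<close> by (simp add: A_def)
    moreover have "w = (a (inv g) x, x)" using w(1) \<open>a (inv g) x = ?y\<close> by simp
    ultimately show "\<exists>g\<in>?J. w = (a (inv g) x, x)" by blast
   qed
   show "nn_integral (count_space (carrier G)) (%g. indicator (A g) (a (inv g) x)) = emeasure (count_space UNIV) (E \<inter> pT x ` carrier G)"
   proof -
    have "nn_integral (count_space (carrier G)) (%g. indicator (A g) (a (inv g) x)) = nn_integral (count_space UNIV) (%g. indicator ?J g)"
     by (subst nn_integral_count_space_indicator, simp, rule nn_integral_cong) (auto split: split_indicator)
    also have "... = emeasure (count_space UNIV) ?J" by simp
    finally show ?thesis using emeasure_count_space_bij[OF bij] by simp
   qed
  qed
  finally show "emeasure R E = nn_integral M (%x. emeasure (count_space UNIV) (E \<inter> pT x ` carrier G))" .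
 qed
qed

lemma R_flip: "distr R R prod.swap = R"
proof (rule fibred_distr[OF R_fibred_S R_fibred_T])
 show "prod.swap \<in> R \<rightarrow>\<^sub>M R" unfolding fibred.measurable_iff[OF R_fibred_S]
  using fibred.p_measurable[OF R_fibred_T] by (simp add: pS_def pT_def)
 show "bij_betw prod.swap (pS x ` carrier G) (pT x ` carrier G)" for x
  by (rule bij_betw_byWitness[where f'=prod.swap]) (auto simp: pS_def pT_def)
qed

interpretation count: sigma_finite_measure "count_space (UNIV :: nat set)"
 by (rule sigma_finite_measure_count_space_countable) simp

section \<open>Slices of the direct sum of copies of the relation\<close>

lemma N_measurable_iff: "F \<in> N \<rightarrow>\<^sub>M K \<longleftrightarrow> (\<forall>k. (%v. F (v, k)) \<in> R \<rightarrow>\<^sub>M K)"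
proof
 show "F \<in> N \<rightarrow>\<^sub>M K ==> \<forall>k. (%v. F (v, k)) \<in> R \<rightarrow>\<^sub>M K" unfolding rel_direct_sum_def by simp
 assume F: "\<forall>k. (%v. F (v, k)) \<in> R \<rightarrow>\<^sub>M K"
 have "(%z. F (snd z, fst z)) \<in> count_space UNIV \<Otimes>\<^sub>M R \<rightarrow>\<^sub>M K"
  by (rule measurable_pair_measure_countable1) (use F in auto)
 from measurable_compose[OF measurable_pair_swap' this] show "F \<in> N \<rightarrow>\<^sub>M K"
  by (simp add: rel_direct_sum_def case_prod_beta)
qed

lemma space_N: "space N = space R \<times> UNIV" by (simp add: rel_direct_sum_def space_pair_measure)

lemma N_nn_integral:
 "F \<in> borel_measurable N ==> nn_integral N (%w. F w) = nn_integral R (%v. (nn_integral (count_space UNIV) (%k. F (v, k))))"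
 unfolding rel_direct_sum_def by (rule count.nn_integral_fst[symmetric])

lemma N_nn_integral_suminf:
 assumes "F \<in> borel_measurable N" shows "nn_integral N (%w. F w) = (\<Sum>k. \<integral>\<^sup>+v. F (v, k) \<partial>R)"
 using assms unfolding N_nn_integral[OF assms] nn_integral_count_space_nat
 by (intro nn_integral_suminf) (simp add: N_measurable_iff)

lemma coords_N: "fibre_coords M (carrier G \<times> UNIV) pN"
proof
 show "{x \<in> space M. pN x b = pN x b'} \<in> sets M" if "b \<in> carrier G \<times> UNIV" "b' \<in> carrier G \<times> UNIV" for b b'
  using that a_coincide[of "fst b" "fst b'"] by (cases) (auto simp: pN_def)
qed (auto simp: pN_def countable_carrier)

lemma N_fibred: "fibred M (carrier G \<times> UNIV) pN N"
proof -
 interpret T: fibred M "carrier G" pT R by (rule R_fibred_T)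
 interpret fibre_coords M "carrier G \<times> (UNIV :: nat set)" pN by (rule coords_N)
 have im: "pN x ` (carrier G \<times> UNIV) = pT x ` carrier G \<times> UNIV" for x by (force simp: pN_def pT_def)
 have tot: "total = space R \<times> UNIV" by (force simp: total_def T.space T.total_def pN_def pT_def)
 have sets: "sets N = fsets"
 proof (intro Set.set_eqI iffI)
  fix E assume E: "E \<in> sets N"
  have "{x \<in> space M. pN x (g, k) \<in> E} \<in> sets M" if "g \<in> carrier G" for g k
  proof -
   have [measurable]: "(%x. pT x g) \<in> M \<rightarrow>\<^sub>M R" using that by (rule T.p_measurable)
   have "(%x. (pT x g, k)) \<in> M \<rightarrow>\<^sub>M N" unfolding rel_direct_sum_def by simp
   from measurable_sets[OF this E] show ?thesis
    by (rule back_subst[of "%X. X \<in> sets M"]) (auto simp: pN_def pT_def)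
  qed
  moreover have "E \<subseteq> space N" using E by (rule sets.sets_into_space)
  ultimately show "E \<in> fsets" by (auto simp: fsets_def tot space_N)
 next
  fix E assume E: "E \<in> fsets"
  have sec: "{v \<in> space R. (v, k) \<in> E} \<in> sets R" for k
  proof -
   have "{x \<in> space M. pT x g \<in> {v \<in> space R. (v, k) \<in> E}} = {x \<in> space M. pN x (g, k) \<in> E}"
    if "g \<in> carrier G" for g using that T.p_space by (auto simp: pN_def pT_def)
   then show ?thesis using E by (auto simp: T.sets T.fsets_def fsets_def T.space)
  qed
  have "E = (\<Union>k. {v \<in> space R. (v, k) \<in> E} \<times> {k})" using E by (auto simp: fsets_def tot)
  moreover have "... \<in> sets N"
   unfolding rel_direct_sum_def by (intro sets.countable_UN'' pair_measureI sec) auto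
  ultimately show "E \<in> sets N" by simp
 qed
 show ?thesis
 proof
  show "space N = total" by (simp add: tot space_N)
  show "sets N = fsets" by (rule sets)
  fix E assume "E \<in> fsets"
  then have [measurable]: "E \<in> sets N" by (simp add: sets)
  have "emeasure N E = nn_integral R (%v. (nn_integral (count_space UNIV) (%k. indicator E (v, k))))"
   by (subst N_nn_integral[symmetric]) auto
  also have "... = nn_integral M (%x. (nn_integral (count_space (pT x ` carrier G)) (%v. (nn_integral (count_space UNIV) (%k. indicator E (v, k))))))"
  proof (rule T.nn_integral)
   show "(%v. \<integral>\<^sup>+k. indicator E (v, k) \<partial>count_space UNIV) \<in> borel_measurable R" using \<open>E \<in> sets N\<close>
    by (simp add: rel_direct_sum_def)
  qed
  also have "... = nn_integral M (%x. emeasure (count_space UNIV) (E \<inter> pN x ` (carrier G \<times> UNIV)))"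
  proof (rule nn_integral_cong)
   fix x
   have "(nn_integral (count_space (pT x ` carrier G)) (%v. (nn_integral (count_space UNIV) (%k. indicator E (v, k)))))
    = nn_integral (count_space UNIV) (%v. (nn_integral (count_space UNIV) (%k. indicator (E \<inter> pN x ` (carrier G \<times> UNIV)) (v, k))))"
    by (subst nn_integral_count_space_indicator)
     (auto simp: im intro!: nn_integral_cong split: split_indicator)
   also have "... = nn_integral (count_space UNIV) (%w. indicator (E \<inter> pN x ` (carrier G \<times> UNIV)) w)"
    by (rule nn_integral_fst_count_space)
   finally show "(nn_integral (count_space (pT x ` carrier G)) (%v. (nn_integral (count_space UNIV) (%k. indicator E (v, k)))))
    = emeasure (count_space UNIV) (E \<inter> pN x ` (carrier G \<times> UNIV))" by simp
  qed
  finally show "emeasure N E = nn_integral M (%x. emeasure (count_space UNIV) (E \<inter> pN x ` (carrier G \<times> UNIV)))" .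
 qed
qed

lemma L2_slice:
 assumes "F \<in> L2 N" shows "(%v. F (v, k)) \<in> L2 R"
proof -
 have m: "(%v. F (v, k)) \<in> borel_measurable R" using L2_measurable[OF assms] by (simp add: N_measurable_iff)
 have "nn_integral R (%v. nsq (F (v, k))) = (\<Sum>j\<in>{k}. \<integral>\<^sup>+v. nsq (F (v, j)) \<partial>R)" by simp
 also have "... \<le> (\<Sum>j. \<integral>\<^sup>+v. nsq (F (v, j)) \<partial>R)" by (rule sum_le_suminf) auto
 also have "... = nn_integral N (%w. nsq (F w))"
  using L2_measurable[OF assms] by (subst N_nn_integral_suminf) auto
 finally show ?thesis using assms L2_measurable[OF assms] by (simp add: L2_iff_nn_integral m)
qed

lemma L2_norm_slices:
 assumes "F \<in> L2 N"
 shows "ennreal ((L2_norm N F)^2) = (\<Sum>k. ennreal ((L2_norm R (%v. F (v, k)))^2))"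
 using L2_measurable[OF assms]
 by (simp add: L2_norm_nn_integral[OF assms] L2_norm_nn_integral[OF L2_slice[OF assms]] N_nn_integral_suminf)

definition embed :: "nat => ('x \<times> 'x => complex) => ('x \<times> 'x) \<times> nat => complex" where
 "embed k f = (%(w, l). if l = k then f w else 0)"

lemma embed_L2:
 assumes "f \<in> L2 R" shows "embed k f \<in> L2 N"
proof -
 have m: "embed k f \<in> borel_measurable N"
  using L2_measurable[OF assms] by (auto simp: N_measurable_iff embed_def)
 have "nn_integral N (%w. nsq (embed k f w)) = (\<Sum>l. \<integral>\<^sup>+v. nsq (embed k f (v, l)) \<partial>R)"
  using m by (subst N_nn_integral_suminf) auto
 also have "... = (\<Sum>l\<in>{k}. \<integral>\<^sup>+v. nsq (embed k f (v, l)) \<partial>R)" by (rule suminf_finite) (auto simp: embed_def)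
 also have "... < \<infinity>" using assms L2_measurable[OF assms] by (simp add: embed_def L2_iff_nn_integral)
 finally show ?thesis by (simp add: L2_iff_nn_integral m)
qed

lemma inner_embed:
 assumes F: "F \<in> L2 N" and f: "f \<in> L2 R"
 shows "L2_inner N F (embed k f) = L2_inner R (%v. F (v, k)) f"
proof -
 have [measurable]: "F \<in> borel_measurable N" "embed k f \<in> borel_measurable N"
  using L2_measurable[OF F] L2_measurable[OF embed_L2[OF f]] by auto
 have i: "(%v. (v, k)) \<in> R \<rightarrow>\<^sub>M N" unfolding rel_direct_sum_def by simp
 have S: "space R \<times> {k} \<in> sets N" unfolding rel_direct_sum_def by simp
 have "L2_inner R (%v. F (v, k)) f = (\<integral>v. F (v, k) * cnj (embed k f (v, k)) \<partial>R)"
  by (simp add: L2_inner_def embed_def)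
 also have "... = (\<integral>w. indicator (space R \<times> {k}) w *\<^sub>R (F w * cnj (embed k f w)) \<partial>N)"
 proof (rule integral_section[OF i S])
  fix A assume A: "A \<in> sets N"
  have [measurable]: "A \<in> sets N" "space R \<times> {k} \<in> sets N" by fact+
  have "emeasure N (A \<inter> (space R \<times> {k})) = nn_integral N (%w. indicator (A \<inter> (space R \<times> {k})) w)" by simp
  also have "... = (\<Sum>l. \<integral>\<^sup>+v. indicator (A \<inter> (space R \<times> {k})) (v, l) \<partial>R)"
   by (subst N_nn_integral_suminf) auto
  also have "... = (\<Sum>l\<in>{k}. \<integral>\<^sup>+v. indicator (A \<inter> (space R \<times> {k})) (v, l) \<partial>R)" by (rule suminf_finite) auto
  also have "... = nn_integral R (%v. indicator ((%v. (v, k)) -` A \<inter> space R) v)"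
   by (simp, intro nn_integral_cong) (auto split: split_indicator)
  also have "... = emeasure R ((%v. (v, k)) -` A \<inter> space R)"
   by (intro nn_integral_indicator measurable_sets[OF i A])
  finally show "emeasure R ((%v. (v, k)) -` A \<inter> space R) = emeasure N (A \<inter> (space R \<times> {k}))" by simp
 qed measurable
 also have "... = L2_inner N F (embed k f)" unfolding L2_inner_def
 by (rule Bochner_Integration.integral_cong[OF refl]) (auto simp: embed_def space_N)
 finally show ?thesis by simp
qed

definition graph_of :: "'g => 'x set => ('x \<times> 'x) set" where "graph_of g A = (%x. (x, a g x)) ` A"

end

section \<open>Independence of the dimension from the embedding\<close>

context pmp_action begin

lemma graph_of_iff:
 assumes "g \<in> carrier G" "A \<subseteq> space M" "x \<in> space M"
 shows "(x, y) \<in> graph_of g A \<longleftrightarrow> x \<in> A \<and> y = a g x" by (auto simp: graph_of_def)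

lemma graph_of_sets:
 assumes g: "g \<in> carrier G" and A: "A \<in> sets M" shows "graph_of g A \<in> sets R"
proof -
 interpret fibred M "carrier G" pS R by (rule R_fibred_S)
 have As: "A \<subseteq> space M" by (rule sets.sets_into_space[OF A])
 have "{x \<in> space M. pS x h \<in> graph_of g A} = A \<inter> {x \<in> space M. a h x = a g x}" for h by (auto simp: pS_def graph_of_def)
 moreover have "graph_of g A \<subseteq> total" using As g by (auto simp: graph_of_def pS_def total_def)
 ultimately show ?thesis unfolding sets fsets_def using A a_coincide[OF _ g] by auto
qed

lemma graph_of_bisection:
 assumes "g \<in> carrier G" "A \<in> sets M" shows "graph_of g A \<in> bisections R"
proof -
 have As: "A \<subseteq> space M" by (rule sets.sets_into_space[OF assms(2)])
 have "inj_on fst (graph_of g A)" by (rule) (auto simp: graph_of_def)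
 moreover have "inj_on snd (graph_of g A)"
 proof (rule inj_onI)
  fix v w assume v: "v \<in> graph_of g A" "w \<in> graph_of g A" and eq: "snd v = snd w"
  obtain x y where xy: "x \<in> A" "y \<in> A" "v = (x, a g x)" "w = (y, a g y)"
   using v unfolding graph_of_def by blast
  have "a (inv g) (a g x) = a (inv g) (a g y)" using eq xy by simp
  then show "v = w" using As assms(1) using xy by (simp add: subset_iff)
 qed
 ultimately show ?thesis using graph_of_sets[OF assms] unfolding bisections_def by blast
qed

lemma integral_graph:
 fixes f :: "'x \<times> 'x => complex"
 assumes g: "g \<in> carrier G" and A: "A \<in> sets M" and f: "f \<in> borel_measurable R"
 shows "(\<integral>v. indicator (graph_of g A) v *\<^sub>R f v \<partial>R) = (\<integral>x. indicator A x *\<^sub>R f (x, a g x) \<partial>M)"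
proof -
 interpret fibred M "carrier G" pS R by (rule R_fibred_S)
 have As: "A \<subseteq> space M" by (rule sets.sets_into_space[OF A])
 have p: "(%x. (x, a g x)) \<in> M \<rightarrow>\<^sub>M R" using p_measurable[OF g] by (simp add: pS_def)
 have i: "(%x. (x, a g x)) \<in> restrict_space M A \<rightarrow>\<^sub>M R" by (rule measurable_restrict_space1[OF p])
 have "(\<integral>x. f (x, a g x) \<partial>restrict_space M A) = (\<integral>v. indicator (graph_of g A) v *\<^sub>R f v \<partial>R)"
 proof (rule integral_section[OF i graph_of_sets[OF g A] f])
  fix B assume B: "B \<in> sets R"
  let ?B = "{x \<in> A. (x, a g x) \<in> B}"
  have eq: "?B = (%x. (x, a g x)) -` B \<inter> space (restrict_space M A)"
   using As by (auto simp: space_restrict_space)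
  have Bs: "?B \<in> sets M"
  proof -
   have "?B = A \<inter> ((%x. (x, a g x)) -` B \<inter> space M)" using As by auto
   then show ?thesis using A measurable_sets[OF p B] by auto
  qed
  have "B \<inter> graph_of g A \<in> sets R" using B graph_of_sets[OF g A] by auto
  then have "emeasure R (B \<inter> graph_of g A)
    = nn_integral M (%x. emeasure (count_space UNIV) (B \<inter> graph_of g A \<inter> pS x ` carrier G))"
   by (intro emeasure) (simp add: sets)
  also have "... = nn_integral M (%x. indicator ?B x)"
  proof (rule nn_integral_cong)
   fix x assume "x \<in> space M"
   then have "B \<inter> graph_of g A \<inter> pS x ` carrier G = (if x \<in> ?B then {(x, a g x)} else {})"
    using g by (auto simp: pS_def graph_of_def)
   then show "emeasure (count_space UNIV) (B \<inter> graph_of g A \<inter> pS x ` carrier G) = indicator ?B x" by simp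
  qed
  also have "... = emeasure M ?B" using Bs by simp
  also have "... = emeasure (restrict_space M A) ?B"
   by (rule emeasure_restrict_space[symmetric]) (use A in auto)
  finally show "emeasure (restrict_space M A) ((%x. (x, a g x)) -` B \<inter> space (restrict_space M A))
    = emeasure R (B \<inter> graph_of g A)" by (simp only: eq)
 qed
 also have "(\<integral>x. f (x, a g x) \<partial>restrict_space M A) = (\<integral>x. indicator A x *\<^sub>R f (x, a g x) \<partial>M)"
  by (rule integral_restrict_space) (use A in auto)
 finally show ?thesis by simp
qed

text \<open>A single value is dominated by the sum over the source fibre, so the restriction to a
  graph is square integrable, hence integrable as \<open>M\<close> is finite.\<close>

lemma L2_R_along:
 assumes u: "u \<in> L2 R" and g: "g \<in> carrier G"
 shows "integrable M (%x. u (x, a g x))"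
proof -
 interpret fibred M "carrier G" pS R by (rule R_fibred_S)
 interpret finite_measure M by (rule finite_M)
 have m [measurable]: "(%x. u (x, a g x)) \<in> borel_measurable M"
  using measurable_iff[of u borel] L2_measurable[OF u] g by (auto simp: pS_def)
 have "(nn_integral M (%x. nsq (u (x, a g x))))
   \<le> nn_integral M (%x. (nn_integral (count_space (pS x ` carrier G)) (%w. nsq (u w))))"
 proof (rule nn_integral_mono)
  fix x
  have "nsq (u (x, a g x)) = nn_integral (count_space (pS x ` carrier G)) (%w. nsq (u w) * indicator {(x, a g x)} w)"
   by (subst nn_integral_count_space'[of "{(x, a g x)}"]) (use g in \<open>auto simp: pS_def\<close>)
  also have "... \<le> nn_integral (count_space (pS x ` carrier G)) (%w. nsq (u w))"
   by (rule nn_integral_mono) (auto split: split_indicator)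
  finally show "nsq (u (x, a g x)) \<le> ..." .
 qed
 also have "... = nn_integral R (%w. nsq (u w))"
  using L2_measurable[OF u] by (intro nn_integral[symmetric]) auto
 finally have "(%x. u (x, a g x)) \<in> L2 M" using u L2_measurable[OF u] by (simp add: L2_iff_nn_integral)
 moreover have "(%x. 1) \<in> L2 M" by (simp add: L2_def)
 ultimately show ?thesis using L2_inner_integrable by fastforce
qed

text \<open>Countably many graphs cover the relation, and on each of them a function is determined
  by its integrals over measurable pieces.\<close>

lemma AE_eq_of_graph_integrals:
 assumes u: "u \<in> L2 R" and w: "w \<in> L2 R"
  and eq: "\<And>g A. g \<in> carrier G ==> A \<in> sets M ==>
   (\<integral>v. indicator (graph_of g A) v *\<^sub>R u v \<partial>R) = (\<integral>v. indicator (graph_of g A) v *\<^sub>R w v \<partial>R)"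
 shows "AE v in R. u v = w v"
proof -
 interpret finite_measure M by (rule finite_M)
 have "AE x in M. u (x, a g x) = w (x, a g x)" if g: "g \<in> carrier G" for g
 proof (rule density_unique_banach)
  show "integrable M (%x. u (x, a g x))" "integrable M (%x. w (x, a g x))"
   by (rule L2_R_along[OF u g], rule L2_R_along[OF w g])
  show "set_lebesgue_integral M A (%x. u (x, a g x)) = set_lebesgue_integral M A (%x. w (x, a g x))"
   if "A \<in> sets M" for A
   using eq[OF g that] integral_graph[OF g that L2_measurable[OF u]] integral_graph[OF g that L2_measurable[OF w]]
   by (simp add: set_lebesgue_integral_def)
 qed
 then show ?thesis unfolding fibred.AE_iff[OF R_fibred_S] by (subst AE_ball_countable) (auto simp: countable_carrier pS_def)
qed

lemma AE_N_slices: "(AE w in N. Q w) \<longleftrightarrow> (\<forall>k. AE v in R. Q (v, k))"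
proof -
 have "(AE w in N. Q w) \<longleftrightarrow> (AE x in M. \<forall>k. \<forall>g\<in>carrier G. Q (pT x g, k))"
  unfolding fibred.AE_iff[OF N_fibred] by (rule) (auto simp: pN_def pT_def)
 then show ?thesis by (simp add: AE_all_countable fibred.AE_iff[OF R_fibred_T])
qed

lemma AE_N_target: "(AE w in N. Q w) \<longleftrightarrow> (AE x in M. \<forall>g\<in>carrier G. \<forall>k. Q ((a g x, x), k))"
 unfolding fibred.AE_iff[OF N_fibred] by (rule) (auto simp: pN_def)

lemma space_R_iff: "(x, y) \<in> space R \<longleftrightarrow> x \<in> space M \<and> (\<exists>g\<in>carrier G. y = a g x)"
 by (auto simp: space_R orbit_relation_def action_groupoid_def)

lemma space_RD: "(x, y) \<in> space R ==> x \<in> space M \<and> y \<in> space M" by (auto simp: space_R_iff a_in)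

lemma left_mult_graph:
 assumes g: "g \<in> carrier G" and A: "A \<subseteq> space M" and z: "z \<in> space M"
 shows "left_mult (graph_of g A) F (x, z) = (if a (inv g) z \<in> A then F (x, a (inv g) z) else 0)"
proof (cases "a (inv g) z \<in> A")
 case True
 have "(THE h. h \<in> graph_of g A \<and> snd h = z) = (a (inv g) z, z)"
  using True g A z by (intro the_equality) (auto simp: graph_of_def)
 moreover have "\<exists>h\<in>graph_of g A. snd h = z"
  using True g z by (intro bexI[of _ "(a (inv g) z, z)"]) (auto simp: graph_of_def)
 ultimately show ?thesis using True by (simp add: left_mult_def bisection_operator_def)
next
 case False
 then show ?thesis using g A by (auto simp: graph_of_def left_mult_def bisection_operator_def)
qed

lemma distr_N_of_R:
 assumes m: "\<Phi> \<in> R \<rightarrow>\<^sub>M R" and d: "distr R R \<Phi> = R"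
 shows "(%w. (\<Phi> (fst w), snd w)) \<in> N \<rightarrow>\<^sub>M N" "distr N N (%w. (\<Phi> (fst w), snd w)) = N"
proof -
 have i: "(%v. (v, k)) \<in> R \<rightarrow>\<^sub>M N" for k unfolding rel_direct_sum_def by simp
 show mm: "(%w. (\<Phi> (fst w), snd w)) \<in> N \<rightarrow>\<^sub>M N"
  unfolding N_measurable_iff using measurable_compose[OF m i] by simp
 show "distr N N (%w. (\<Phi> (fst w), snd w)) = N"
 proof (rule measure_eqI)
  fix A assume "A \<in> sets (distr N N (%w. (\<Phi> (fst w), snd w)))"
  then have A [measurable]: "A \<in> sets N" by simp
  have Ak: "(%v. indicator A (v, k) :: ennreal) \<in> borel_measurable R" for k by (auto intro: measurable_compose[OF i])
  have "emeasure (distr N N (%w. (\<Phi> (fst w), snd w))) A = nn_integral (distr N N (%w. (\<Phi> (fst w), snd w))) (%w. indicator A w)"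
   by simp
  also have "... = nn_integral N (%w. indicator A (\<Phi> (fst w), snd w))"
   by (subst nn_integral_distr[OF mm]) auto
  also have "... = (\<Sum>k. \<integral>\<^sup>+v. indicator A (\<Phi> v, k) \<partial>R)"
   by (subst N_nn_integral_suminf) (auto intro: measurable_compose[OF mm])
  also have "... = (\<Sum>k. \<integral>\<^sup>+v. indicator A (v, k) \<partial>R)"
  proof (rule suminf_cong)
   fix k
   have "nn_integral R (%v. indicator A (\<Phi> v, k)) = nn_integral (distr R R \<Phi>) (%v. indicator A (v, k))"
    by (rule nn_integral_distr[symmetric, OF m, of "%v. indicator A (v, k)"]) (simp add: Ak)
   then show "nn_integral R (%v. indicator A (\<Phi> v, k)) = nn_integral R (%v. indicator A (v, k))"
    by (simp only: d)
  qed
  also have "... = nn_integral N (%w. indicator A w)" by (subst N_nn_integral_suminf) auto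
  finally show "emeasure (distr N N (%w. (\<Phi> (fst w), snd w))) A = emeasure N A" by simp
 qed simp
qed

lemma R_shift_snd:
 assumes g: "g \<in> carrier G"
 shows "(%v. (fst v, a g (snd v))) \<in> R \<rightarrow>\<^sub>M R" "distr R R (%v. (fst v, a g (snd v))) = R"
proof -
 interpret fibred M "carrier G" pS R by (rule R_fibred_S)
 have m: "(%x. (x, a g (a h x))) \<in> M \<rightarrow>\<^sub>M R" if "h \<in> carrier G" for h
 proof -
  have "(%x. pS x (g \<otimes> h)) \<in> M \<rightarrow>\<^sub>M R" using g that by (intro p_measurable) auto
  then show ?thesis by (rule measurable_cong[THEN iffD1, rotated]) (use g that in \<open>auto simp: pS_def a_mult\<close>)
 qed
 then show mm: "(%v. (fst v, a g (snd v))) \<in> R \<rightarrow>\<^sub>M R" unfolding measurable_iff by (simp add: pS_def)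
 show "distr R R (%v. (fst v, a g (snd v))) = R"
 proof (rule fibred_distr[OF R_fibred_S R_fibred_S mm])
  fix x assume x: "x \<in> space M"
  show "bij_betw (%v. (fst v, a g (snd v))) (pS x ` carrier G) (pS x ` carrier G)"
  proof (rule bij_betw_byWitness[where f'="%v. (fst v, a (inv g) (snd v))"])
   show "(%v. (fst v, a g (snd v))) ` pS x ` carrier G \<subseteq> pS x ` carrier G"
    using g x by (auto simp: pS_def simp flip: a_mult)
   show "(%v. (fst v, a (inv g) (snd v))) ` pS x ` carrier G \<subseteq> pS x ` carrier G"
    using g x by (auto simp: pS_def simp flip: a_mult)
  qed (use g x in \<open>auto simp: pS_def a_in\<close>)
 qed
qed

text \<open>Conjugating the translation of the target by the flip; this is the measure preservation
  behind the right translations \<open>rho\<close>.\<close>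

lemma R_shift_fst:
 assumes g: "g \<in> carrier G"
 shows "(%v. (a g (fst v), snd v)) \<in> R \<rightarrow>\<^sub>M R" "distr R R (%v. (a g (fst v), snd v)) = R"
proof -
 have sw: "prod.swap \<in> R \<rightarrow>\<^sub>M R" unfolding fibred.measurable_iff[OF R_fibred_S]
  using fibred.p_measurable[OF R_fibred_T] by (simp add: pS_def pT_def)
 let ?s = "%v. (fst v, a g (snd v))"
 have eq: "(%v. (a g (fst v), snd v)) = prod.swap \<circ> (?s \<circ> prod.swap)" by auto
 note m = R_shift_snd[OF g]
 have m1: "?s \<circ> prod.swap \<in> R \<rightarrow>\<^sub>M R" by (rule measurable_comp[OF sw m(1)])
 show "(%v. (a g (fst v), snd v)) \<in> R \<rightarrow>\<^sub>M R" unfolding eq by (rule measurable_comp[OF m1 sw])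
 have "distr R R (?s \<circ> prod.swap) = distr (distr R R prod.swap) R ?s"
  by (rule distr_distr[OF m(1) sw, symmetric])
 then have "distr R R (?s \<circ> prod.swap) = R" by (simp only: R_flip m(2))
 moreover have "distr R R (prod.swap \<circ> (?s \<circ> prod.swap)) = distr (distr R R (?s \<circ> prod.swap)) R prod.swap"
  by (rule distr_distr[OF sw m1, symmetric])
 ultimately show "distr R R (%v. (a g (fst v), snd v)) = R" unfolding eq by (simp only: R_flip)
qed

section \<open>Translations along graphs and the trace vectors\<close>

definition shift_snd :: "'g => 'x set => (('x \<times> 'x) \<times> nat => complex) => ('x \<times> 'x) \<times> nat => complex" where
 "shift_snd g A F = diagonal_op (left_mult (graph_of g A)) F"

lemma shift_snd_apply:
 assumes "g \<in> carrier G" "A \<subseteq> space M" "w \<in> space N"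
 shows "shift_snd g A F w = indicator A (a (inv g) (snd (fst w))) * F ((fst (fst w), a (inv g) (snd (fst w))), snd w)"
 using assms space_RD by (cases w) (auto simp: shift_snd_def diagonal_op_def space_N left_mult_graph)

lemma target_set_measurable:
 assumes A: "A \<in> sets M" and g: "g \<in> carrier G"
 shows "(%w. indicator A (a g (snd (fst w))) :: complex) \<in> borel_measurable N"
  using a_measurable[OF g] A by (subst fibred.measurable_iff[OF N_fibred]) (auto simp: pN_def)

lemma shift_snd_L2:
 assumes g: "g \<in> carrier G" and A: "A \<in> sets M" and F: "F \<in> L2 N"
 shows "shift_snd g A F \<in> L2 N"
proof -
 note As = sets.sets_into_space[OF A]
 note s = distr_N_of_R[OF R_shift_snd[OF inv_closed[OF g]]]
 let ?\<Phi> = "%w. ((fst (fst w), a (inv g) (snd (fst w))), snd w)"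
 have Fm: "F \<in> borel_measurable N" by (rule L2_measurable[OF F])
 have "(%w. indicator A (a (inv g) (snd (fst w))) * F (?\<Phi> w)) \<in> borel_measurable N"
  using target_set_measurable[OF A inv_closed[OF g]] measurable_compose[OF s(1) Fm] by simp
 then have m: "shift_snd g A F \<in> borel_measurable N"
  by (rule measurable_cong[THEN iffD2, rotated]) (simp add: shift_snd_apply[OF g As])
 have "nn_integral N (%w. nsq (shift_snd g A F w)) \<le> nn_integral N (%w. nsq (F (?\<Phi> w)))"
  by (rule nn_integral_mono) (auto simp: shift_snd_apply[OF g As] split: split_indicator)
 also have "... = nn_integral (distr N N ?\<Phi>) (%w. nsq (F w))"
  using Fm by (subst nn_integral_distr[OF s(1)]) auto
 finally show ?thesis unfolding s(2) using F Fm by (simp add: L2_iff_nn_integral m)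
qed

lemma translate_set:
 assumes g: "g \<in> carrier G" and A: "A \<in> sets M"
 shows "a g ` A \<in> sets M" "\<And>z. z \<in> space M ==> z \<in> a g ` A \<longleftrightarrow> a (inv g) z \<in> A"
proof -
 note As = sets.sets_into_space[OF A]
 show 1: "z \<in> a g ` A \<longleftrightarrow> a (inv g) z \<in> A" if "z \<in> space M" for z
  using that g As by (auto intro!: image_eqI[of _ _ "a (inv g) z"])
 have "a g ` A = a (inv g) -` A \<inter> space M" using 1 g As a_in by auto
 then show "a g ` A \<in> sets M" using measurable_sets[OF a_measurable[OF inv_closed[OF g]] A] by simp
qed

text \<open>The adjoint is translation along the inverse graph, that is, the graph of
  \<open>inv g\<close> over the image of \<open>A\<close>; it follows by substituting the measure
  preserving translation of targets.\<close>

lemma shift_snd_adjoint: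
 assumes g: "g \<in> carrier G" and A: "A \<in> sets M" and F: "F \<in> L2 N" and F': "F' \<in> L2 N"
 shows "L2_inner N (shift_snd g A F) F' = L2_inner N F (shift_snd (inv g) (a g ` A) F')"
proof -
 note As = sets.sets_into_space[OF A]
 note gA = translate_set[OF g A]
 note gAs = sets.sets_into_space[OF gA(1)]
 note s = distr_N_of_R[OF R_shift_snd[OF g]]
 let ?\<Phi> = "%w. ((fst (fst w), a g (snd (fst w))), snd w)"
 have "L2_inner N (shift_snd g A F) F' = (\<integral>w. shift_snd g A F w * cnj (F' w) \<partial>distr N N ?\<Phi>)"
  by (simp add: L2_inner_def s(2))
 also have "... = (\<integral>w. shift_snd g A F (?\<Phi> w) * cnj (F' (?\<Phi> w)) \<partial>N)"
  by (intro integral_distr[OF s(1)] borel_measurable_times borel_measurable_cnj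
   L2_measurable[OF shift_snd_L2[OF g A F]] L2_measurable[OF F'])
 also have "... = (\<integral>w. F w * cnj (shift_snd (inv g) (a g ` A) F' w) \<partial>N)"
 proof (rule Bochner_Integration.integral_cong[OF refl])
  fix w assume w: "w \<in> space N"
  then have w': "?\<Phi> w \<in> space N" by (rule measurable_space[OF s(1)])
  obtain x z k where wx: "w = ((x, z), k)" by (metis surj_pair)
  have "x \<in> space M" "z \<in> space M" using w space_RD by (auto simp: wx space_N)
  then show "shift_snd g A F (?\<Phi> w) * cnj (F' (?\<Phi> w)) = F w * cnj (shift_snd (inv g) (a g ` A) F' w)"
   using w w' g gA(2)[of "a g z"]
   by (simp add: shift_snd_apply[OF g As] shift_snd_apply[OF inv_closed[OF g] gAs] wx a_in split: split_indicator)
 qed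
 finally show ?thesis by (simp add: L2_inner_def)
qed

lemma Id_L2: "indicator Id \<in> L2 R"
proof -
 interpret fibred M "carrier G" pS R by (rule R_fibred_S)
 have eq: "graph_of \<one> (space M) = {v \<in> space R. v \<in> Id}" by (auto simp: graph_of_def a_one space_R_iff intro!: bexI[of _ \<one>])
 then have S: "{v \<in> space R. v \<in> Id} \<in> sets R" using graph_of_sets[OF one_closed sets.top] by simp
 then have [measurable]: "(indicator Id :: _ => complex) \<in> borel_measurable R" by simp
 have "nn_integral R (%v. nsq (indicator Id v)) = nn_integral R (%v. indicator {v \<in> space R. v \<in> Id} v)"
  by (intro nn_integral_cong) (auto split: split_indicator)
 also have "... = emeasure R {v \<in> space R. v \<in> Id}" using S by simp
 also have "... = nn_integral M (%x. emeasure (count_space UNIV) ({v \<in> space R. v \<in> Id} \<inter> pS x ` carrier G))"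
  using S by (intro emeasure) (simp add: sets)
 also have "... \<le> nn_integral M (%x. 1)"
 proof (rule nn_integral_mono)
  fix x
  have "{v \<in> space R. v \<in> Id} \<inter> pS x ` carrier G \<subseteq> {(x, x)}" by (auto simp: pS_def)
  then have "emeasure (count_space UNIV) ({v \<in> space R. v \<in> Id} \<inter> pS x ` carrier G) \<le> emeasure (count_space UNIV) {(x, x)}"
   by (intro emeasure_mono) auto
  then show "emeasure (count_space UNIV) ({v \<in> space R. v \<in> Id} \<inter> pS x ` carrier G) \<le> 1" by simp
 qed
 also have "... < \<infinity>" by (simp add: prob)
 finally show ?thesis by (subst L2_iff_nn_integral) auto
qed

text \<open>The trace vector of the copy number \<open>k\<close>.\<close>

definition "e k = embed k (indicator Id)"

lemma e_L2: "e k \<in> L2 N" by (simp add: e_def embed_L2 Id_L2)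

lemma shift_snd_e:
 assumes g: "g \<in> carrier G" and A: "A \<in> sets M"
 shows "indicator (graph_of g A) \<in> L2 R" "\<And>w. w \<in> space N ==> shift_snd g A (e k) w = embed k (indicator (graph_of g A)) w"
proof -
 note As = sets.sets_into_space[OF A]
 show 1: "shift_snd g A (e k) w = embed k (indicator (graph_of g A)) w" if w: "w \<in> space N" for w k
 proof -
  obtain x z l where wx: "w = ((x, z), l)" by (metis surj_pair)
  have "(x, z) \<in> graph_of g A \<longleftrightarrow> a (inv g) z \<in> A \<and> x = a (inv g) z" using w space_RD
   using g As by (auto simp: wx space_N graph_of_iff)
  then show ?thesis
   using w by (auto simp: shift_snd_apply[OF g As] wx e_def embed_def split: split_indicator)
 qed
 have "(%v. shift_snd g A (e 0) (v, 0)) \<in> L2 R" by (intro L2_slice shift_snd_L2 g A e_L2)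
 then show "indicator (graph_of g A) \<in> L2 R"
 proof (rule L2_cong_AE)
  show "(indicator (graph_of g A) :: _ => complex) \<in> borel_measurable R" using graph_of_sets[OF g A] by simp
  show "AE v in R. shift_snd g A (e 0) (v, 0) = indicator (graph_of g A) v"
   using 1 by (intro AE_I2) (auto simp: space_N embed_def)
 qed
qed

text \<open>Translating a trace vector along a graph gives the indicator of that graph, so inner
  products with the translates of the \<open>e k\<close> determine a vector.\<close>

lemma inner_shift_e:
 assumes g: "g \<in> carrier G" and A: "A \<in> sets M" and F: "F \<in> L2 N"
 shows "L2_inner N F (shift_snd g A (e k)) = (\<integral>v. indicator (graph_of g A) v *\<^sub>R F (v, k) \<partial>R)"
proof -
 have "L2_inner N F (shift_snd g A (e k)) = L2_inner N F (embed k (indicator (graph_of g A)))"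
  by (rule L2_inner_cong_AE) (auto intro!: F shift_snd_L2 g A e_L2 embed_L2 shift_snd_e)
 also have "... = L2_inner R (%v. F (v, k)) (indicator (graph_of g A))"
  by (rule inner_embed[OF F shift_snd_e(1)[OF g A]])
 also have "... = (\<integral>v. indicator (graph_of g A) v *\<^sub>R F (v, k) \<partial>R)"
  unfolding L2_inner_def by (rule Bochner_Integration.integral_cong) (auto split: split_indicator)
 finally show ?thesis .
qed

lemma graph_flip:
 assumes g: "g \<in> carrier G" and A: "A \<in> sets M" and f: "f \<in> borel_measurable R"
 shows "(\<integral>v. indicator (graph_of (inv g) (a g ` A)) v *\<^sub>R f v \<partial>R) = (\<integral>v. indicator (graph_of g A) v *\<^sub>R (f (prod.swap v) :: complex) \<partial>R)"
proof -
 note As = sets.sets_into_space[OF A]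
 note gA = translate_set[OF g A]
 have sw: "prod.swap \<in> R \<rightarrow>\<^sub>M R" unfolding fibred.measurable_iff[OF R_fibred_S]
  using fibred.p_measurable[OF R_fibred_T] by (simp add: pS_def pT_def)
 have [measurable]: "graph_of (inv g) (a g ` A) \<in> sets R" by (rule graph_of_sets[OF inv_closed[OF g] gA(1)])
 have "(\<integral>v. indicator (graph_of (inv g) (a g ` A)) v *\<^sub>R f v \<partial>R)
   = (\<integral>v. indicator (graph_of (inv g) (a g ` A)) v *\<^sub>R f v \<partial>distr R R prod.swap)" by (simp add: R_flip)
 also have "... = (\<integral>v. indicator (graph_of (inv g) (a g ` A)) (prod.swap v) *\<^sub>R f (prod.swap v) \<partial>R)"
  using f by (intro integral_distr[OF sw]) measurable
 also have "... = (\<integral>v. indicator (graph_of g A) v *\<^sub>R f (prod.swap v) \<partial>R)"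
 proof (rule Bochner_Integration.integral_cong[OF refl])
  fix v assume v: "v \<in> space R"
  obtain x y where vx: "v = (x, y)" by (metis surj_pair)
  have "prod.swap v \<in> graph_of (inv g) (a g ` A) \<longleftrightarrow> v \<in> graph_of g A" using v space_RD
   using g As sets.sets_into_space[OF gA(1)] by (auto simp: vx graph_of_iff)
  then show "indicator (graph_of (inv g) (a g ` A)) (prod.swap v) *\<^sub>R f (prod.swap v) = indicator (graph_of g A) v *\<^sub>R f (prod.swap v)"
   by auto
 qed
 finally show ?thesis .
qed

lemma L2_norm_eqI:
 assumes "f \<in> L2 M1" "g \<in> L2 M2"
  and "nn_integral M1 (%v. nsq (f v)) = nn_integral M2 (%v. nsq (g v))"
 shows "L2_norm M1 f = L2_norm M2 g"
proof -
 have "ennreal ((L2_norm M1 f)^2) = ennreal ((L2_norm M2 g)^2)" using assms L2_norm_nn_integral by metis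
 then show ?thesis by simp
qed

lemma L2_swap:
 assumes "f \<in> L2 R"
 shows "(%v. cnj (f (prod.swap v))) \<in> L2 R" "L2_norm R (%v. cnj (f (prod.swap v))) = L2_norm R f"
proof -
 have sw: "prod.swap \<in> R \<rightarrow>\<^sub>M R" unfolding fibred.measurable_iff[OF R_fibred_S]
  using fibred.p_measurable[OF R_fibred_T] by (simp add: pS_def pT_def)
 have fm: "f \<in> borel_measurable R" by (rule L2_measurable[OF assms])
 have m: "(%v. cnj (f (prod.swap v))) \<in> borel_measurable R" using measurable_compose[OF sw fm] by simp
 have eq: "nn_integral R (%v. nsq (cnj (f (prod.swap v)))) = nn_integral R (%v. nsq (f v))"
  using nn_integral_distr[OF sw, of "%v. nsq (f v)"] fm by (simp add: R_flip)
 show 1: "(%v. cnj (f (prod.swap v))) \<in> L2 R" using assms eq fm m by (simp add: L2_iff_nn_integral)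
 show "L2_norm R (%v. cnj (f (prod.swap v))) = L2_norm R f" by (rule L2_norm_eqI[OF 1 assms]) (rule eq)
qed

text \<open>\<open>P (e k)\<close> lies in \<open>W\<close> up to a null set and
  \<open>e k - P (e k)\<close> is orthogonal to \<open>W\<close>, hence the vector state gives the
  squared norm of \<open>P (e k)\<close>.\<close>

lemma trace_diagonal_entry:
 assumes P: "orthogonal_projection_onto N W P" and W: "\<And>F. F \<in> W ==> F \<in> L2 N"
 shows "rel_trace R (diagonal_entry k P) = of_real ((L2_norm N (P (e k)))^2)"
proof -
 have Pe: "P (e k) \<in> L2 N" using P e_L2 by (auto simp: orthogonal_projection_onto_def)
 obtain E where E: "E \<in> W" "AE v in N. P (e k) v = E v" "L2_inner N (%v. e k v - P (e k) v) E = 0"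
  using P e_L2 unfolding orthogonal_projection_onto_def by blast
 have d: "diagonal_entry k P (indicator Id) = (%v. P (e k) (v, k))"
  by (simp add: diagonal_entry_def e_def embed_def fun_eq_iff)
 have "rel_trace R (diagonal_entry k P) = L2_inner N (P (e k)) (e k)"
  unfolding rel_trace_def d e_def by (rule inner_embed[symmetric]) (use Pe Id_L2 in \<open>auto simp: e_def\<close>)
 moreover have "L2_inner N (%v. e k v - P (e k) v) (P (e k)) = L2_inner N (%v. e k v - P (e k) v) E"
  using E W Pe e_L2 by (intro L2_inner_cong_AE) (auto intro: L2_diff)
 then have "L2_inner N (e k) (P (e k)) = L2_inner N (P (e k)) (P (e k))"
  using E(3) by (simp add: L2_inner_diff e_L2 Pe)
 ultimately show ?thesis by (metis L2_inner_cnj L2_inner_self)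
qed

text \<open>Let \<open>u\<close> be the partial isometry carrying \<open>V f\<close> to
  \<open>V' f\<close>. It commutes with graph translations, \<open>V' (z k)\<close> is the image of
  \<open>e k\<close> under \<open>u\<close>, and \<open>V (z' l)\<close> is the image of
  \<open>e l\<close> under its adjoint. The claim is that \<open>u\<close> times its adjoint and the
  adjoint times \<open>u\<close> have equal traces.\<close>

lemma trace_symmetric:
 fixes V V' :: "('p => complex) => ('x \<times> 'x) \<times> nat => complex"
 assumes lin: "\<And>f f' c. f \<in> Z ==> f' \<in> Z ==> (%v. f v + c * f' v) \<in> Z"
  and inv: "\<And>g A f. g \<in> carrier G ==> A \<in> sets M ==> f \<in> Z ==> opr (graph_of g A) f \<in> Z"
  and V: "module_embedding R M' opr Z B V" and P: "orthogonal_projection_onto N (V ` Z) P"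
  and V': "module_embedding R M' opr Z B V'" and P': "orthogonal_projection_onto N (V' ` Z) P'"
 shows "(\<Sum>k. ennreal (Re (rel_trace R (diagonal_entry k P)))) = (\<Sum>k. ennreal (Re (rel_trace R (diagonal_entry k P'))))"
proof -
 have VL: "V f \<in> L2 N" "V' f \<in> L2 N" if "f \<in> Z" for f using V V' that by (auto simp: module_embedding_def)
 have Vlin: "AE v in N. V (%w. f w + c * f' w) v = V f v + c * V f' v"
  "AE v in N. V' (%w. f w + c * f' w) v = V' f v + c * V' f' v" if "f \<in> Z" "f' \<in> Z" for f f' c
  using V V' that by (auto simp: module_embedding_def)
 have Vnorm: "L2_norm N (V f) = L2_norm N (V' f)" if "f \<in> Z" for f
  using V V' that by (auto simp: module_embedding_def)
 have Veq: "AE v in N. V (opr (graph_of g A) f) v = shift_snd g A (V f) v"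
  "AE v in N. V' (opr (graph_of g A) f) v = shift_snd g A (V' f) v"
  if "f \<in> Z" "g \<in> carrier G" "A \<in> sets M" for f g A
  using V V' that graph_of_bisection[of g A] by (auto simp: module_embedding_def shift_snd_def)
 \<comment> \<open>Both embeddings induce the same quotient norm; polarization with the coefficients
   1 and \<open>\<i>\<close> yields equal inner products.\<close>
 have polar: "L2_inner N (V f) (V f') = L2_inner N (V' f) (V' f')" if f: "f \<in> Z" "f' \<in> Z" for f f'
 proof -
  have re: "Re (cnj c * L2_inner N (V f) (V f')) = Re (cnj c * L2_inner N (V' f) (V' f'))" for c
  proof -
   have "L2_norm N (%v. V f v + c * V f' v) = L2_norm N (V (%v. f v + c * f' v))"
    using Vlin(1)[OF f, of c] by (intro L2_norm_cong_AE) (auto intro: L2_lin VL f lin)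
   also have "... = L2_norm N (V' (%v. f v + c * f' v))" by (rule Vnorm[OF lin[OF f]])
   also have "... = L2_norm N (%v. V' f v + c * V' f' v)"
    using Vlin(2)[OF f, of c] by (intro L2_norm_cong_AE) (auto intro: L2_lin VL f lin)
   finally show ?thesis using L2_norm_lin_square[OF VL(1)[OF f(1)] VL(1)[OF f(2)], of c]
     L2_norm_lin_square[OF VL(2)[OF f(1)] VL(2)[OF f(2)], of c] Vnorm f by simp
  qed
  show ?thesis using re[of 1] re[of \<i>] by (simp add: complex_eq_iff)
 qed
 have ex: "\<exists>z\<in>Z. AE v in N. P (e k) v = V z v" "\<exists>z\<in>Z. AE v in N. P' (e k) v = V' z v" for k
  using P P' e_L2[of k] by (fastforce simp: orthogonal_projection_onto_def)+
 define z where "z k = (SOME z. z \<in> Z \<and> (AE v in N. P (e k) v = V z v))" for k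
 define z' where "z' k = (SOME z. z \<in> Z \<and> (AE v in N. P' (e k) v = V' z v))" for k
 have z: "z k \<in> Z" "AE v in N. P (e k) v = V (z k) v" for k
  using someI_ex[of "%z. z \<in> Z \<and> (AE v in N. P (e k) v = V z v)"] ex(1)[of k] unfolding z_def by blast+
 have z': "z' k \<in> Z" "AE v in N. P' (e k) v = V' (z' k) v" for k
  using someI_ex[of "%z. z \<in> Z \<and> (AE v in N. P' (e k) v = V' z v)"] ex(2)[of k] unfolding z'_def by blast+
 have PL: "P (e k) \<in> L2 N" "P' (e k) \<in> L2 N" for k
  using P P' e_L2 by (auto simp: orthogonal_projection_onto_def)
 have orth: "L2_inner N (e k) (V f) = L2_inner N (V (z k)) (V f)"
   "L2_inner N (e k) (V' f) = L2_inner N (V' (z' k)) (V' f)" if f: "f \<in> Z" for f k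
 proof -
  have "L2_inner N (%v. e k v - P (e k) v) (V f) = 0" "L2_inner N (%v. e k v - P' (e k) v) (V' f) = 0"
   using P P' e_L2[of k] f by (auto simp: orthogonal_projection_onto_def)
  then have "L2_inner N (e k) (V f) = L2_inner N (P (e k)) (V f)" "L2_inner N (e k) (V' f) = L2_inner N (P' (e k)) (V' f)"
   by (simp_all add: L2_inner_diff e_L2 PL VL f)
  moreover have "L2_inner N (P (e k)) (V f) = L2_inner N (V (z k)) (V f)"
   "L2_inner N (P' (e k)) (V' f) = L2_inner N (V' (z' k)) (V' f)"
   using z[of k] z'[of k] f by (auto intro!: L2_inner_cong_AE PL VL)
  ultimately show "L2_inner N (e k) (V f) = L2_inner N (V (z k)) (V f)"
   "L2_inner N (e k) (V' f) = L2_inner N (V' (z' k)) (V' f)" by auto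
 qed
 \<comment> \<open>The matrix entries of \<open>u\<close> and of its adjoint agree up to flip and
   conjugation. Both sides are tested against graphs, and the translation is moved across the inner
   product until \<open>polar\<close> applies.\<close>
 have key: "AE v in R. V' (z k) (v, l) = cnj (V (z' l) (prod.swap v, k))" for k l
 proof (rule AE_eq_of_graph_integrals)
  show "(%v. V' (z k) (v, l)) \<in> L2 R" by (intro L2_slice VL z)
  show "(%v. cnj (V (z' l) (prod.swap v, k))) \<in> L2 R"
   by (intro L2_swap(1)[of "%v. V (z' l) (v, k)"] L2_slice VL z')
  fix g A assume g: "g \<in> carrier G" and A: "A \<in> sets M"
  note gA = translate_set[OF g A]
  let ?f = "opr (graph_of g A) (z' l)"
  have f: "?f \<in> Z" by (intro inv g A z')
  have "(\<integral>v. indicator (graph_of g A) v *\<^sub>R V' (z k) (v, l) \<partial>R) = L2_inner N (V' (z k)) (shift_snd g A (e l))"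
   by (rule inner_shift_e[symmetric, OF g A VL(2)[OF z(1)]])
  also have "... = cnj (L2_inner N (e l) (shift_snd (inv g) (a g ` A) (V' (z k))))"
   by (simp add: L2_inner_cnj flip: shift_snd_adjoint[OF g A e_L2 VL(2)[OF z(1)]])
  also have "L2_inner N (e l) (shift_snd (inv g) (a g ` A) (V' (z k)))
    = L2_inner N (e l) (V' (opr (graph_of (inv g) (a g ` A)) (z k)))"
   using AE_symmetric[OF Veq(2)[OF z(1) inv_closed[OF g] gA(1)]]
   by (intro L2_inner_cong_AE) (auto intro!: e_L2 shift_snd_L2 VL z inv g gA)
  also have "... = L2_inner N (V' (z' l)) (V' (opr (graph_of (inv g) (a g ` A)) (z k)))"
   by (intro orth inv inv_closed g gA z)
  also have "... = L2_inner N (V' (z' l)) (shift_snd (inv g) (a g ` A) (V' (z k)))"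
   using Veq(2)[OF z(1) inv_closed[OF g] gA(1)]
   by (intro L2_inner_cong_AE) (auto intro!: shift_snd_L2 VL z z' inv g gA)
  also have "cnj ... = L2_inner N (V' (z k)) (shift_snd g A (V' (z' l)))"
   by (simp add: L2_inner_cnj flip: shift_snd_adjoint[OF g A VL(2)[OF z'(1)] VL(2)[OF z(1)]])
  also have "... = L2_inner N (V' (z k)) (V' ?f)"
   using AE_symmetric[OF Veq(2)[OF z'(1) g A]] by (intro L2_inner_cong_AE) (auto intro!: shift_snd_L2 VL z z' f g A)
  also have "... = L2_inner N (V (z k)) (V ?f)" by (intro polar[symmetric] z f)
  also have "... = L2_inner N (e k) (V ?f)" by (rule orth(1)[OF f, symmetric])
  also have "... = L2_inner N (e k) (shift_snd g A (V (z' l)))"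
   using Veq(1)[OF z'(1) g A] by (intro L2_inner_cong_AE) (auto intro!: shift_snd_L2 VL z' f g A e_L2)
  also have "... = cnj (L2_inner N (V (z' l)) (shift_snd (inv g) (a g ` A) (e k)))"
   by (simp add: L2_inner_cnj flip: shift_snd_adjoint[OF g A VL(1)[OF z'(1)] e_L2])
  also have "... = cnj (\<integral>v. indicator (graph_of g A) v *\<^sub>R V (z' l) (prod.swap v, k) \<partial>R)"
   using graph_flip[OF g A L2_measurable[OF L2_slice[OF VL(1)[OF z'(1)]]]]
   by (simp add: inner_shift_e[OF inv_closed[OF g] gA(1) VL(1)[OF z'(1)]])
  also have "... = (\<integral>v. indicator (graph_of g A) v *\<^sub>R cnj (V (z' l) (prod.swap v, k)) \<partial>R)"
   by (subst Bochner_Integration.integral_cnj[symmetric]) (simp)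
  finally show "(\<integral>v. indicator (graph_of g A) v *\<^sub>R V' (z k) (v, l) \<partial>R)
    = (\<integral>v. indicator (graph_of g A) v *\<^sub>R cnj (V (z' l) (prod.swap v, k)) \<partial>R)" .
 qed
 have slice: "L2_norm R (%v. V' (z k) (v, l)) = L2_norm R (%v. V (z' l) (v, k))" for k l
 proof -
  have "L2_norm R (%v. V' (z k) (v, l)) = L2_norm R (%v. cnj (V (z' l) (prod.swap v, k)))"
   by (intro L2_norm_cong_AE key L2_slice VL z L2_swap(1)[of "%v. V (z' l) (v, k)"] z')
  also have "... = L2_norm R (%v. V (z' l) (v, k))"
   by (intro L2_swap(2)[of "%v. V (z' l) (v, k)"] L2_slice VL z')
  finally show ?thesis .
 qed
 have WL: "F \<in> L2 N" if "F \<in> V ` Z \<or> F \<in> V' ` Z" for F using that VL by auto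
 have "(\<Sum>k. ennreal (Re (rel_trace R (diagonal_entry k P)))) = (\<Sum>k. ennreal ((L2_norm N (V' (z k)))^2))"
 proof (rule suminf_cong)
  fix k
  have "L2_norm N (P (e k)) = L2_norm N (V (z k))" by (intro L2_norm_cong_AE PL VL z)
  then show "ennreal (Re (rel_trace R (diagonal_entry k P))) = ennreal ((L2_norm N (V' (z k)))^2)"
   using trace_diagonal_entry[OF P WL, of k] Vnorm[OF z(1)] by simp
 qed
 also have "... = (\<Sum>k. \<Sum>l. ennreal ((L2_norm R (%v. V (z' l) (v, k)))^2))"
  by (simp add: L2_norm_slices VL z slice)
 also have "... = (\<Sum>l. \<Sum>k. ennreal ((L2_norm R (%v. V (z' l) (v, k)))^2))"
  unfolding nn_integral_count_space_nat[symmetric]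
  by (rule nn_integral_count_space_nn_integral[where I="UNIV::nat set" and M="count_space (UNIV::nat set)"]) auto
 also have "... = (\<Sum>l. ennreal ((L2_norm N (V (z' l)))^2))" by (simp add: L2_norm_slices VL z')
 also have "... = (\<Sum>l. ennreal (Re (rel_trace R (diagonal_entry l P'))))"
 proof (rule suminf_cong)
  fix l
  have "L2_norm N (P' (e l)) = L2_norm N (V' (z' l))" by (intro L2_norm_cong_AE PL VL z')
  then show "ennreal ((L2_norm N (V (z' l)))^2) = ennreal (Re (rel_trace R (diagonal_entry l P')))"
   using trace_diagonal_entry[OF P' WL, of l] Vnorm[OF z'(1)] by simp
 qed
 finally show ?thesis .
qed

theorem rel_dim_eq:
 fixes V :: "('p => complex) => ('x \<times> 'x) \<times> nat => complex"
 assumes "\<And>f f' c. f \<in> Z ==> f' \<in> Z ==> (%v. f v + c * f' v) \<in> Z"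
  and "\<And>g A f. g \<in> carrier G ==> A \<in> sets M ==> f \<in> Z ==> opr (graph_of g A) f \<in> Z"
  and "module_embedding R M' opr Z B V" and "orthogonal_projection_onto N (V ` Z) P"
 shows "rel_dim R M' opr Z B = (\<Sum>k. ennreal ((L2_norm N (P (e k)))^2))"
proof -
 have "rel_dim R M' opr Z B = (\<Sum>k. ennreal (Re (rel_trace R (diagonal_entry k P))))" unfolding rel_dim_def
 proof (rule the_equality)
  show "\<exists>V P'. module_embedding R M' opr Z B V \<and> orthogonal_projection_onto N (V ` Z) P' \<and>
    (\<Sum>k. ennreal (Re (rel_trace R (diagonal_entry k P)))) = (\<Sum>k. ennreal (Re (rel_trace R (diagonal_entry k P'))))"
   using assms(3,4) by blast
 next
  fix d assume "\<exists>V P'. module_embedding R M' opr Z B V \<and> orthogonal_projection_onto N (V ` Z) P' \<and>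
    d = (\<Sum>k. ennreal (Re (rel_trace R (diagonal_entry k P'))))"
  then obtain V' P' where *: "module_embedding R M' opr Z B V'" "orthogonal_projection_onto N (V' ` Z) P'"
    "d = (\<Sum>k. ennreal (Re (rel_trace R (diagonal_entry k P'))))" by blast
  show "d = (\<Sum>k. ennreal (Re (rel_trace R (diagonal_entry k P))))"
   unfolding *(3) by (rule trace_symmetric[OF assms(1,2) *(1,2) assms(3,4)])
 qed
 moreover have "F \<in> L2 N" if "F \<in> V ` Z" for F using assms(3) that by (auto simp: module_embedding_def)
 ultimately show ?thesis by (simp add: trace_diagonal_entry[OF assms(4)])
qed

end

section \<open>Invariant kernels on free sets\<close>

text \<open>By freeness each \<open>b\<close> is uniquely \<open>gpart b\<close> applied to the
  representative number \<open>ipart b\<close>. This serves as the fundamental domain of the whole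
  argument; it lies in the complex and not in the probability space.\<close>

locale free_gset = group G for G :: "('g, 'm) monoid_scheme" (structure) +
 fixes B :: "'b set" and mv :: "'g => 'b => 'b" and rp :: "nat => 'b" and m :: nat
 assumes mv_in: "\<And>g b. g \<in> carrier G ==> b \<in> B ==> mv g b \<in> B"
  and mv_mult: "\<And>g h b. g \<in> carrier G ==> h \<in> carrier G ==> b \<in> B ==> mv (g \<otimes> h) b = mv g (mv h b)"
  and mv_one: "\<And>b. b \<in> B ==> mv \<one> b = b"
  and mv_free: "\<And>g b. g \<in> carrier G ==> b \<in> B ==> mv g b = b ==> g = \<one>"
  and rp_in: "\<And>l. l < m ==> rp l \<in> B"
  and rp_cover: "\<And>b. b \<in> B ==> \<exists>g\<in>carrier G. \<exists>l<m. b = mv g (rp l)"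
  and rp_distinct: "\<And>g l l'. g \<in> carrier G ==> l < m ==> l' < m ==> mv g (rp l) = rp l' ==> l = l'"
begin

lemma mv_inv [simp]: "g \<in> carrier G ==> b \<in> B ==> mv (inv g) (mv g b) = b"
 "g \<in> carrier G ==> b \<in> B ==> mv g (mv (inv g) b) = b" by (auto simp: mv_one simp flip: mv_mult)

lemma mv_eq_iff:
 assumes "g \<in> carrier G" "h \<in> carrier G" "b \<in> B" shows "mv g b = mv h b \<longleftrightarrow> g = h"
proof
 assume "mv g b = mv h b"
 then have "mv (inv h \<otimes> g) b = b" using assms by (simp add: mv_mult)
 then have "inv h \<otimes> g = \<one>" using assms by (intro mv_free) auto
 then show "g = h" using assms by (metis inv_closed inv_equality inv_inv)
qed simp

lemma mv_inj: "g \<in> carrier G ==> inj_on (mv g) B"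
proof (rule inj_onI)
 fix b b' assume g: "g \<in> carrier G" and b: "b \<in> B" "b' \<in> B" and eq: "mv g b = mv g b'"
 have "b = mv (inv g) (mv g b)" by (rule mv_inv(1)[OF g b(1), symmetric])
 also have "... = mv (inv g) (mv g b')" by (simp only: eq)
 also have "... = b'" by (rule mv_inv(1)[OF g b(2)])
 finally show "b = b'" .
qed

definition "gpart b = (SOME g. g \<in> carrier G \<and> (\<exists>l<m. b = mv g (rp l)))"
definition "ipart b = (SOME l. l < m \<and> b = mv (gpart b) (rp l))"

lemma parts:
 assumes "b \<in> B"
 shows gpart_in: "gpart b \<in> carrier G" and ipart_less: "ipart b < m"
  and parts_eq: "mv (gpart b) (rp (ipart b)) = b"
proof -
 have g: "gpart b \<in> carrier G \<and> (\<exists>l<m. b = mv (gpart b) (rp l))"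
  unfolding gpart_def by (rule someI_ex) (use rp_cover[OF assms] in blast)
 then obtain l where "l < m \<and> b = mv (gpart b) (rp l)" by blast
 then have i: "ipart b < m \<and> b = mv (gpart b) (rp (ipart b))" unfolding ipart_def by (rule someI)
 show "gpart b \<in> carrier G" "ipart b < m" "mv (gpart b) (rp (ipart b)) = b" using g i by auto
qed

lemma parts_unique:
 assumes g: "g \<in> carrier G" and l: "l < m" shows "gpart (mv g (rp l)) = g" "ipart (mv g (rp l)) = l"
proof -
 let ?b = "mv g (rp l)"
 have b: "?b \<in> B" using assms by (simp add: mv_in rp_in)
 note p = parts[OF b]
 have "mv (inv g \<otimes> gpart ?b) (rp (ipart ?b)) = rp l" using p g l by (simp add: mv_mult rp_in)
 then show "ipart ?b = l" using p g l by (intro rp_distinct) auto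
 then show "gpart ?b = g" using p(3) mv_eq_iff[OF p(1) g rp_in[OF l]] by simp
qed

lemma parts_mv:
 assumes "g \<in> carrier G" "b \<in> B" shows "gpart (mv g b) = g \<otimes> gpart b" "ipart (mv g b) = ipart b"
proof -
 have "mv g b = mv (g \<otimes> gpart b) (rp (ipart b))" using assms parts[OF assms(2)] by (simp add: mv_mult rp_in)
 then show "gpart (mv g b) = g \<otimes> gpart b" "ipart (mv g b) = ipart b"
  using assms parts[OF assms(2)] by (simp_all add: parts_unique)
qed

lemma parts_rp: "l < m ==> gpart (rp l) = \<one>" "l < m ==> ipart (rp l) = l"
 using parts_unique[of \<one> l] by (simp_all add: mv_one rp_in)

section \<open>Invariant kernels, their algebra and their operators\<close>

definition supp :: "('b => 'b => real) => 'b => 'b set" where "supp k b = {b' \<in> B. k b b' \<noteq> 0}"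
text \<open>Finite rows let a kernel act on arbitrary functions; finite columns make the transpose a
  kernel again.\<close>

definition kernel :: "('b => 'b => real) => bool" where
 "kernel k \<longleftrightarrow> (\<forall>g\<in>carrier G. \<forall>b\<in>B. \<forall>b'\<in>B. k (mv g b) (mv g b') = k b b')
   \<and> (\<forall>b\<in>B. finite (supp k b)) \<and> (\<forall>b\<in>B. finite {b' \<in> B. k b' b \<noteq> 0})"
definition kop :: "('b => 'b => real) => ('b => complex) => 'b => complex" where
 "kop k h b = (\<Sum>b'\<in>supp k b. of_real (k b b') * h b')"
definition kmul :: "('b => 'b => real) => ('b => 'b => real) => 'b => 'b => real" where
 "kmul k1 k2 b b'' = (\<Sum>b'\<in>supp k1 b. k1 b b' * k2 b' b'')"
definition kid :: "'b => 'b => real" where "kid b b' = of_bool (b = b')"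
definition ktr :: "('b => 'b => real) => 'b => 'b => real" where "ktr k b b' = k b' b"
primrec kpow :: "('b => 'b => real) => nat => 'b => 'b => real" where
 "kpow k 0 = kid" | "kpow k (Suc n) = kmul k (kpow k n)"

lemma kernelD:
 assumes "kernel k"
 shows kernel_inv: "g \<in> carrier G ==> b \<in> B ==> b' \<in> B ==> k (mv g b) (mv g b') = k b b'"
  and finite_supp: "b \<in> B ==> finite (supp k b)"
  and finite_cosupp: "b \<in> B ==> finite {b' \<in> B. k b' b \<noteq> 0}"
 using assms by (auto simp: kernel_def)

lemma supp_subset: "supp k b \<subseteq> B" by (auto simp: supp_def)

lemma kop_superset:
 assumes "finite S" "supp k b \<subseteq> S" "S \<subseteq> B"
 shows "kop k h b = (\<Sum>b'\<in>S. of_real (k b b') * h b')"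
 unfolding kop_def by (rule sum.mono_neutral_left) (use assms in \<open>auto simp: supp_def\<close>)

lemma kop_cong: "(\<And>b'. b' \<in> B ==> h b' = h' b') ==> kop k h b = kop k h' b"
 unfolding kop_def by (rule) (auto simp: supp_def)

lemma kop_lin: "kop k (%b. f b + c * g b) b = kop k f b + c * kop k g b"
 by (simp add: kop_def sum_distrib_left algebra_simps)

lemma kop_zero: "kop k (%b. 0) b = 0" by (simp add: kop_def)

lemma supp_mv:
 assumes "kernel k" "g \<in> carrier G" "b \<in> B" shows "supp k (mv g b) = mv g ` supp k b"
proof
 show "supp k (mv g b) \<subseteq> mv g ` supp k b"
 proof
  fix b' assume b': "b' \<in> supp k (mv g b)"
  then show "b' \<in> mv g ` supp k b" using kernel_inv[OF assms(1,2,3), of "mv (inv g) b'"]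
   using assms by (intro image_eqI[of _ _ "mv (inv g) b'"]) (auto simp: supp_def mv_in)
 qed
 show "mv g ` supp k b \<subseteq> supp k (mv g b)" using assms kernel_inv[OF assms(1)] by (auto simp: supp_def mv_in)
qed

lemma sum_supp_mv:
 assumes "kernel k" "g \<in> carrier G" "b \<in> B"
 shows "(\<Sum>b'\<in>supp k (mv g b). F (k (mv g b) b') b') = (\<Sum>b'\<in>supp k b. F (k b b') (mv g b'))"
 unfolding supp_mv[OF assms]
 by (subst sum.reindex) (use assms in \<open>auto simp: supp_def kernel_inv inj_on_def intro: inj_onD[OF mv_inj]\<close>)

lemma kop_mv:
 assumes "kernel k" "g \<in> carrier G" "b \<in> B" shows "kop k h (mv g b) = kop k (%b'. h (mv g b')) b"
 unfolding kop_def by (rule sum_supp_mv[OF assms])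

lemma kernel_tr: "kernel k ==> kernel (ktr k)" by (auto simp: kernel_def supp_def ktr_def)

lemma kernel_id: "kernel kid" by (auto simp: kernel_def supp_def kid_def inj_on_eq_iff[OF mv_inj])

lemma kernel_lin:
 assumes "kernel k1" "kernel k2" shows "kernel (%b b'. c * k1 b b' + d * k2 b b')"
proof -
 let ?k = "%b b'. c * k1 b b' + d * k2 b b'"
 have 1: "finite (supp ?k b)" if b: "b \<in> B" for b
 proof (rule finite_subset)
  show "supp ?k b \<subseteq> supp k1 b \<union> supp k2 b" by (auto simp: supp_def)
  show "finite (supp k1 b \<union> supp k2 b)" using finite_supp[OF assms(1) b] finite_supp[OF assms(2) b] by simp
 qed
 have 2: "finite {b' \<in> B. ?k b' b \<noteq> 0}" if b: "b \<in> B" for b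
 proof (rule finite_subset)
  show "{b' \<in> B. ?k b' b \<noteq> 0} \<subseteq> {b' \<in> B. k1 b' b \<noteq> 0} \<union> {b' \<in> B. k2 b' b \<noteq> 0}" by auto
  show "finite ({b' \<in> B. k1 b' b \<noteq> 0} \<union> {b' \<in> B. k2 b' b \<noteq> 0})"
   using finite_cosupp[OF assms(1) b] finite_cosupp[OF assms(2) b] by simp
 qed
 show ?thesis unfolding kernel_def using 1 2 kernel_inv[OF assms(1)] kernel_inv[OF assms(2)] by simp
qed

lemma kmul_superset:
 assumes "finite S" "supp k1 b \<subseteq> S" "S \<subseteq> B"
 shows "kmul k1 k2 b b'' = (\<Sum>b'\<in>S. k1 b b' * k2 b' b'')"
 unfolding kmul_def by (rule sum.mono_neutral_left) (use assms in \<open>auto simp: supp_def\<close>)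

lemma supp_kmul: "supp (kmul k1 k2) b \<subseteq> (\<Union>b'\<in>supp k1 b. supp k2 b')"
proof
 fix b'' assume "b'' \<in> supp (kmul k1 k2) b"
 then obtain b' where "b' \<in> supp k1 b" "k1 b b' * k2 b' b'' \<noteq> 0" "b'' \<in> B"
  by (auto simp: supp_def kmul_def elim: sum.not_neutral_contains_not_neutral)
 then show "b'' \<in> (\<Union>b'\<in>supp k1 b. supp k2 b')" by (auto simp: supp_def)
qed

lemma kernel_mul:
 assumes k1: "kernel k1" and k2: "kernel k2" shows "kernel (kmul k1 k2)"
 unfolding kernel_def
proof (intro conjI ballI)
 fix g b b'' assume g: "g \<in> carrier G" and b: "b \<in> B" "b'' \<in> B"
 have "kmul k1 k2 (mv g b) (mv g b'') = (\<Sum>b'\<in>supp k1 b. k1 b b' * k2 (mv g b') (mv g b''))"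
  unfolding kmul_def by (rule sum_supp_mv[OF k1 g b(1)])
 also have "... = kmul k1 k2 b b''"
  unfolding kmul_def using g b kernel_inv[OF k2] by (intro sum.cong) (auto simp: supp_def)
 finally show "kmul k1 k2 (mv g b) (mv g b'') = kmul k1 k2 b b''" .
next
 fix b assume b: "b \<in> B"
 have "finite (\<Union>b'\<in>supp k1 b. supp k2 b')" using finite_supp[OF k1 b] finite_supp[OF k2] supp_subset by blast
 then show "finite (supp (kmul k1 k2) b)" by (rule finite_subset[OF supp_kmul])
 have "{b' \<in> B. kmul k1 k2 b' b \<noteq> 0} \<subseteq> (\<Union>c\<in>{c \<in> B. k2 c b \<noteq> 0}. {b' \<in> B. k1 b' c \<noteq> 0})"
 proof
  fix b' assume "b' \<in> {b' \<in> B. kmul k1 k2 b' b \<noteq> 0}"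
  then obtain c where "c \<in> supp k1 b'" "k1 b' c * k2 c b \<noteq> 0" "b' \<in> B"
   by (auto simp: kmul_def elim: sum.not_neutral_contains_not_neutral)
  then show "b' \<in> (\<Union>c\<in>{c \<in> B. k2 c b \<noteq> 0}. {b' \<in> B. k1 b' c \<noteq> 0})" by (auto simp: supp_def)
 qed
 moreover have "finite (\<Union>c\<in>{c \<in> B. k2 c b \<noteq> 0}. {b' \<in> B. k1 b' c \<noteq> 0})"
  using finite_cosupp[OF k2 b] finite_cosupp[OF k1] by auto
 ultimately show "finite {b' \<in> B. kmul k1 k2 b' b \<noteq> 0}" by (rule finite_subset)
qed

lemma ktr_kmul:
 assumes k1: "kernel k1" and k2: "kernel k2" and b: "b \<in> B" "b'' \<in> B"
 shows "ktr (kmul k1 k2) b b'' = kmul (ktr k2) (ktr k1) b b''"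
proof -
 let ?S = "supp k1 b'' \<union> supp (ktr k2) b"
 have S: "finite ?S" "?S \<subseteq> B"
  using finite_supp[OF k1 b(2)] finite_supp[OF kernel_tr[OF k2] b(1)] supp_subset by auto
 have "ktr (kmul k1 k2) b b'' = kmul k1 k2 b'' b" by (simp only: ktr_def)
 also have "... = (\<Sum>b'\<in>?S. k1 b'' b' * k2 b' b)" by (rule kmul_superset) (use S in auto)
 also have "... = (\<Sum>b'\<in>?S. ktr k2 b b' * ktr k1 b' b'')" by (intro sum.cong) (auto simp: ktr_def)
 also have "... = kmul (ktr k2) (ktr k1) b b''" by (rule kmul_superset[symmetric]) (use S in auto)
 finally show ?thesis .
qed

lemma kop_kcong:
 assumes "\<And>b'. b' \<in> B ==> k b b' = k' b b'" shows "kop k h b = kop k' h b" unfolding kop_def using assms by (intro sum.cong) (auto simp: supp_def)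

lemma kop_scale: "kop k (%b. c * h b) b = c * kop k h b" by (simp add: kop_def sum_distrib_left algebra_simps)

lemma kernel_pow: "kernel k ==> kernel (kpow k n)" by (induction n) (auto simp: kernel_id kernel_mul)

lemma kop_mul:
 assumes k1: "kernel k1" and k2: "kernel k2" and b: "b \<in> B"
 shows "kop (kmul k1 k2) h b = kop k1 (kop k2 h) b"
proof -
 let ?S = "\<Union>b'\<in>supp k1 b. supp k2 b'"
 have fin: "finite ?S" "?S \<subseteq> B" using finite_supp[OF k1 b] finite_supp[OF k2] supp_subset by auto
 have "kop (kmul k1 k2) h b = (\<Sum>c\<in>?S. of_real (kmul k1 k2 b c) * h c)"
  by (rule kop_superset[OF fin(1) supp_kmul fin(2)])
 also have "... = (\<Sum>c\<in>?S. \<Sum>b'\<in>supp k1 b. of_real (k1 b b') * (of_real (k2 b' c) * h c))"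
  by (simp add: kmul_def sum_distrib_right mult.assoc)
 also have "... = (\<Sum>b'\<in>supp k1 b. of_real (k1 b b') * (\<Sum>c\<in>?S. of_real (k2 b' c) * h c))"
  by (subst sum.swap) (simp add: sum_distrib_left)
 also have "... = (\<Sum>b'\<in>supp k1 b. of_real (k1 b b') * kop k2 h b')"
  using fin by (intro sum.cong refl) (subst kop_superset[of ?S], auto)
 finally show ?thesis by (simp add: kop_def)
qed

lemma kop_id: "b \<in> B ==> kop kid h b = h b" by (subst kop_superset[of "{b}"]) (auto simp: supp_def kid_def)

lemma kop_combine:
 assumes "kernel k1" "kernel k2" "b \<in> B"
 shows "kop (%b b'. c * k1 b b' + d * k2 b b') h b = of_real c * kop k1 h b + of_real d * kop k2 h b"
proof -
 let ?S = "supp k1 b \<union> supp k2 b"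
 have S: "finite ?S" "?S \<subseteq> B" using assms finite_supp supp_subset by auto
 have "kop (%b b'. c * k1 b b' + d * k2 b b') h b = (\<Sum>b'\<in>?S. of_real (c * k1 b b' + d * k2 b b') * h b')"
  by (rule kop_superset) (use S in \<open>auto simp: supp_def\<close>)
 also have "... = of_real c * (\<Sum>b'\<in>?S. of_real (k1 b b') * h b') + of_real d * (\<Sum>b'\<in>?S. of_real (k2 b b') * h b')"
  by (simp add: sum_distrib_left algebra_simps)
 also have "... = of_real c * kop k1 h b + of_real d * kop k2 h b"
  using S by (subst (1 2) kop_superset[of ?S]) auto
 finally show ?thesis .
qed

lemma kop_pow:
 assumes "kernel k" "b \<in> B" shows "kop (kpow k n) h b = (kop k ^^ n) h b"
 using assms(2)
proof (induction n arbitrary: b)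
 case (Suc n)
 then have "kop (kpow k (Suc n)) h b = kop k (kop (kpow k n) h) b" by (simp add: kop_mul assms kernel_pow)
 also have "... = kop k ((kop k ^^ n) h) b" by (rule kop_cong) (rule Suc.IH)
 finally show ?case by simp
qed (simp add: kop_id)

text \<open>Adding up the rows of all representatives is wasteful, but it bounds at once every row
  sum, on \<open>B\<close> and on any quotient, and the operator norm on the direct sum.\<close>

definition ksum :: "('b => 'b => real) => real" where "ksum k = (\<Sum>j<m. \<Sum>b'\<in>supp k (rp j). \<bar>k (rp j) b'\<bar>)"

lemma row_sum_le:
 assumes "kernel k" "b \<in> B" shows "(\<Sum>b'\<in>supp k b. \<bar>k b b'\<bar>) \<le> ksum k"
proof -
 note p = parts[OF assms(2)]
 have "(\<Sum>b'\<in>supp k b. \<bar>k b b'\<bar>) = (\<Sum>b'\<in>supp k (rp (ipart b)). \<bar>k (rp (ipart b)) b'\<bar>)"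
  using sum_supp_mv[OF assms(1) p(1) rp_in[OF p(2)], of "%r b'. \<bar>r\<bar>"] by (simp add: p(3))
 also have "... \<le> ksum k" unfolding ksum_def using p(2)
  by (intro member_le_sum[of "ipart b" _ "%j. \<Sum>b'\<in>supp k (rp j). \<bar>k (rp j) b'\<bar>"]) (auto)
 finally show ?thesis .
qed

text \<open>A finite set of group elements: those through which the kernel can contribute to a
  diagonal entry of a quotient.\<close>

definition fixers :: "('b => 'b => real) => nat => 'g set" where
 "fixers k j = {g \<in> carrier G. k (rp j) (mv g (rp j)) \<noteq> 0}"

lemma finite_fixers:
 assumes "kernel k" "j < m" shows "finite (fixers k j)"
proof (rule finite_imageD)
 show "finite ((%g. mv g (rp j)) ` fixers k j)" using finite_supp[OF assms(1) rp_in[OF assms(2)]]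
  by (rule finite_subset[rotated]) (use assms in \<open>auto simp: fixers_def supp_def mv_in rp_in\<close>)
 show "inj_on (%g. mv g (rp j)) (fixers k j)"
  using assms by (auto simp: inj_on_def fixers_def mv_eq_iff rp_in)
qed

text \<open>The common trace formula: \<open>ph\<close> counts fixed cosets for a finite quotient
  and measures fixed point sets for the orbit relation.\<close>

definition trace_sum :: "('b => 'b => real) => nat => ('g => real) => real" where
 "trace_sum k j ph = (\<Sum>\<gamma>\<in>fixers k j. k (rp j) (mv \<gamma> (rp j)) * ph \<gamma>)"

end

text \<open>The class map is abstract because it is used both for lists of vertex orbits and for the
  orbits in \<open>B\<close> of a point stabilizer.\<close>

locale gset_quotient = free_gset +
 fixes S :: "'a set" and cl :: "'c => 'd"
 assumes S_sub: "subgroup S G"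
  and cl_eq: "\<And>b b'. b \<in> B ==> b' \<in> B ==> cl b = cl b' \<longleftrightarrow> (\<exists>s\<in>S. b' = mv s b)"
begin

lemma S_carrier: "s \<in> S ==> s \<in> carrier G" using subgroup.mem_carrier[OF S_sub] .

lemma cl_mv: "s \<in> S ==> b \<in> B ==> cl (mv s b) = cl b" using cl_eq[of b "mv s b"] S_carrier mv_in by metis

definition kopq :: "('c => 'c => real) => ('d => complex) => 'd => complex" where
 "kopq k f c = kop k (%b. f (cl b)) (SOME b. b \<in> B \<and> cl b = c)"
text \<open>The kernel pushed down to classes by summing over a class of columns; by invariance the
  chosen representative of the row does not matter.\<close>

definition kmat :: "('c => 'c => real) => 'd => 'd => real" where
 "kmat k c c' = (let b = SOME b. b \<in> B \<and> cl b = c in \<Sum>b'\<in>{b' \<in> supp k b. cl b' = c'}. k b b')"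

lemma rep_ex:
 assumes "b \<in> B" shows "\<exists>s\<in>S. (SOME b'. b' \<in> B \<and> cl b' = cl b) = mv s b"
proof -
 have "(SOME b'. b' \<in> B \<and> cl b' = cl b) \<in> B \<and> cl (SOME b'. b' \<in> B \<and> cl b' = cl b) = cl b"
  by (rule someI_ex) (use assms in blast)
 then show ?thesis using cl_eq[OF assms] by metis
qed

lemma kop_invariant:
 assumes k: "kernel k" and b: "b \<in> B" and s: "s \<in> S"
 shows "kop k (%b. f (cl b)) (mv s b) = kop k (%b. f (cl b)) b"
 unfolding kop_mv[OF k S_carrier[OF s] b] by (rule kop_cong) (simp add: cl_mv s)

lemma kopq_cl: "kernel k ==> b \<in> B ==> kopq k f (cl b) = kop k (%b. f (cl b)) b"
 unfolding kopq_def using rep_ex[of b] kop_invariant by metis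

lemma kmat_eq:
 assumes k: "kernel k" and b: "b \<in> B" and b': "b' \<in> B"
 shows "kmat k (cl b) (cl b') = (\<Sum>s\<in>{s \<in> S. k b (mv s b') \<noteq> 0}. k b (mv s b'))"
proof -
 obtain t where t: "t \<in> S" "(SOME b'. b' \<in> B \<and> cl b' = cl b) = mv t b" using rep_ex[OF b] by blast
 note tc = S_carrier[OF t(1)]
 have "kmat k (cl b) (cl b') = (\<Sum>b''\<in>{b'' \<in> supp k (mv t b). cl b'' = cl b'}. k (mv t b) b'')"
  by (simp add: kmat_def Let_def t(2))
 also have "{b'' \<in> supp k (mv t b). cl b'' = cl b'} = (%s. mv t (mv s b')) ` {s \<in> S. k b (mv s b') \<noteq> 0}"
 proof (intro Set.set_eqI iffI)
  fix b'' assume "b'' \<in> {b'' \<in> supp k (mv t b). cl b'' = cl b'}"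
  then obtain c where c: "c \<in> supp k b" "b'' = mv t c" "cl b'' = cl b'"
   unfolding supp_mv[OF k tc b] by blast
  then have cB: "c \<in> B" by (simp add: supp_def)
  obtain s where "s \<in> S" "c = mv s b'" using c cl_mv[OF t(1) cB] using cl_eq[OF b' cB] by auto
  then show "b'' \<in> (%s. mv t (mv s b')) ` {s \<in> S. k b (mv s b') \<noteq> 0}" using c by (auto simp: supp_def)
 next
  fix b'' assume "b'' \<in> (%s. mv t (mv s b')) ` {s \<in> S. k b (mv s b') \<noteq> 0}"
  then show "b'' \<in> {b'' \<in> supp k (mv t b). cl b'' = cl b'}" using b' t S_carrier
   by (auto simp: supp_def cl_mv mv_in kernel_inv[OF k tc b])
 qed
 also have "(\<Sum>b''\<in>(%s. mv t (mv s b')) ` {s \<in> S. k b (mv s b') \<noteq> 0}. k (mv t b) b'')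
   = (\<Sum>s\<in>{s \<in> S. k b (mv s b') \<noteq> 0}. k (mv t b) (mv t (mv s b')))"
 proof (subst sum.reindex)
  show "inj_on (%s. mv t (mv s b')) {s \<in> S. k b (mv s b') \<noteq> 0}"
   using tc b' S_carrier by (intro inj_onI) (metis (mono_tags, lifting) mv_eq_iff mv_in mv_inv(1) mem_Collect_eq)
 qed simp
 also have "... = (\<Sum>s\<in>{s \<in> S. k b (mv s b') \<noteq> 0}. k b (mv s b'))"
  using b b' tc S_carrier by (intro sum.cong kernel_inv[OF k]) (auto simp: mv_in)
 finally show ?thesis .
qed

lemma kmat_tr:
 assumes k: "kernel k" and "c \<in> cl ` B" "c' \<in> cl ` B" shows "kmat (ktr k) c' c = kmat k c c'"
proof -
 obtain b b' where b: "b \<in> B" "c = cl b" "b' \<in> B" "c' = cl b'" using assms by auto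
 have inv: "k (mv s b) b' = k b (mv (inv s) b')" if "s \<in> S" for s
  using kernel_inv[OF k S_carrier[OF that] b(1), of "mv (inv s) b'"] b that S_carrier by (simp add: mv_in)
 have "kmat (ktr k) c' c = (\<Sum>s\<in>{s \<in> S. k (mv s b) b' \<noteq> 0}. k (mv s b) b')"
  using kmat_eq[OF kernel_tr[OF k] b(3,1)] by (simp add: b ktr_def)
 also have "... = (\<Sum>s\<in>{s \<in> S. k b (mv s b') \<noteq> 0}. k b (mv s b'))"
  by (rule sum.reindex_bij_witness[of _ "%s. inv s" "%s. inv s"])
   (use S_carrier inv subgroup.m_inv_closed[OF S_sub] in \<open>auto simp: b\<close>)
 finally show ?thesis using kmat_eq[OF k b(1,3)] b by simp
qed

lemma kopq_kmat:
 assumes k: "kernel k" and fin: "finite (cl ` B)" and c: "c \<in> cl ` B"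
 shows "kopq k f c = (\<Sum>c'\<in>cl ` B. of_real (kmat k c c') * f c')"
proof -
 obtain b where b: "b \<in> B" "c = cl b" using c by auto
 define b0 where "b0 = (SOME b. b \<in> B \<and> cl b = c)"
 have b0: "b0 \<in> B" unfolding b0_def using b by (metis (mono_tags, lifting) someI_ex)
 have fs: "finite (supp k b0)" by (rule finite_supp[OF k b0])
 have "kopq k f c = (\<Sum>b'\<in>supp k b0. of_real (k b0 b') * f (cl b'))" by (simp add: kopq_def kop_def b0_def)
 also have "... = (\<Sum>c'\<in>cl ` B. \<Sum>b'\<in>{b' \<in> supp k b0. cl b' = c'}. of_real (k b0 b') * f (cl b'))"
  using supp_subset by (intro sum.group[symmetric] fs fin) auto
 finally show ?thesis by (simp add: kmat_def Let_def b0_def sum_distrib_right)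
qed

text \<open>Written with \<open>kop\<close> on \<open>B\<close>, the diagonal entry makes sense for
  infinite quotients too; it is applied to stabilizers, which may have infinite index.\<close>

lemma kop_indicator:
 assumes k: "kernel k" and b: "b \<in> B"
 shows "kop k (%b'. of_bool (cl b' = cl b)) b = of_real (kmat k (cl b) (cl b))"
proof -
 define b0 where "b0 = (SOME b'. b' \<in> B \<and> cl b' = cl b)"
 have b0: "b0 \<in> B" unfolding b0_def using b by (metis (mono_tags, lifting) someI_ex)
 have "kop k (%b'. of_bool (cl b' = cl b)) b = kopq k (%c. of_bool (c = cl b)) (cl b)"
  by (rule kopq_cl[OF k b, symmetric])
 also have "... = (\<Sum>b'\<in>supp k b0. if cl b' = cl b then of_real (k b0 b') else 0)"
  unfolding kopq_def kop_def b0_def by (intro sum.cong) auto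
 also have "... = (\<Sum>b'\<in>{b' \<in> supp k b0. cl b' = cl b}. of_real (k b0 b'))"
  by (rule sum.inter_filter[symmetric, OF finite_supp[OF k b0]])
 finally show ?thesis by (simp add: kmat_def Let_def b0_def)
qed

text \<open>Conjugation by \<open>g\<close> moves the sum over \<open>S\<close> to the
  representative. The condition on \<open>\<gamma>\<close> says that it fixes the coset
  \<open>inv g <# S\<close>, which is how fixed points enter the traces.\<close>

lemma kmat_diagonal:
 assumes k: "kernel k" and g: "g \<in> carrier G" and j: "j < m"
 shows "kmat k (cl (mv g (rp j))) (cl (mv g (rp j)))
   = (\<Sum>\<gamma>\<in>fixers k j. if g \<otimes> \<gamma> \<otimes> inv g \<in> S then k (rp j) (mv \<gamma> (rp j)) else 0)"
proof -
 let ?b = "mv g (rp j)"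
 have sj: "rp j \<in> B" and b: "?b \<in> B" using g j by (auto simp: mv_in rp_in)
 have eq: "k ?b (mv (g \<otimes> \<gamma> \<otimes> inv g) ?b) = k (rp j) (mv \<gamma> (rp j))" if "\<gamma> \<in> carrier G" for \<gamma>
  using kernel_inv[OF k g sj mv_in[OF that sj]] that g sj by (simp add: mv_mult mv_in)
 have conj: "g \<otimes> (inv g \<otimes> s \<otimes> g) \<otimes> inv g = s" "inv g \<otimes> (g \<otimes> s \<otimes> inv g) \<otimes> g = s" if "s \<in> carrier G" for s
  using that g by (simp_all add: m_assoc) (simp_all add: m_assoc[symmetric])
 have eq2: "k (rp j) (mv (inv g \<otimes> s \<otimes> g) (rp j)) = k ?b (mv s ?b)" if "s \<in> S" for s
 proof -
  have s: "s \<in> carrier G" by (rule S_carrier[OF that])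
  then have "inv g \<otimes> s \<otimes> g \<in> carrier G" using g by simp
  from eq[OF this] show ?thesis unfolding conj(1)[OF s] by simp
 qed
 have "kmat k (cl ?b) (cl ?b) = (\<Sum>s\<in>{s \<in> S. k ?b (mv s ?b) \<noteq> 0}. k ?b (mv s ?b))" by (rule kmat_eq[OF k b b])
 also have "... = (\<Sum>\<gamma>\<in>{\<gamma> \<in> fixers k j. g \<otimes> \<gamma> \<otimes> inv g \<in> S}. k (rp j) (mv \<gamma> (rp j)))"
  by (rule sum.reindex_bij_witness[of _ "%\<gamma>. g \<otimes> \<gamma> \<otimes> inv g" "%s. inv g \<otimes> s \<otimes> g"])
   (use g S_carrier conj in \<open>auto simp: fixers_def eq eq2\<close>)
 finally show ?thesis using finite_fixers[OF k j] by (subst sum.inter_filter[symmetric])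
qed

end

section \<open>Small eigenvalues of integer matrices\<close>

lemma upper_triangular_mult:
 fixes A B :: "'a :: comm_ring_1 mat"
 assumes A: "A \<in> carrier_mat n n" "upper_triangular A" and B: "B \<in> carrier_mat n n" "upper_triangular B"
 shows "upper_triangular (A * B)" and "i < n ==> (A * B) $$ (i,i) = A $$ (i,i) * B $$ (i,i)"
proof -
 have ent: "(A * B) $$ (i,j) = (\<Sum>k<n. A $$ (i,k) * B $$ (k,j))" if "i < n" "j < n" for i j
  using A(1) B(1) that by (simp add: scalar_prod_def lessThan_atLeast0)
 have A0: "A $$ (i,k) = 0" if "k < i" "i < n" for i k using A that by auto
 have B0: "B $$ (i,k) = 0" if "k < i" "i < n" for i k using B that by auto
 show "upper_triangular (A * B)" unfolding upper_triangular_def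
 proof (intro allI impI)
  fix i j assume ij: "i < dim_row (A * B)" "j < i"
  then have "i < n" "j < n" using A by auto
  have "A $$ (i,k) * B $$ (k,j) = 0" if "k < n" for k
   using A0[of k i] B0[of j k] that ij \<open>i < n\<close> by (cases "k < i") auto
  then show "(A * B) $$ (i,j) = 0" unfolding ent[OF \<open>i < n\<close> \<open>j < n\<close>] by simp
 qed
 assume i: "i < n"
 have "(\<Sum>k<n. A $$ (i,k) * B $$ (k,i)) = (\<Sum>k\<in>{i}. A $$ (i,k) * B $$ (k,i))"
 proof (rule sum.mono_neutral_right)
  show "\<forall>k\<in>{..<n} - {i}. A $$ (i,k) * B $$ (k,i) = 0"
  proof
   fix k assume "k \<in> {..<n} - {i}"
   then show "A $$ (i,k) * B $$ (k,i) = 0" using A0[of k i] B0[of i k] i by (cases "k < i") auto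
  qed
 qed (use i in auto)
 then show "(A * B) $$ (i,i) = A $$ (i,i) * B $$ (i,i)" by (simp add: ent[OF i i])
qed

lemma upper_triangular_pow:
 fixes A :: "'a :: comm_ring_1 mat"
 assumes A: "A \<in> carrier_mat n n" "upper_triangular A"
 shows "upper_triangular (A ^\<^sub>m k)" and "i < n ==> (A ^\<^sub>m k) $$ (i,i) = (A $$ (i,i)) ^ k"
proof (induction k)
 case 0
 case 1 show ?case by auto
 case 2 then show ?case using A by auto
next
 case (Suc k)
 have c: "A ^\<^sub>m k \<in> carrier_mat n n" using A by auto
 case 1 show ?case using upper_triangular_mult(1)[OF c Suc(1) A] by simp
 case 2 then show ?case using upper_triangular_mult(2)[OF c Suc(1) A, of i] Suc(2) by simp
qed

lemma trace_similar:
 fixes A B :: "'a :: comm_ring_1 mat"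
 assumes wit: "similar_mat_wit A B P Q" and A: "A \<in> carrier_mat n n"
 shows "(\<Sum>i<n. A $$ (i,i)) = (\<Sum>i<n. B $$ (i,i))"
proof -
 note w = similar_mat_witD2[OF A wit]
 have B: "B \<in> carrier_mat n n" and P: "P \<in> carrier_mat n n" and Q: "Q \<in> carrier_mat n n"
  and AE: "A = P * B * Q" and QP: "Q * P = 1\<^sub>m n" using w by auto
 have ent: "(X * Y) $$ (i,j) = (\<Sum>k<n. X $$ (i,k) * Y $$ (k,j))"
  if "i < n" "j < n" "X \<in> carrier_mat n n" "Y \<in> carrier_mat n n" for i j and X Y :: "'a mat"
  using that by (simp add: scalar_prod_def lessThan_atLeast0)
 have "(\<Sum>i<n. A $$ (i,i)) = (\<Sum>i<n. \<Sum>k<n. (P * B) $$ (i,k) * Q $$ (k,i))"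
  unfolding AE using P B Q by (intro sum.cong ent) auto
 also have "... = (\<Sum>k<n. \<Sum>i<n. Q $$ (k,i) * (P * B) $$ (i,k))" by (subst sum.swap) (simp add: mult.commute)
 also have "... = (\<Sum>k<n. (Q * (P * B)) $$ (k,k))" using P B Q by (intro sum.cong ent[symmetric]) auto
 finally show ?thesis using P B Q QP by (simp flip: assoc_mult_mat)
qed

definition real_sym_op :: "'q set => ('q => 'q => real) => ('q => complex) => 'q => complex" where
 "real_sym_op Q A f q = (if q \<in> Q then \<Sum>q'\<in>Q. of_real (A q q') * f q' else 0)"

definition contracted_op :: "real => 'q set => ('q => 'q => real) => ('q => complex) => 'q => complex" where
 "contracted_op C Q A f q = (if q \<in> Q then f q - real_sym_op Q A f q / of_real C else 0)"

definition op_trace :: "'q set => (('q => complex) => 'q => complex) => complex" where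
 "op_trace Q T = (\<Sum>q\<in>Q. T (indicator {q}) q)"

text \<open>One constant \<open>C\<close> governs matrices of every size, so estimates in terms of
  \<open>C\<close> are uniform over all the finite quotients.\<close>

locale integral_psd =
 fixes C :: real and Q :: "'q set" and A :: "'q => 'q => real"
 assumes C: "C \<ge> 1" and finite_Q: "finite Q"
  and ints: "\<And>q q'. q \<in> Q ==> q' \<in> Q ==> A q q' \<in> \<int>"
  and A_sym: "\<And>q q'. q \<in> Q ==> q' \<in> Q ==> A q q' = A q' q"
  and psd: "\<And>f. 0 \<le> Re (\<Sum>q\<in>Q. real_sym_op Q A f q * cnj (f q))"
  and row: "\<And>q. q \<in> Q ==> (\<Sum>q'\<in>Q. \<bar>A q q'\<bar>) \<le> C"
begin

lemma form_real: "Im (\<Sum>q\<in>Q. real_sym_op Q A f q * cnj (f q)) = 0"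
proof -
 have "cnj (\<Sum>q\<in>Q. real_sym_op Q A f q * cnj (f q)) = (\<Sum>q\<in>Q. \<Sum>q'\<in>Q. of_real (A q q') * cnj (f q') * f q)"
  by (simp add: real_sym_op_def sum_distrib_right)
 also have "... = (\<Sum>q\<in>Q. \<Sum>q'\<in>Q. of_real (A q q') * cnj (f q) * f q')" by (subst sum.swap) (auto simp: A_sym)
 finally have "(\<Sum>q\<in>Q. real_sym_op Q A f q * cnj (f q)) \<in> \<real>" by (simp add: real_sym_op_def sum_distrib_left mult_ac Reals_cnj_iff)
 then show ?thesis by (simp only: complex_is_Real_iff)
qed

lemma eigenvalue_bounds:
 assumes f: "\<And>q. q \<in> Q ==> real_sym_op Q A f q = ev * f q" and nz: "q0 \<in> Q" "f q0 \<noteq> 0"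
 shows "ev = of_real (Re ev)" "0 \<le> Re ev" "Re ev \<le> C"
proof -
 define S where "S = (\<Sum>q\<in>Q. (cmod (f q))^2)"
 have "S > 0" unfolding S_def by (rule sum_pos2[of _ q0]) (use nz finite_Q in auto)
 have eq: "(\<Sum>q\<in>Q. real_sym_op Q A f q * cnj (f q)) = ev * of_real S"
  unfolding S_def of_real_sum sum_distrib_left
  by (intro sum.cong refl) (simp only: f complex_norm_square mult.assoc)
 show "ev = of_real (Re ev)" using form_real[of f] \<open>S > 0\<close> unfolding eq by (simp add: complex_eq_iff)
 show "0 \<le> Re ev" using psd[of f] \<open>S > 0\<close> unfolding eq by (simp add: zero_le_mult_iff)
 \<comment> \<open>The row at an entry of maximal modulus bounds the eigenvalue by the row
   sum.\<close>
 define \<mu> where "\<mu> = Max ((%q. cmod (f q)) ` Q)"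
 have max: "cmod (f q) \<le> \<mu>" if "q \<in> Q" for q unfolding \<mu>_def using that finite_Q by simp
 have "\<mu> \<in> (%q. cmod (f q)) ` Q" unfolding \<mu>_def using finite_Q nz by (intro Max_in) auto
 then obtain q where q: "q \<in> Q" "cmod (f q) = \<mu>" by auto
 have "\<mu> > 0" using max[OF nz(1)] nz(2) by (meson less_le_trans zero_less_norm_iff)
 have "cmod ev * \<mu> = cmod (\<Sum>q'\<in>Q. of_real (A q q') * f q')"
  using f[OF q(1)] q by (simp add: real_sym_op_def norm_mult)
 also have "... \<le> (\<Sum>q'\<in>Q. \<bar>A q q'\<bar> * \<mu>)"
  by (rule order_trans[OF norm_sum sum_mono]) (auto simp: norm_mult intro: mult_left_mono max)
 finally show "Re ev \<le> C" using row[OF q(1)] using \<open>\<mu> > 0\<close> complex_Re_le_cmod[of ev] by (simp flip: sum_distrib_right)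
qed

text \<open>Traces of powers are read off from a Schur triangulation; the product bound comes from
  the integrality of the characteristic polynomial.\<close>

lemma eigenvalue_list: obtains es :: "real list" where "length es = card Q" "\<And>e. e \<in> set es ==> 0 \<le> e \<and> e \<le> C"
  "1 \<le> prod_list (filter (%e. e \<noteq> 0) es)"
  "\<And>n. op_trace Q (contracted_op C Q A ^^ n) = of_real (\<Sum>e\<leftarrow>es. (1 - e / C) ^ n)"
proof -
 define N where "N = card Q"
 obtain h where h: "bij_betw h {..<N} Q"
  using ex_bij_betw_nat_finite[OF finite_Q] by (auto simp: N_def lessThan_atLeast0)
 have hQ: "h i \<in> Q" if "i < N" for i using h that by (auto simp: bij_betw_def)
 have sumQ: "(\<Sum>q\<in>Q. F q) = (\<Sum>i<N. F (h i))" for F :: "'q => complex"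
  by (rule sum.reindex_bij_betw[OF h, symmetric])
 have hinj: "h i = h j \<longleftrightarrow> i = j" if "i < N" "j < N" for i j
  using h that by (auto simp: bij_betw_def inj_on_def)
 define AZ where "AZ = mat N N (%(i,j). \<lfloor>A (h i) (h j)\<rfloor>)"
 define AC :: "complex mat" where "AC = map_mat of_int AZ"
 have AZ: "AZ \<in> carrier_mat N N" and AC: "AC \<in> carrier_mat N N" by (auto simp: AZ_def AC_def)
 have ACent: "AC $$ (i,j) = of_real (A (h i) (h j))" if ij: "i < N" "j < N" for i j
 proof -
  obtain n where "A (h i) (h j) = of_int n" using ints[OF hQ[OF ij(1)] hQ[OF ij(2)]] by (rule Ints_cases)
  then show ?thesis using ij by (simp add: AC_def AZ_def)
 qed
 have poly: "char_poly AC = map_poly of_int (char_poly AZ)"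
  unfolding AC_def by (rule of_int_hom.char_poly_hom[OF AZ])
 obtain es where es: "char_poly AC = (\<Prod>a\<leftarrow>es. [:- a, 1:])" "length es = N"
  using char_poly_factorized[OF AC] by blast
 obtain B P P' where BPP: "schur_decomposition AC es = (B, P, P')" by (metis prod_cases3)
 note sch = schur_decomposition[OF AC es(1) BPP]
 note w = similar_mat_witD2[OF AC conjunct1[OF sch]]
 have B: "B \<in> carrier_mat N N" "upper_triangular B" "diag_mat B = es"
  and P: "P \<in> carrier_mat N N" "P' \<in> carrier_mat N N" using sch w by auto
 have Bes: "B $$ (i,i) = es ! i" if "i < N" for i using B that by (auto simp: diag_mat_def)
 have bounds: "e = of_real (Re e) \<and> 0 \<le> Re e \<and> Re e \<le> C" if e: "e \<in> set es" for e
 proof -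
  have "eigenvalue AC e" using e using eigenvalue_root_char_poly[OF AC] by (simp add: es poly_prod_list)
  then obtain v where v: "v \<in> carrier_vec N" "v \<noteq> 0\<^sub>v N" "AC *\<^sub>v v = e \<cdot>\<^sub>v v"
   using AC by (auto simp: eigenvalue_def eigenvector_def)
  define f where "f q = v $ (the_inv_into {..<N} h q)" for q
  have fh: "f (h i) = v $ i" if "i < N" for i
   using that h by (simp add: f_def the_inv_into_f_f bij_betw_def)
  have eq: "real_sym_op Q A f q = e * f q" if "q \<in> Q" for q
  proof -
   have "q \<in> h ` {..<N}" using h that by (simp add: bij_betw_def)
   then obtain i where i: "i < N" "q = h i" by blast
   have "real_sym_op Q A f q = (\<Sum>j<N. AC $$ (i,j) * v $ j)"
    using that i by (simp add: real_sym_op_def sumQ ACent fh)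
   also have "... = (AC *\<^sub>v v) $ i" using i AC v(1) by (simp add: scalar_prod_def lessThan_atLeast0)
   finally show ?thesis using v i by (simp add: fh)
  qed
  obtain i where i: "i < N" "v $ i \<noteq> 0" using v(1,2) by (metis carrier_vecD eq_vecI index_zero_vec)
  show ?thesis using eigenvalue_bounds[OF eq hQ[OF i(1)]] i by (simp add: fh)
 qed
 define rs where "rs = map Re es"
 have es_rs: "es = map of_real rs" using bounds by (auto simp: rs_def intro!: nth_equalityI)
 \<comment> \<open>Dividing out the zero eigenvalues leaves, up to sign, their complementary product
   as a coefficient of an integer polynomial; it is not 0, so its modulus is at least 1.\<close>
 have prod1: "1 \<le> prod_list (filter (%e. e \<noteq> 0) rs)"
 proof -
  let ?z = "length (filter (%e. e = 0) es)"
  let ?r = "\<Prod>a\<leftarrow>filter (%e. e \<noteq> 0) es. [:- a, 1:]"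
  have split: "(\<Prod>a\<leftarrow>xs. [:- a, 1:]) = monom 1 (length (filter (%e. e = 0) xs)) * (\<Prod>a\<leftarrow>filter (%e. e \<noteq> 0) xs. [:- a, 1:])"
   for xs :: "complex list"
  proof (induction xs)
   case (Cons x xs)
   show ?case
   proof (cases "x = 0")
    case True
    then show ?thesis by (simp add: Cons.IH monom_Suc)
   next
    case False
    then show ?thesis by (simp add: Cons.IH del: mult_pCons_left)
   qed
  qed simp
  have "char_poly AC = monom 1 ?z * ?r" unfolding es(1) by (rule split)
  then have "coeff (char_poly AC) ?z = coeff ?r 0" by (simp add: coeff_monom_mult)
  also have "... = (\<Prod>a\<leftarrow>filter (%e. e \<noteq> 0) es. - a)"
   by (simp add: poly_0_coeff_0[symmetric] poly_prod_list comp_def)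
  finally have c: "of_int (coeff (char_poly AZ) ?z) = (\<Prod>a\<leftarrow>filter (%e. e \<noteq> 0) es. - a)" by (simp add: poly)
  then have "coeff (char_poly AZ) ?z \<noteq> 0" by auto
  then have "1 \<le> cmod (of_int (coeff (char_poly AZ) ?z))" by simp
  also have "... = cmod (\<Prod>a\<leftarrow>filter (%e. e \<noteq> 0) es. - a)" by (simp add: c)
  also have "... = prod_list (filter (%e. e \<noteq> 0) rs)"
  proof -
   have "cmod (\<Prod>a\<leftarrow>filter (%e. e \<noteq> 0) (map of_real xs). - a) = prod_list (filter (%e. e \<noteq> 0) xs)"
    if "\<And>x. x \<in> set xs ==> 0 \<le> x" for xs :: "real list"
    using that by (induction xs) (auto simp: norm_mult)
   moreover have "0 \<le> x" if "x \<in> set rs" for x using that bounds by (auto simp: rs_def)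
   ultimately show ?thesis by (simp only: es_rs)
  qed
  finally show ?thesis .
 qed
 have tr: "op_trace Q (contracted_op C Q A ^^ n) = of_real (\<Sum>e\<leftarrow>rs. (1 - e / C) ^ n)" for n
 proof -
  \<comment> \<open>The Schur basis of \<open>A\<close> also triangularizes \<open>1 - A/C\<close>,
    so the traces of its powers are power sums of the diagonal entries.\<close>
  define TC where "TC = 1\<^sub>m N + (- 1 / of_real C) \<cdot>\<^sub>m AC"
  define TB where "TB = 1\<^sub>m N + (- 1 / of_real C) \<cdot>\<^sub>m B"
  have TC: "TC \<in> carrier_mat N N" and TB: "TB \<in> carrier_mat N N" using AC B by (auto simp: TC_def TB_def)
  let ?c = "- 1 / of_real C :: complex"
  have "P * TB = P * 1\<^sub>m N + P * (?c \<cdot>\<^sub>m B)"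
   unfolding TB_def by (rule mult_add_distrib_mat[of _ N N _ N]) (use P B in auto)
  also have "P * (?c \<cdot>\<^sub>m B) = ?c \<cdot>\<^sub>m (P * B)" by (rule mult_smult_distrib[OF P(1) B(1)])
  finally have "P * TB * P' = (P * 1\<^sub>m N + ?c \<cdot>\<^sub>m (P * B)) * P'" by simp
  also have "... = P * 1\<^sub>m N * P' + (?c \<cdot>\<^sub>m (P * B)) * P'"
   by (rule add_mult_distrib_mat[of _ N N _ _ N]) (use P B in auto)
  also have "(?c \<cdot>\<^sub>m (P * B)) * P' = ?c \<cdot>\<^sub>m (P * B * P')"
   by (rule mult_smult_assoc_mat[of _ N N _ N]) (use P B in auto)
  finally have "similar_mat_wit TC TB P P'" unfolding TC_def
   using TB w by (intro similar_mat_witI[of P P' N]) auto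
  from similar_mat_wit_pow[OF this, of n]
  have "(\<Sum>i<N. (TC ^\<^sub>m n) $$ (i,i)) = (\<Sum>i<N. (TB ^\<^sub>m n) $$ (i,i))" by (rule trace_similar) (use TC in auto)
  also have "... = (\<Sum>i<N. (1 - es ! i / of_real C) ^ n)"
  proof (rule sum.cong[OF refl])
   fix i assume i: "i \<in> {..<N}"
   have "(TB ^\<^sub>m n) $$ (i,i) = (TB $$ (i,i)) ^ n" using B using upper_triangular_pow(2)[OF TB] i by (auto simp: TB_def upper_triangular_def)
   also have "TB $$ (i,i) = 1 - es ! i / of_real C" using i B(1) by (simp add: TB_def Bes)
   finally show "(TB ^\<^sub>m n) $$ (i,i) = (1 - es ! i / of_real C) ^ n" .
  qed
  finally have trC: "(\<Sum>i<N. (TC ^\<^sub>m n) $$ (i,i)) = of_real (\<Sum>e\<leftarrow>rs. (1 - e / C) ^ n)"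
   using es(2) by (simp add: sum_list_sum_nth es_rs lessThan_atLeast0)
  have step: "contracted_op C Q A f (h i) = (\<Sum>j<N. TC $$ (i,j) * f (h j))" if "i < N" for f i
  proof -
   have "(\<Sum>j<N. TC $$ (i,j) * f (h j)) = (\<Sum>j<N. of_bool (i = j) * f (h j) - of_real (A (h i) (h j)) * f (h j) / of_real C)"
    using that AC by (intro sum.cong) (auto simp: TC_def ACent algebra_simps)
   also have "... = f (h i) - (\<Sum>j<N. of_real (A (h i) (h j)) * f (h j)) / of_real C"
    using that by (simp add: sum_subtractf sum_divide_distrib)
   finally show ?thesis using that by (simp add: contracted_op_def real_sym_op_def hQ sumQ)
  qed
  have pow: "(contracted_op C Q A ^^ n) f (h i) = (\<Sum>j<N. (TC ^\<^sub>m n) $$ (i,j) * f (h j))" if "i < N" for f i n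
   using that
  proof (induction n arbitrary: f i)
   case 0
   then have "(\<Sum>j<N. (TC ^\<^sub>m 0) $$ (i,j) * f (h j)) = (\<Sum>j<N. if j = i then f (h j) else 0)"
    using TC by (intro sum.cong) auto
   then show ?case using 0 by simp
  next
   case (Suc n)
   have "(contracted_op C Q A ^^ Suc n) f (h i) = (contracted_op C Q A ^^ n) (contracted_op C Q A f) (h i)"
    by (simp only: funpow_Suc_right comp_apply)
   also have "... = (\<Sum>k<N. (TC ^\<^sub>m n) $$ (i,k) * (\<Sum>j<N. TC $$ (k,j) * f (h j)))" by (simp add: Suc step)
   also have "... = (\<Sum>j<N. (\<Sum>k<N. (TC ^\<^sub>m n) $$ (i,k) * TC $$ (k,j)) * f (h j))"
    by (simp add: sum_distrib_left sum_distrib_right mult.assoc) (rule sum.swap)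
   finally show ?case using TC Suc.prems by (simp add: scalar_prod_def lessThan_atLeast0)
  qed
  have "op_trace Q (contracted_op C Q A ^^ n) = (\<Sum>i<N. (TC ^\<^sub>m n) $$ (i,i))" unfolding op_trace_def sumQ
  proof (rule sum.cong[OF refl])
   fix i assume i: "i \<in> {..<N}"
   have "(\<Sum>j<N. (TC ^\<^sub>m n) $$ (i,j) * indicator {h i} (h j)) = (\<Sum>j<N. if j = i then (TC ^\<^sub>m n) $$ (i,j) else 0)"
    using i by (intro sum.cong) (auto simp: hinj)
   then show "(contracted_op C Q A ^^ n) (indicator {h i}) (h i) = (TC ^\<^sub>m n) $$ (i,i)" using i by (simp add: pow)
  qed
  with trC show ?thesis by simp
 qed
 show thesis
 proof (rule that[of rs])
  show "length rs = card Q" using es(2) by (simp add: rs_def N_def)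
  show "0 \<le> e \<and> e \<le> C" if "e \<in> set rs" for e using that bounds by (auto simp: rs_def)
 qed (fact prod1 tr)+
qed

end

text \<open>Since the product of the nonzero eigenvalues is a nonzero integer, at most
 \<open>N ln C / ln (1/\<delta>)\<close> of the \<open>N\<close> eigenvalues lie in \<open>(0, \<delta>)\<close>.\<close>

lemma few_small_factors:
 fixes xs :: "real list"
 assumes "\<And>x. x \<in> set xs ==> 0 < x \<and> x \<le> C" "1 \<le> prod_list xs" "C \<ge> 1" "0 < \<delta>" "\<delta> < 1"
 shows "real (length (filter (%x. x < \<delta>) xs)) * ln (1/\<delta>) \<le> real (length xs) * ln C"
proof -
 have "prod_list xs > 0 \<and> ln (prod_list xs) \<le> real (length xs) * ln C - real (length (filter (%x. x < \<delta>) xs)) * ln (1/\<delta>)"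
  using assms(1)
 proof (induction xs)
  case (Cons x xs)
  then have IH: "prod_list xs > 0" "ln (prod_list xs) \<le> real (length xs) * ln C - real (length (filter (%x. x < \<delta>) xs)) * ln (1/\<delta>)"
   and x: "0 < x" "x \<le> C" by auto
  have "ln x \<le> ln C - (if x < \<delta> then ln (1/\<delta>) else 0)"
  proof (cases "x < \<delta>")
   case True
   then have "ln x \<le> ln \<delta>" using x by simp
   also have "... \<le> ln C - ln (1/\<delta>)" using assms(3,4) by (simp add: ln_div)
   finally show ?thesis using True by simp
  qed (use x in simp)
  moreover have "ln (x * prod_list xs) = ln x + ln (prod_list xs)" by (rule ln_mult_pos[OF x(1) IH(1)])
  ultimately show ?case using IH(2) using IH(1) x(1) by (simp add: algebra_simps split: if_splits)
 qed simp
 moreover have "0 \<le> ln (prod_list xs)" using assms(2) by simp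
 ultimately show ?thesis by linarith
qed

text \<open>The point is that \<open>n0\<close> precedes \<open>Q\<close> and \<open>A\<close>.
  Eigenvalues below \<open>\<delta>\<close> are few, and those above it contribute at most
  \<open>(1 - \<delta> / C) ^ n\<close> each.\<close>

theorem trace_approximation:
 fixes C \<eta> :: real
 assumes C: "C \<ge> 1" and \<eta>: "\<eta> > 0"
 obtains n0 where "\<And>n (Q :: 'q set) A. n \<ge> n0 ==> integral_psd C Q A ==>
  \<exists>z. (%n. op_trace Q (contracted_op C Q A ^^ n)) \<longlonglongrightarrow> of_nat z \<and>
   cmod (op_trace Q (contracted_op C Q A ^^ n) - of_nat z) \<le> \<eta> * real (card Q)"
proof -
 \<comment> \<open>Chosen so that the fraction \<open>ln C / ln (1/\<delta>)\<close> of small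
   eigenvalues is at most \<open>\<eta> / 2\<close>; the summand 1 keeps \<open>\<delta>\<close>
   below 1 when \<open>C\<close> is 1.\<close>
 define \<delta> where "\<delta> = exp (- (2 * ln C / \<eta> + 1))"
 have "0 \<le> 2 * ln C / \<eta>" using C \<eta> by simp
 then have \<delta>: "0 < \<delta>" "\<delta> < 1" unfolding \<delta>_def by auto
 have ln\<delta>: "ln (1/\<delta>) = 2 * ln C / \<eta> + 1" by (simp add: \<delta>_def ln_div)
 have "1 - \<delta> / C < 1" "0 \<le> 1 - \<delta> / C" using \<delta> C by auto
 then have "(%n. (1 - \<delta> / C) ^ n) \<longlonglongrightarrow> 0" by (intro LIMSEQ_realpow_zero)
 then obtain n0 where n0: "\<And>n. n \<ge> n0 ==> (1 - \<delta> / C) ^ n < \<eta> / 2"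
  using order_tendstoD(2)[of _ 0 sequentially "\<eta>/2"] \<eta> by (fastforce simp: eventually_sequentially)
 show thesis
 proof (rule that)
  fix n and Q :: "'q set" and A assume n: "n \<ge> n0" and psd: "integral_psd C Q A"
  interpret integral_psd C Q A by (rule psd)
  obtain es where es: "length es = card Q" "\<And>e. e \<in> set es ==> 0 \<le> e \<and> e \<le> C"
   "1 \<le> prod_list (filter (%e. e \<noteq> 0) es)"
   "\<And>n. op_trace Q (contracted_op C Q A ^^ n) = of_real (\<Sum>e\<leftarrow>es. (1 - e / C) ^ n)"
   using eigenvalue_list by blast
  define z where "z = length (filter (%e. e = 0) es)"
  define xs where "xs = filter (%e. e \<noteq> 0) es"
  have xs: "0 < x \<and> x \<le> C" if "x \<in> set xs" for x using that es(2)[of x] by (auto simp: xs_def)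
  have split: "(\<Sum>e\<leftarrow>ys. (1 - e / C) ^ n) = real (length (filter (%e. e = 0) ys)) + (\<Sum>e\<leftarrow>filter (%e. e \<noteq> 0) ys. (1 - e / C) ^ n)"
   for n and ys :: "real list" by (induction ys) auto
  have tr: "op_trace Q (contracted_op C Q A ^^ n) - of_nat z = of_real (\<Sum>e\<leftarrow>xs. (1 - e / C) ^ n)" for n
   unfolding es(4) split[of n es] by (simp add: z_def xs_def)
  have base: "0 \<le> 1 - x / C" "1 - x / C < 1" if "x \<in> set xs" for x using xs[OF that] by auto
  have "(%n. \<Sum>e\<leftarrow>ys. (1 - e / C) ^ n) \<longlonglongrightarrow> 0" if "set ys \<subseteq> set xs" for ys using that
  proof (induction ys)
   case (Cons y ys)
   then have "(%n. (1 - y / C) ^ n + (\<Sum>e\<leftarrow>ys. (1 - e / C) ^ n)) \<longlonglongrightarrow> 0 + 0"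
    using base[of y] by (intro tendsto_add LIMSEQ_realpow_zero) auto
   then show ?case by simp
  qed simp
  then have "(%n. complex_of_real (\<Sum>e\<leftarrow>xs. (1 - e / C) ^ n)) \<longlonglongrightarrow> of_real 0" by (intro tendsto_of_real) auto
  then have lim: "(%n. op_trace Q (contracted_op C Q A ^^ n)) \<longlonglongrightarrow> of_nat z"
   unfolding tr[symmetric] by (simp add: LIM_zero_iff)
  have nonneg: "0 \<le> (\<Sum>e\<leftarrow>xs. (1 - e / C) ^ n)" using base by (intro sum_list_nonneg) auto
  \<comment> \<open>Small eigenvalues are counted with weight 1 and the decay rate at
    \<open>\<delta>\<close> is allowed for every entry; each of the two terms then costs half of
    \<open>\<eta>\<close>.\<close>
  have "(\<Sum>e\<leftarrow>ys. (1 - e / C) ^ n) \<le> real (length (filter (%x. x < \<delta>) ys)) + real (length ys) * (1 - \<delta> / C) ^ n"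
   if "set ys \<subseteq> set xs" for ys using that
  proof (induction ys)
   case (Cons y ys)
   have "(1 - y / C) ^ n \<le> (if y < \<delta> then 1 else 0) + (1 - \<delta> / C) ^ n"
   proof (cases "y < \<delta>")
    case True
    have "(1 - y / C) ^ n \<le> 1" using base[of y] Cons.prems by (intro power_le_one) auto
    moreover have "0 \<le> (1 - \<delta> / C) ^ n" using \<open>0 \<le> 1 - \<delta> / C\<close> by simp
    ultimately show ?thesis using True by simp
   next
    case False
    then have "(1 - y / C) ^ n \<le> (1 - \<delta> / C) ^ n"
     using base[of y] Cons.prems C by (intro power_mono) (auto simp: divide_right_mono)
    then show ?thesis by simp
   qed
   then show ?case using Cons by (auto simp: algebra_simps)
  qed simp
  then have "(\<Sum>e\<leftarrow>xs. (1 - e / C) ^ n) \<le> real (length (filter (%x. x < \<delta>) xs)) + real (length xs) * (1 - \<delta> / C) ^ n"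
   by simp
  also have "real (length (filter (%x. x < \<delta>) xs)) \<le> real (length xs) * (\<eta> / 2)"
  proof -
   have "real (length (filter (%x. x < \<delta>) xs)) * ln (1/\<delta>) \<le> real (length xs) * ln C"
    by (rule few_small_factors) (use xs es(3) C \<delta> in \<open>auto simp: xs_def\<close>)
   also have "... \<le> real (length xs) * (\<eta> / 2 * ln (1/\<delta>))"
    unfolding ln\<delta> using \<eta> by (intro mult_left_mono) (auto simp: field_simps)
   finally show ?thesis using \<delta> by simp
  qed
  also have "real (length xs) * (1 - \<delta> / C) ^ n \<le> real (length xs) * (\<eta> / 2)"
   using n0[OF n] by (intro mult_left_mono) auto
  also have "real (length xs) * (\<eta> / 2) + real (length xs) * (\<eta> / 2) \<le> \<eta> * real (card Q)"
   using es(1) \<eta> by (simp add: xs_def) (metis length_filter_le)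
  finally have "cmod (op_trace Q (contracted_op C Q A ^^ n) - of_nat z) \<le> \<eta> * real (card Q)"
   unfolding tr using nonneg by simp
  with lim show "\<exists>z. (%n. op_trace Q (contracted_op C Q A ^^ n)) \<longlonglongrightarrow> of_nat z \<and>
   cmod (op_trace Q (contracted_op C Q A ^^ n) - of_nat z) \<le> \<eta> * real (card Q)" by blast
 qed
qed

section \<open>Kernels of positive operators\<close>

lemma quadratic_form:
 assumes lin: "\<And>f g c. A (%v. f v + c * g v) = (%v. A f v + c * A g v)"
  and f: "f \<in> L2 M" "A f \<in> L2 M" "A (A f) \<in> L2 M"
  and sym: "L2_inner M (A (A f)) f = L2_inner M (A f) (A f)"
 shows "Re (L2_inner M (A (%v. f v + - of_real t * A f v)) (%v. f v + - of_real t * A f v))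
  = Re (L2_inner M (A f) f) - 2 * t * (L2_norm M (A f))^2 + t^2 * Re (L2_inner M (A (A f)) (A f))"
proof -
 define c where "c = (- of_real t :: complex)"
 define n where "n = (L2_norm M (A f))^2"
 have n: "L2_inner M (A f) (A f) = of_real n" by (simp only: L2_inner_self n_def)
 have "L2_inner M (A (%v. f v + c * A f v)) (%v. f v + c * A f v)
   = L2_inner M (A f) f + cnj c * L2_inner M (A f) (A f) + c * (L2_inner M (A (A f)) f + cnj c * L2_inner M (A (A f)) (A f))"
  unfolding lin using f by (simp add: L2_inner_lin L2_inner_lin_right L2_lin)
 then have E: "L2_inner M (A (%v. f v + c * A f v)) (%v. f v + c * A f v)
   = L2_inner M (A f) f + c * of_real n + c * (of_real n + c * L2_inner M (A (A f)) (A f))"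
  by (simp add: sym n c_def)
 show ?thesis
  unfolding c_def[symmetric] n_def[symmetric] E by (simp add: c_def algebra_simps power2_eq_square)
qed

text \<open>Positivity of the form at \<open>f - A f / C\<close> bounds the squared norm of
  \<open>A f\<close> by \<open>C\<close> times the form at \<open>f\<close>; inserting this into the
  expanded square replaces an appeal to the spectrum of \<open>A\<close>.\<close>

lemma psd_contraction:
 assumes lin: "\<And>f g c. A (%v. f v + c * g v) = (%v. A f v + c * A g v)"
  and L2: "\<And>f. f \<in> L2 M ==> A f \<in> L2 M"
  and sym: "\<And>f g. f \<in> L2 M ==> g \<in> L2 M ==> L2_inner M (A f) g = L2_inner M f (A g)"
  and psd: "\<And>f. f \<in> L2 M ==> 0 \<le> Re (L2_inner M (A f) f)"
  and bound: "\<And>f. f \<in> L2 M ==> Re (L2_inner M (A f) f) \<le> C * (L2_norm M f)^2"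
  and C: "C > 0" and f: "f \<in> L2 M"
 shows "(L2_norm M (%v. f v - A f v / of_real C))^2 \<le> (L2_norm M f)^2 - Re (L2_inner M (A f) f) / C"
proof -
 let ?g = "A f" and ?c = "- of_real (1/C) :: complex"
 have g: "?g \<in> L2 M" by (rule L2[OF f])
 have "Re (L2_inner M (A (%v. f v + ?c * ?g v)) (%v. f v + ?c * ?g v))
   = Re (L2_inner M (A f) f) - 2 * (1/C) * (L2_norm M ?g)^2 + (1/C)^2 * Re (L2_inner M (A ?g) ?g)"
  by (rule quadratic_form[OF lin f g L2[OF g] sym[OF g f]])
 moreover have "0 \<le> Re (L2_inner M (A (%v. f v + ?c * ?g v)) (%v. f v + ?c * ?g v))"
  by (rule psd[OF L2_lin[OF f g]])
 moreover have "(1/C)^2 * Re (L2_inner M (A ?g) ?g) \<le> (1/C)^2 * (C * (L2_norm M ?g)^2)"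
  by (intro mult_left_mono bound g) auto
 moreover have "(1/C)^2 * (C * (L2_norm M ?g)^2) = (L2_norm M ?g)^2 / C" by (simp add: power2_eq_square)
 ultimately have le: "(L2_norm M ?g)^2 / C \<le> Re (L2_inner M (A f) f)" by simp
 have "(L2_norm M (%v. f v - ?g v / of_real C))^2 = (L2_norm M (%v. f v + ?c * ?g v))^2" by simp
 also have "... = (L2_norm M f)^2 + 2 * Re (cnj ?c * L2_inner M f ?g) + (cmod ?c)^2 * (L2_norm M ?g)^2"
  by (rule L2_norm_lin_square[OF f g])
 also have "L2_inner M f ?g = L2_inner M ?g f" by (rule sym[OF f f, symmetric])
 also have "(cmod ?c)^2 * (L2_norm M ?g)^2 = ((L2_norm M ?g)^2 / C) / C" by (simp add: norm_divide power2_eq_square)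
 also have "... \<le> Re (L2_inner M (A f) f) / C" using le C by (intro divide_right_mono) auto
 finally show ?thesis by simp
qed

section \<open>Orthonormal bases of spaces of finitely supported functions\<close>

lemma L2_count_space: "finite Q ==> f \<in> L2 (count_space Q)" by (simp add: L2_def integrable_count_space)

lemma L2_inner_count_space: "finite Q ==> L2_inner (count_space Q) f g = (\<Sum>q\<in>Q. f q * cnj (g q))"
 unfolding L2_inner_def by (simp add: lebesgue_integral_count_space_finite)

definition fsubspace :: "'q set => ('q => complex) set => bool" where
 "fsubspace Q W \<longleftrightarrow> (%_. 0) \<in> W \<and> (\<forall>f\<in>W. \<forall>g\<in>W. \<forall>c. (%v. f v + c * g v) \<in> W) \<and> (\<forall>f\<in>W. \<forall>v. v \<notin> Q --> f v = 0)"

definition onset :: "'q set => ('q => complex) set => bool" where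
 "onset Q S \<longleftrightarrow> finite S \<and> (\<forall>b\<in>S. \<forall>b'\<in>S. L2_inner (count_space Q) b b' = of_bool (b = b'))"

definition onbasis :: "'q set => ('q => complex) set => ('q => complex) set => bool" where
 "onbasis Q W S \<longleftrightarrow> onset Q S \<and> S \<subseteq> W \<and> (\<forall>w\<in>W. w = (%v. \<Sum>b\<in>S. L2_inner (count_space Q) w b * b v))"

lemma fsubspace_sum:
 assumes "fsubspace Q W" "finite S" "S \<subseteq> W" shows "(%v. \<Sum>b\<in>S. c b * b v) \<in> W"
 using assms(2,3)
proof (induction S rule: finite_induct)
 case empty then show ?case using assms(1) by (simp add: fsubspace_def)
next
 case (insert x F)
 then show ?case using assms(1) by (auto simp: fsubspace_def add.commute)
qed

context
 fixes Q :: "'q set" assumes Q: "finite Q"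
begin

abbreviation "ip \<equiv> L2_inner (count_space Q)"

lemma ip_sum: "ip (%v. \<Sum>b\<in>S. c b * b v) g = (\<Sum>b\<in>S. c b * ip b g)"
 by (simp add: L2_inner_sum L2_count_space[OF Q] L2_inner_scale)

lemma ip_scale: "ip (%v. c * f v) g = c * ip f g" "ip f (%v. c * g v) = cnj c * ip f g"
 by (simp_all add: L2_inner_count_space[OF Q] sum_distrib_left algebra_simps)

lemma onset_coeff:
 assumes "onset Q S" "b' \<in> S" shows "ip (%v. \<Sum>b\<in>S. c b * b v) b' = c b'"
using assms by (auto simp: ip_sum onset_def)

lemma ip_indicator: assumes "q \<in> Q" shows "ip (indicator {q}) g = cnj (g q)"
proof -
 have "ip (indicator {q}) g = (\<Sum>x\<in>Q. if x = q then cnj (g q) else 0)"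
  unfolding L2_inner_count_space[OF Q] by (intro sum.cong) auto
 then show ?thesis using assms Q by simp
qed

text \<open>Bessel's inequality at each point mass, summed over \<open>Q\<close>: the double sum of
  all \<open>(cmod (b q))^2\<close> counts \<open>S\<close> in one order and is at most
  \<open>card Q\<close> in the other.\<close>

lemma onset_card: assumes "onset Q S" shows "card S \<le> card Q"
proof -
 have bessel: "(\<Sum>b\<in>S. (cmod (b q))^2) \<le> 1" if q: "q \<in> Q" for q
 proof -
  let ?p = "%v. \<Sum>b\<in>S. cnj (b q) * b v" and ?d = "indicator {q} :: 'q => complex"
  define s where "s = (\<Sum>b\<in>S. (cmod (b q))^2)"
  have pg: "ip ?p g = (\<Sum>b\<in>S. cnj (b q) * ip b g)" for g by (rule ip_sum)
  have "ip ?p ?d = of_real s"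
   unfolding pg s_def of_real_sum using L2_inner_cnj[of "count_space Q" ?d] ip_indicator[OF q]
   by (intro sum.cong refl) (metis complex_cnj_cnj complex_norm_square mult.commute)
  moreover have "ip ?p ?p = of_real s"
  proof -
   have "ip b ?p = b q" if "b \<in> S" for b
    using onset_coeff[OF assms that, of "%b. cnj (b q)"] L2_inner_cnj[of "count_space Q" ?p b] by simp
   then have "ip ?p ?p = (\<Sum>b\<in>S. cnj (b q) * b q)" unfolding pg by simp
   then show ?thesis unfolding s_def of_real_sum by (simp only: complex_norm_square mult.commute)
  qed
  ultimately have "(L2_norm (count_space Q) (%v. ?d v - ?p v))^2 = 1 - 2 * s + s" using ip_indicator[OF q, of ?d]
   using L2_norm_diff_square[of ?d "count_space Q" ?p] L2_inner_cnj[of "count_space Q" ?p ?d]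
    L2_inner_self[of "count_space Q" ?d] L2_inner_self[of "count_space Q" ?p]
   by (simp add: L2_count_space[OF Q] del: of_real_power) (metis Re_complex_of_real)
  then show ?thesis using zero_le_power2[of "L2_norm (count_space Q) (%v. ?d v - ?p v)"] by (simp add: s_def)
 qed
 have "(\<Sum>q\<in>Q. (cmod (b q))^2) = 1" if "b \<in> S" for b
 proof -
  have "complex_of_real (\<Sum>q\<in>Q. (cmod (b q))^2) = ip b b"
   unfolding L2_inner_count_space[OF Q] of_real_sum complex_norm_square ..
  also have "... = of_real 1" using assms that by (simp add: onset_def)
  finally show ?thesis by (simp only: of_real_eq_iff)
 qed
 then have "real (card S) = (\<Sum>b\<in>S. \<Sum>q\<in>Q. (cmod (b q))^2)" by simp
 also have "... = (\<Sum>q\<in>Q. \<Sum>b\<in>S. (cmod (b q))^2)" by (rule sum.swap)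
 also have "... \<le> (\<Sum>q\<in>Q. 1)" by (intro sum_mono bessel)
 finally show ?thesis by simp
qed

text \<open>A largest orthonormal set containing \<open>S0\<close> exists by the cardinality bound;
  a nonzero remainder of an expansion could be normalized and added to it.\<close>

lemma onbasis_extend:
 assumes W: "fsubspace Q W" and S0: "onset Q S0" "S0 \<subseteq> W"
 obtains S where "onbasis Q W S" "S0 \<subseteq> S"
proof -
 let ?P = "%S. onset Q S \<and> S0 \<subseteq> S \<and> S \<subseteq> W"
 have "?P S0" using S0 by simp
 moreover have "\<forall>S. ?P S --> card S < Suc (card Q)" using onset_card by (auto simp: le_imp_less_Suc)
 ultimately obtain S where S: "?P S" and max: "\<And>S'. ?P S' ==> card S' \<le> card S"
  using ex_has_greatest_nat[of ?P S0 card "Suc (card Q)"] by auto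
 have fin: "finite S" using S by (simp add: onset_def)
 have "w = (%v. \<Sum>b\<in>S. ip w b * b v)" if w: "w \<in> W" for w
 proof (rule ccontr)
  let ?p = "%v. \<Sum>b\<in>S. ip w b * b v"
  assume ne: "w \<noteq> ?p"
  define r where "r v = w v - ?p v" for v
  have pW: "?p \<in> W" using S fin by (intro fsubspace_sum[OF W]) auto
  have rW: "r \<in> W" using pW[THEN W[unfolded fsubspace_def, THEN conjunct2, THEN conjunct1, rule_format, OF w], of "-1"]
   by (simp add: r_def[abs_def])
  have r0: "ip r b = 0" if "b \<in> S" for b using onset_coeff[OF _ that, of "ip w"] S unfolding r_def[abs_def]
   by (simp add: L2_inner_diff L2_count_space[OF Q])
  obtain q where "r q \<noteq> 0" using ne by (auto simp: r_def)
  then have q: "q \<in> Q" "r q \<noteq> 0" using rW W by (auto simp: fsubspace_def)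
  define n where "n = L2_norm (count_space Q) r"
  have "n \<noteq> 0" using q L2_norm_eq_0_iff[OF L2_count_space[OF Q], of r] by (auto simp: n_def AE_count_space)
  define u where "u v = of_real (1/n) * r v" for v
  have "ip u u = of_real (1/n) * (cnj (of_real (1/n)) * ip r r)"
   unfolding u_def[abs_def] by (simp only: ip_scale)
  then have uu: "ip u u = 1" using \<open>n \<noteq> 0\<close> by (simp add: L2_inner_self n_def[symmetric] power2_eq_square)
  have u0: "ip u b = 0" "ip b u = 0" if "b \<in> S" for b
  proof -
   show "ip u b = 0" unfolding u_def[abs_def] ip_scale r0[OF that] by simp
   then show "ip b u = 0" using L2_inner_cnj[of "count_space Q" u b] by simp
  qed
  have "u \<notin> S" using u0 uu by force
  have uW: "u \<in> W"
   using W rW[THEN W[unfolded fsubspace_def, THEN conjunct2, THEN conjunct1, rule_format, of "%_. 0", rotated], of "of_real (1/n)"]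
   by (simp add: u_def[abs_def] fsubspace_def)
  have "?P (insert u S)" using S uW u0 uu by (auto simp: onset_def)
  from max[OF this] show False using \<open>u \<notin> S\<close> fin by simp
 qed
 with S that show thesis by (auto simp: onbasis_def)
qed

lemma onbasis_dim:
 assumes W: "fsubspace Q W" and S: "onbasis Q W S"
 shows "vector_space.dim (%(c::complex) f v. c * f v) W = card S"
proof -
 interpret vs: vector_space "%(c::complex) (f :: 'q => complex) v. c * f v"
  by standard (auto simp: algebra_simps)
 have fin: "finite S" and on: "onset Q S" using S by (auto simp: onbasis_def onset_def)
 have sum_fun: "(\<Sum>b\<in>T. (%v. c b * b v)) = (%v. \<Sum>b\<in>T. c b * b v)" for T and c :: "('q => complex) => complex"
  by (induction rule: infinite_finite_induct) (auto)
 show ?thesis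
 proof (rule vs.dim_unique)
  show "S \<subseteq> W" using S by (simp add: onbasis_def)
  show "W \<subseteq> vs.span S"
  proof
   fix w assume "w \<in> W"
   then have "w = (\<Sum>b\<in>S. (%v. ip w b * b v))" using S by (simp add: onbasis_def sum_fun)
   moreover have "(\<Sum>b\<in>S. (%v. ip w b * b v)) \<in> vs.span S" by (intro vs.span_sum vs.span_scale vs.span_base)
   ultimately show "w \<in> vs.span S" by simp
  qed
  show "vs.independent S"
  proof (rule vs.independent_if_scalars_zero[OF fin])
   fix c b assume z: "(\<Sum>x\<in>S. (%v. c x * x v)) = 0" and b: "b \<in> S"
   have "(%v. \<Sum>x\<in>S. c x * x v) = (%v. 0)" using z unfolding sum_fun by auto
   then show "c b = 0" using onset_coeff[OF on b, of c] by simp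
  qed
 qed simp
qed

text \<open>Extending an orthonormal basis of \<open>B\<close> to one of \<open>Z\<close> leaves a
  basis of the complement, which turns the dimension of homology into that of a space of harmonic
  chains.\<close>

lemma dim_orthogonal_complement:
 assumes Z: "fsubspace Q Z" and B: "fsubspace Q B" and BZ: "B \<subseteq> Z"
 obtains S where "onbasis Q {f \<in> Z. \<forall>g\<in>B. ip f g = 0} S"
  "vector_space.dim (%(c::complex) f v. c * f v) Z - vector_space.dim (%(c::complex) f v. c * f v) B = card S"
proof -
 obtain S0 where S0: "onbasis Q B S0" using onbasis_extend[OF B, of "{}"] by (auto simp: onset_def)
 then obtain S where S: "onbasis Q Z S" "S0 \<subseteq> S"
  using onbasis_extend[OF Z, of S0] BZ by (auto simp: onbasis_def)
 have fin: "finite S" and on: "onset Q S" "onset Q S0" using S S0 by (auto simp: onbasis_def onset_def)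
 have perp: "(\<forall>g\<in>B. ip f g = 0) \<longleftrightarrow> (\<forall>b\<in>S0. ip f b = 0)" for f
 proof
  assume *: "\<forall>b\<in>S0. ip f b = 0"
  show "\<forall>g\<in>B. ip f g = 0"
  proof
   fix g assume "g \<in> B"
   then have "ip g f = ip (%v. \<Sum>b\<in>S0. ip g b * b v) f" using S0 by (simp add: onbasis_def)
   also have "... = (\<Sum>b\<in>S0. ip g b * ip b f)" by (rule ip_sum)
   also have "... = 0" using * by (intro sum.neutral) (metis L2_inner_cnj complex_cnj_zero mult_zero_right)
   finally show "ip f g = 0" by (metis L2_inner_cnj complex_cnj_zero)
  qed
 qed (use S0 in \<open>auto simp: onbasis_def\<close>)
 have "onbasis Q {f \<in> Z. \<forall>g\<in>B. ip f g = 0} (S - S0)" unfolding onbasis_def perp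
 proof (intro conjI ballI)
  show "onset Q (S - S0)" using on by (auto simp: onset_def)
  show "S - S0 \<subseteq> {f \<in> Z. \<forall>b\<in>S0. ip f b = 0}" using S by (auto simp: onbasis_def onset_def)
  fix w assume w: "w \<in> {f \<in> Z. \<forall>b\<in>S0. ip f b = 0}"
  then have "w = (%v. \<Sum>b\<in>S. ip w b * b v)" using S by (simp add: onbasis_def)
  also have "... = (%v. \<Sum>b\<in>S - S0. ip w b * b v)" using w fin by (intro ext sum.mono_neutral_right) auto
  finally show "w = (%v. \<Sum>b\<in>S - S0. ip w b * b v)" .
 qed
 moreover have "card (S - S0) = card S - card S0" using S(2) fin finite_subset by (intro card_Diff_subset)
 then have "vector_space.dim (%(c::complex) f v. c * f v) Z - vector_space.dim (%(c::complex) f v. c * f v) B = card (S - S0)"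
  by (simp only: onbasis_dim[OF Z S(1)] onbasis_dim[OF B S0])
 ultimately show thesis by (rule)
qed

lemma onbasis_trace:
 assumes S: "onbasis Q {f. \<forall>v. v \<notin> Q --> f v = 0} S"
  and lin: "\<And>f g c. T (%v. f v + c * g v) = (%v. T f v + c * T g v)"
 shows "op_trace Q T = (\<Sum>b\<in>S. ip (T b) b)"
proof -
 have T0: "T (%v. 0) = (%v. 0)" using lin[of "%v. 0" "-1" "%v. 0"] by simp
 have Tsum: "T (%v. \<Sum>b\<in>F. c b * b v) = (%v. \<Sum>b\<in>F. c b * T b v)" for F and c :: "('q => complex) => complex"
 proof (induction F rule: infinite_finite_induct)
  case (insert x F)
  then show ?case using lin[of "%v. \<Sum>b\<in>F. c b * b v" "c x" x] by (simp add: add.commute)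
 qed (simp_all add: T0)
 have "op_trace Q T = (\<Sum>q\<in>Q. \<Sum>b\<in>S. cnj (b q) * T b q)" unfolding op_trace_def
 proof (rule sum.cong[OF refl])
  fix q assume q: "q \<in> Q"
  have "indicator {q} = (%v. \<Sum>b\<in>S. ip (indicator {q}) b * b v)" using q
   using S unfolding onbasis_def by (auto split: split_indicator)
  then show "T (indicator {q}) q = (\<Sum>b\<in>S. cnj (b q) * T b q)"
   using Tsum[of "%b. cnj (b q)" S] by (simp only: ip_indicator[OF q])
 qed
 also have "... = (\<Sum>b\<in>S. ip (T b) b)" by (subst sum.swap) (simp add: L2_inner_count_space[OF Q] mult.commute)
 finally show ?thesis .
qed

end

section \<open>The kernel of a positive integer matrix through traces of powers\<close>

context integral_psd begin

abbreviation "L \<equiv> real_sym_op Q A"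
abbreviation "T \<equiv> contracted_op C Q A"

lemma L_lin: "L (%v. f v + c * g v) = (%v. L f v + c * L g v)"
 by (auto simp: real_sym_op_def sum_distrib_left algebra_simps)

lemma L_inner_sym: "ip Q (L f) g = ip Q f (L g)"
proof -
 have "ip Q (L f) g = (\<Sum>q\<in>Q. \<Sum>q'\<in>Q. of_real (A q q') * f q' * cnj (g q))"
  by (simp add: L2_inner_count_space[OF finite_Q] real_sym_op_def sum_distrib_right)
 also have "... = (\<Sum>q\<in>Q. \<Sum>q'\<in>Q. of_real (A q q') * f q * cnj (g q'))" by (subst sum.swap) (auto simp: A_sym)
 finally show ?thesis by (simp add: L2_inner_count_space[OF finite_Q] real_sym_op_def sum_distrib_left mult_ac)
qed

text \<open>Schur's test: each mixed product is at most half the sum of the squares, and symmetry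
  turns both halves into row sums.\<close>

lemma L_bound: "Re (ip Q (L f) f) \<le> C * (L2_norm (count_space Q) f)^2"
proof -
 have n: "(L2_norm (count_space Q) f)^2 = (\<Sum>q\<in>Q. (cmod (f q))^2)"
  using L2_inner_self[of "count_space Q" f] unfolding L2_inner_count_space[OF finite_Q] complex_norm_square[symmetric] of_real_sum[symmetric]
  by (simp only: of_real_eq_iff)
 have "ip Q (L f) f = (\<Sum>q\<in>Q. \<Sum>q'\<in>Q. of_real (A q q') * f q' * cnj (f q))"
  by (simp add: L2_inner_count_space[OF finite_Q] real_sym_op_def sum_distrib_right)
 then have "Re (ip Q (L f) f) \<le> cmod (\<Sum>q\<in>Q. \<Sum>q'\<in>Q. of_real (A q q') * f q' * cnj (f q))"
  by (simp only: complex_Re_le_cmod)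
 also have "... \<le> (\<Sum>q\<in>Q. \<Sum>q'\<in>Q. \<bar>A q q'\<bar> * ((cmod (f q))^2 + (cmod (f q'))^2) / 2)"
 proof (intro order_trans[OF norm_sum] sum_mono)
  fix q q'
  have "2 * (cmod (f q') * cmod (f q)) \<le> (cmod (f q'))^2 + (cmod (f q))^2"
   using sum_squares_bound[of "cmod (f q')" "cmod (f q)"] by simp
  moreover have "2 * z \<le> u + v ==> z \<le> (v + u) / 2" for u v z :: real by simp
  ultimately have "cmod (f q') * cmod (f q) \<le> ((cmod (f q))^2 + (cmod (f q'))^2) / 2" by blast
  from mult_left_mono[OF this, of "\<bar>A q q'\<bar>"]
  show "cmod (of_real (A q q') * f q' * cnj (f q)) \<le> \<bar>A q q'\<bar> * ((cmod (f q))^2 + (cmod (f q'))^2) / 2"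
   by (simp add: norm_mult)
 qed
 also have "... = (\<Sum>q\<in>Q. \<Sum>q'\<in>Q. \<bar>A q q'\<bar> * (cmod (f q))^2 / 2) + (\<Sum>q\<in>Q. \<Sum>q'\<in>Q. \<bar>A q q'\<bar> * (cmod (f q'))^2 / 2)"
  by (simp only: sum.distrib[symmetric] distrib_left add_divide_distrib)
 also have "(\<Sum>q\<in>Q. \<Sum>q'\<in>Q. \<bar>A q q'\<bar> * (cmod (f q'))^2 / 2) = (\<Sum>q\<in>Q. \<Sum>q'\<in>Q. \<bar>A q q'\<bar> * (cmod (f q))^2 / 2)"
  by (subst sum.swap) (auto simp: A_sym)
 also have "(\<Sum>q\<in>Q. \<Sum>q'\<in>Q. \<bar>A q q'\<bar> * (cmod (f q))^2 / 2) + (\<Sum>q\<in>Q. \<Sum>q'\<in>Q. \<bar>A q q'\<bar> * (cmod (f q))^2 / 2)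
   = (\<Sum>q\<in>Q. (\<Sum>q'\<in>Q. \<bar>A q q'\<bar>) * (cmod (f q))^2)" by (simp add: sum_distrib_right sum.distrib[symmetric])
 also have "... \<le> (\<Sum>q\<in>Q. C * (cmod (f q))^2)" by (intro sum_mono mult_right_mono row) auto
 finally show ?thesis by (simp add: n sum_distrib_left)
qed

lemma L_nonneg: "0 \<le> Re (ip Q (L f) f)" using psd[of f] by (simp only: L2_inner_count_space[OF finite_Q])

lemma T_contraction:
 "(L2_norm (count_space Q) (T f))^2 \<le> (L2_norm (count_space Q) f)^2 - Re (ip Q (L f) f) / C"
proof -
 have "L2_norm (count_space Q) (T f) = L2_norm (count_space Q) (%v. f v - L f v / of_real C)"
  by (intro L2_norm_cong_AE L2_count_space finite_Q) (auto simp: contracted_op_def)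
 moreover have "(L2_norm (count_space Q) (%v. f v - L f v / of_real C))^2 \<le> (L2_norm (count_space Q) f)^2 - Re (ip Q (L f) f) / C"
  by (rule psd_contraction[OF L_lin L2_count_space[OF finite_Q] L_inner_sym L_nonneg L_bound _ L2_count_space[OF finite_Q]])
   (use C in simp)
 ultimately show ?thesis by simp
qed

lemma T_lin: "T (%v. f v + c * g v) = (%v. T f v + c * T g v)"
 by (auto simp: contracted_op_def L_lin algebra_simps add_divide_distrib)

sublocale con: symmetric_contraction "count_space Q" T
proof
 note L2c = L2_count_space[OF finite_Q]
 fix f g :: "'q => complex"
 show "T (%v. f v + c * g v) = (%v. T f v + c * T g v)" for c by (rule T_lin)
 show "T f \<in> L2 (count_space Q)" by (rule L2c)
 have eq: "ip Q (T f) g = ip Q (%v. f v + (- of_real (1/C)) * L f v) g" "ip Q f (T g) = ip Q f (%v. g v + (- of_real (1/C)) * L g v)"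
  by (auto intro!: L2_inner_cong_AE L2c simp: contracted_op_def)
 show "ip Q (T f) g = ip Q f (T g)"
  unfolding eq L2_inner_lin[OF L2c L2c L2c] L2_inner_lin_right[OF L2c L2c L2c] by (simp add: L_inner_sym)
 have "0 \<le> Re (ip Q (L f) f)" by (rule L_nonneg)
 then have "(L2_norm (count_space Q) (T f))^2 \<le> (L2_norm (count_space Q) f)^2"
  using T_contraction[of f] C by (smt (verit) divide_nonneg_nonneg)
 then show "L2_norm (count_space Q) (T f) \<le> L2_norm (count_space Q) f" by simp
qed

definition "ker = {f. (\<forall>v. v \<notin> Q --> f v = 0) \<and> (\<forall>q\<in>Q. L f q = 0)}"

text \<open>A vector where the nonnegative form vanishes is a minimum, so the derivative in the
  direction \<open>L f\<close> must vanish too.\<close>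

lemma ker_if_form_zero:
 assumes "Re (ip Q (L f) f) = 0" "q \<in> Q" shows "L f q = 0"
proof -
 note L2c = L2_count_space[OF finite_Q]
 let ?g = "L f" and ?n = "L2_norm (count_space Q)"
 have quad: "0 \<le> - 2 * t * (?n ?g)^2 + t^2 * (C * (?n ?g)^2)" for t :: real
 proof -
  let ?c = "- of_real t :: complex"
  have "Re (ip Q (L (%v. f v + ?c * ?g v)) (%v. f v + ?c * ?g v))
    = Re (ip Q (L f) f) - 2 * t * (?n ?g)^2 + t^2 * Re (ip Q (L ?g) ?g)"
   by (rule quadratic_form[where A=L and M="count_space Q" and f=f and t=t]) (rule L_lin L2c L_inner_sym)+
  moreover have "0 \<le> Re (ip Q (L (%v. f v + ?c * ?g v)) (%v. f v + ?c * ?g v))" by (rule L_nonneg)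
  moreover have "t^2 * Re (ip Q (L ?g) ?g) \<le> t^2 * (C * (?n ?g)^2)" by (intro mult_left_mono L_bound) auto
  ultimately show ?thesis using assms(1) by simp
 qed
 \<comment> \<open>At \<open>t = 1/C\<close> the quadratic bound becomes minus the squared norm of
   \<open>?g\<close> divided by \<open>C\<close>.\<close>
 have "(?n ?g)^2 \<le> 0" using quad[of "1/C"] C by (simp add: field_simps power2_eq_square)
 then show ?thesis using L2_norm_eq_0_iff[OF L2c, of ?g] assms(2) by (simp add: AE_count_space)
qed

text \<open>Evaluated in an orthonormal basis extending \<open>S1\<close>: vectors of
  \<open>S1\<close> are fixed, and the powers applied to any other basis vector tend to an element
  of the kernel, which is orthogonal to that vector.\<close>

lemma trace_limit:
 assumes S1: "onbasis Q ker S1"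
 shows "(%k. op_trace Q (T ^^ (2*k))) \<longlonglongrightarrow> of_nat (card S1)"
proof -
 note L2c = L2_count_space[OF finite_Q]
 have F: "fsubspace Q {f. \<forall>v. v \<notin> Q --> f v = 0}" by (auto simp: fsubspace_def)
 obtain S where S: "onbasis Q {f. \<forall>v. v \<notin> Q --> f v = 0} S" "S1 \<subseteq> S"
 proof (rule onbasis_extend[OF finite_Q F])
  show "onset Q S1" "S1 \<subseteq> {f. \<forall>v. v \<notin> Q --> f v = 0}" using S1 by (auto simp: onbasis_def ker_def)
 qed
 have fin: "finite S" and on: "onset Q S" using S by (auto simp: onbasis_def onset_def)
 have lim: "(%k. ip Q ((T ^^ (2*k)) b) b) \<longlonglongrightarrow> of_bool (b \<in> S1)" if b: "b \<in> S" for b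
 proof (cases "b \<in> S1")
  case True
  then have "T b = b" using S1 by (auto simp: onbasis_def ker_def contracted_op_def fun_eq_iff)
  then have "(T ^^ n) b = b" for n by (induction n) auto
  then show ?thesis using True on b by (simp add: onset_def)
 next
  case False
  let ?p = "con.proj b"
  \<comment> \<open>The limit is determined on \<open>Q\<close> only, whereas members of
    \<open>ker\<close> vanish outside \<open>Q\<close>.\<close>
  let ?p' = "%v. if v \<in> Q then ?p v else 0"
  have "L2_norm (count_space Q) (T (T ?p)) = L2_norm (count_space Q) ?p"
   by (intro L2_norm_cong_AE L2c con.proj_TT)
  then have "(L2_norm (count_space Q) ?p)^2 \<le> (L2_norm (count_space Q) (T ?p))^2"
   using con.contr[OF L2c, of "T ?p"] by simp
  then have "Re (ip Q (L ?p) ?p) / C \<le> 0" using T_contraction[of ?p] by linarith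
  then have z: "Re (ip Q (L ?p) ?p) = 0" using C using L_nonneg[of ?p] by (auto simp: divide_le_0_iff)
  have p': "?p' = (%v. \<Sum>c\<in>S1. ip Q ?p' c * c v)" using ker_if_form_zero[OF z] using S1 by (simp add: real_sym_op_def ker_def onbasis_def)
  have "ip Q ?p b = ip Q ?p' b" by (intro L2_inner_cong_AE L2c) (auto)
  also have "... = (\<Sum>c\<in>S1. ip Q ?p' c * ip Q c b)" by (subst p') (rule ip_sum[OF finite_Q])
  also have "... = 0" using on b False S(2) by (intro sum.neutral) (auto simp: onset_def)
  finally have "ip Q ?p b = 0" .
  then show ?thesis using L2_inner_tendsto[OF con.pow_L2[OF L2c] con.proj_L2[OF L2c] L2c con.proj_lim[OF L2c], of b b] False by simp
 qed
 have "op_trace Q (T ^^ n) = (\<Sum>b\<in>S. ip Q ((T ^^ n) b) b)" for n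
  by (rule onbasis_trace[OF finite_Q S(1)]) (rule con.pow_lin)
 moreover have "(%k. \<Sum>b\<in>S. ip Q ((T ^^ (2*k)) b) b) \<longlonglongrightarrow> (\<Sum>b\<in>S. of_bool (b \<in> S1))" by (intro tendsto_sum lim)
 ultimately show ?thesis using fin S(2) by (simp add: Int_absorb1)
qed

end

text \<open>The multiplicity of the eigenvalue 0 in the triangulation and the dimension of the
  kernel are limits of the same traces, hence equal.\<close>

theorem kernel_dimension_approximation:
 fixes C \<eta> :: real
 assumes "C \<ge> 1" "\<eta> > 0"
 obtains k where "\<And>(Q :: 'q set) A S. integral_psd C Q A ==> onbasis Q (integral_psd.ker Q A) S ==>
   cmod (op_trace Q (contracted_op C Q A ^^ (2*k)) - of_nat (card S)) \<le> \<eta> * real (card Q)" and "k \<ge> K"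
proof -
 obtain n0 where n0: "\<And>n (Q :: 'q set) A. n \<ge> n0 ==> integral_psd C Q A ==>
  \<exists>z. (%n. op_trace Q (contracted_op C Q A ^^ n)) \<longlonglongrightarrow> of_nat z \<and>
   cmod (op_trace Q (contracted_op C Q A ^^ n) - of_nat z) \<le> \<eta> * real (card Q)"
  using trace_approximation[OF assms] by metis
 show thesis
 proof (rule that[of "max K n0"])
  fix Q :: "'q set" and A S assume p: "integral_psd C Q A" and S: "onbasis Q (integral_psd.ker Q A) S"
  obtain z where z: "(%n. op_trace Q (contracted_op C Q A ^^ n)) \<longlonglongrightarrow> of_nat z"
   "cmod (op_trace Q (contracted_op C Q A ^^ (2 * max K n0)) - of_nat z) \<le> \<eta> * real (card Q)"
  proof -
   have "n0 \<le> 2 * max K n0" by simp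
   from n0[OF this p] show thesis using that by blast
  qed
  have "filterlim (%k. 2 * k) sequentially sequentially"
   by (rule filterlim_subseq) (auto simp: strict_mono_def)
  from filterlim_compose[OF z(1) this]
  have "of_nat z = complex_of_nat (card S)" using integral_psd.trace_limit[OF p S] LIMSEQ_unique by blast
  with z(2) show "cmod (op_trace Q (contracted_op C Q A ^^ (2 * max K n0)) - of_nat (card S)) \<le> \<eta> * real (card Q)"
   by simp
 qed simp
qed

section \<open>Kernel operators on the orbit relation\<close>

locale pmp_gset = pmp_action G M a + free_gset G B mv rp m
 for G :: "('g, 'n) monoid_scheme" (structure) and M :: "'x measure" and a :: "'g => 'x => 'x"
  and B :: "'b set" and mv :: "'g => 'b => 'b" and rp :: "nat => 'b" and m :: nat
begin

text \<open>Reads a function on the direct sum as a function on the simplices of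
  \<open>\<Sigma>\<close> over the target \<open>x\<close>. Stabilizer translates of
  \<open>b\<close> give the same point, so the function descends to the quotient by the
  stabilizer.\<close>

definition lift :: "(('x \<times> 'x) \<times> nat => complex) => 'x => 'b => complex" where
 "lift F x b = F ((a (inv (gpart b)) x, x), ipart b)"

definition Op :: "('b => 'b => real) => (('x \<times> 'x) \<times> nat => complex) => ('x \<times> 'x) \<times> nat => complex" where
 "Op k F = (%((y, x), j). if j < m then
   \<Sum>b'\<in>supp k (rp j). of_real (k (rp j) b') * F ((a (inv (gpart b')) y, x), ipart b') else 0)"

text \<open>Right translation acts on the source while bisections act on the target, so the two
  commute.\<close>

definition rho :: "'g => ('x \<times> 'x => complex) => 'x \<times> 'x => complex" where
 "rho g f = (%(y, x). f (a (inv g) y, x))"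

text \<open>On each fibre the operator is the plain action of the kernel: invariance translates the
  row of the representative to the row of \<open>b\<close>. Identities between kernels thereby
  transfer to the direct sum.\<close>

lemma lift_Op:
 assumes k: "kernel k" and x: "x \<in> space M" and b: "b \<in> B"
 shows "lift (Op k F) x b = kop k (lift F x) b"
proof -
 note p = parts[OF b]
 have sl: "rp (ipart b) \<in> B" by (rule rp_in[OF p(2)])
 have "kop k (lift F x) b = (\<Sum>b'\<in>supp k (rp (ipart b)). of_real (k (rp (ipart b)) b') * F ((a (inv (gpart b')) (a (inv (gpart b)) x), x), ipart b'))"
  using kop_mv[OF k p(1) sl, of "lift F x"] unfolding kop_def using p x
 by (auto simp: supp_def lift_def parts_mv inv_mult_group a_mult gpart_in)
 also have "... = lift (Op k F) x b" using p(2) by (simp add: lift_def Op_def)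
 finally show ?thesis by simp
qed

lemma lift_pow:
 assumes "kernel k" "x \<in> space M" "b \<in> B"
 shows "lift ((Op k ^^ n) F) x b = kop (kpow k n) (lift F x) b" using assms(3)
proof (induction n arbitrary: b)
 case (Suc n)
 have "lift ((Op k ^^ Suc n) F) x b = kop k (lift ((Op k ^^ n) F) x) b"
  using lift_Op[OF assms(1,2) Suc.prems] by simp
 also have "... = kop k (kop (kpow k n) (lift F x)) b" by (rule kop_cong) (rule Suc.IH)
 finally show ?case using Suc.prems by (simp add: kop_mul kernel_pow assms)
qed (simp add: kop_id)

lemma point_lift:
 assumes "x \<in> space M" "g \<in> carrier G" "j < m" shows "F ((a g x, x), j) = lift F x (mv (inv g) (rp j))"
 using assms by (simp add: lift_def parts_unique)

lemma space_N_cases: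
 assumes "w \<in> space N" obtains x g j where "x \<in> space M" "g \<in> carrier G" "w = ((a g x, x), j)"
proof -
 obtain v j where w: "w = (v, j)" "v \<in> space R" using assms by (auto simp: space_N)
 then obtain x g where "v = pT x g" "x \<in> space M" "g \<in> carrier G"
  using fibred.space[OF R_fibred_T] by (auto simp: fibre_coords.total_def[OF coords_T])
 with w that show thesis by (simp add: pT_def)
qed

lemma in_space_N: "x \<in> space M ==> g \<in> carrier G ==> ((a g x, x), j) \<in> space N"
 using fibred.p_space[OF N_fibred, of x "(g, j)"] by (simp add: pN_def)

lemma Op_eqI:
 assumes "w \<in> space N" "\<And>x b. x \<in> space M ==> b \<in> B ==> lift (Op k F) x b = lift (Op k' F') x b"
 shows "Op k F w = Op k' F' w"
proof -
 obtain x g j where w: "x \<in> space M" "g \<in> carrier G" "w = ((a g x, x), j)" by (rule space_N_cases[OF assms(1)])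
 show ?thesis
 proof (cases "j < m")
  case True
  then show ?thesis using w assms(2)[of x "mv (inv g) (rp j)"] by (simp add: point_lift mv_in rp_in)
 qed (simp add: w Op_def)
qed

lemma Op_mul:
 assumes "kernel k1" "kernel k2" "w \<in> space N" shows "Op (kmul k1 k2) F w = Op k1 (Op k2 F) w"
 by (rule Op_eqI[OF assms(3)]) (use assms in \<open>auto simp: lift_Op kernel_mul kop_mul intro!: kop_cong\<close>)

lemma Op_kcong:
 assumes "\<And>b b'. b \<in> B ==> b' \<in> B ==> k b b' = k' b b'" shows "Op k F = Op k' F"
proof -
 have s: "supp k (rp j) = supp k' (rp j)" if "j < m" for j
  using assms[OF rp_in[OF that]] by (auto simp: supp_def)
 have "(\<Sum>b'\<in>supp k (rp j). of_real (k (rp j) b') * F ((a (inv (gpart b')) y, x), ipart b'))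
   = (\<Sum>b'\<in>supp k' (rp j). of_real (k' (rp j) b') * F ((a (inv (gpart b')) y, x), ipart b'))" if "j < m" for j y x
  unfolding s[OF that] using assms[OF rp_in[OF that]] by (intro sum.cong refl) (simp add: supp_def)
 then show ?thesis by (auto simp: Op_def)
qed

lemma Op_lin: "Op k (%w. F w + c * F' w) = (%w. Op k F w + c * Op k F' w)"
 by (auto simp: Op_def sum_distrib_left algebra_simps)

lemma AE_lift:
 assumes "AE w in N. F w = F' w" shows "AE x in M. \<forall>b\<in>B. lift F x b = lift F' x b"
 using assms unfolding AE_N_target by (rule) (auto simp: lift_def gpart_in)

lemma AE_of_lift:
 assumes "AE x in M. \<forall>b\<in>B. lift F x b = lift F' x b"
  and "\<And>w. w \<in> space N ==> snd w \<ge> m ==> F w = F' w"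
 shows "AE w in N. F w = F' w" unfolding AE_N_target using assms(1)
proof (rule AE_mp, intro AE_I2 impI ballI allI)
 fix x g j assume x: "x \<in> space M" "\<forall>b\<in>B. lift F x b = lift F' x b" "g \<in> carrier G"
 show "F ((a g x, x), j) = F' ((a g x, x), j)" using x assms(2)[OF in_space_N[OF x(1,3), of j]]
  by (cases "j < m") (auto simp: point_lift mv_in rp_in)
qed

lemma rho_L2:
 assumes g: "g \<in> carrier G" and f: "f \<in> L2 R"
 shows "rho g f \<in> L2 R" "L2_norm R (rho g f) = L2_norm R f"
proof -
 note s = R_shift_fst[OF inv_closed[OF g]]
 have eq: "rho g f = (%v. f (a (inv g) (fst v), snd v))" by (auto simp: rho_def)
 have fm: "f \<in> borel_measurable R" by (rule L2_measurable[OF f])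
 have m: "rho g f \<in> borel_measurable R" unfolding eq by (rule measurable_compose[OF s(1) fm])
 have n: "nn_integral R (%v. nsq (rho g f v)) = nn_integral R (%v. nsq (f v))"
  using nn_integral_distr[OF s(1), of "%v. nsq (f v)"] fm unfolding s(2) eq by simp
 show 1: "rho g f \<in> L2 R" using f n fm m by (simp add: L2_iff_nn_integral)
 show "L2_norm R (rho g f) = L2_norm R f" by (rule L2_norm_eqI[OF 1 f n])
qed

lemma rho_adjoint:
 assumes g: "g \<in> carrier G" and f: "f \<in> L2 R" and h: "h \<in> L2 R"
 shows "L2_inner R (rho g f) h = L2_inner R f (rho (inv g) h)"
proof -
 note s = R_shift_fst[OF g]
 have [measurable]: "rho g f \<in> borel_measurable R" "h \<in> borel_measurable R"
  using L2_measurable rho_L2 g f h by auto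
 have "L2_inner R (rho g f) h = (\<integral>v. rho g f v * cnj (h v) \<partial>distr R R (%v. (a g (fst v), snd v)))"
  by (simp add: L2_inner_def s(2))
 also have "... = (\<integral>v. rho g f (a g (fst v), snd v) * cnj (h (a g (fst v), snd v)) \<partial>R)"
  by (rule integral_distr[OF s(1)]) measurable
 also have "... = (\<integral>v. f v * cnj (rho (inv g) h v) \<partial>R)"
 proof (rule Bochner_Integration.integral_cong[OF refl])
  fix v assume "v \<in> space R"
  then show "rho g f (a g (fst v), snd v) * cnj (h (a g (fst v), snd v)) = f v * cnj (rho (inv g) h v)" using space_RD
   using g by (cases v) (simp add: rho_def)
 qed
 finally show ?thesis by (simp add: L2_inner_def)
qed

text \<open>A kernel operator is a finite matrix whose entries are combinations of right
  translations; boundedness and adjoints are computed term by term.\<close>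

definition Op_term :: "('b => 'b => real) => (('x \<times> 'x) \<times> nat => complex) => nat \<times> 'b => ('x \<times> 'x) \<times> nat => complex" where
 "Op_term k F jb = (%w. of_real (k (rp (fst jb)) (snd jb)) * embed (fst jb) (rho (gpart (snd jb)) (%v. F (v, ipart (snd jb)))) w)"

definition "Op_ix k = (SIGMA j:{..<m}. supp k (rp j))"

lemma Op_sum: assumes "kernel k" shows "Op k F = (%w. \<Sum>jb\<in>Op_ix k. Op_term k F jb w)"
proof
 fix w :: "('x \<times> 'x) \<times> nat"
 obtain y x l where w: "w = ((y, x), l)" by (metis surj_pair)
 have "(\<Sum>jb\<in>Op_ix k. Op_term k F jb w) = (\<Sum>j<m. \<Sum>b'\<in>supp k (rp j). Op_term k F (j, b') w)"
  unfolding Op_ix_def by (subst sum.Sigma) (auto intro: finite_supp[OF assms] rp_in)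
 also have "... = (\<Sum>j<m. if j = l then \<Sum>b'\<in>supp k (rp j). of_real (k (rp j) b') * F ((a (inv (gpart b')) y, x), ipart b') else 0)"
  by (intro sum.cong) (auto simp: Op_term_def embed_def rho_def w)
 finally show "Op k F w = (\<Sum>jb\<in>Op_ix k. Op_term k F jb w)" by (simp add: Op_def w)
qed

lemma Op_ix_D: "jb \<in> Op_ix k ==> fst jb < m \<and> snd jb \<in> B" by (auto simp: Op_ix_def supp_def)

lemma Op_term_L2:
 assumes "F \<in> L2 N" "jb \<in> Op_ix k" shows "Op_term k F jb \<in> L2 N"
 unfolding Op_term_def
 by (intro L2_scale embed_L2 rho_L2 L2_slice assms gpart_in) (use Op_ix_D[OF assms(2)] in auto)

lemma Op_L2: "kernel k ==> F \<in> L2 N ==> Op k F \<in> L2 N" unfolding Op_sum by (intro L2_sum Op_term_L2)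

lemma norm_embed: assumes "f \<in> L2 R" shows "L2_norm N (embed k f) = L2_norm R f"
proof -
 have "ennreal ((L2_norm N (embed k f))^2) = (\<Sum>l. ennreal ((L2_norm R (%v. embed k f (v, l)))^2))"
  by (rule L2_norm_slices[OF embed_L2[OF assms]])
 also have "... = (\<Sum>l\<in>{k}. ennreal ((L2_norm R (%v. embed k f (v, l)))^2))"
  by (rule suminf_finite) (auto simp: embed_def L2_norm_def)
 finally show ?thesis by (simp add: embed_def)
qed

lemma norm_slice: assumes "F \<in> L2 N" shows "L2_norm R (%v. F (v, k)) \<le> L2_norm N F"
proof -
 have "ennreal ((L2_norm R (%v. F (v, k)))^2) = (\<Sum>l\<in>{k}. ennreal ((L2_norm R (%v. F (v, l)))^2))" by simp
 also have "... \<le> (\<Sum>l. ennreal ((L2_norm R (%v. F (v, l)))^2))" by (rule sum_le_suminf) auto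
 also have "... = ennreal ((L2_norm N F)^2)" by (rule L2_norm_slices[OF assms, symmetric])
 finally show ?thesis by simp
qed

text \<open>Right translations are isometric, so each term costs at most the modulus of its
  coefficient, and these add up to \<open>ksum k\<close>.\<close>

lemma Op_norm:
 assumes k: "kernel k" and F: "F \<in> L2 N" shows "L2_norm N (Op k F) \<le> ksum k * L2_norm N F"
proof -
 have "L2_norm N (Op k F) \<le> (\<Sum>jb\<in>Op_ix k. L2_norm N (Op_term k F jb))"
  unfolding Op_sum[OF k] by (intro L2_norm_sum_le Op_term_L2 F)
 also have "... \<le> (\<Sum>jb\<in>Op_ix k. \<bar>k (rp (fst jb)) (snd jb)\<bar> * L2_norm N F)"
 proof (rule sum_mono)
  fix jb assume "jb \<in> Op_ix k"
  then have g: "gpart (snd jb) \<in> carrier G" using Op_ix_D gpart_in by blast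
  show "L2_norm N (Op_term k F jb) \<le> \<bar>k (rp (fst jb)) (snd jb)\<bar> * L2_norm N F" using g
   by (simp add: Op_term_def L2_norm_scale norm_embed rho_L2 L2_slice F mult_left_mono norm_slice)
 qed
 finally show ?thesis
  unfolding ksum_def Op_ix_def sum_distrib_right by (subst sum.Sigma) (auto intro: finite_supp[OF k] rp_in simp: split_beta)
qed

lemma Op_cong_AE:
 assumes k: "kernel k" and F: "F \<in> L2 N" "F' \<in> L2 N" and eq: "AE w in N. F w = F' w"
 shows "AE w in N. Op k F w = Op k F' w"
proof -
 let ?d = "%w. F w + (-1) * F' w"
 have d: "?d \<in> L2 N" by (rule L2_lin[OF F])
 have "L2_norm N (Op k ?d) \<le> 0" using eq using L2_norm_eq_0_iff[OF d] using Op_norm[OF k d] by simp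
 then have "AE w in N. Op k ?d w = 0" using L2_norm_nonneg[of N "Op k ?d"] using L2_norm_eq_0_iff[OF Op_L2[OF k d]] by linarith
 then show ?thesis unfolding Op_lin by simp
qed

lemma inner_embed_left:
 assumes "F \<in> L2 N" "f \<in> L2 R" shows "L2_inner N (embed k f) F = L2_inner R f (%v. F (v, k))"
 using inner_embed[OF assms, of k] by (metis L2_inner_cnj)

lemma Op_adjoint:
 assumes k: "kernel k" and F: "F \<in> L2 N" and F': "F' \<in> L2 N"
 shows "L2_inner N (Op k F) F' = L2_inner N F (Op (ktr k) F')"
proof -
 let ?s = "%F l v. F (v, l)"
 note tk = kernel_tr[OF k]
 have 1: "L2_inner N (Op k F) F' = (\<Sum>jb\<in>Op_ix k. of_real (k (rp (fst jb)) (snd jb)) *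
   L2_inner R (?s F (ipart (snd jb))) (rho (inv (gpart (snd jb))) (?s F' (fst jb))))"
  if k: "kernel k" and F: "F \<in> L2 N" and F': "F' \<in> L2 N" for k F F'
 proof -
  have "L2_inner N (Op k F) F' = (\<Sum>jb\<in>Op_ix k. L2_inner N (Op_term k F jb) F')"
   unfolding Op_sum[OF k] by (intro L2_inner_sum Op_term_L2 F F')
  also have "... = (\<Sum>jb\<in>Op_ix k. of_real (k (rp (fst jb)) (snd jb)) *
   L2_inner R (?s F (ipart (snd jb))) (rho (inv (gpart (snd jb))) (?s F' (fst jb))))"
  using Op_ix_D gpart_in F F'
  by (auto simp: Op_term_def L2_inner_scale inner_embed_left rho_adjoint embed_L2 rho_L2 L2_slice)
  finally show ?thesis .
 qed
 have "L2_inner N F (Op (ktr k) F') = cnj (L2_inner N (Op (ktr k) F') F)" by (simp add: L2_inner_cnj)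
 also have "... = (\<Sum>lb\<in>Op_ix (ktr k). of_real (k (snd lb) (rp (fst lb))) *
   L2_inner R (rho (inv (gpart (snd lb))) (?s F (fst lb))) (?s F' (ipart (snd lb))))"
  unfolding 1[OF tk F' F] by (simp add: ktr_def L2_inner_cnj)
 also have "... = (\<Sum>lb\<in>Op_ix (ktr k). of_real (k (snd lb) (rp (fst lb))) *
   L2_inner R (?s F (fst lb)) (rho (gpart (snd lb)) (?s F' (ipart (snd lb)))))"
  by (intro sum.cong refl arg_cong2[where f="(*)"], subst rho_adjoint)
   (use Op_ix_D[of _ "ktr k"] in \<open>auto intro!: L2_slice F F' simp: gpart_in\<close>)
 also have "... = (\<Sum>jb\<in>Op_ix k. of_real (k (rp (fst jb)) (snd jb)) *
   L2_inner R (?s F (ipart (snd jb))) (rho (inv (gpart (snd jb))) (?s F' (fst jb))))"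
 \<comment> \<open>The entry from \<open>rp j\<close> to \<open>b\<close> is translated by
   \<open>inv (gpart b)\<close>, which makes \<open>rp (ipart b)\<close> the new starting point;
   this involution matches the terms of \<open>k\<close> with those of its transpose.\<close>
 proof (rule sum.reindex_bij_witness[where
    i="%jb. (ipart (snd jb), mv (inv (gpart (snd jb))) (rp (fst jb)))" and
    j="%lb. (ipart (snd lb), mv (inv (gpart (snd lb))) (rp (fst lb)))"])
  have swap: "k' (mv (inv (gpart b)) (rp j)) (rp (ipart b)) = k' (rp j) b" if "kernel k'" "b \<in> B" "j < m" for k' b j
  proof -
   note p = parts[OF that(2)]
   have "k' (mv (gpart b) (mv (inv (gpart b)) (rp j))) (mv (gpart b) (rp (ipart b)))
    = k' (mv (inv (gpart b)) (rp j)) (rp (ipart b))"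
    using p that by (intro kernel_inv) (auto simp: mv_in rp_in)
   then show ?thesis using p that by (simp add: rp_in)
  qed
  fix lb assume lb: "lb \<in> Op_ix (ktr k)"
  then obtain l b where l: "lb = (l, b)" "l < m" "b \<in> B" "k b (rp l) \<noteq> 0"
   by (auto simp: Op_ix_def supp_def ktr_def)
  note p = parts[OF l(3)]
  show "(ipart (snd (ipart (snd lb), mv (inv (gpart (snd lb))) (rp (fst lb)))),
     mv (inv (gpart (snd (ipart (snd lb), mv (inv (gpart (snd lb))) (rp (fst lb))))))
      (rp (fst (ipart (snd lb), mv (inv (gpart (snd lb))) (rp (fst lb)))))) = lb"
   using l p by (simp add: parts_unique)
  show "(ipart (snd lb), mv (inv (gpart (snd lb))) (rp (fst lb))) \<in> Op_ix k"
   using l p swap[OF tk l(3,2)] by (auto simp: Op_ix_def supp_def ktr_def mv_in rp_in)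
  show "of_real (k (rp (fst (ipart (snd lb), mv (inv (gpart (snd lb))) (rp (fst lb)))))
      (snd (ipart (snd lb), mv (inv (gpart (snd lb))) (rp (fst lb))))) *
    L2_inner R (?s F (ipart (snd (ipart (snd lb), mv (inv (gpart (snd lb))) (rp (fst lb))))))
     (rho (inv (gpart (snd (ipart (snd lb), mv (inv (gpart (snd lb))) (rp (fst lb))))))
      (?s F' (fst (ipart (snd lb), mv (inv (gpart (snd lb))) (rp (fst lb)))))) =
    of_real (k (snd lb) (rp (fst lb))) * L2_inner R (?s F (fst lb)) (rho (gpart (snd lb)) (?s F' (ipart (snd lb))))"
   using l p swap[OF tk l(3,2)] by (simp add: parts_unique ktr_def)
 next
  fix jb assume "jb \<in> Op_ix k"
  then obtain j b where j: "jb = (j, b)" "j < m" "b \<in> B" "k (rp j) b \<noteq> 0" by (auto simp: Op_ix_def supp_def)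
  note p = parts[OF j(3)]
  have swap: "k (mv (inv (gpart b)) (rp j)) (rp (ipart b)) = k (rp j) b"
  proof -
   have "k (mv (gpart b) (mv (inv (gpart b)) (rp j))) (mv (gpart b) (rp (ipart b)))
    = k (mv (inv (gpart b)) (rp j)) (rp (ipart b))"
    using p j by (intro kernel_inv k) (auto simp: mv_in rp_in)
   then show ?thesis using p j by (simp add: rp_in)
  qed
  show "(ipart (snd (ipart (snd jb), mv (inv (gpart (snd jb))) (rp (fst jb)))),
     mv (inv (gpart (snd (ipart (snd jb), mv (inv (gpart (snd jb))) (rp (fst jb))))))
      (rp (fst (ipart (snd jb), mv (inv (gpart (snd jb))) (rp (fst jb)))))) = jb"
   using j p by (simp add: parts_unique)
  show "(ipart (snd jb), mv (inv (gpart (snd jb))) (rp (fst jb))) \<in> Op_ix (ktr k)"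
   using j p swap by (auto simp: Op_ix_def supp_def ktr_def mv_in rp_in)
 qed
 also have "... = L2_inner N (Op k F) F'" by (rule 1[OF k F F', symmetric])
 finally show ?thesis by simp
qed

section \<open>The trace of a kernel operator on the orbit relation\<close>

lemma inner_e:
 assumes F: "F \<in> L2 N" and j: "j < m"
 shows "L2_inner N F (e j) = (\<integral>x. lift F x (rp j) \<partial>M)"
proof -
 have "L2_inner N F (e j) = L2_inner R (%v. F (v, j)) (indicator Id)"
  unfolding e_def by (rule inner_embed[OF F Id_L2])
 also have "... = (\<integral>v. indicator (graph_of \<one> (space M)) v *\<^sub>R F (v, j) \<partial>R)" unfolding L2_inner_def
 proof (rule Bochner_Integration.integral_cong[OF refl])
  fix v assume v: "v \<in> space R"
  obtain x y where vx: "v = (x, y)" by (metis surj_pair)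
  have "v \<in> graph_of \<one> (space M) \<longleftrightarrow> v \<in> Id" using v space_RD by (auto simp: vx graph_of_iff a_one)
  then show "F (v, j) * cnj (indicator Id v) = indicator (graph_of \<one> (space M)) v *\<^sub>R F (v, j)" by auto
 qed
 also have "... = (\<integral>x. indicator (space M) x *\<^sub>R F ((x, a \<one> x), j) \<partial>M)"
  by (rule integral_graph) (use L2_measurable[OF L2_slice[OF F]] in auto)
 also have "... = (\<integral>x. lift F x (rp j) \<partial>M)"
  by (rule Bochner_Integration.integral_cong) (auto simp: lift_def parts_rp j a_one)
 finally show ?thesis .
qed

definition "stab x = {g \<in> carrier G. a g x = x}"

lemma stab_subgroup: assumes x: "x \<in> space M" shows "subgroup (stab x) G"
proof (rule subgroupI)
 show "stab x \<subseteq> carrier G" by (auto simp: stab_def)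
 show "stab x \<noteq> {}" using a_one[OF x] by (auto simp: stab_def)
 show "inv g \<in> stab x" if "g \<in> stab x" for g
 proof -
  have g: "g \<in> carrier G" "a g x = x" using that by (auto simp: stab_def)
  have "a (inv g) (a g x) = x" by (rule a_inv(1)[OF g(1) x])
  then show ?thesis by (simp add: g stab_def)
 qed
 show "g \<otimes> h \<in> stab x" if "g \<in> stab x" "h \<in> stab x" for g h using x that by (auto simp: stab_def a_mult)
qed

text \<open>Over \<open>x\<close> the trace vector is the indicator of the stabilizer orbit of
  \<open>rp j\<close>, so this is a diagonal entry of the kernel on the quotient by the
  stabilizer.\<close>

lemma kop_lift_e:
 assumes k: "kernel k" and j: "j < m" and x: "x \<in> space M"
 shows "kop k (lift (e j) x) (rp j) = of_real (\<Sum>\<gamma>\<in>fixers k j. if a \<gamma> x = x then k (rp j) (mv \<gamma> (rp j)) else 0)"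
proof -
 let ?cl = "%b. (%s. mv s b) ` stab x"
 have S: "subgroup (stab x) G" by (rule stab_subgroup[OF x])
 interpret q: gset_quotient G B mv rp m "stab x" ?cl
 proof (intro gset_quotient.intro free_gset_axioms gset_quotient_axioms.intro S)
  fix b b' assume b: "b \<in> B" "b' \<in> B"
  note Sc = subgroup.mem_carrier[OF S]
  show "?cl b = ?cl b' \<longleftrightarrow> (\<exists>s\<in>stab x. b' = mv s b)"
  proof
   assume eq: "?cl b = ?cl b'"
   have "b' \<in> ?cl b'" using subgroup.one_closed[OF S] b by (intro image_eqI[of _ _ \<one>]) (auto simp: mv_one)
   then show "\<exists>s\<in>stab x. b' = mv s b" using eq by auto
  next
   assume "\<exists>s\<in>stab x. b' = mv s b"
   then obtain s where s: "s \<in> stab x" "b' = mv s b" by blast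
   show "?cl b = ?cl b'"
   proof (intro Set.set_eqI iffI)
    fix c assume "c \<in> ?cl b"
    then obtain r where r: "r \<in> stab x" "c = mv r b" by blast
    then have "c = mv (r \<otimes> inv s) b'" using s b Sc by (simp add: mv_mult)
    then show "c \<in> ?cl b'" using r s S by (auto simp: subgroup.m_closed subgroup.m_inv_closed)
   next
    fix c assume "c \<in> ?cl b'"
    then obtain r where r: "r \<in> stab x" "c = mv r b'" by blast
    then have "c = mv (r \<otimes> s) b" using s b Sc by (simp add: mv_mult)
    then show "c \<in> ?cl b" using r s S by (auto simp: subgroup.m_closed)
   qed
  qed
 qed
 have lift_e: "lift (e j) x b = of_bool (?cl b = ?cl (rp j))" if b: "b \<in> B" for b
 proof -
  note p = parts[OF b]
  have "?cl b = ?cl (rp j) \<longleftrightarrow> (\<exists>s\<in>stab x. b = mv s (rp j))" using q.cl_eq[OF rp_in[OF j] b] by auto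
  also have "... \<longleftrightarrow> ipart b = j \<and> gpart b \<in> stab x" using j p by (auto simp: parts_unique stab_def)
  also have "gpart b \<in> stab x \<longleftrightarrow> a (inv (gpart b)) x = x"
   using p(1) x unfolding stab_def by (metis (mono_tags, lifting) a_inv mem_Collect_eq)
  finally show ?thesis by (auto simp: lift_def e_def embed_def)
 qed
 have "kop k (lift (e j) x) (rp j) = kop k (%b. of_bool (?cl b = ?cl (rp j))) (rp j)"
  by (rule kop_cong) (rule lift_e)
 also have "... = of_real (q.kmat k (?cl (rp j)) (?cl (rp j)))" by (rule q.kop_indicator[OF k rp_in[OF j]])
 also have "q.kmat k (?cl (rp j)) (?cl (rp j)) = q.kmat k (?cl (mv \<one> (rp j))) (?cl (mv \<one> (rp j)))"
  using j by (simp add: mv_one rp_in)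
 also have "... = (\<Sum>\<gamma>\<in>fixers k j. if \<one> \<otimes> \<gamma> \<otimes> inv \<one> \<in> stab x then k (rp j) (mv \<gamma> (rp j)) else 0)"
  by (rule q.kmat_diagonal[OF k one_closed j])
 finally show ?thesis by (simp add: fixers_def stab_def)
qed

text \<open>Integrating \<open>kop_lift_e\<close> over \<open>x\<close> replaces the condition that
  \<open>\<gamma>\<close> fixes \<open>x\<close> by the measure of its fixed point set: the
  counterpart of the trace formula for a finite quotient.\<close>

lemma trace_pow:
 assumes k: "kernel k" and j: "j < m"
 shows "L2_inner N ((Op k ^^ n) (e j)) (e j)
  = of_real (trace_sum (kpow k n) j (%\<gamma>. measure M {x \<in> space M. a \<gamma> x = x}))"
proof -
 have L: "(Op k ^^ n) (e j) \<in> L2 N" by (induction n) (auto intro: e_L2 Op_L2 k)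
 note kn = kernel_pow[OF k, of n]
 let ?t = "%\<gamma>. kpow k n (rp j) (mv \<gamma> (rp j))"
 have "L2_inner N ((Op k ^^ n) (e j)) (e j) = (\<integral>x. lift ((Op k ^^ n) (e j)) x (rp j) \<partial>M)"
  by (rule inner_e[OF L j])
 also have "... = (\<integral>x. of_real (\<Sum>\<gamma>\<in>fixers (kpow k n) j. ?t \<gamma> * indicator {x \<in> space M. a \<gamma> x = x} x) \<partial>M)"
  by (rule Bochner_Integration.integral_cong[OF refl]) (auto simp: lift_pow[OF k _ rp_in[OF j]] kop_lift_e[OF kn j] intro!: sum.cong)
 also have "... = of_real (\<integral>x. (\<Sum>\<gamma>\<in>fixers (kpow k n) j. ?t \<gamma> * indicator {x \<in> space M. a \<gamma> x = x} x) \<partial>M)"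
  by (rule integral_complex_of_real)
 also have "(\<integral>x. (\<Sum>\<gamma>\<in>fixers (kpow k n) j. ?t \<gamma> * indicator {x \<in> space M. a \<gamma> x = x} x) \<partial>M)
   = (\<Sum>\<gamma>\<in>fixers (kpow k n) j. ?t \<gamma> * measure M {x \<in> space M. a \<gamma> x = x})"
 proof -
  interpret finite_measure M by (rule finite_M)
  have "{x \<in> space M. a \<gamma> x = x} \<in> sets M" if "\<gamma> \<in> fixers (kpow k n) j" for \<gamma>
   using that by (auto simp: fixers_def intro: a_fix)
  then show ?thesis by (subst Bochner_Integration.integral_sum) (auto simp: less_top[symmetric])
 qed
 finally show ?thesis by (simp add: trace_sum_def)
qed

end

text \<open>\<open>E\<close> collects the equations of harmonic chains, as a kernel with columns indexed by the orbits
 in \<open>J\<close>. For \<open>C \<ge> \<parallel>E\<^sup>* E\<parallel>\<close> the powers of \<open>T = 1 - E\<^sup>* E / C\<close> converge to the projection onto its zeros.\<close>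

locale kernel_contraction = free_gset +
 fixes J :: "nat set" and E :: "'c => 'c => real" and C :: real
 assumes J: "J \<subseteq> {..<m}" and E: "kernel E"
  and E_col: "\<And>b b'. b \<in> B ==> b' \<in> B ==> E b b' \<noteq> 0 ==> ipart b' \<in> J"
  and C1: "1 \<le> C" and C_large: "ksum (kmul (ktr E) E) \<le> C"
begin

definition "kL = kmul (ktr E) E"
definition "kchi b b' = (of_bool (b = b' \<and> ipart b \<in> J) :: real)"
text \<open>With the identity in place of \<open>kchi\<close>, simplices of other dimensions, on
  which \<open>kL\<close> vanishes, would be fixed and would count in the trace.\<close>

definition "kT b b' = 1 * kchi b b' + (- (1 / C)) * kL b b'"

lemma kernel_L: "kernel kL" unfolding kL_def by (intro kernel_mul kernel_tr E)

lemma kernel_chi: "kernel kchi" by (auto simp: kernel_def supp_def kchi_def inj_on_eq_iff[OF mv_inj] parts_mv)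

lemma kernel_T: "kernel kT" unfolding kT_def[abs_def] by (intro kernel_lin kernel_chi kernel_L)

lemma L_expand:
 assumes "b \<in> B" "finite S" "{b'' \<in> B. E b'' b \<noteq> 0} \<subseteq> S" "S \<subseteq> B"
 shows "kL b b' = (\<Sum>b''\<in>S. E b'' b * E b'' b')"
 unfolding kL_def by (subst kmul_superset[of S]) (use assms in \<open>auto simp: supp_def ktr_def\<close>)

lemma L_sym: assumes "b \<in> B" "b' \<in> B" shows "kL b b' = kL b' b"
proof -
 let ?S = "{b'' \<in> B. E b'' b \<noteq> 0} \<union> {b'' \<in> B. E b'' b' \<noteq> 0}"
 show ?thesis using finite_cosupp[OF E] using assms by (subst (1 2) L_expand[of _ ?S]) (auto simp: mult.commute)
qed

lemma L_supp: assumes "b \<in> B" "b' \<in> B" "kL b b' \<noteq> 0" shows "ipart b \<in> J" "ipart b' \<in> J"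
proof -
 have *: "ipart b' \<in> J" if "b \<in> B" "b' \<in> B" "kL b b' \<noteq> 0" for b b'
 proof -
  have "(\<Sum>b''\<in>supp (ktr E) b. ktr E b b'' * E b'' b') \<noteq> 0" using that by (simp add: kL_def kmul_def)
  then obtain b'' where "b'' \<in> supp (ktr E) b" "ktr E b b'' * E b'' b' \<noteq> 0"
   by (rule sum.not_neutral_contains_not_neutral)
  then show ?thesis using E_col that by (auto simp: supp_def)
 qed
 show "ipart b \<in> J" "ipart b' \<in> J" using *[of b b'] *[of b' b] L_sym assms by auto
qed

lemma kop_chi: "b \<in> B ==> kop kchi h b = (if ipart b \<in> J then h b else 0)"
 by (subst kop_superset[of "{b}"]) (auto simp: supp_def kchi_def)

lemma kop_T: "b \<in> B ==> kop kT h b = (if ipart b \<in> J then h b else 0) - kop kL h b / of_real C"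
 unfolding kT_def[abs_def] by (subst kop_combine) (auto simp: kernel_chi kernel_L kop_chi)

end

locale harmonic_op = pmp_gset G M a B mv rp m + kernel_contraction G B mv rp m J E C
 for G :: "('g, 'n) monoid_scheme" (structure) and M :: "'x measure" and a :: "'g => 'x => 'x"
  and B :: "'b set" and mv :: "'g => 'b => 'b" and rp :: "nat => 'b" and m :: nat
  and J :: "nat set" and E :: "'b => 'b => real" and C :: real
begin

abbreviation "T \<equiv> Op kT"

definition cut :: "(('x \<times> 'x) \<times> nat => complex) => ('x \<times> 'x) \<times> nat => complex" where
 "cut F w = (if snd w \<in> J then F w else 0)"

definition harm :: "(('x \<times> 'x) \<times> nat => complex) set" where
 "harm = {F \<in> L2 N. (AE w in N. F w = cut F w) \<and> (AE w in N. Op E F w = 0)}"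

lemma cut_L2: assumes "F \<in> L2 N" shows "cut F \<in> L2 N" "L2_norm N (cut F) \<le> L2_norm N F"
proof -
 have m: "cut F \<in> borel_measurable N"
  unfolding N_measurable_iff using L2_measurable[OF L2_slice[OF assms]] by (simp add: cut_def)
 have le: "nn_integral N (%w. nsq (cut F w)) \<le> nn_integral N (%w. nsq (F w))"
  by (rule nn_integral_mono) (auto simp: cut_def)
 then show 1: "cut F \<in> L2 N" using assms L2_measurable[OF assms] m by (auto simp: L2_iff_nn_integral)
 show "L2_norm N (cut F) \<le> L2_norm N F"
  using le unfolding L2_norm_nn_integral[OF assms, symmetric] L2_norm_nn_integral[OF 1, symmetric] by simp
qed

lemma lift_cut: "lift (cut F) x b = (if ipart b \<in> J then lift F x b else 0)" by (simp add: lift_def cut_def)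

lemma T_eq:
 assumes w: "w \<in> space N" shows "T F w = cut F w - Op kL (cut F) w / of_real C"
proof -
 obtain x g j where wx: "x \<in> space M" "g \<in> carrier G" "w = ((a g x, x), j)" by (rule space_N_cases[OF w])
 show ?thesis
 proof (cases "j < m")
  case True
  let ?b = "mv (inv g) (rp j)"
  have b: "?b \<in> B" using wx True by (simp add: mv_in rp_in)
  have "kop kL (lift F x) ?b = kop kL (lift (cut F) x) ?b"
   unfolding kop_def using L_supp(2)[OF b] by (intro sum.cong) (auto simp: supp_def lift_cut)
  then show ?thesis using True wx b kernel_T kernel_L by (simp add: point_lift lift_Op kop_T lift_cut)
 next
  case False
  then show ?thesis using J wx by (auto simp: Op_def cut_def)
 qed
qed

lemma Op_L_form:
 assumes F: "F \<in> L2 N" shows "L2_inner N (Op kL F) F = of_real ((L2_norm N (Op E F))^2)"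
proof -
 have "L2_inner N (Op kL F) F = L2_inner N (Op (ktr E) (Op E F)) F"
  using F by (intro L2_inner_cong_AE Op_L2 kernel_L) (auto simp: kL_def Op_mul kernel_tr E)
 also have "... = L2_inner N (Op E F) (Op (ktr (ktr E)) F)" by (intro Op_adjoint kernel_tr E Op_L2 F)
 also have "ktr (ktr E) = E" by (auto simp: ktr_def fun_eq_iff)
 finally show ?thesis by (simp add: L2_inner_self)
qed

lemma Op_L_sym:
 assumes "F \<in> L2 N" "F' \<in> L2 N" shows "L2_inner N (Op kL F) F' = L2_inner N F (Op kL F')"
proof -
 have "Op (ktr kL) F' = Op kL F'" by (rule Op_kcong) (simp add: ktr_def L_sym)
 then show ?thesis using Op_adjoint[OF kernel_L assms] by simp
qed

text \<open>Quantifies the loss of norm: it is at least the squared defect in the equations divided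
  by \<open>C\<close>, so a vector whose norm is preserved solves the equations.\<close>

lemma T_norm:
 assumes F: "F \<in> L2 N"
 shows "(L2_norm N (T F))^2 \<le> (L2_norm N F)^2 - (L2_norm N (Op E (cut F)))^2 / C"
proof -
 note cF = cut_L2(1)[OF F]
 have TL: "T F \<in> L2 N" by (rule Op_L2[OF kernel_T F])
 have ks: "ksum kL \<le> C" using C_large by (simp add: kL_def)
 have e1: "L2_norm N (T F) = L2_norm N (%w. cut F w - Op kL (cut F) w / of_real C)"
 proof (rule L2_norm_cong_AE[OF TL])
  show "AE w in N. T F w = cut F w - Op kL (cut F) w / of_real C" by (intro AE_I2 T_eq)
  show "(%w. cut F w - Op kL (cut F) w / of_real C) \<in> L2 N"
   using L2_lin[OF cF Op_L2[OF kernel_L cF], of "- 1 / of_real C"] by simp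
 qed
 have e2: "(L2_norm N (%w. cut F w - Op kL (cut F) w / of_real C))^2 \<le> (L2_norm N (cut F))^2 - Re (L2_inner N (Op kL (cut F)) (cut F)) / C"
 proof (rule psd_contraction[where A="Op kL"])
  fix f assume f: "f \<in> L2 N"
  show "0 \<le> Re (L2_inner N (Op kL f) f)" unfolding Op_L_form[OF f] by simp
  have "Re (L2_inner N (Op kL f) f) \<le> L2_norm N (Op kL f) * L2_norm N f"
   using L2_Cauchy_Schwarz[OF Op_L2[OF kernel_L f] f] complex_Re_le_cmod order_trans by blast
  also have "... \<le> (C * L2_norm N f) * L2_norm N f"
   by (intro mult_right_mono order_trans[OF Op_norm[OF kernel_L f] mult_right_mono[OF ks]]) auto
  finally show "Re (L2_inner N (Op kL f) f) \<le> C * (L2_norm N f)^2" by (simp add: power2_eq_square)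
 qed (use C1 in \<open>auto simp: Op_lin Op_L2 kernel_L Op_L_sym cF\<close>)
 have e3: "Re (L2_inner N (Op kL (cut F)) (cut F)) = (L2_norm N (Op E (cut F)))^2"
  unfolding Op_L_form[OF cF] by simp
 have "(L2_norm N (cut F))^2 \<le> (L2_norm N F)^2" using cut_L2(2)[OF F] by simp
 then show ?thesis using e2 unfolding e1 e3 by linarith
qed

sublocale con: symmetric_contraction N T
proof
 fix F F' assume F: "F \<in> L2 N" "F' \<in> L2 N"
 have "kchi b b' = kchi b' b" for b b' by (auto simp: kchi_def)
 then have "Op (ktr kT) F' = Op kT F'" by (intro Op_kcong) (simp add: ktr_def kT_def L_sym)
 then show "L2_inner N (T F) F' = L2_inner N F (T F')" using Op_adjoint[OF kernel_T F] by simp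
next
 fix F assume F: "F \<in> L2 N"
 have "0 \<le> (L2_norm N (Op E (cut F)))^2 / C" using C1 by simp
 then have "(L2_norm N (T F))^2 \<le> (L2_norm N F)^2" using T_norm[OF F] by linarith
 then show "L2_norm N (T F) \<le> L2_norm N F" by simp
qed (auto simp: Op_lin Op_L2 kernel_T)

lemma Op_E_cut: "w \<in> space N ==> Op E (cut F) w = Op E F w"
proof (rule Op_eqI)
 fix x b assume x: "x \<in> space M" and b: "b \<in> B"
 show "lift (Op E (cut F)) x b = lift (Op E F) x b" unfolding lift_Op[OF E x b] kop_def using E_col[OF b]
  by (intro sum.cong) (auto simp: supp_def lift_cut)
qed

text \<open>The square of \<open>T\<close> fixes the limit, so its norm is preserved already by the
  first application and \<open>T_norm\<close> forces the equations to hold. Values of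
  \<open>T\<close> live on the copies in \<open>J\<close>.\<close>

lemma proj_harm: assumes F: "F \<in> L2 N" shows "con.proj F \<in> harm"
proof -
 let ?p = "con.proj F"
 have p: "?p \<in> L2 N" by (rule con.proj_L2[OF F])
 have Tp: "T ?p \<in> L2 N" by (rule con.L2[OF p])
 have eq: "AE w in N. T (T ?p) w = ?p w" by (rule con.proj_TT[OF F])
 have "L2_norm N ?p = L2_norm N (T (T ?p))" using eq by (intro L2_norm_cong_AE p con.L2) auto
 also have "... \<le> L2_norm N (T ?p)" by (rule con.contr[OF Tp])
 finally have "(L2_norm N ?p)^2 \<le> (L2_norm N (T ?p))^2" by simp
 with T_norm[OF p] have "(L2_norm N (Op E (cut ?p)))^2 / C \<le> 0" by linarith
 then have 1: "AE w in N. Op E ?p w = 0" using C1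
  using L2_norm_eq_0_iff[OF Op_L2[OF E cut_L2(1)[OF p]]] by (simp add: divide_le_0_iff Op_E_cut)
 have "AE w in N. T (T ?p) w = cut (T (T ?p)) w"
 proof (rule AE_I2)
  fix w assume w: "w \<in> space N"
  obtain x g j where wx: "x \<in> space M" "g \<in> carrier G" "w = ((a g x, x), j)" by (rule space_N_cases[OF w])
  have "Op kL F' w = 0" if "j \<notin> J" for F'
  proof (cases "j < m")
   case True
   have "supp kL (rp j) = {}" using that L_supp(1)[OF rp_in[OF True]] by (auto simp: supp_def parts_rp True)
   then show ?thesis using wx by (simp add: Op_def)
  qed (simp add: wx Op_def)
  then show "T (T ?p) w = cut (T (T ?p)) w" using T_eq[OF w] wx by (auto simp: cut_def)
 qed
 with eq have "AE w in N. ?p w = cut ?p w" by (auto simp: cut_def)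
 with 1 p show ?thesis by (simp add: harm_def)
qed

lemma T_harm: assumes "F \<in> harm" shows "AE w in N. T F w = F w"
proof -
 have F: "F \<in> L2 N" "AE w in N. F w = cut F w" "AE w in N. Op E F w = 0" using assms by (auto simp: harm_def)
 have "AE w in N. Op (ktr E) (Op E F) w = Op (ktr E) (%w. 0) w" by (intro Op_cong_AE kernel_tr E Op_L2 F L2_zero)
 moreover have "AE w in N. Op kL F w = Op (ktr E) (Op E F) w" by (rule) (simp add: kL_def Op_mul kernel_tr E)
 moreover have "Op (ktr E) (%w. 0) w = 0" for w by (simp add: Op_def split_beta)
 moreover have "AE w in N. Op kL (cut F) w = Op kL F w"
  using F(2) by (intro Op_cong_AE kernel_L cut_L2 F) auto
 moreover have "AE w in N. T F w = cut F w - Op kL (cut F) w / of_real C" by (intro AE_I2 T_eq)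
 ultimately show ?thesis using F(2) by auto
qed

lemma proj_harm_id: "F \<in> harm ==> AE w in N. con.proj F w = F w"
 by (rule con.proj_fix[OF _ T_harm]) (auto simp: harm_def)

lemma proj_norm_e: "of_real ((L2_norm N (con.proj (e j)))^2) = L2_inner N (con.proj (e j)) (e j)"
proof -
 let ?p = "con.proj (e j)"
 have p: "?p \<in> L2 N" by (rule con.proj_L2[OF e_L2])
 have "L2_inner N (%v. e j v - ?p v) ?p = 0"
  by (rule con.proj_orthogonal[OF e_L2 p T_harm[OF proj_harm[OF e_L2]]])
 then have "L2_inner N (e j) ?p = L2_inner N ?p ?p" by (simp add: L2_inner_diff e_L2 p)
 then show ?thesis by (metis L2_inner_cnj L2_inner_self)
qed

text \<open>\<open>T\<close> kills trace vectors of copies outside \<open>J\<close>, in particular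
  of all copies that label no representative, so the infinite trace becomes a finite sum.\<close>

lemma proj_e_outside: assumes "j \<notin> J" shows "L2_norm N (con.proj (e j)) = 0"
proof -
 have "T (e j) w = 0" if w: "w \<in> space N" for w using assms using T_eq[OF w] by (simp add: cut_def e_def embed_def Op_def split_beta)
 then have z: "AE w in N. (T ^^ 1) (e j) w = 0" by simp
 have "AE w in N. (T ^^ Suc n) (e j) w = 0" for n
 proof -
  have "AE w in N. (T ^^ n) ((T ^^ 1) (e j)) w = (T ^^ n) (%w. 0) w"
   using z by (intro con.pow_cong_AE con.pow_L2 e_L2 L2_zero)
  then show ?thesis by (simp add: con.pow_zero funpow_swap1)
 qed
 then have "L2_norm N (%w. (T ^^ (2 * Suc k)) (e j) w - (%w. 0) w) = 0" for k
  by (subst L2_norm_eq_0_iff) (auto intro!: con.pow_L2 e_L2 simp del: funpow.simps)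
 then have "(%k. L2_norm N (%w. (T ^^ (2 * Suc k)) (e j) w - (%w. 0) w)) \<longlonglongrightarrow> 0" by simp
 then have "(%k. L2_norm N (%w. (T ^^ (2 * k)) (e j) w - (%w. 0) w)) \<longlonglongrightarrow> 0" by (rule LIMSEQ_imp_Suc)
 then have "AE w in N. con.proj (e j) w = 0" by (intro con.proj_unique e_L2 L2_zero)
 then show ?thesis by (subst L2_norm_eq_0_iff) (auto intro: con.proj_L2 e_L2)
qed

theorem proj_trace:
 shows "(\<Sum>j. ennreal ((L2_norm N (con.proj (e j)))^2)) = ennreal (\<Sum>j\<in>J. (L2_norm N (con.proj (e j)))^2)"
  and "(%n. \<Sum>j\<in>J. trace_sum (kpow kT (2*n)) j (%\<gamma>. measure M {x \<in> space M. a \<gamma> x = x}))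
   \<longlonglongrightarrow> (\<Sum>j\<in>J. (L2_norm N (con.proj (e j)))^2)"
proof -
 have fin: "finite J" using J finite_subset by blast
 have "(\<Sum>j. ennreal ((L2_norm N (con.proj (e j)))^2)) = (\<Sum>j\<in>J. ennreal ((L2_norm N (con.proj (e j)))^2))"
  by (rule suminf_finite[OF fin]) (simp add: proj_e_outside)
 then show "(\<Sum>j. ennreal ((L2_norm N (con.proj (e j)))^2)) = ennreal (\<Sum>j\<in>J. (L2_norm N (con.proj (e j)))^2)"
  by simp
 show "(%n. \<Sum>j\<in>J. trace_sum (kpow kT (2*n)) j (%\<gamma>. measure M {x \<in> space M. a \<gamma> x = x}))
   \<longlonglongrightarrow> (\<Sum>j\<in>J. (L2_norm N (con.proj (e j)))^2)"
 proof (rule tendsto_sum)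
  fix j assume "j \<in> J"
  then have j: "j < m" using J by auto
  have "(%n. Re (L2_inner N ((T ^^ (2*n)) (e j)) (e j))) \<longlonglongrightarrow> Re (L2_inner N (con.proj (e j)) (e j))"
   by (intro tendsto_Re L2_inner_tendsto con.pow_L2 con.proj_L2 con.proj_lim e_L2)
  then show "(%n. trace_sum (kpow kT (2*n)) j (%\<gamma>. measure M {x \<in> space M. a \<gamma> x = x}))
    \<longlonglongrightarrow> (L2_norm N (con.proj (e j)))^2" unfolding trace_pow[OF kernel_T j] proj_norm_e[symmetric] by simp
 qed
qed

end

section \<open>Ordered simplices as a free set\<close>

lemma free_gset_reps:
 fixes mv :: "'g => 'b => 'b" and G :: "('g, 'n) monoid_scheme" (structure)
 assumes "group G"
  and in_B: "\<And>g b. g \<in> carrier G ==> b \<in> B ==> mv g b \<in> B"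
  and mult: "\<And>g h b. g \<in> carrier G ==> h \<in> carrier G ==> b \<in> B ==> mv (g \<otimes> h) b = mv g (mv h b)"
  and one: "\<And>b. b \<in> B ==> mv \<one> b = b"
  and free: "\<And>g b. g \<in> carrier G ==> b \<in> B ==> mv g b = b ==> g = \<one>"
  and F: "finite F" "F \<subseteq> B" "\<And>b. b \<in> B ==> \<exists>g\<in>carrier G. \<exists>b'\<in>F. b = mv g b'"
 obtains rp m where "free_gset G B mv rp m"
proof -
 interpret group G by fact
 define orb where "orb b = (%g. mv g b) ` carrier G" for b
 have orb_eq: "orb (mv g b) = orb b" if "g \<in> carrier G" "b \<in> B" for g b
 proof (intro Set.set_eqI iffI)
  fix c assume "c \<in> orb (mv g b)"
  then obtain h where "h \<in> carrier G" "c = mv h (mv g b)" by (auto simp: orb_def)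
  then show "c \<in> orb b" using that by (auto simp: orb_def mult[symmetric])
 next
  fix c assume "c \<in> orb b"
  then obtain h where h: "h \<in> carrier G" "c = mv h b" by (auto simp: orb_def)
  then have "c = mv (h \<otimes> inv g) (mv g b)" using that by (simp add: mult[symmetric] m_assoc)
  then show "c \<in> orb (mv g b)" using h that by (auto simp: orb_def)
 qed
 obtain h where h: "bij_betw h {..<card (orb ` F)} (orb ` F)"
  using ex_bij_betw_nat_finite[of "orb ` F"] F(1) by (auto simp: lessThan_atLeast0)
 define m where "m = card (orb ` F)"
 define rp where "rp l = (SOME b. b \<in> F \<and> orb b = h l)" for l
 have rp: "rp l \<in> F \<and> orb (rp l) = h l" if "l < m" for l
 proof -
  have "h l \<in> orb ` F" using h that by (auto simp: bij_betw_def m_def)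
  then obtain b where "b \<in> F \<and> orb b = h l" by blast
  then show ?thesis unfolding rp_def by (rule someI)
 qed
 have "free_gset G B mv rp m"
 proof
  fix b assume "b \<in> B"
  then obtain g b' where b': "g \<in> carrier G" "b' \<in> F" "b = mv g b'" using F(3) by blast
  have "orb b' \<in> h ` {..<m}" using h b'(2) by (simp add: bij_betw_def m_def)
  then obtain l where l: "l < m" "h l = orb b'" by auto
  have "b \<in> orb (rp l)" using b' using rp[OF l(1)] l(2) by (auto simp: orb_def)
  then show "\<exists>g\<in>carrier G. \<exists>l<m. b = mv g (rp l)" using l(1) by (auto simp: orb_def)
 next
  fix g l l' assume g: "g \<in> carrier G" and l: "l < m" "l' < m" and eq: "mv g (rp l) = rp l'"
  have "h l = h l'" using orb_eq[OF g, of "rp l"] rp[OF l(1)] rp[OF l(2)] F(2) eq by auto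
  then show "l = l'" using h l by (auto simp: bij_betw_def inj_on_def m_def)
 next
  show "rp l \<in> B" if "l < m" for l using rp[OF that] F(2) by blast
 qed (fact in_B mult one free)+
 then show thesis by (rule)
qed

locale free_simplicial = group G for G :: "('g, 'n) monoid_scheme" (structure) +
 fixes \<Sigma> :: "'v set set" and act :: "'g => 'v => 'v"
 assumes cpx: "abstract_complex \<Sigma>" and simp_act: "simplicial_action G \<Sigma> act"
  and free_act: "free_action G \<Sigma> act" and quot_cpx: "quotient_is_complex G \<Sigma> act"
begin

abbreviation "V \<equiv> \<Union>\<Sigma>"

lemma ga: "group_action G V act" using simp_act by (simp add: simplicial_action_def)

lemma act_in: "g \<in> carrier G ==> v \<in> V ==> act g v \<in> V" using group_action.element_image[OF ga] by blast

lemma act_mult: "g \<in> carrier G ==> h \<in> carrier G ==> v \<in> V ==> act (g \<otimes> h) v = act g (act h v)"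
 using group_action.composition_rule[OF ga] by blast

lemma act_one: "v \<in> V ==> act \<one> v = v" using group_action.id_eq_one[OF ga] by (metis restrict_apply')

lemma act_inj: "g \<in> carrier G ==> inj_on (act g) V" using group_action.inj_prop[OF ga] .

lemma act_simplex: "g \<in> carrier G ==> s \<in> \<Sigma> ==> act g ` s \<in> \<Sigma>"
 using simp_act by (simp add: simplicial_action_def)

lemma simplexD: assumes "s \<in> \<Sigma>"
 shows simplex_finite: "finite s" and simplex_ne: "s \<noteq> {}" and simplex_face: "t \<subseteq> s ==> t \<noteq> {} ==> t \<in> \<Sigma>"
proof -
 have *: "finite s \<and> s \<noteq> {} \<and> (\<forall>\<tau>. \<tau> \<subseteq> s \<and> \<tau> \<noteq> {} --> \<tau> \<in> \<Sigma>)"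
  using cpx assms unfolding abstract_complex_def by blast
 then show "finite s" "s \<noteq> {}" by auto
 show "t \<subseteq> s ==> t \<noteq> {} ==> t \<in> \<Sigma>" using * by blast
qed

lemma vertex_free: assumes "g \<in> carrier G" "v \<in> V" "act g v = v" shows "g = \<one>"
proof -
 have "{v} \<in> \<Sigma>" using assms(2) simplex_face by auto
 then have "stabilizer G (%g \<tau>. act g ` \<tau>) {v} = {\<one>}" using free_act by (simp add: free_action_def)
 then show ?thesis using assms by (auto simp: stabilizer_def)
qed

text \<open>Ordered simplices of all dimensions form one free set, so that boundary, coboundary and
  antisymmetrization are kernels on the same set.\<close>

definition "B = {vs. distinct vs \<and> set vs \<in> \<Sigma>}"
definition "mv g vs = map (act g) vs"

lemma B_ordered: "vs \<in> ordered_simplices \<Sigma> i \<longleftrightarrow> vs \<in> B \<and> length vs = Suc i"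
 by (auto simp: ordered_simplices_def B_def)

lemma B_D: assumes "vs \<in> B" shows "set vs \<subseteq> V" "vs \<noteq> []" "set vs \<in> \<Sigma>" "distinct vs"
 using assms simplex_ne[of "set vs"] by (auto simp: B_def)

lemma B_vertex: "vs \<in> B ==> v \<in> set vs ==> v \<in> V" using B_D by blast

lemma B_sub: "vs \<in> B ==> set us \<subseteq> set vs ==> us \<noteq> [] ==> distinct us ==> us \<in> B"
 using simplex_face[of "set vs" "set us"] by (auto simp: B_def)

lemma mv_B:
 shows "g \<in> carrier G ==> vs \<in> B ==> mv g vs \<in> B"
  and "g \<in> carrier G ==> h \<in> carrier G ==> vs \<in> B ==> mv (g \<otimes> h) vs = mv g (mv h vs)"
  and "vs \<in> B ==> mv \<one> vs = vs"
  and "g \<in> carrier G ==> vs \<in> B ==> mv g vs = vs ==> g = \<one>"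
proof -
 show "mv g vs \<in> B" if g: "g \<in> carrier G" and vs: "vs \<in> B"
 proof -
  have "inj_on (act g) (set vs)" by (rule inj_on_subset[OF act_inj[OF g] B_D(1)[OF vs]])
  then show ?thesis
   using B_D(4)[OF vs] act_simplex[OF g B_D(3)[OF vs]] by (simp add: B_def mv_def distinct_map)
 qed
 show "g \<in> carrier G ==> h \<in> carrier G ==> vs \<in> B ==> mv (g \<otimes> h) vs = mv g (mv h vs)"
  using B_vertex[of vs] by (auto simp: mv_def act_mult)
 show "vs \<in> B ==> mv \<one> vs = vs" using B_vertex[of vs] by (auto simp: mv_def act_one intro: map_idI)
 assume g: "g \<in> carrier G" "vs \<in> B" "mv g vs = vs"
 obtain v ws where v: "vs = v # ws" using B_D(2)[OF g(2)] by (cases vs) auto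
 then show "g = \<one>" using g B_vertex[of vs v] using vertex_free by (auto simp: mv_def)
qed

text \<open>Each of the finitely many orbits of simplices contributes the finitely many orderings of
  the faces of one simplex that represent it.\<close>

lemma reps_exist:
 assumes "cocompact_action G \<Sigma> act"
 obtains rp m where "free_gset G B mv rp m"
proof -
 let ?ph = "%g \<tau>. act g ` \<tau>"
 have fin: "finite (orbits G \<Sigma> ?ph)" using assms by (simp add: cocompact_action_def)
 define rep where "rep Ob = (SOME s. s \<in> Ob \<and> s \<in> \<Sigma>)" for Ob
 define F where "F = {vs \<in> B. set vs \<in> rep ` orbits G \<Sigma> ?ph}"
 have rep: "rep Ob \<in> Ob \<and> rep Ob \<in> \<Sigma>" if "Ob \<in> orbits G \<Sigma> ?ph" for Ob
 proof -
  obtain s where "s \<in> \<Sigma>" "Ob = orbit G ?ph s" using \<open>Ob \<in> orbits G \<Sigma> ?ph\<close> by (auto simp: orbits_def)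
  moreover have "act \<one> ` s = s" using \<open>s \<in> \<Sigma>\<close> act_one by (force)
  ultimately have "s \<in> Ob \<and> s \<in> \<Sigma>" by (auto simp: orbit_def)
  then show ?thesis unfolding rep_def by (rule someI)
 qed
 note result = that
 show thesis
 proof (rule free_gset_reps[of G B mv F])
  have "F \<subseteq> (\<Union>s\<in>rep ` orbits G \<Sigma> ?ph. {vs. set vs \<subseteq> s \<and> length vs \<le> card s})"
  proof
   fix vs assume "vs \<in> F"
   then have "set vs \<in> rep ` orbits G \<Sigma> ?ph" "distinct vs" by (auto simp: F_def B_def)
   then show "vs \<in> (\<Union>s\<in>rep ` orbits G \<Sigma> ?ph. {vs. set vs \<subseteq> s \<and> length vs \<le> card s})"
    by (intro UN_I[of "set vs"]) (auto simp: distinct_card)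
  qed
  moreover have "finite ..." using fin rep simplex_finite by (auto intro!: finite_lists_length_le)
  ultimately show "finite F" by (rule finite_subset)
  show "F \<subseteq> B" by (auto simp: F_def)
  fix vs assume vs: "vs \<in> B"
  let ?Ob = "orbit G ?ph (set vs)"
  have Ob: "?Ob \<in> orbits G \<Sigma> ?ph" using B_D(3)[OF vs] by (auto simp: orbits_def)
  then obtain g where g: "g \<in> carrier G" "rep ?Ob = act g ` set vs" using rep[OF Ob] by (auto simp: orbit_def)
  have "mv g vs \<in> F" using mv_B(1)[OF g(1) vs] Ob g(2) by (auto simp: F_def mv_def)
  moreover have "vs = mv (inv g) (mv g vs)" using g vs mv_B(2)[of "inv g" g vs] mv_B(3) by simp
  ultimately show "\<exists>g\<in>carrier G. \<exists>b'\<in>F. vs = mv g b'" using g(1) by blast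
 next
  show "thesis" if "free_gset G B mv rp m" for rp m by (rule result[OF that])
 qed (fact is_group mv_B)+
qed

section \<open>Quotients of the complex by subgroups\<close>

definition "q S v = orbit (G\<lparr>carrier := S\<rparr>) act v"
definition "cl S vs = map (q S) vs"

lemma q_eq: "q S v = {act s v |s. s \<in> S}" by (simp add: q_def orbit_def)

lemma q_orbit:
 assumes S: "subgroup S G" and v: "v \<in> V"
 shows "q S v = q S w ==> w \<in> V ==> \<exists>s\<in>S. w = act s v" and "s \<in> S ==> q S (act s v) = q S v"
proof -
 assume "q S v = q S w" "w \<in> V"
 moreover have "w \<in> q S w" using subgroup.one_closed[OF S] act_one[OF \<open>w \<in> V\<close>] by (metis (mono_tags, lifting) mem_Collect_eq q_eq)
 ultimately show "\<exists>s\<in>S. w = act s v" by (auto simp: q_eq)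
next
 note Sc = subgroup.mem_carrier[OF S]
 assume s: "s \<in> S"
 show "q S (act s v) = q S v"
 proof (intro Set.set_eqI iffI)
  fix u assume "u \<in> q S (act s v)"
  then obtain t where "t \<in> S" "u = act t (act s v)" by (auto simp: q_eq)
  then have "u = act (t \<otimes> s) v" "t \<otimes> s \<in> S" using s v Sc by (auto simp: act_mult subgroup.m_closed[OF S])
  then show "u \<in> q S v" by (auto simp: q_eq)
 next
  fix u assume "u \<in> q S v"
  then obtain t where t: "t \<in> S" "u = act t v" by (auto simp: q_eq)
  then have "u = act (t \<otimes> inv s) (act s v)" using s v Sc by (simp add: act_mult[symmetric] m_assoc)
  then show "u \<in> q S (act s v)" using t s by (auto simp: q_eq subgroup.m_closed[OF S] subgroup.m_inv_closed[OF S])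
 qed
qed

lemma q_inj:
 assumes S: "subgroup S G" and s: "s \<in> \<Sigma>" shows "inj_on (q S) s"
proof (rule inj_onI)
 fix v w assume vw: "v \<in> s" "w \<in> s" "q S v = q S w"
 have vV: "v \<in> V" "w \<in> V" using vw s by auto
 obtain t where t: "t \<in> S" "w = act t v" using q_orbit(1)[OF S vV(1) vw(3) vV(2)] by blast
 show "v = w"
  using q_orbit(2)[OF subgroup_self vV(1)] subgroup.mem_carrier[OF S t(1)] using t(2) using quot_cpx s vw by (simp add: q_def quotient_is_complex_def inj_on_def)
qed

lemma G_orbit_inj:
 assumes s: "s \<in> \<Sigma>" and "v \<in> s" "w \<in> s" "g \<in> carrier G" "w = act g v" shows "v = w" using q_orbit(2)[OF subgroup_self, of v g] using q_inj[OF subgroup_self s] assms by (auto dest: inj_onD)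

text \<open>Vertexwise equivalence yields a possibly different element of \<open>S\<close> for each
  vertex; the assumptions that the full quotient is a complex and that the action is free merge them
  into one.\<close>

lemma cl_eq:
 assumes S: "subgroup S G" and b: "b \<in> B" "b' \<in> B"
 shows "cl S b = cl S b' \<longleftrightarrow> (\<exists>s\<in>S. b' = mv s b)"
proof
 assume "\<exists>s\<in>S. b' = mv s b"
 then show "cl S b = cl S b'" using B_vertex[OF b(1)] q_orbit(2)[OF S] by (auto simp: cl_def mv_def)
next
 note Sc = subgroup.mem_carrier[OF S]
 assume eq: "cl S b = cl S b'"
 have len: "length b = length b'" using eq by (metis cl_def length_map)
 have nth: "\<exists>s\<in>S. b' ! i = act s (b ! i)" if "i < length b" for i
 proof -
  have "q S (b ! i) = q S (b' ! i)" using eq that len by (metis cl_def nth_map)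
  then show ?thesis using q_orbit(1)[OF S] B_vertex[OF b(1)] B_vertex[OF b(2)] that len by simp
 qed
 have "q (carrier G) ` set b = q (carrier G) ` set b'"
 proof -
  have "q (carrier G) (b ! i) = q (carrier G) (b' ! i)" if "i < length b" for i
   using nth[OF that] q_orbit(2)[OF subgroup_self, of "b ! i"] Sc B_vertex[OF b(1)] that by auto
  then have "map (q (carrier G)) b = map (q (carrier G)) b'" using len by (intro nth_equalityI) auto
  then show ?thesis by (metis set_map)
 qed
 then have "set b' \<in> orbit G (%g \<rho>. act g ` \<rho>) (set b)"
  using quot_cpx B_D(3)[OF b(1)] B_D(3)[OF b(2)] by (simp add: q_def quotient_is_complex_def)
 then obtain g where g: "g \<in> carrier G" "set b' = act g ` set b" by (auto simp: orbit_def)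
 \<comment> \<open>Both \<open>act g (b ! i)\<close> and \<open>b' ! i\<close> lie in one simplex
   and in one orbit, hence agree; freeness at the vertex \<open>b ! i\<close> then identifies
   \<open>g\<close> with the element of \<open>S\<close> found before.\<close>
 have gi: "b' ! i = act g (b ! i) \<and> g \<in> S" if i: "i < length b" for i
 proof -
  obtain s where s: "s \<in> S" "b' ! i = act s (b ! i)" using nth[OF i] by blast
  have bi: "b ! i \<in> V" using B_vertex[OF b(1)] i by simp
  have m1: "act g (b ! i) \<in> set b'" using g i by simp
  have m2: "b' ! i \<in> set b'" using i len by simp
  have m3: "b' ! i = act (s \<otimes> inv g) (act g (b ! i))"
   using s bi g Sc by (simp add: act_mult[symmetric] m_assoc)
  have "s \<otimes> inv g \<in> carrier G" using s g Sc by simp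
  then have e: "act g (b ! i) = b' ! i" by (rule G_orbit_inj[OF B_D(3)[OF b(2)] m1 m2 _ m3])
  then have "act (inv s \<otimes> g) (b ! i) = b ! i" using s bi g Sc by (simp add: act_mult) (simp add: act_mult[symmetric] act_one)
  then have "inv s \<otimes> g = \<one>" using s g Sc by (intro vertex_free[OF _ bi]) auto
  with e s show ?thesis using g Sc by (metis inv_closed inv_equality inv_inv)
 qed
 have "b' = mv g b" using gi len by (intro nth_equalityI) (auto simp: mv_def)
 moreover have "g \<in> S" using gi[of 0] B_D(2)[OF b(1)] by auto
 ultimately show "\<exists>s\<in>S. b' = mv s b" by blast
qed

lemma quotient_ordered:
 assumes S: "subgroup S G"
 shows "ordered_simplices (quotient_complex G S \<Sigma> act) i = cl S ` {b \<in> B. length b = Suc i}"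
proof (intro Set.set_eqI iffI)
 fix ws assume "ws \<in> cl S ` {b \<in> B. length b = Suc i}"
 then obtain b where b: "b \<in> B" "length b = Suc i" "ws = cl S b" by auto
 then show "ws \<in> ordered_simplices (quotient_complex G S \<Sigma> act) i" using q_inj[OF S B_D(3)[OF b(1)]] B_D(4)[OF b(1)]
  using B_D(3)[OF b(1)] by (simp add: cl_def distinct_map ordered_simplices_def quotient_complex_def q_def)
next
 fix ws assume "ws \<in> ordered_simplices (quotient_complex G S \<Sigma> act) i"
 then obtain s where s: "s \<in> \<Sigma>" "set ws = q S ` s" "distinct ws" "length ws = Suc i"
  by (auto simp: ordered_simplices_def quotient_complex_def q_def)
 note inj = q_inj[OF S s(1)]
 let ?b = "map (inv_into s (q S)) ws"
 have "map (q S \<circ> inv_into s (q S)) ws = ws" by (rule map_idI) (use s(2) in \<open>simp add: f_inv_into_f\<close>)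
 then have "cl S ?b = ws" by (simp add: cl_def)
 moreover have "set ?b = s" using s(2) inj by simp
 moreover have "distinct ?b" using s by (auto simp: distinct_map intro: inj_on_inv_into)
 ultimately have b: "cl S ?b = ws" "?b \<in> B" "length ?b = Suc i" using s by (simp_all add: B_def)
 have "cl S ?b \<in> cl S ` {b \<in> B. length b = Suc i}" using b(2,3) by simp
 then show "ws \<in> cl S ` {b \<in> B. length b = Suc i}" by (simp only: b(1))
qed

lemma length_cl [simp]: "length (cl S b) = length b" by (simp add: cl_def)

end

locale simplicial_gset = free_simplicial G \<Sigma> act + free_gset G "free_simplicial.B \<Sigma>" "free_simplicial.mv act" rp m
 for G :: "('g, 'n) monoid_scheme" (structure) and \<Sigma> :: "'v set set" and act :: "'g => 'v => 'v"
  and rp :: "nat => 'v list" and m :: nat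
begin

lemma quotient: "subgroup S G ==> gset_quotient G B mv rp m S (cl S)"
 by (intro gset_quotient.intro free_gset_axioms gset_quotient_axioms.intro cl_eq)

section \<open>Boundary and antisymmetrization as kernels\<close>

definition face :: "'v list => 'v list => real" where
 "face ws us = of_bool (ws \<noteq> [] \<and> us \<noteq> [] \<and> butlast us = ws)"
text \<open>The antisymmetrizer without the factor 1 over the factorial, which keeps its entries
  integral.\<close>

definition alt :: "'v list => 'v list => real" where
 "alt us us' = (\<Sum>pm | pm permutes {..<length us}. of_int (sign pm) * of_bool (permute_list pm us = us'))"

lemma mv_list_eq:
 assumes "g \<in> carrier G" "set us \<subseteq> V" "set vs \<subseteq> V" shows "mv g us = mv g vs \<longleftrightarrow> us = vs"
 using act_inj[OF assms(1)] assms unfolding mv_def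
 by (metis (no_types, lifting) Un_least inj_on_map_eq_map inj_on_subset)

text \<open>Finiteness of the rows is local finiteness of \<open>\<Sigma>\<close>: a simplex
  extending \<open>b\<close> by one vertex is a translate of some \<open>rp l\<close>, and by
  freeness at most one translate of each shortened representative equals \<open>b\<close>.\<close>

lemma kernel_face: "kernel face" unfolding kernel_def
proof (intro conjI ballI)
 fix g b b' assume g: "g \<in> carrier G" and b: "b \<in> B" "b' \<in> B"
 have "set (butlast b') \<subseteq> V" using B_D(1)[OF b(2)] by (auto dest: in_set_butlastD)
 then show "face (mv g b) (mv g b') = face b b'"
  using mv_list_eq[OF g, of "butlast b'" b] B_D(1)[OF b(1)] by (simp add: mv_def map_butlast face_def)
next
 fix b assume b: "b \<in> B"
 have "supp face b \<subseteq> (\<Union>l<m. (%g. mv g (rp l)) ` {g \<in> carrier G. mv g (butlast (rp l)) = b})"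
 proof
  fix us assume "us \<in> supp face b"
  then have us: "us \<in> B" "butlast us = b" by (auto simp: supp_def face_def)
  note p = parts[OF us(1)]
  have "mv (gpart us) (butlast (rp (ipart us))) = b" using p(3) us(2) by (metis mv_def map_butlast)
  then show "us \<in> (\<Union>l<m. (%g. mv g (rp l)) ` {g \<in> carrier G. mv g (butlast (rp l)) = b})"
   using p by (intro UN_I[of "ipart us"] image_eqI[of _ _ "gpart us"]) auto
 qed
 moreover have "finite ((%g. mv g (rp l)) ` {g \<in> carrier G. mv g (butlast (rp l)) = b})" if l: "l < m" for l
 proof (rule finite_imageI)
  have "g = g'" if g: "g \<in> carrier G" "mv g (butlast (rp l)) = b" "g' \<in> carrier G" "mv g' (butlast (rp l)) = b" for g g'
  proof -
   have "butlast (rp l) \<noteq> []" using g(2) B_D(2)[OF b] by (auto simp: mv_def)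
   then show ?thesis
    using B_sub[OF rp_in[OF l], of "butlast (rp l)"] B_D(4)[OF rp_in[OF l]] using mv_eq_iff[OF g(1,3), of "butlast (rp l)"] g(2,4) by (auto dest: in_set_butlastD simp: distinct_butlast)
  qed
  then have "{g \<in> carrier G. mv g (butlast (rp l)) = b} \<subseteq> {SOME g. g \<in> carrier G \<and> mv g (butlast (rp l)) = b}"
   by (auto intro: some_equality[symmetric])
  then show "finite {g \<in> carrier G. mv g (butlast (rp l)) = b}" by (rule finite_subset) simp
 qed
 ultimately show "finite (supp face b)" by (meson finite_UN_I finite_lessThan finite_subset lessThan_iff)
 show "finite {b' \<in> B. face b' b \<noteq> 0}" by (auto simp: face_def)
qed

lemma permute_mv: "pm permutes {..<length us} ==> permute_list pm (mv g us) = mv g (permute_list pm us)"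
 by (simp add: mv_def permute_list_map)

lemma permute_B: "us \<in> B ==> pm permutes {..<length us} ==> permute_list pm us \<in> B" by (simp add: B_def)

lemma alt_nonzero: "alt us us' \<noteq> 0 ==> \<exists>pm. pm permutes {..<length us} \<and> permute_list pm us = us'"
 unfolding alt_def by (erule sum.not_neutral_contains_not_neutral) (auto)

lemma kernel_alt: "kernel alt" unfolding kernel_def
proof (intro conjI ballI)
 fix g b b' assume g: "g \<in> carrier G" and b: "b \<in> B" "b' \<in> B"
 show "alt (mv g b) (mv g b') = alt b b'" unfolding alt_def
 proof (rule sum.cong)
  fix pm assume "pm \<in> {pm. pm permutes {..<length b}}"
  then have p: "pm permutes {..<length b}" by simp
  have "mv g (permute_list pm b) = mv g b' \<longleftrightarrow> permute_list pm b = b'"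
   by (rule mv_list_eq[OF g]) (use B_D(1)[OF b(1)] B_D(1)[OF b(2)] p in auto)
  then show "of_int (sign pm) * of_bool (permute_list pm (mv g b) = mv g b') = of_int (sign pm) * of_bool (permute_list pm b = b')"
   by (simp add: permute_mv[OF p])
 qed (simp add: mv_def)
next
 fix b assume b: "b \<in> B"
 have fin: "finite {xs. set xs \<subseteq> set b \<and> length xs = length b}" by (rule finite_lists_length_eq) simp
 have sub: "set us' = set us \<and> length us' = length us" if "alt us us' \<noteq> 0" for us us'
  using alt_nonzero[OF that] by auto
 show "finite (supp alt b)" by (rule finite_subset[OF _ fin]) (use sub[of b] in \<open>auto simp: supp_def\<close>)
 show "finite {b' \<in> B. alt b' b \<noteq> 0}" by (rule finite_subset[OF _ fin]) (use sub[of _ b] in auto)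
qed

lemma kop_alt:
 assumes b: "b \<in> B" shows "kop alt h b = (\<Sum>pm | pm permutes {..<length b}. of_int (sign pm) * h (permute_list pm b))"
proof -
 let ?P = "{pm. pm permutes {..<length b}}"
 let ?S = "(%pm. permute_list pm b) ` ?P"
 have fP: "finite ?P" by (rule finite_permutations) simp
 have "kop alt h b = (\<Sum>b'\<in>?S. of_real (alt b b') * h b')"
  by (rule kop_superset) (use fP alt_nonzero[of b] permute_B[OF b] in \<open>auto simp: supp_def\<close>)
 also have "... = (\<Sum>b'\<in>?S. \<Sum>pm\<in>?P. of_int (sign pm) * (of_bool (permute_list pm b = b') * h b'))"
 proof -
  have "complex_of_real (of_bool P) = of_bool P" for P by simp
  then show ?thesis by (simp add: alt_def sum_distrib_right mult.assoc)
 qed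
 also have "... = (\<Sum>pm\<in>?P. of_int (sign pm) * (\<Sum>b'\<in>?S. of_bool (permute_list pm b = b') * h b'))"
  by (subst sum.swap) (simp add: sum_distrib_left)
 finally show ?thesis using fP by auto
qed

lemma kop_face_tr:
 assumes b: "b \<in> B" shows "kop (ktr face) h b = (if butlast b = [] then 0 else h (butlast b))"
proof (cases "butlast b = []")
 case True
 then show ?thesis by (simp add: ktr_def face_def kop_def)
next
 case False
 then have "butlast b \<in> B"
  using B_sub[OF b, of "butlast b"] B_D(4)[OF b] by (auto dest: in_set_butlastD simp: distinct_butlast)
 then have "kop (ktr face) h b = (\<Sum>b'\<in>{butlast b}. of_real (ktr face b b') * h b')"
  by (intro kop_superset) (auto simp: supp_def ktr_def face_def)
 then show ?thesis using B_D(2)[OF b] by (simp add: ktr_def face_def)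
qed

lemma kop_face:
 assumes b: "b \<in> B" shows "kop face h b = (\<Sum>v | b @ [v] \<in> B. h (b @ [v]))" and "finite {v. b @ [v] \<in> B}"
proof -
 have s: "supp face b = (%v. b @ [v]) ` {v. b @ [v] \<in> B}"
 proof (intro Set.set_eqI iffI)
  fix us assume "us \<in> supp face b"
  then have us: "us \<in> B" "butlast us = b" "us \<noteq> []" by (auto simp: supp_def face_def)
  then have "us = b @ [last us]" by auto
  then show "us \<in> (%v. b @ [v]) ` {v. b @ [v] \<in> B}" using us(1) by simp
 next
  fix us assume "us \<in> (%v. b @ [v]) ` {v. b @ [v] \<in> B}"
  then show "us \<in> supp face b" using B_D(2)[OF b] by (auto simp: supp_def face_def)
 qed
 have inj: "inj_on (%v. b @ [v]) {v. b @ [v] \<in> B}" by (auto simp: inj_on_def)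
 show "finite {v. b @ [v] \<in> B}" using finite_supp[OF kernel_face b] inj unfolding s by simp
 have one: "face b us = 1" if "us \<in> supp face b" for us using that by (auto simp: supp_def face_def)
 have "kop face h b = (\<Sum>us\<in>supp face b. h us)" unfolding kop_def by (intro sum.cong refl) (simp add: one)
 then show "kop face h b = (\<Sum>v | b @ [v] \<in> B. h (b @ [v]))" unfolding s by (simp add: sum.reindex[OF inj])
qed

lemma kop_alt_sign:
 assumes b: "b \<in> B" and \<tau>: "\<tau> permutes {..<length b}"
 shows "kop alt h (permute_list \<tau> b) = of_int (sign \<tau>) * kop alt h b"
proof -
 let ?P = "{pm. pm permutes {..<length b}}"
 have fin: "finite {..<length b}" by simp
 have sgn: "sign (\<tau> \<circ> pm) = sign \<tau> * sign pm" if "pm \<in> ?P" for pm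
  using that \<tau> by (intro sign_compose) (auto intro: permutes_imp_permutation[OF fin])
 have ss: "of_int (sign \<tau>) * (of_int (sign \<tau>) :: complex) = 1" by (simp add: sign_def)
 have "kop alt h (permute_list \<tau> b) = (\<Sum>pm\<in>?P. of_int (sign pm) * h (permute_list (\<tau> \<circ> pm) b))"
  using kop_alt[OF permute_B[OF b \<tau>]] by (simp add: permute_list_compose)
 also have "... = (\<Sum>pm\<in>?P. of_int (sign \<tau>) * (of_int (sign (\<tau> \<circ> pm)) * h (permute_list (\<tau> \<circ> pm) b)))"
  by (intro sum.cong refl) (simp add: sgn ss)
 also have "... = of_int (sign \<tau>) * (\<Sum>pm\<in>?P. of_int (sign (\<tau> \<circ> pm)) * h (permute_list (\<tau> \<circ> pm) b))"
  by (simp add: sum_distrib_left)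
 also have "(\<Sum>pm\<in>?P. of_int (sign (\<tau> \<circ> pm)) * h (permute_list (\<tau> \<circ> pm) b)) = (\<Sum>pm\<in>?P. of_int (sign pm) * h (permute_list pm b))"
  by (rule sum.reindex_bij_witness[of _ "%pm. inv_into UNIV \<tau> \<circ> pm" "%pm. \<tau> \<circ> pm"])
   (use \<tau> in \<open>auto simp: o_assoc permutes_inv_o intro: permutes_compose permutes_inv\<close>)
 finally show ?thesis using kop_alt[OF b, of h] by simp
qed

definition antisym_on :: "nat => ('v list => complex) => bool" where
 "antisym_on i h \<longleftrightarrow> (\<forall>b\<in>B. length b = Suc i -->
   (\<forall>pm. pm permutes {..<Suc i} --> h (permute_list pm b) = of_int (sign pm) * h b))"

lemma antisym_lin: "antisym_on j f ==> antisym_on j g ==> antisym_on j (%b. f b + z * g b)"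
 by (auto simp: antisym_on_def algebra_simps)

text \<open>Turns antisymmetry into one linear equation with an invariant integer kernel, so that it
  can join the equations of harmonic chains.\<close>

lemma antisym_alt: "antisym_on i h \<longleftrightarrow> (\<forall>b\<in>B. length b = Suc i --> kop alt h b = fact (Suc i) * h b)"
proof
 assume a: "antisym_on i h"
 show "\<forall>b\<in>B. length b = Suc i --> kop alt h b = fact (Suc i) * h b"
 proof (intro ballI impI)
  fix b assume b: "b \<in> B" "length b = Suc i"
  have "kop alt h b = (\<Sum>pm | pm permutes {..<length b}. h b)" unfolding kop_alt[OF b(1)] using a b
   by (intro sum.cong) (auto simp: antisym_on_def sign_def)
  also have "... = fact (Suc i) * h b" using b by (simp add: card_permutations[OF refl] del: fact_Suc)
  finally show "kop alt h b = fact (Suc i) * h b" .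
 qed
next
 assume a: "\<forall>b\<in>B. length b = Suc i --> kop alt h b = fact (Suc i) * h b"
 show "antisym_on i h" unfolding antisym_on_def
 proof (intro ballI impI allI)
  fix b pm assume b: "b \<in> B" "length b = Suc i" "pm permutes {..<Suc i}"
  then have "fact (Suc i) * h (permute_list pm b) = kop alt h (permute_list pm b)"
   using a permute_B[OF b(1), of pm] by simp
  also have "... = of_int (sign pm) * (fact (Suc i) * h b)" using kop_alt_sign[OF b(1), of pm h] a b by simp
  finally show "h (permute_list pm b) = of_int (sign pm) * h b" by (simp del: fact_Suc)
 qed
qed

lemma alt_sym:
 assumes b: "b \<in> B" "b' \<in> B" shows "alt b b' = alt b' b"
proof (cases "length b = length b'")
 case False
 have "alt b b' = 0" using False alt_nonzero[of b b'] by (metis length_permute_list)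
 moreover have "alt b' b = 0" using False alt_nonzero[of b' b] by (metis length_permute_list)
 ultimately show ?thesis by simp
next
 case True
 let ?P = "{pm. pm permutes {..<length b}}"
 have "(permute_list (inv_into UNIV pm) b' = b) = (permute_list pm b = b')" if "pm \<in> ?P" for pm
 proof -
  have p: "pm permutes {..<length b}" "inv_into UNIV pm permutes {..<length b}" using that permutes_inv by auto
  have "permute_list (inv_into UNIV pm) (permute_list pm b) = b"
   using p by (subst permute_list_compose[symmetric]) (auto simp: permutes_inv_o)
  moreover have "permute_list pm (permute_list (inv_into UNIV pm) b') = b'"
   using p True by (subst permute_list_compose[symmetric]) (auto simp: permutes_inv_o)
  ultimately show ?thesis by metis
 qed
 moreover have "sign (inv_into UNIV pm) = sign pm" if "pm \<in> ?P" for pm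
  using that by (intro sign_inverse) (auto intro: permutes_imp_permutation[of "{..<length b}"])
 ultimately have "alt b b' = (\<Sum>pm\<in>?P. of_int (sign (inv_into UNIV pm)) * of_bool (permute_list (inv_into UNIV pm) b' = b))"
  unfolding alt_def by simp
 also have "... = (\<Sum>pm\<in>?P. of_int (sign pm) * of_bool (permute_list pm b' = b))"
  by (rule sum.reindex_bij_witness[of _ "inv_into UNIV" "inv_into UNIV"])
   (auto simp: permutes_inv permutes_inv_inv)
 finally show ?thesis using True by (simp add: alt_def)
qed

text \<open>The rows of \<open>eqs i\<close> of lengths \<open>i\<close>, \<open>i + 1\<close> and \<open>i + 2\<close> express for a function on ordered
 \<open>i\<close>-simplices that it is a cycle, antisymmetric, and orthogonal to the boundaries; the factorials
 make the kernel integral.\<close>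

definition lenchi :: "nat => 'v list => 'v list => real" where
 "lenchi i b b' = of_bool (b = b' \<and> length b = Suc i)"
definition eqs0 :: "nat => 'v list => 'v list => real" where
 "eqs0 i b b' = 1 * (1 * face b b' + 1 * kmul alt (ktr face) b b') + 1 * (fact (Suc i) * kid b b' + (-1) * alt b b')"
definition eqs :: "nat => 'v list => 'v list => real" where "eqs i = kmul (eqs0 i) (lenchi i)"

lemma kernel_lenchi: "kernel (lenchi i)"
  by (auto simp: kernel_def supp_def lenchi_def inj_on_eq_iff[OF mv_inj]) (auto simp: mv_def)

lemma kernel_eqs0: "kernel (eqs0 i)" unfolding eqs0_def[abs_def]
 by (intro kernel_lin kernel_mul kernel_tr kernel_id kernel_face kernel_alt)

lemma kernel_eqs: "kernel (eqs i)" unfolding eqs_def by (intro kernel_mul kernel_eqs0 kernel_lenchi)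

lemma kop_lenchi: "b \<in> B ==> kop (lenchi i) h b = (if length b = Suc i then h b else 0)"
 by (subst kop_superset[of "{b}"]) (auto simp: supp_def lenchi_def)

lemma kop_eqs0:
 assumes b: "b \<in> B"
 shows "kop (eqs0 i) h b = kop face h b + kop alt (kop (ktr face) h) b + (fact (Suc i) * h b - kop alt h b)"
proof -
 let ?k1 = "%b b'. 1 * face b b' + 1 * kmul alt (ktr face) b b'"
 let ?k2 = "%b b'. fact (Suc i) * kid b b' + (-1) * alt b b'"
 note kf = kernel_mul[OF kernel_alt kernel_tr[OF kernel_face]]
 have "kop (eqs0 i) h b = of_real 1 * kop ?k1 h b + of_real 1 * kop ?k2 h b" unfolding eqs0_def[abs_def]
  by (rule kop_combine[OF kernel_lin[OF kernel_face kf] kernel_lin[OF kernel_id kernel_alt] b])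
 also have "kop ?k1 h b = of_real 1 * kop face h b + of_real 1 * kop (kmul alt (ktr face)) h b"
  by (rule kop_combine[OF kernel_face kf b])
 also have "kop ?k2 h b = of_real (fact (Suc i)) * kop kid h b + of_real (-1) * kop alt h b"
  by (rule kop_combine[OF kernel_id kernel_alt b])
 finally show ?thesis by (simp add: kop_mul[OF kernel_alt kernel_tr[OF kernel_face] b] kop_id b)
qed

text \<open>The transpose of \<open>face\<close> followed by \<open>alt\<close> is the coboundary up
  to a factor, so the last condition is orthogonality to boundaries of antisymmetric chains.\<close>

definition harmonic :: "nat => ('v list => complex) => bool" where
 "harmonic i h \<longleftrightarrow> antisym_on i h \<and> (\<forall>b\<in>B. length b = i --> kop face h b = 0)
   \<and> (\<forall>b\<in>B. length b = Suc (Suc i) --> kop alt (kop (ktr face) h) b = 0)"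

lemma coface_outside:
 assumes h: "\<And>b. b \<in> B ==> length b \<noteq> Suc i ==> h b = 0" and b: "b \<in> B" "length b \<noteq> Suc (Suc i)"
 shows "kop alt (kop (ktr face) h) b = 0"
proof -
 have t: "kop (ktr face) h b = 0" if b: "b \<in> B" "length b \<noteq> Suc (Suc i)" for b
 proof (cases "butlast b = []")
  case False
  then have "butlast b \<in> B"
   using B_sub[OF b(1), of "butlast b"] B_D(4)[OF b(1)] by (auto dest: in_set_butlastD simp: distinct_butlast)
  moreover have "length (butlast b) \<noteq> Suc i" using b by simp
  ultimately show ?thesis using h kop_face_tr[OF b(1)] by auto
 qed (simp add: kop_face_tr b)
 show ?thesis unfolding kop_alt[OF b(1)] by (rule) (use t permute_B[OF b(1)] b(2) in auto)
qed

lemma eqs_row: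
 assumes h: "\<And>b. b \<in> B ==> length b \<noteq> Suc i ==> h b = 0" and b: "b \<in> B"
 shows "kop (eqs i) h b = (if length b = i then kop face h b else if length b = Suc i then fact (Suc i) * h b - kop alt h b
   else if length b = Suc (Suc i) then kop alt (kop (ktr face) h) b else 0)"
proof -
 have eq: "kop (eqs i) h b = kop (eqs0 i) h b" if b: "b \<in> B" for b
 proof -
  have "kop (eqs i) h b = kop (eqs0 i) (kop (lenchi i) h) b"
   unfolding eqs_def by (rule kop_mul[OF kernel_eqs0 kernel_lenchi b])
  also have "... = kop (eqs0 i) h b" by (rule kop_cong) (auto simp: kop_lenchi h)
  finally show ?thesis .
 qed
 have f: "kop face h b = 0" if b: "b \<in> B" "length b \<noteq> i" for b
  unfolding kop_face(1)[OF b(1)] by (rule) (use h b(2) in auto)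
 have at: "kop alt (kop (ktr face) h) b = 0" if "b \<in> B" "length b \<noteq> Suc (Suc i)" for b
  using coface_outside[OF h that] by simp
 have al: "kop alt h b = 0" if b: "b \<in> B" "length b \<noteq> Suc i" for b
  unfolding kop_alt[OF b(1)] by (rule) (use h permute_B[OF b(1)] b(2) in auto)
 show ?thesis using f[OF b] at[OF b] al[OF b] h[OF b] by (auto simp: eq[OF b] kop_eqs0[OF b])
qed

lemma eqs_iff_harmonic:
 assumes h: "\<And>b. b \<in> B ==> length b \<noteq> Suc i ==> h b = 0"
 shows "(\<forall>b\<in>B. kop (eqs i) h b = 0) \<longleftrightarrow> harmonic i h"
proof -
 have row: "kop (eqs i) h b = 0 \<longleftrightarrow> (length b = i --> kop face h b = 0)
   \<and> (length b = Suc i --> kop alt h b = fact (Suc i) * h b)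
   \<and> (length b = Suc (Suc i) --> kop alt (kop (ktr face) h) b = 0)" if b: "b \<in> B" for b
  using eqs_row[of i h, OF h b] by auto
 show ?thesis unfolding harmonic_def antisym_alt using row by blast
qed

lemma eqs_ints: "b \<in> B ==> b' \<in> B ==> eqs i b b' \<in> \<int>"
proof -
 have f: "face x y \<in> \<int>" for x y by (simp add: face_def)
 have a: "alt x y \<in> \<int>" for x y unfolding alt_def by auto
 have "eqs0 i x y \<in> \<int>" for x y
  unfolding eqs0_def kmul_def ktr_def kid_def by (intro Ints_add Ints_mult Ints_sum f a) (auto simp: fact_in_Ints)
 then show "eqs i b b' \<in> \<int>" unfolding eqs_def kmul_def lenchi_def by auto
qed

lemma eqs_col: "b \<in> B ==> b' \<in> B ==> eqs i b b' \<noteq> 0 ==> length b' = Suc i"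
 unfolding eqs_def kmul_def by (erule sum.not_neutral_contains_not_neutral) (auto simp: lenchi_def)

definition "Jix i = {l. l < m \<and> length (rp l) = Suc i}"

lemma ipart_Jix: "b \<in> B ==> ipart b \<in> Jix i \<longleftrightarrow> length b = Suc i"
 using parts[of b] by (auto simp: Jix_def) (metis mv_def length_map)+

text \<open>The maximum with 1 makes \<open>ln C\<close> nonnegative in the eigenvalue count;
  \<open>ksum\<close> makes the constant independent of the quotient.\<close>

definition "Cst i = max 1 (ksum (kmul (ktr (eqs i)) (eqs i)))"

lemma contraction: "kernel_contraction G B mv rp m (Jix i) (eqs i) (Cst i)"
proof (intro kernel_contraction.intro kernel_contraction_axioms.intro free_gset_axioms)
 show "Jix i \<subseteq> {..<m}" by (auto simp: Jix_def)
 show "kernel (eqs i)" by (rule kernel_eqs)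
 show "ipart b' \<in> Jix i" if "b \<in> B" "b' \<in> B" "eqs i b b' \<noteq> 0" for b b'
  using eqs_col[OF that] ipart_Jix[OF that(2)] by simp
 show "1 \<le> Cst i" "ksum (kmul (ktr (eqs i)) (eqs i)) \<le> Cst i" by (simp_all add: Cst_def)
qed

text \<open>Extensions of \<open>b\<close> by a vertex correspond to extensions of its class: a
  class can be moved so that it starts with \<open>b\<close>, and an element fixing \<open>b\<close>
  is trivial by freeness.\<close>

lemma quotient_boundary:
 assumes S: "subgroup S G" and b: "b \<in> B" "length b = Suc i"
 shows "simplicial_boundary (quotient_complex G S \<Sigma> act) (Suc i) f (cl S b) = kop face (%b. f (cl S b)) b"
proof -
 let ?A = "{w. cl S b @ [w] \<in> ordered_simplices (quotient_complex G S \<Sigma> act) (Suc i)}"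
 have bij: "bij_betw (q S) {v. b @ [v] \<in> B} ?A"
 proof (rule bij_betwI')
  fix v v' assume v: "v \<in> {v. b @ [v] \<in> B}" "v' \<in> {v. b @ [v] \<in> B}"
  show "(q S v = q S v') = (v = v')"
  proof
   assume "q S v = q S v'"
   then have "cl S (b @ [v]) = cl S (b @ [v'])" by (simp add: cl_def)
   then obtain s where s: "s \<in> S" "b @ [v'] = mv s (b @ [v])" using cl_eq[OF S] v by blast
   then have "mv s b = b" "v' = act s v" by (auto simp: mv_def)
   moreover have "s = \<one>" using mv_B(4)[OF subgroup.mem_carrier[OF S s(1)] b(1)] calculation by simp
   ultimately show "v = v'" using v B_vertex[of "b @ [v]" v] using act_one by simp
  qed simp
 next
  fix v assume "v \<in> {v. b @ [v] \<in> B}"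
  then show "q S v \<in> ?A" using b unfolding quotient_ordered[OF S] by (auto simp: cl_def intro!: image_eqI[of _ _ "b @ [v]"])
 next
  fix w assume "w \<in> ?A"
  then obtain c where c: "c \<in> B" "length c = Suc (Suc i)" "cl S b @ [w] = cl S c"
   unfolding quotient_ordered[OF S] by auto
  obtain c' u where cu: "c = c' @ [u]" using c(2) by (cases c rule: rev_cases) auto
  have c'B: "c' \<in> B" using B_sub[OF c(1), of c'] B_D(4)[OF c(1)] c(2) cu by (cases c') auto
  have "cl S b = cl S c'" "w = q S u" using c(3) cu by (auto simp: cl_def)
  then obtain s where s: "s \<in> S" "b = mv s c'" using cl_eq[OF S c'B b(1)] by auto
  have sc: "s \<in> carrier G" using subgroup.mem_carrier[OF S s(1)] .
  have "b @ [act s u] \<in> B" using s cu using mv_B(1)[OF sc c(1)] by (simp add: mv_def)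
  moreover have "q S (act s u) = w" using q_orbit(2)[OF S _ s(1), of u] B_vertex[OF c(1), of u] cu \<open>w = q S u\<close> by simp
  ultimately show "\<exists>v\<in>{v. b @ [v] \<in> B}. w = q S v" by blast
 qed
 have "simplicial_boundary (quotient_complex G S \<Sigma> act) (Suc i) f (cl S b) = (\<Sum>w\<in>?A. f (cl S b @ [w]))"
  using kop_face(2)[OF b(1)] bij_betw_finite[OF bij] by (simp add: simplicial_boundary_def)
 also have "... = (\<Sum>v | b @ [v] \<in> B. f (cl S (b @ [v])))"
  using sum.reindex_bij_betw[OF bij, of "%w. f (cl S b @ [w])"] by (simp add: cl_def)
 finally show ?thesis by (simp add: kop_face[OF b(1)])
qed

lemma boundary_outside:
 assumes S: "subgroup S G" and ws: "ws \<notin> cl S ` {b \<in> B. length b = Suc i}"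
 shows "simplicial_boundary (quotient_complex G S \<Sigma> act) (Suc i) f ws = 0"
proof -
 have "{w. ws @ [w] \<in> ordered_simplices (quotient_complex G S \<Sigma> act) (Suc i)} = {}"
 proof (rule ccontr)
  assume "{w. ws @ [w] \<in> ordered_simplices (quotient_complex G S \<Sigma> act) (Suc i)} \<noteq> {}"
  then obtain w c where c: "c \<in> B" "length c = Suc (Suc i)" "ws @ [w] = cl S c"
   unfolding quotient_ordered[OF S] by auto
  obtain c' u where cu: "c = c' @ [u]" using c(2) by (cases c rule: rev_cases) auto
  have "c' \<in> B" using B_sub[OF c(1), of c'] B_D(4)[OF c(1)] c(2) cu by (cases c') auto
  then show False using ws c cu by (auto simp: cl_def)
 qed
 then show ?thesis by (simp add: simplicial_boundary_def)
qed

lemma antisym_face: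
 assumes a: "antisym_on (Suc i) h" shows "antisym_on i (kop face h)"
 unfolding antisym_on_def
proof (intro ballI impI allI)
 fix b pm assume b: "b \<in> B" "length b = Suc i" and pm: "pm permutes {..<Suc i}"
 have pb: "permute_list pm b \<in> B" using permute_B[OF b(1)] pm b(2) by simp
 have pm': "pm permutes {..<Suc (Suc i)}" using pm by (rule permutes_subset) auto
 have perm: "permute_list pm (b @ [v]) = permute_list pm b @ [v]" for v
 proof (rule nth_equalityI)
  fix k assume k: "k < length (permute_list pm (b @ [v]))"
  show "permute_list pm (b @ [v]) ! k = (permute_list pm b @ [v]) ! k" using b pm k
  by (auto simp: permute_list_nth nth_append permutes_def)
 qed simp
 have eq: "{v. permute_list pm b @ [v] \<in> B} = {v. b @ [v] \<in> B}" using pm b by (auto simp: B_def)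
 show "kop face h (permute_list pm b) = of_int (sign pm) * kop face h b"
  unfolding kop_face(1)[OF pb] kop_face(1)[OF b(1)] eq sum_distrib_left
 proof (rule sum.cong[OF refl])
  fix v assume "v \<in> {v. b @ [v] \<in> B}"
  then have "h (permute_list pm (b @ [v])) = of_int (sign pm) * h (b @ [v])"
   using a b pm' by (auto simp: antisym_on_def)
  then show "h (permute_list pm b @ [v]) = of_int (sign pm) * h (b @ [v])" by (simp add: perm)
 qed
qed

text \<open>The two added vertices can be exchanged, which permutes the index set of the double sum
  and changes the sign of each term.\<close>

lemma face_face:
 assumes a: "antisym_on (Suc i) h" and b: "b \<in> B" "length b = i"
 shows "kop face (kop face h) b = 0"
proof -
 let ?A = "%b. {v. b @ [v] \<in> B}"
 have "kop face (kop face h) b = (\<Sum>v\<in>?A b. \<Sum>w\<in>?A (b @ [v]). h (b @ [v, w]))"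
  unfolding kop_face(1)[OF b(1)] by (intro sum.cong) (auto simp: kop_face(1))
 also have "... = (\<Sum>vw\<in>(SIGMA v:?A b. ?A (b @ [v])). h (b @ [fst vw, snd vw]))"
  by (subst sum.Sigma) (use kop_face(2)[OF b(1)] kop_face(2) in \<open>auto simp: split_beta simp del: append_assoc\<close>)
 finally have 1: "kop face (kop face h) b = (\<Sum>vw\<in>(SIGMA v:?A b. ?A (b @ [v])). h (b @ [fst vw, snd vw]))" .
 have sw: "prod.swap vw \<in> (SIGMA v:?A b. ?A (b @ [v]))" if "vw \<in> (SIGMA v:?A b. ?A (b @ [v]))" for vw
 proof -
  have *: "b @ [fst vw, snd vw] \<in> B" using that by auto
  have "b @ [snd vw] \<in> B" "b @ [snd vw, fst vw] \<in> B" using B_D(4)[OF *] by (auto intro!: B_sub[OF *])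
  then show ?thesis by (cases vw) auto
 qed
 have "(\<Sum>vw\<in>(SIGMA v:?A b. ?A (b @ [v])). h (b @ [fst vw, snd vw]))
   = (\<Sum>vw\<in>(SIGMA v:?A b. ?A (b @ [v])). h (b @ [snd vw, fst vw]))"
  by (rule sum.reindex_bij_witness[of _ prod.swap prod.swap]) (simp_all only: sw swap_swap fst_swap snd_swap)
 also have "... = (\<Sum>vw\<in>(SIGMA v:?A b. ?A (b @ [v])). - h (b @ [fst vw, snd vw]))"
 proof (rule sum.cong[OF refl])
  fix vw assume "vw \<in> (SIGMA v:?A b. ?A (b @ [v]))"
  then have *: "b @ [fst vw, snd vw] \<in> B" by auto
  \<comment> \<open>As \<open>b\<close> has length \<open>i\<close>, these are the positions of the
    two added vertices.\<close>
  let ?t = "Transposition.transpose i (Suc i)"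
  have t: "?t permutes {..<Suc (Suc i)}" by (rule permutes_swap_id) auto
  have "permute_list ?t (b @ [fst vw, snd vw]) = b @ [snd vw, fst vw]"
  proof (rule nth_equalityI)
   fix k assume "k < length (permute_list ?t (b @ [fst vw, snd vw]))"
   then consider "k < i" | "k = i" | "k = Suc i" using b by force
   then show "permute_list ?t (b @ [fst vw, snd vw]) ! k = (b @ [snd vw, fst vw]) ! k"
    using b t by cases (auto simp: permute_list_nth nth_append)
  qed (use b in simp)
  then show "h (b @ [snd vw, fst vw]) = - h (b @ [fst vw, snd vw])"
   using a * t b unfolding antisym_on_def by (metis (no_types, lifting) length_append length_Cons list.size(3)
    Nat.add_0_right add_Suc_right sign_swap_id n_not_Suc_n of_int_minus of_int_1 mult_minus1)
 qed
 finally show ?thesis unfolding 1 by (simp add: sum_negf)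
qed

end

section \<open>Betti numbers of finite quotients\<close>

locale simplicial_degree = simplicial_gset G \<Sigma> act rp m
 for G :: "('g, 'n) monoid_scheme" (structure) and \<Sigma> :: "'v set set" and act :: "'g => 'v => 'v"
  and rp :: "nat => 'v list" and m :: nat +
 fixes i :: nat
begin

sublocale kernel_contraction G B mv rp m "Jix i" "eqs i" "Cst i" by (rule contraction)

end

locale simplicial_quotient = simplicial_degree G \<Sigma> act rp m i
 for G :: "('g, 'n) monoid_scheme" (structure) and \<Sigma> :: "'v set set" and act :: "'g => 'v => 'v"
  and rp :: "nat => 'v list" and m :: nat and i :: nat +
 fixes S :: "'g set"
 assumes S: "subgroup S G" and fin_ix: "finite (lcosets S)"
begin

sublocale quo: gset_quotient G B mv rp m S "cl S" by (rule quotient[OF S])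

abbreviation "K \<equiv> quotient_complex G S \<Sigma> act"
abbreviation "Q \<equiv> ordered_simplices K i"
abbreviation "c \<equiv> cl S"
abbreviation "kopq \<equiv> quo.kopq"
abbreviation "kmat \<equiv> quo.kmat"

lemma Q_eq: "Q = c ` {b \<in> B. length b = Suc i}" by (rule quotient_ordered[OF S])

lemma c_Q: "b \<in> B ==> c b \<in> Q \<longleftrightarrow> length b = Suc i"
 unfolding Q_eq using length_cl by (metis (mono_tags, lifting) image_iff mem_Collect_eq)

definition "rep y = (SOME h. h \<in> y)"

lemma rep: assumes "y \<in> lcosets S" shows "rep y \<in> carrier G" "y = rep y <# S"
proof -
 obtain g where g: "g \<in> carrier G" "y = g <# S" using assms by (auto simp: LCOSETS_def)
 have r: "rep y \<in> y" using lcos_self[OF g(1) S] g(2) by (metis someI rep_def)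
 show 1: "rep y \<in> carrier G" using r subgroup.lcosets_carrier[OF S is_group assms] by blast
 have "rep y \<in> g <# S" using r g by simp
 then show "y = rep y <# S" unfolding g(2) by (rule l_repr_independence[OF _ g(1) S])
qed

text \<open>Classes in the orbit of \<open>rp j\<close> correspond to right cosets of
  \<open>S\<close>; inverting the coset representative passes to the left cosets on which
  \<open>G\<close> acts.\<close>

lemma coset_class_bij:
 assumes J: "J \<subseteq> {..<m}"
 shows "bij_betw (%(y, j). c (mv (inv (rep y)) (rp j))) ((lcosets S) \<times> J) (c ` {b \<in> B. ipart b \<in> J})"
proof (rule bij_betwI')
 note Sc = subgroup.mem_carrier[OF S]
 fix x x' assume x: "x \<in> (lcosets S) \<times> J" "x' \<in> (lcosets S) \<times> J"
 then obtain y j y' j' where xy: "x = (y, j)" "x' = (y', j')" "y \<in> lcosets S" "y' \<in> lcosets S" "j \<in> J" "j' \<in> J" by auto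
 have j: "j < m" "j' < m" using xy J by auto
 note r = rep[OF xy(3)] and r' = rep[OF xy(4)]
 show "((case x of (y, j) => c (mv (inv (rep y)) (rp j))) = (case x' of (y, j) => c (mv (inv (rep y)) (rp j)))) = (x = x')"
 proof
  assume "(case x of (y, j) => c (mv (inv (rep y)) (rp j))) = (case x' of (y, j) => c (mv (inv (rep y)) (rp j)))"
  then obtain s where s: "s \<in> S" "mv (inv (rep y')) (rp j') = mv s (mv (inv (rep y)) (rp j))"
   using quo.cl_eq[of "mv (inv (rep y)) (rp j)" "mv (inv (rep y')) (rp j')"] xy r r' j by (auto simp: mv_in rp_in)
  then have e: "mv (inv (rep y')) (rp j') = mv (s \<otimes> inv (rep y)) (rp j)"
   using r Sc j by (simp add: mv_mult rp_in)
  have jj: "j = j'" and gg: "inv (rep y') = s \<otimes> inv (rep y)"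
   using parts_unique[of "inv (rep y')" j'] parts_unique[of "s \<otimes> inv (rep y)" j] e r r' s Sc j by auto
  have "rep y' = inv (s \<otimes> inv (rep y))" using gg r' by (metis inv_inv)
  then have "rep y' \<in> rep y <# S" using r s Sc using subgroup.m_inv_closed[OF S s(1)] by (auto simp: inv_mult_group l_coset_def)
  then have "rep y <# S = rep y' <# S" by (rule l_repr_independence[OF _ r(1) S])
  then show "x = x'" using xy jj r(2) r'(2) by simp
 qed simp
next
 fix x assume "x \<in> (lcosets S) \<times> J"
 then obtain y j where x: "x = (y, j)" "y \<in> lcosets S" "j \<in> J" by auto
 then show "(case x of (y, j) => c (mv (inv (rep y)) (rp j))) \<in> c ` {b \<in> B. ipart b \<in> J}"
  using rep[OF x(2)] J by (auto simp: mv_in rp_in parts_unique)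
next
 note Sc = subgroup.mem_carrier[OF S]
 fix w assume "w \<in> c ` {b \<in> B. ipart b \<in> J}"
 then obtain b where b: "b \<in> B" "ipart b \<in> J" "w = c b" by auto
 note p = parts[OF b(1)]
 let ?y = "inv (gpart b) <# S"
 have y: "?y \<in> lcosets S" using p(1) by (auto simp: LCOSETS_def)
 obtain s where s: "s \<in> S" "rep ?y = inv (gpart b) \<otimes> s" using rep[OF y] lcos_self[OF rep(1)[OF y] S] by (auto simp: l_coset_def)
 have "c (mv (inv (rep ?y)) (rp (ipart b))) = w" using p s Sc
  using quo.cl_mv[OF subgroup.m_inv_closed[OF S s(1)] b(1)] b(3) by (simp add: inv_mult_group mv_mult rp_in)
 then show "\<exists>x\<in>(lcosets S) \<times> J. w = (case x of (y, j) => c (mv (inv (rep y)) (rp j)))" using y b(2) by auto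
qed

lemma finite_classes: "finite (c ` B)"
proof -
 have "{b \<in> B. ipart b \<in> {..<m}} = B" using ipart_less by auto
 then show ?thesis using bij_betw_finite[OF coset_class_bij[of "{..<m}"]] fin_ix by simp
qed

lemma finite_Q: "finite Q" unfolding Q_eq by (rule finite_subset[OF _ finite_classes]) auto

lemma Q_Jix: "Q = c ` {b \<in> B. ipart b \<in> Jix i}" unfolding Q_eq using ipart_Jix by auto

lemma Jix_less: "Jix i \<subseteq> {..<m}" by (auto simp: Jix_def)

lemma card_Q: "card Q = card (lcosets S) * card (Jix i)"
 using bij_betw_same_card[OF coset_class_bij[OF Jix_less]] by (simp add: Q_Jix card_cartesian_product)

text \<open>Summing the diagonal entries over all cosets and exchanging the sums lets each
  \<open>\<gamma>\<close> count the cosets that it fixes.\<close>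

lemma diagonal_sum:
 assumes k: "kernel k"
 shows "(\<Sum>q\<in>Q. kmat k q q) = (\<Sum>j\<in>Jix i. trace_sum k j (%\<gamma>. real (card {y \<in> lcosets S. \<gamma> <# y = y})))"
proof -
 have inS: "inv (rep y) \<otimes> \<gamma> \<otimes> inv (inv (rep y)) \<in> S \<longleftrightarrow> \<gamma> <# y = y" if y: "y \<in> lcosets S" and \<gamma>: "\<gamma> \<in> carrier G" for y \<gamma>
 proof -
  note r = rep[OF y]
  let ?h = "rep y"
  have gy: "\<gamma> <# y = (\<gamma> \<otimes> ?h) <# S" using r lcos_m_assoc[OF subgroup.subset[OF S] \<gamma> r(1)] by metis
  have "\<gamma> <# y = y \<longleftrightarrow> \<gamma> \<otimes> ?h \<in> ?h <# S" using gy r lcos_self S \<gamma> l_repr_independence by blast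
  also have "... \<longleftrightarrow> inv ?h \<otimes> (\<gamma> \<otimes> ?h) \<in> S"
  proof
   assume "\<gamma> \<otimes> ?h \<in> ?h <# S"
   then show "inv ?h \<otimes> (\<gamma> \<otimes> ?h) \<in> S" by (rule subgroup.lcos_module_imp[OF S is_group r(1)])
  next
   assume s: "inv ?h \<otimes> (\<gamma> \<otimes> ?h) \<in> S"
   have "?h \<otimes> (inv ?h \<otimes> (\<gamma> \<otimes> ?h)) = \<gamma> \<otimes> ?h" using \<gamma> r(1) by (simp add: m_assoc[symmetric])
   then show "\<gamma> \<otimes> ?h \<in> ?h <# S" using s by (force simp: l_coset_def)
  qed
  finally show ?thesis using \<gamma> r(1) by (simp add: m_assoc)
 qed
 have "(\<Sum>q\<in>Q. kmat k q q) = (\<Sum>x\<in>(lcosets S) \<times> Jix i. case x of (y, j) => kmat k (c (mv (inv (rep y)) (rp j))) (c (mv (inv (rep y)) (rp j))))"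
  unfolding Q_Jix by (subst sum.reindex_bij_betw[OF coset_class_bij[OF Jix_less], symmetric]) (simp add: split_beta)
 also have "... = (\<Sum>y\<in>lcosets S. \<Sum>j\<in>Jix i. kmat k (c (mv (inv (rep y)) (rp j))) (c (mv (inv (rep y)) (rp j))))"
  by (simp add: sum.cartesian_product)
 also have "... = (\<Sum>y\<in>lcosets S. \<Sum>j\<in>Jix i. \<Sum>\<gamma>\<in>fixers k j. if \<gamma> <# y = y then k (rp j) (mv \<gamma> (rp j)) else 0)"
 proof (intro sum.cong refl)
  fix y j assume y: "y \<in> lcosets S" and j: "j \<in> Jix i"
  then show "kmat k (c (mv (inv (rep y)) (rp j))) (c (mv (inv (rep y)) (rp j)))
    = (\<Sum>\<gamma>\<in>fixers k j. if \<gamma> <# y = y then k (rp j) (mv \<gamma> (rp j)) else 0)"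
   using quo.kmat_diagonal[OF k inv_closed[OF rep(1)[OF y]], of j] Jix_less inS[OF y]
   by (auto simp: fixers_def)
 qed
 also have "... = (\<Sum>j\<in>Jix i. \<Sum>\<gamma>\<in>fixers k j. \<Sum>y\<in>lcosets S. if \<gamma> <# y = y then k (rp j) (mv \<gamma> (rp j)) else 0)"
  by (subst sum.swap) (intro sum.swap)
 finally show ?thesis
  unfolding trace_sum_def using fin_ix by (simp add: sum.inter_filter[symmetric] mult.commute)
qed

section \<open>Harmonic chains of a finite quotient\<close>

abbreviation "ipc \<equiv> L2_inner (count_space (c ` B))"

lemma kopq_adjoint: assumes k: "kernel k" shows "ipc (kopq k f) g = ipc f (kopq (ktr k) g)"
proof -
 note fin = finite_classes
 have "ipc (kopq k f) g = (\<Sum>x\<in>c ` B. \<Sum>y\<in>c ` B. of_real (kmat k x y) * f y * cnj (g x))"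
  by (simp add: L2_inner_count_space[OF fin] quo.kopq_kmat[OF k fin] sum_distrib_right)
 also have "... = (\<Sum>y\<in>c ` B. \<Sum>x\<in>c ` B. of_real (kmat (ktr k) y x) * f y * cnj (g x))"
  by (subst sum.swap) (intro sum.cong refl, simp add: quo.kmat_tr[OF k])
 finally show ?thesis by (simp add: L2_inner_count_space[OF fin] quo.kopq_kmat[OF kernel_tr[OF k] fin] sum_distrib_left mult_ac)
qed

lemma ipc_zero: assumes "ipc f f = 0" "b \<in> B" shows "f (c b) = 0" using assms(1) unfolding L2_inner_self
  using L2_norm_eq_0_iff[OF L2_count_space[OF finite_classes], of f] assms(2) by (auto simp: AE_count_space)

lemma ipc_Q: assumes "\<And>q. q \<notin> Q ==> g q = 0" shows "ipc f g = L2_inner (count_space Q) f g"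
proof -
 have "Q \<subseteq> c ` B" unfolding Q_eq by auto
 then show ?thesis unfolding L2_inner_count_space[OF finite_classes] L2_inner_count_space[OF finite_Q]
  by (intro sum.mono_neutral_right finite_classes) (auto simp: assms)
qed

lemma kopq_mul:
 assumes "kernel k1" "kernel k2" "b \<in> B" shows "kopq (kmul k1 k2) f (c b) = kopq k1 (kopq k2 f) (c b)"
 using assms by (simp add: quo.kopq_cl kernel_mul kop_mul) (intro kop_cong, simp add: quo.kopq_cl)

abbreviation "LQ \<equiv> real_sym_op Q (kmat kL)"

lemma LQ_kop: assumes b: "b \<in> B" shows "LQ f (c b) = kop kL (%b. f (c b)) b"
proof (cases "length b = Suc i")
 case True
 have "kop kL (%b. f (c b)) b = (\<Sum>q\<in>c ` B. of_real (kmat kL (c b) q) * f q)"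
  using quo.kopq_kmat[OF kernel_L finite_classes, of "c b" f] quo.kopq_cl[OF kernel_L b, of f] b by simp
 also have "... = (\<Sum>q\<in>Q. of_real (kmat kL (c b) q) * f q)"
 proof (rule sum.mono_neutral_right[OF finite_classes])
  show "Q \<subseteq> c ` B" unfolding Q_eq by auto
  show "\<forall>q\<in>c ` B - Q. of_real (kmat kL (c b) q) * f q = 0"
  proof
   fix q assume "q \<in> c ` B - Q"
   then obtain b' where b': "b' \<in> B" "q = c b'" "length b' \<noteq> Suc i" using c_Q by auto
   have "kL b (mv s b') = 0" if "s \<in> S" for s
    using L_supp(2)[OF b mv_in[OF quo.S_carrier[OF that] b'(1)]] b' parts_mv(2)[OF quo.S_carrier[OF that] b'(1)]
     ipart_Jix[OF b'(1)] by auto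
   then show "of_real (kmat kL (c b) q) * f q = 0" unfolding b'(2) quo.kmat_eq[OF kernel_L b b'(1)] by simp
  qed
 qed
 finally show ?thesis using True b by (simp add: real_sym_op_def c_Q)
next
 case False
 then have "supp kL b = {}" using L_supp(1)[OF b] ipart_Jix[OF b] by (auto simp: supp_def)
 then show ?thesis using False b by (simp add: real_sym_op_def c_Q kop_def)
qed

text \<open>The quotient inherits transposes and products of kernels, so the form of the transposed
  equations times the equations is a squared norm; this gives positivity and identifies the
  kernel.\<close>

lemma form_square:
 assumes f: "\<And>q. q \<notin> Q ==> f q = 0"
 shows "(\<Sum>q\<in>Q. LQ f q * cnj (f q)) = ipc (kopq (eqs i) f) (kopq (eqs i) f)"
proof -
 have "(\<Sum>q\<in>Q. LQ f q * cnj (f q)) = ipc (LQ f) f"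
  using ipc_Q[of f "LQ f", OF f] L2_inner_count_space[OF finite_Q, of "LQ f" f] by simp
 also have "... = ipc (kopq (ktr (eqs i)) (kopq (eqs i) f)) f"
  unfolding L2_inner_count_space[OF finite_classes]
 proof (rule sum.cong[OF refl])
  fix q assume "q \<in> c ` B"
  then obtain b where b: "b \<in> B" "q = c b" by auto
  have "LQ f q = kopq kL f q" using b by (simp add: LQ_kop quo.kopq_cl kernel_L)
  also have "... = kopq (ktr (eqs i)) (kopq (eqs i) f) q"
   unfolding kL_def b(2) by (rule kopq_mul[OF kernel_tr[OF E] E b(1)])
  finally show "LQ f q * cnj (f q) = kopq (ktr (eqs i)) (kopq (eqs i) f) q * cnj (f q)" by simp
 qed
 also have "... = ipc (kopq (eqs i) f) (kopq (ktr (ktr (eqs i))) f)" by (rule kopq_adjoint[OF kernel_tr[OF E]])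
 also have "ktr (ktr (eqs i)) = eqs i" by (simp add: ktr_def fun_eq_iff)
 finally show ?thesis .
qed

text \<open>All bounds descend because an entry on classes sums entries over a class: integrality is
  kept, and absolute row sums can only shrink.\<close>

lemma integral_psd_quotient: "integral_psd (Cst i) Q (kmat kL)"
proof
 show "1 \<le> Cst i" by (rule C1)
 show "finite Q" by (rule finite_Q)
 have kL_int: "kL b b' \<in> \<int>" if "b \<in> B" "b' \<in> B" for b b'
  unfolding kL_def kmul_def ktr_def using that eqs_ints by (intro Ints_sum) (auto simp: supp_def)
 fix q q' assume "q \<in> Q" "q' \<in> Q"
 then obtain b b' where b: "b \<in> B" "q = c b" "b' \<in> B" "q' = c b'" unfolding Q_eq by auto
 show "kmat kL q q' \<in> \<int>"
  unfolding b quo.kmat_eq[OF kernel_L b(1,3)] using kL_int[OF b(1)] mv_in b(3) quo.S_carrier by auto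
 have "kmat (ktr kL) q' q = kmat kL q q'" using b by (intro quo.kmat_tr kernel_L) auto
 moreover have "kmat (ktr kL) q' q = kmat kL q' q"
  unfolding b quo.kmat_eq[OF kernel_L b(3,1)] quo.kmat_eq[OF kernel_tr[OF kernel_L] b(3,1)]
  using b quo.S_carrier L_sym[OF b(3)] by (intro sum.cong) (auto simp: ktr_def mv_in)
 ultimately show "kmat kL q q' = kmat kL q' q" by simp
next
 fix f :: "'v set list => complex"
 let ?f = "%q. if q \<in> Q then f q else 0"
 have "(\<Sum>q\<in>Q. LQ f q * cnj (f q)) = (\<Sum>q\<in>Q. LQ ?f q * cnj (?f q))"
  by (intro sum.cong refl) (simp add: real_sym_op_def)
 also have "... = ipc (kopq (eqs i) ?f) (kopq (eqs i) ?f)" by (rule form_square) simp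
 finally show "0 \<le> Re (\<Sum>q\<in>Q. LQ f q * cnj (f q))" by (simp add: L2_inner_self)
next
 fix q assume "q \<in> Q"
 then obtain b where b: "b \<in> B" "q = c b" unfolding Q_eq by auto
 define b0 where "b0 = (SOME b'. b' \<in> B \<and> c b' = q)"
 have b0: "b0 \<in> B" unfolding b0_def using b by (metis (mono_tags, lifting) someI_ex)
 have fs: "finite (supp kL b0)" by (rule finite_supp[OF kernel_L b0])
 have "(\<Sum>q'\<in>Q. \<bar>kmat kL q q'\<bar>) \<le> (\<Sum>q'\<in>c ` B. \<bar>kmat kL q q'\<bar>)"
  unfolding Q_eq by (intro sum_mono2 finite_classes) auto
 also have "... \<le> (\<Sum>q'\<in>c ` B. \<Sum>b'\<in>{b' \<in> supp kL b0. c b' = q'}. \<bar>kL b0 b'\<bar>)"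
  by (intro sum_mono) (simp add: quo.kmat_def b0_def[symmetric])
 also have "... = (\<Sum>b'\<in>supp kL b0. \<bar>kL b0 b'\<bar>)" using supp_subset by (intro sum.group fs finite_classes) auto
 also have "... \<le> ksum kL" by (rule row_sum_le[OF kernel_L b0])
 finally show "(\<Sum>q'\<in>Q. \<bar>kmat kL q q'\<bar>) \<le> Cst i" using C_large by (simp add: kL_def)
qed

lemma contracted_kop: assumes b: "b \<in> B" shows "contracted_op (Cst i) Q (kmat kL) f (c b) = kop kT (%b. f (c b)) b"
 unfolding kop_T[OF b] contracted_op_def using b
 by (auto simp: c_Q ipart_Jix LQ_kop[symmetric] real_sym_op_def)

lemma contracted_pow:
 assumes "b \<in> B" shows "(contracted_op (Cst i) Q (kmat kL) ^^ n) f (c b) = kop (kpow kT n) (%b. f (c b)) b"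
 unfolding kop_pow[OF kernel_T assms] using assms
proof (induction n arbitrary: b)
 case (Suc n)
 have "(contracted_op (Cst i) Q (kmat kL) ^^ Suc n) f (c b) = kop kT (%b. (contracted_op (Cst i) Q (kmat kL) ^^ n) f (c b)) b"
  by (simp add: contracted_kop[OF Suc.prems])
 also have "... = kop kT ((kop kT ^^ n) (%b. f (c b))) b" by (rule kop_cong) (rule Suc.IH)
 finally show ?case by simp
qed simp

theorem contracted_trace: "op_trace Q (contracted_op (Cst i) Q (kmat kL) ^^ n)
  = of_real (\<Sum>j\<in>Jix i. trace_sum (kpow kT n) j (%\<gamma>. real (card {y \<in> lcosets S. \<gamma> <# y = y})))"
proof -
 have "op_trace Q (contracted_op (Cst i) Q (kmat kL) ^^ n) = (\<Sum>q\<in>Q. of_real (kmat (kpow kT n) q q))"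
  unfolding op_trace_def
 proof (rule sum.cong[OF refl])
  fix q assume "q \<in> Q"
  then obtain b where b: "b \<in> B" "q = c b" unfolding Q_eq by auto
  have "kop (kpow kT n) (%b'. indicator {c b} (c b')) b = kop (kpow kT n) (%b'. of_bool (c b' = c b)) b"
   by (rule kop_cong) (auto)
  then show "(contracted_op (Cst i) Q (kmat kL) ^^ n) (indicator {q}) q = of_real (kmat (kpow kT n) q q)"
   unfolding b(2) contracted_pow[OF b(1)] using quo.kop_indicator[OF kernel_pow[OF kernel_T] b(1)] by simp
 qed
 also have "... = of_real (\<Sum>q\<in>Q. kmat (kpow kT n) q q)" by simp
 finally show ?thesis by (simp only: diagonal_sum[OF kernel_pow[OF kernel_T]])
qed

lemma supp_class: "(\<And>q. q \<notin> ordered_simplices K j ==> f q = 0) ==> b \<in> B ==> length b \<noteq> Suc j ==> f (c b) = 0"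
 unfolding quotient_ordered[OF S] using length_cl by (metis (mono_tags, lifting) image_iff mem_Collect_eq)

lemma ker_harmonic: "integral_psd.ker Q (kmat kL) = {f. (\<forall>q. q \<notin> Q --> f q = 0) \<and> harmonic i (%b. f (c b))}"
proof -
 interpret integral_psd "Cst i" Q "kmat kL" by (rule integral_psd_quotient)
 have "(\<forall>q\<in>Q. LQ f q = 0) \<longleftrightarrow> harmonic i (%b. f (c b))" if f: "\<And>q. q \<notin> Q ==> f q = 0" for f
 proof -
  have "harmonic i (%b. f (c b)) \<longleftrightarrow> (\<forall>b\<in>B. kop (eqs i) (%b. f (c b)) b = 0)"
   using supp_class[of i f] f by (intro eqs_iff_harmonic[symmetric]) auto
  also have "... \<longleftrightarrow> (\<forall>q\<in>Q. LQ f q = 0)"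
  proof
   assume z: "\<forall>b\<in>B. kop (eqs i) (%b. f (c b)) b = 0"
   show "\<forall>q\<in>Q. LQ f q = 0"
   proof
    fix q assume "q \<in> Q"
    then obtain b where b: "b \<in> B" "q = c b" unfolding Q_eq by auto
    have "LQ f q = kop (ktr (eqs i)) (kop (eqs i) (%b. f (c b))) b"
     unfolding b(2) LQ_kop[OF b(1)] unfolding kL_def by (rule kop_mul[OF kernel_tr[OF E] E b(1)])
    also have "... = kop (ktr (eqs i)) (%b. 0) b" by (rule kop_cong) (simp add: z)
    finally show "LQ f q = 0" by (simp add: kop_zero)
   qed
  next
   assume "\<forall>q\<in>Q. LQ f q = 0"
   then have "ipc (kopq (eqs i) f) (kopq (eqs i) f) = 0" by (simp flip: form_square[OF f])
   then show "\<forall>b\<in>B. kop (eqs i) (%b. f (c b)) b = 0" using ipc_zero by (simp flip: quo.kopq_cl[OF E])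
  qed
  finally show ?thesis by blast
 qed
 then show ?thesis by (auto simp: ker_def)
qed

lemma chains_iff:
 "f \<in> simplicial_chains K j \<longleftrightarrow> (\<forall>q. q \<notin> ordered_simplices K j --> f q = 0) \<and> antisym_on j (%b. f (c b))"
proof -
 have fin: "finite (ordered_simplices K j)"
  unfolding quotient_ordered[OF S] by (rule finite_subset[OF _ finite_classes]) auto
 have perm: "permute_list pm (c b) = c (permute_list pm b)" if "pm permutes {..<Suc j}" "length b = Suc j" for pm b
  using that by (simp add: cl_def permute_list_map)
 have "(\<forall>pm vs. pm permutes {..<Suc j} \<and> vs \<in> ordered_simplices K j --> f (permute_list pm vs) = of_int (sign pm) * f vs)
   \<longleftrightarrow> antisym_on j (%b. f (c b))" unfolding quotient_ordered[OF S] antisym_on_def using perm by fastforce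
 then show ?thesis unfolding simplicial_chains_def using fin by (auto intro: finite_subset)
qed

lemma cycles_iff: "f \<in> simplicial_cycles K i \<longleftrightarrow> (\<forall>q. q \<notin> Q --> f q = 0) \<and> antisym_on i (%b. f (c b))
   \<and> (\<forall>b\<in>B. length b = i --> kop face (%b. f (c b)) b = 0)"
proof -
 have "simplicial_boundary K i f = (%_. 0) \<longleftrightarrow> (\<forall>b\<in>B. length b = i --> kop face (%b. f (c b)) b = 0)"
 proof (cases i)
  case 0
  then show ?thesis using B_D(2) by (auto simp: simplicial_boundary_def)
 next
  case (Suc j)
  show ?thesis
  proof
   assume "simplicial_boundary K i f = (%_. 0)"
   then show "\<forall>b\<in>B. length b = i --> kop face (%b. f (c b)) b = 0"
    using quotient_boundary[OF S, of _ j f] Suc by simp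
  next
   assume z: "\<forall>b\<in>B. length b = i --> kop face (%b. f (c b)) b = 0"
   show "simplicial_boundary K i f = (%_. 0)"
   proof
    fix ws show "simplicial_boundary K i f ws = 0"
    proof (cases "ws \<in> c ` {b \<in> B. length b = Suc j}")
     case True
     then show ?thesis using quotient_boundary[OF S, of _ j f] Suc z by auto
    next
     case False
     then show ?thesis using boundary_outside[OF S] Suc by blast
    qed
   qed
  qed
 qed
 then show ?thesis by (auto simp: simplicial_cycles_def chains_iff)
qed

lemma boundary_supp: "w \<notin> Q ==> simplicial_boundary K (Suc i) g w = 0"
 using boundary_outside[OF S, of w i g] by (simp add: Q_eq)

lemma boundary_kopq: "b \<in> B ==> length b = Suc i ==> simplicial_boundary K (Suc i) g (c b) = kopq face g (c b)"
 by (simp add: quotient_boundary[OF S] quo.kopq_cl kernel_face)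

lemma boundary_lin:
 "simplicial_boundary K (Suc i) (%v. f v + z * g v) = (%v. simplicial_boundary K (Suc i) f v + z * simplicial_boundary K (Suc i) g v)"
proof
 fix q
 show "simplicial_boundary K (Suc i) (%v. f v + z * g v) q = simplicial_boundary K (Suc i) f q + z * simplicial_boundary K (Suc i) g q"
 proof (cases "q \<in> Q")
  case True
  then obtain b where "b \<in> B" "length b = Suc i" "q = c b" unfolding Q_eq by auto
  then show ?thesis by (simp add: quotient_boundary[OF S] kop_lin)
 qed (simp add: boundary_supp)
qed

lemma chains_lin:
 "f \<in> simplicial_chains K j ==> g \<in> simplicial_chains K j ==> (%v. f v + z * g v) \<in> simplicial_chains K j"
 by (simp add: chains_iff antisym_lin)

lemma zero_chain: "(%_. 0) \<in> simplicial_chains K j" by (simp add: chains_iff antisym_on_def)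

lemma fsubspace_cycles: "fsubspace Q (simplicial_cycles K i)" unfolding fsubspace_def
proof (intro conjI ballI allI impI)
 show "(%_. 0) \<in> simplicial_cycles K i" unfolding cycles_iff by (simp add: antisym_on_def kop_zero)
next
 fix f g z assume "f \<in> simplicial_cycles K i" "g \<in> simplicial_cycles K i"
 then show "(%v. f v + z * g v) \<in> simplicial_cycles K i" unfolding cycles_iff by (simp add: antisym_lin kop_lin)
next
 fix f v assume "f \<in> simplicial_cycles K i" "v \<notin> Q"
 then show "f v = 0" unfolding cycles_iff by simp
qed

lemma fsubspace_boundaries: "fsubspace Q (simplicial_boundaries K i)" unfolding fsubspace_def
proof (intro conjI ballI allI impI)
 have "simplicial_boundary K (Suc i) (%_. 0) = (%_. 0)" by (simp add: simplicial_boundary_def fun_eq_iff)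
 then show "(%_. 0) \<in> simplicial_boundaries K i"
  unfolding simplicial_boundaries_def using zero_chain by (metis image_eqI)
 fix f g z assume "f \<in> simplicial_boundaries K i" "g \<in> simplicial_boundaries K i"
 then show "(%v. f v + z * g v) \<in> simplicial_boundaries K i"
  unfolding simplicial_boundaries_def by (auto simp: boundary_lin[symmetric] intro!: chains_lin)
next
 fix f v assume "f \<in> simplicial_boundaries K i" "v \<notin> Q"
 then show "f v = 0" by (auto simp: simplicial_boundaries_def boundary_supp)
qed

lemma boundaries_cycles: "simplicial_boundaries K i \<subseteq> simplicial_cycles K i"
proof
 fix f assume "f \<in> simplicial_boundaries K i"
 then obtain g where g: "g \<in> simplicial_chains K (Suc i)" "f = simplicial_boundary K (Suc i) g"
  by (auto simp: simplicial_boundaries_def)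
 have a: "antisym_on (Suc i) (%b. g (c b))" using g(1) by (simp add: chains_iff)
 have f: "f (c b) = kop face (%b. g (c b)) b" if "b \<in> B" "length b = Suc i" for b
  using that g(2) by (simp add: quotient_boundary[OF S])
 have "antisym_on i (%b. f (c b))" using antisym_face[OF a] f permute_B unfolding antisym_on_def by simp
 moreover have "kop face (%b. f (c b)) b = 0" if b: "b \<in> B" "length b = i" for b
 proof -
  have "kop face (%b. f (c b)) b = kop face (kop face (%b. g (c b))) b"
   unfolding kop_face(1)[OF b(1)] using f b(2) by simp
  then show ?thesis using face_face[OF a b] by simp
 qed
 ultimately show "f \<in> simplicial_cycles K i" unfolding cycles_iff using g(2) boundary_supp by auto
qed

text \<open>Boundaries are taken of antisymmetric chains, on which \<open>alt\<close> is
  multiplication by the factorial. Moving \<open>face\<close> and the symmetric kernel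
  \<open>alt\<close> to the other side gives the coboundary condition in the form used in
  \<open>eqs\<close>.\<close>

lemma orthogonal_to_boundaries:
 assumes f: "\<And>q. q \<notin> Q ==> f q = 0" and g: "g \<in> simplicial_chains K (Suc i)"
 shows "fact (Suc (Suc i)) * ipc f (simplicial_boundary K (Suc i) g) = ipc (kopq alt (kopq (ktr face) f)) g"
proof -
 have galt: "kopq alt g (c b) = fact (Suc (Suc i)) * g (c b)" if b: "b \<in> B" for b
 proof (cases "length b = Suc (Suc i)")
  case True
  then show ?thesis using g b unfolding chains_iff antisym_alt by (simp add: quo.kopq_cl kernel_alt)
 next
  case False
  have z: "g (c b') = 0" if "b' \<in> B" "length b' \<noteq> Suc (Suc i)" for b'
   using supp_class[of "Suc i" g b'] g that by (auto simp: chains_iff)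
  have "kopq alt g (c b) = 0" unfolding quo.kopq_cl[OF kernel_alt b] kop_alt[OF b]
   by (rule) (use z permute_B[OF b] False in auto)
  then show ?thesis using z[OF b False] by simp
 qed
 have "ipc f (simplicial_boundary K (Suc i) g) = ipc f (kopq face g)"
  unfolding L2_inner_count_space[OF finite_classes]
 proof (rule sum.cong[OF refl])
  fix q assume "q \<in> c ` B"
  then obtain b where b: "b \<in> B" "q = c b" by auto
  show "f q * cnj (simplicial_boundary K (Suc i) g q) = f q * cnj (kopq face g q)"
   using f[of q] c_Q[OF b(1)] boundary_kopq[OF b(1)] b(2) by auto
 qed
 also have "... = ipc (kopq (ktr face) f) g"
  using kopq_adjoint[OF kernel_tr[OF kernel_face], of f g] by (simp add: ktr_def[abs_def])
 finally have 1: "ipc f (simplicial_boundary K (Suc i) g) = ipc (kopq (ktr face) f) g" .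
 have "fact (Suc (Suc i)) * ipc (kopq (ktr face) f) g = ipc (kopq (ktr face) f) (%q. fact (Suc (Suc i)) * g q)"
  by (simp add: L2_inner_scale L2_count_space[OF finite_classes])
 also have "... = ipc (kopq (ktr face) f) (kopq alt g)"
  unfolding L2_inner_count_space[OF finite_classes] using galt by (intro sum.cong) auto
 also have "... = ipc (kopq (ktr face) f) (kopq (ktr alt) g)"
  unfolding L2_inner_count_space[OF finite_classes]
 proof (intro sum.cong refl arg_cong2[where f="(*)"] arg_cong[where f=cnj])
  fix q assume "q \<in> c ` B"
  then obtain b where b: "b \<in> B" "q = c b" by auto
  then show "kopq alt g q = kopq (ktr alt) g q"
   unfolding b(2) quo.kopq_cl[OF kernel_alt b(1)] quo.kopq_cl[OF kernel_tr[OF kernel_alt] b(1)] kop_def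
   using alt_sym[OF b(1)] by (intro sum.cong) (auto simp: supp_def ktr_def)
 qed
 also have "... = ipc (kopq alt (kopq (ktr face) f)) g" by (rule kopq_adjoint[OF kernel_alt, symmetric])
 finally show ?thesis by (simp only: 1)
qed

lemma harmonic_cycles:
 "{f \<in> simplicial_cycles K i. \<forall>g\<in>simplicial_boundaries K i. L2_inner (count_space Q) f g = 0} = integral_psd.ker Q (kmat kL)"
proof (intro Set.set_eqI iffI)
 fix f assume f: "f \<in> {f \<in> simplicial_cycles K i. \<forall>g\<in>simplicial_boundaries K i. L2_inner (count_space Q) f g = 0}"
 then have f0: "\<And>q. q \<notin> Q ==> f q = 0" by (auto simp: cycles_iff)
 \<comment> \<open>The antisymmetrized coboundary of \<open>f\<close>, whose pairing with
   \<open>f\<close> through its own boundary is its squared norm. It is set to 0 off the classes,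
   where \<open>kopq\<close> has arbitrary values.\<close>
 define D where "D q = (if q \<in> c ` B then kopq alt (kopq (ktr face) f) q else 0)" for q
 have D: "D (c b) = kop alt (kop (ktr face) (%b. f (c b))) b" if b: "b \<in> B" for b unfolding D_def using b
  by (simp add: quo.kopq_cl kernel_alt) (intro kop_cong, simp add: quo.kopq_cl kernel_tr kernel_face)
 have Dc: "D \<in> simplicial_chains K (Suc i)" unfolding chains_iff
 proof (intro conjI allI impI)
  fix q assume q: "q \<notin> ordered_simplices K (Suc i)"
  show "D q = 0"
  proof (cases "q \<in> c ` B")
   case True
   then obtain b where b: "b \<in> B" "q = c b" by auto
   then have "length b \<noteq> Suc (Suc i)" using q by (auto simp: quotient_ordered[OF S])
   then show ?thesis
    unfolding b(2) D[OF b(1)] using supp_class[of i f] f0 by (intro coface_outside[where i=i] b) auto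
  qed (simp add: D_def)
 next
  show "antisym_on (Suc i) (%b. D (c b))" unfolding antisym_on_def using D permute_B kop_alt_sign by simp
 qed
 have "L2_inner (count_space Q) f (simplicial_boundary K (Suc i) D) = 0"
  using f Dc by (auto simp: simplicial_boundaries_def)
 then have "ipc f (simplicial_boundary K (Suc i) D) = 0" by (subst ipc_Q) (auto simp: boundary_supp)
 then have "ipc D D = 0" using orthogonal_to_boundaries[of f D, OF f0 Dc] unfolding L2_inner_count_space[OF finite_classes] by (simp add: D_def)
 then have "kop alt (kop (ktr face) (%b. f (c b))) b = 0" if "b \<in> B" for b using ipc_zero[of D b] D[OF that] that by simp
 then show "f \<in> integral_psd.ker Q (kmat kL)" using f by (auto simp: ker_harmonic harmonic_def cycles_iff)
next
 fix f assume f: "f \<in> integral_psd.ker Q (kmat kL)"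
 then have f0: "\<And>q. q \<notin> Q ==> f q = 0" and h: "harmonic i (%b. f (c b))" by (auto simp: ker_harmonic)
 have cyc: "f \<in> simplicial_cycles K i" using f0 h by (auto simp: cycles_iff harmonic_def)
 have z: "kopq alt (kopq (ktr face) f) q = 0" if "q \<in> c ` B" for q
 proof -
  obtain b where b: "b \<in> B" "q = c b" using \<open>q \<in> c ` B\<close> by auto
  have "kopq alt (kopq (ktr face) f) q = kop alt (kop (ktr face) (%b. f (c b))) b"
   unfolding b(2) using b(1) by (simp add: quo.kopq_cl kernel_alt) (intro kop_cong, simp add: quo.kopq_cl kernel_tr kernel_face)
  also have "... = 0"
   using h b(1) coface_outside[of i "%b. f (c b)" b] supp_class[of i f] f0 by (cases) (auto simp: harmonic_def)
  finally show ?thesis .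
 qed
 have "L2_inner (count_space Q) f g = 0" if "g \<in> simplicial_boundaries K i" for g
 proof -
  obtain g' where g': "g' \<in> simplicial_chains K (Suc i)" "g = simplicial_boundary K (Suc i) g'"
   using \<open>g \<in> simplicial_boundaries K i\<close> by (auto simp: simplicial_boundaries_def)
  have "fact (Suc (Suc i)) * ipc f g = ipc (kopq alt (kopq (ktr face) f)) g'"
   unfolding g'(2) by (rule orthogonal_to_boundaries[OF f0 g'(1)])
  also have "... = 0" unfolding L2_inner_count_space[OF finite_classes] by (simp add: z)
  finally show ?thesis using ipc_Q[of g f] boundary_supp g'(2) by (simp del: fact_Suc)
 qed
 with cyc show "f \<in> {f \<in> simplicial_cycles K i. \<forall>g\<in>simplicial_boundaries K i. L2_inner (count_space Q) f g = 0}" by blast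
qed

theorem betti_harmonic: "\<exists>S'. onbasis Q (integral_psd.ker Q (kmat kL)) S' \<and> betti i K = card S'"
 by (rule dim_orthogonal_complement[OF finite_Q fsubspace_cycles fsubspace_boundaries boundaries_cycles])
  (unfold betti_def harmonic_cycles, blast)

end

section \<open>The quotient complex over the orbit relation\<close>

context simplicial_degree begin

definition cycle :: "('v list => complex) => bool" where
 "cycle h \<longleftrightarrow> antisym_on i h \<and> (\<forall>b\<in>B. length b = i --> kop face h b = 0)"

lemma cycle_lin: "cycle f ==> cycle g ==> cycle (%b. f b + c * g b)"
 by (simp add: cycle_def antisym_lin kop_lin)

lemma cycle_mv: assumes g: "g \<in> carrier G" and h: "cycle h" shows "cycle (%b. h (mv g b))"
 unfolding cycle_def antisym_on_def
proof (intro conjI ballI impI allI)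
 fix b pm assume b: "b \<in> B" "length b = Suc i" and p: "pm permutes {..<Suc i}"
 have "mv g (permute_list pm b) = permute_list pm (mv g b)" using p b(2) permute_mv[of pm b g] by simp
 then show "h (mv g (permute_list pm b)) = of_int (sign pm) * h (mv g b)"
  using h mv_in[OF g b(1)] b(2) p by (simp add: cycle_def antisym_on_def) (simp add: mv_def)
next
 fix b assume b: "b \<in> B" "length b = i"
 show "kop face (%b. h (mv g b)) b = 0" using b(2)
  unfolding kop_mv[OF kernel_face g b(1), symmetric] using h mv_in[OF g b(1)] by (simp add: mv_def cycle_def)
qed

lemma harmonic_cycle: "harmonic i h ==> cycle h" by (simp add: harmonic_def cycle_def)

lemma alt_transpose: "b \<in> B ==> kop (ktr alt) h b = kop alt h b"
 by (rule kop_kcong) (simp add: ktr_def alt_sym)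

lemma coface_antisym: "antisym_on (Suc i) (kop alt (kop (ktr face) h))"
 unfolding antisym_on_def by (auto intro: kop_alt_sign)

text \<open>On cycles the operator \<open>eqs\<^sup>* eqs\<close> is a multiple of the boundary of the coboundary.\<close>

lemma laplace_cycle:
 assumes h0: "\<And>b. b \<in> B ==> length b \<noteq> Suc i ==> h b = 0" and h: "cycle h" and b: "b \<in> B"
 shows "kop kL h b = fact (Suc (Suc i)) * kop face (kop alt (kop (ktr face) h)) b"
proof -
 let ?D = "kop alt (kop (ktr face) h)"
 have D0: "?D b = 0" if "b \<in> B" "length b \<noteq> Suc (Suc i)" for b
  using coface_outside[of i h b] h0 that by blast
 have 1: "kop (eqs i) h b' = ?D b'" if b': "b' \<in> B" for b'
  using eqs_row[of i h b'] h0 b' D0[OF b'] h[unfolded cycle_def antisym_alt] by simp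
 have "kop kL h b = kop (ktr (eqs i)) (kop (eqs i) h) b"
  unfolding kL_def by (rule kop_mul[OF kernel_tr[OF E] E b])
 also have "... = kop (ktr (eqs i)) ?D b" by (rule kop_cong) (rule 1)
 also have "... = kop (kmul (ktr (lenchi i)) (ktr (eqs0 i))) ?D b"
  unfolding eqs_def by (rule kop_kcong) (rule ktr_kmul[OF kernel_eqs0 kernel_lenchi b])
 also have "... = kop (ktr (lenchi i)) (kop (ktr (eqs0 i)) ?D) b"
  by (rule kop_mul[OF kernel_tr[OF kernel_lenchi] kernel_tr[OF kernel_eqs0] b])
 also have "ktr (lenchi i) = lenchi i" by (auto simp: ktr_def lenchi_def fun_eq_iff)
 also have "kop (lenchi i) (kop (ktr (eqs0 i)) ?D) b = fact (Suc (Suc i)) * kop face ?D b"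
 proof (cases "length b = Suc i")
  case False
  have "kop face ?D b = 0" unfolding kop_face(1)[OF b] by (rule) (use D0 False in auto)
  then show ?thesis using False by (simp add: kop_lenchi[OF b])
 next
  case True
  \<comment> \<open>\<open>?D\<close> lives on lists of length \<open>i + 2\<close> and
    \<open>b\<close> has length \<open>i + 1\<close>, so of the transposed equations only the part
    combining \<open>face\<close> and \<open>alt\<close> contributes.\<close>
  let ?k1 = "%b b'. 1 * ktr face b b' + 1 * ktr (kmul alt (ktr face)) b b'"
  let ?k2 = "%b b'. fact (Suc i) * ktr kid b b' + (-1) * ktr alt b b'"
  note ka = kernel_tr[OF kernel_face] and kb = kernel_tr[OF kernel_mul[OF kernel_alt kernel_tr[OF kernel_face]]]
   and kc = kernel_tr[OF kernel_id] and kd = kernel_tr[OF kernel_alt]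
  have "ktr (eqs0 i) = (%b b'. 1 * ?k1 b b' + 1 * ?k2 b b')" by (simp add: eqs0_def ktr_def fun_eq_iff)
  then have "kop (ktr (eqs0 i)) ?D b = of_real 1 * kop ?k1 ?D b + of_real 1 * kop ?k2 ?D b"
   by (simp only: kop_combine[OF kernel_lin[OF ka kb] kernel_lin[OF kc kd] b])
  also have "kop ?k1 ?D b = of_real 1 * kop (ktr face) ?D b + of_real 1 * kop (ktr (kmul alt (ktr face))) ?D b"
   by (rule kop_combine[OF ka kb b])
  also have "kop ?k2 ?D b = of_real (fact (Suc i)) * kop (ktr kid) ?D b + of_real (-1) * kop (ktr alt) ?D b"
   by (rule kop_combine[OF kc kd b])
  moreover have "kop (ktr face) ?D b = 0"
  proof (cases "butlast b = []")
   case False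
   then have "butlast b \<in> B"
    using B_sub[OF b, of "butlast b"] B_D(4)[OF b] by (auto dest: in_set_butlastD simp: distinct_butlast)
   then have "?D (butlast b) = 0" using True by (intro D0) auto
   then show ?thesis by (simp add: kop_face_tr b)
  qed (simp add: kop_face_tr b)
  moreover have "kop (ktr kid) ?D b = 0"
  proof -
   have "ktr kid = kid" by (auto simp: ktr_def kid_def fun_eq_iff)
   then show ?thesis using D0[OF b] True by (simp add: kop_id b)
  qed
  moreover have "kop (ktr alt) ?D b = 0" unfolding alt_transpose[OF b] kop_alt[OF b, of ?D]
   by (rule) (use D0 permute_B[OF b] True in auto)
  moreover have "kop (ktr (kmul alt (ktr face))) ?D b = fact (Suc (Suc i)) * kop face ?D b"
  proof -
   have "kop (ktr (kmul alt (ktr face))) ?D b = kop (kmul (ktr (ktr face)) (ktr alt)) ?D b"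
    by (rule kop_kcong) (rule ktr_kmul[OF kernel_alt kernel_tr[OF kernel_face] b])
   also have "... = kop (ktr (ktr face)) (kop (ktr alt) ?D) b"
    by (rule kop_mul[OF kernel_tr[OF kernel_tr[OF kernel_face]] kernel_tr[OF kernel_alt] b])
   also have "ktr (ktr face) = face" by (simp add: ktr_def fun_eq_iff)
   also have "kop face (kop (ktr alt) ?D) b = kop face (%b. fact (Suc (Suc i)) * ?D b) b"
   proof (rule kop_cong)
    fix b' assume b': "b' \<in> B"
    show "kop (ktr alt) ?D b' = fact (Suc (Suc i)) * ?D b'"
    proof (cases "length b' = Suc (Suc i)")
     case True
     then show ?thesis using coface_antisym[of h] b' unfolding antisym_alt alt_transpose[OF b'] by blast
    next
     case False
     have "kop alt ?D b' = 0"
      unfolding kop_alt[OF b', of ?D] by (rule) (use D0 permute_B[OF b'] False in auto)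
     then show ?thesis using D0[OF b' False] by (simp add: alt_transpose b')
    qed
   qed
   finally show ?thesis by (simp only: kop_scale)
  qed
  ultimately show ?thesis using True by (simp add: kop_lenchi[OF b])
 qed
 finally show ?thesis .
qed

end

locale orbit_complex = simplicial_degree G \<Sigma> act rp m i + pmp_action G M a
 for G :: "('g, 'n) monoid_scheme" (structure) and \<Sigma> :: "'v set set" and act :: "'g => 'v => 'v"
  and rp :: "nat => 'v list" and m :: nat and i :: nat and M :: "'x measure" and a :: "'g => 'x => 'x"
begin

sublocale harmonic_op G M a B mv rp m "Jix i" "eqs i" "Cst i" by unfold_locales

abbreviation "Xi \<equiv> isotropy_quotient G M a \<Sigma> act"
abbreviation "W \<equiv> simplices Xi"
abbreviation "qc x \<equiv> cl (stab x)"
definition "pX x b = (x, qc x b)"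
definition "Bl j = {b \<in> B. length b = Suc j}"

lemma Bl_ordered: "ordered_simplices \<Sigma> j = Bl j" by (auto simp: Bl_def B_ordered)

lemma Bl_B: "b \<in> Bl j ==> b \<in> B" by (simp add: Bl_def)

lemma countable_B: "countable B"
proof (rule countable_subset)
 show "B \<subseteq> (%(g, l). mv g (rp l)) ` (carrier G \<times> {..<m})" using rp_cover by fastforce
qed (simp add: countable_carrier)

lemma isotropy_section: "x \<in> space M ==> isotropy_groupoid G M a `` {x} = stab x"
 by (auto simp: isotropy_groupoid_def action_groupoid_def stab_def)

lemma fibre_Xi: "x \<in> space M ==> fibre Xi x = quotient_complex G (stab x) \<Sigma> act"
 by (simp add: isotropy_quotient_def isotropy_fibre_def isotropy_section)

lemma projection_pX: "x \<in> space M ==> isotropy_projection G M a act (x, b) = pX x b"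
 unfolding isotropy_projection_def pX_def cl_def q_def[abs_def] by (simp add: isotropy_section)

lemma qc_eq: "x \<in> space M ==> b \<in> B ==> b' \<in> B ==> qc x b = qc x b' \<longleftrightarrow> (\<exists>s\<in>stab x. b' = mv s b)"
 by (rule cl_eq[OF stab_subgroup])

lemma qc_stab: "x \<in> space M ==> b \<in> B ==> s \<in> stab x ==> qc x (mv s b) = qc x b"
 using qc_eq[of x b "mv s b"] mv_in[of s b] by (auto simp: stab_def)

text \<open>Two sections coincide nowhere, or on the fixed point set of the unique group element
  carrying \<open>b\<close> to \<open>b'\<close>; measurability of fixed point sets is what makes
  the complex measurable.\<close>

lemma coords_X: "fibre_coords M (Bl j) pX"
proof
 show "countable (Bl j)" by (rule countable_subset[OF _ countable_B]) (auto simp: Bl_def)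
 fix b b' assume "b \<in> Bl j" "b' \<in> Bl j"
 then have b: "b \<in> B" "b' \<in> B" by (auto simp: Bl_def)
 show "{x \<in> space M. pX x b = pX x b'} \<in> sets M"
 proof (cases "\<exists>s\<in>carrier G. b' = mv s b")
  case True
  then obtain s where s: "s \<in> carrier G" "b' = mv s b" by blast
  have "pX x b = pX x b' \<longleftrightarrow> a s x = x" if "x \<in> space M" for x
  proof -
   have "pX x b = pX x b' \<longleftrightarrow> (\<exists>t\<in>stab x. mv s b = mv t b)" using qc_eq[OF that b] s(2) by (simp add: pX_def)
   also have "... \<longleftrightarrow> s \<in> stab x" using s(1) b(1) by (auto simp: stab_def mv_eq_iff)
   finally show ?thesis using s(1) by (simp add: stab_def)
  qed
  then have "{x \<in> space M. pX x b = pX x b'} = {x \<in> space M. a s x = x}" by blast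
  then show ?thesis using a_fix[OF s(1)] by simp
 next
  case False
  then have "{x \<in> space M. pX x b = pX x b'} = {}" using qc_eq b by (auto simp: pX_def stab_def)
  then show ?thesis by (simp only: sets.empty_sets)
 qed
qed (simp add: pX_def)

lemma total_X:
 "fibre_coords.total M (Bl j) pX = (SIGMA x:space M. ordered_simplices (isotropy_fibre G M a \<Sigma> act x) j)"
proof -
 have "ordered_simplices (isotropy_fibre G M a \<Sigma> act x) j = qc x ` Bl j" if "x \<in> space M" for x
  using quotient_ordered[OF stab_subgroup[OF that], of j] that
  by (simp add: isotropy_fibre_def isotropy_section Bl_def)
 then show ?thesis unfolding fibre_coords.total_def[OF coords_X] by (auto simp: pX_def)
qed

lemma W_fibred: "fibred M (Bl j) pX (W j)"
proof -
 interpret fibre_coords M "Bl j" pX by (rule coords_X)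
 let ?Y = "M \<Otimes>\<^sub>M count_space (ordered_simplices \<Sigma> j)"
 let ?S = "{E. E \<subseteq> total \<and> isotropy_projection G M a act -` E \<inter> space ?Y \<in> sets ?Y}"
 let ?\<nu> = "%E. \<integral>\<^sup>+x. emeasure (count_space UNIV) {vs. (x, vs) \<in> E} \<partial>M"
 have Y: "space ?Y = space M \<times> Bl j" by (simp add: space_pair_measure Bl_ordered)
 have S: "?S = fsets"
 proof (intro Set.set_eqI iffI)
  fix E assume "E \<in> ?S"
  then have E: "E \<subseteq> total" "isotropy_projection G M a act -` E \<inter> space ?Y \<in> sets ?Y" by auto
  have "{x \<in> space M. pX x b \<in> E} \<in> sets M" if b: "b \<in> Bl j" for b
  proof -
   have "(%x. (x, b)) \<in> M \<rightarrow>\<^sub>M ?Y" using b by (intro measurable_Pair) (auto simp: Bl_ordered)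
   from measurable_sets[OF this E(2)]
   have "(%x. (x, b)) -` (isotropy_projection G M a act -` E \<inter> space ?Y) \<inter> space M \<in> sets M" .
   also have "(%x. (x, b)) -` (isotropy_projection G M a act -` E \<inter> space ?Y) \<inter> space M = {x \<in> space M. pX x b \<in> E}"
    using b projection_pX by (auto simp: Y)
   finally show ?thesis .
  qed
  then show "E \<in> fsets" using E(1) by (simp add: fsets_def)
 next
  fix E assume E: "E \<in> fsets"
  have "isotropy_projection G M a act -` E \<inter> space ?Y = (\<Union>b\<in>Bl j. {x \<in> space M. pX x b \<in> E} \<times> {b})"
   using projection_pX by (auto simp: Y)
  also have "... \<in> sets ?Y"
   using E by (intro sets.countable_UN'[OF countable]) (auto simp: fsets_def Bl_ordered)
  finally show "E \<in> ?S" using E by (simp add: fsets_def)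
 qed
 have "fibred M (Bl j) pX (measure_of total ?S ?\<nu>)"
 proof (rule fibred_measure_of)
  show "?S \<subseteq> Pow total" by auto
  show "sigma_sets total ?S = fsets"
   unfolding S by (rule sigma_algebra.sigma_sets_eq[OF sigma_algebra_fsets])
  fix E assume E: "E \<in> fsets"
  show "?\<nu> E = nn_integral M (%x. emeasure (count_space UNIV) (E \<inter> pX x ` Bl j))"
  proof (rule nn_integral_cong)
   fix x assume "x \<in> space M"
   have "bij_betw (Pair x) {vs. (x, vs) \<in> E} (E \<inter> pX x ` Bl j)" unfolding bij_betw_def using E
   by (auto simp: fsets_def total_def pX_def inj_on_def)
   then show "emeasure (count_space UNIV) {vs. (x, vs) \<in> E} = emeasure (count_space UNIV) (E \<inter> pX x ` Bl j)"
    by (rule emeasure_count_space_bij)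
  qed
 qed
 moreover have "W j = measure_of total ?S ?\<nu>"
  by (simp add: isotropy_quotient_def isotropy_simplices_def Let_def total_X)
 ultimately show ?thesis by simp
qed

section \<open>The complex as a part of the direct sum\<close>

definition pt :: "'x => 'v list => ('x \<times> 'x) \<times> nat" where "pt x b = ((a (inv (gpart b)) x, x), ipart b)"
text \<open>Recovers the simplex class from its coordinates. Two choices of \<open>g\<close> differ
  by an element of the stabilizer of \<open>x\<close>, which the class does not see.\<close>

definition orbit_pt :: "('x \<times> 'x) \<times> nat => 'x \<times> 'v set list" where
 "orbit_pt = (%((y, x), k). pX x (mv (SOME g. g \<in> carrier G \<and> a g y = x) (rp k)))"
text \<open>Pullback to the direct sum; the copies that label representatives of dimension
  \<open>j\<close> carry the image.\<close>

definition Th :: "nat => ('x \<times> 'v set list => complex) => ('x \<times> 'x) \<times> nat => complex" where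
 "Th j f w = (if snd w \<in> Jix j then f (orbit_pt w) else 0)"
text \<open>The inverse of \<open>Th\<close>: any representative may be read off because
  \<open>lift\<close> is constant on stabilizer orbits.\<close>

definition \<Lambda> :: "nat => (('x \<times> 'x) \<times> nat => complex) => 'x \<times> 'v set list => complex" where
 "\<Lambda> j F = (%(x, w). lift F x (SOME b. b \<in> Bl j \<and> qc x b = w))"

lemma lift_pt: "lift F x b = F (pt x b)" by (simp add: lift_def pt_def)

lemma orbit_pt:
 assumes x: "x \<in> space M" and b: "b \<in> B" shows "orbit_pt (pt x b) = pX x b"
proof -
 note p = parts[OF b]
 let ?y = "a (inv (gpart b)) x"
 define g where "g = (SOME g. g \<in> carrier G \<and> a g ?y = x)"
 have "g \<in> carrier G \<and> a g ?y = x" unfolding g_def by (rule someI[of _ "gpart b"]) (use p x in simp)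
 then have g: "g \<in> carrier G" "a g ?y = x" by auto
 have s: "g \<otimes> inv (gpart b) \<in> stab x" using g p(1) x by (simp add: stab_def a_mult)
 have "mv (g \<otimes> inv (gpart b)) b = mv g (mv (inv (gpart b)) b)" using g(1) p(1) b by (simp add: mv_mult)
 also have "mv (inv (gpart b)) b = rp (ipart b)" using mv_inv(1)[OF p(1) rp_in[OF p(2)]] p(3) by simp
 finally show ?thesis using qc_stab[OF x b s] by (simp add: orbit_pt_def pt_def pX_def g_def)
qed

lemma lift_Th: "x \<in> space M ==> b \<in> B ==> lift (Th j f) x b = (if length b = Suc j then f (pX x b) else 0)"
 by (simp add: lift_pt Th_def orbit_pt) (simp add: pt_def ipart_Jix)

lemma pt_point:
 assumes "x \<in> space M" "g \<in> carrier G" "k < m" shows "((a g x, x), k) = pt x (mv (inv g) (rp k))"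
 using assms by (simp add: pt_def parts_unique)

lemma Th_point:
 assumes "x \<in> space M" "g \<in> carrier G"
 shows "Th j f ((a g x, x), k) = (if k \<in> Jix j then f (pX x (mv (inv g) (rp k))) else 0)"
proof (cases "k \<in> Jix j")
 case True
 then have k: "k < m" by (simp add: Jix_def)
 then have "mv (inv g) (rp k) \<in> B" using assms by (simp add: mv_in rp_in)
 then show ?thesis using assms by (simp add: Th_def pt_point[OF assms k] orbit_pt) (simp add: pt_def parts_unique k)
qed (simp add: Th_def)

lemma lift_stab:
 assumes x: "x \<in> space M" and b: "b \<in> B" and s: "s \<in> stab x" shows "lift F x (mv s b) = lift F x b"
using s a_inv x b gpart_in by (fastforce simp: stab_def lift_def parts_mv inv_mult_group a_mult)

lemma \<Lambda>_pX:
 assumes x: "x \<in> space M" and b: "b \<in> Bl j" shows "\<Lambda> j F (pX x b) = lift F x b"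
proof -
 define b' where "b' = (SOME b'. b' \<in> Bl j \<and> qc x b' = qc x b)"
 have "b' \<in> Bl j \<and> qc x b' = qc x b" unfolding b'_def by (rule someI[of _ b]) (simp add: b)
 then obtain s where "s \<in> stab x" "b' = mv s b" using qc_eq[OF x Bl_B[OF b], of b'] Bl_B by metis
 then show ?thesis using lift_stab[OF x Bl_B[OF b]] by (simp add: \<Lambda>_def pX_def b'_def)
qed

lemma N_eqI:
 assumes "w \<in> space N" "\<And>x b. x \<in> space M ==> b \<in> B ==> lift F x b = lift F' x b"
  and "\<And>w. w \<in> space N ==> snd w \<ge> m ==> F w = F' w"
 shows "F w = F' w"
proof -
 obtain x g k where w: "x \<in> space M" "g \<in> carrier G" "w = ((a g x, x), k)" by (rule space_N_cases[OF assms(1)])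
 show ?thesis using w assms by (fastforce simp: mv_in rp_in lift_pt pt_point)
qed

lemma Th_big: "snd w \<ge> m ==> Th j f w = 0" by (simp add: Th_def Jix_def)

lemma Th_\<Lambda>: "w \<in> space N ==> Th j (\<Lambda> j F) w = (if snd w \<in> Jix j then F w else 0)"
proof (rule N_eqI)
 fix x b assume x: "x \<in> space M" "b \<in> B"
 show "lift (Th j (\<Lambda> j F)) x b = lift (%w. if snd w \<in> Jix j then F w else 0) x b"
  using x by (simp add: lift_Th \<Lambda>_pX Bl_def) (simp add: lift_def ipart_Jix)
qed (auto simp: Th_def Jix_def)

lemma Th_lin: "Th j (%v. f v + c * g v) = (%w. Th j f w + c * Th j g w)" by (auto simp: Th_def)

lemma Th_diff: "Th j (%v. f v - g v) = (%w. Th j f w - Th j g w)" by (auto simp: Th_def)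

lemma lift_lin: "lift (%w. F w + c * F' w) x = (%b. lift F x b + c * lift F' x b)"
 by (simp add: lift_def fun_eq_iff)

lemma pt_image:
 assumes x: "x \<in> space M" shows "pt x ` Bl j = {w \<in> pN x ` (carrier G \<times> UNIV). snd w \<in> Jix j}"
proof (intro Set.set_eqI iffI)
 fix w assume "w \<in> pt x ` Bl j"
 then obtain b where b: "b \<in> Bl j" "w = pt x b" by blast
 have "w = pN x (inv (gpart b), ipart b)" using b by (simp add: pt_def pN_def)
 moreover have "inv (gpart b) \<in> carrier G" using gpart_in[OF Bl_B[OF b(1)]] by simp
 moreover have "snd w \<in> Jix j" using b ipart_Jix by (simp add: pt_def Bl_def)
 ultimately show "w \<in> {w \<in> pN x ` (carrier G \<times> UNIV). snd w \<in> Jix j}" by blast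
next
 fix w assume "w \<in> {w \<in> pN x ` (carrier G \<times> UNIV). snd w \<in> Jix j}"
 then obtain g k where w: "g \<in> carrier G" "w = ((a g x, x), k)" "k \<in> Jix j" by (auto simp: pN_def)
 then have k: "k < m" "length (rp k) = Suc j" by (auto simp: Jix_def)
 show "w \<in> pt x ` Bl j" using k mv_in[OF inv_closed[OF w(1)] rp_in[OF k(1)]] using pt_point[OF x w(1) k(1)] w(2) by (simp add: Bl_def) (simp add: mv_def)
qed

text \<open>The key to the isometry: passing from \<open>b\<close> to its point in the relation and
  passing to its class identify the same simplices, namely translates under the stabilizer.\<close>

lemma fibre_bij:
 assumes x: "x \<in> space M" shows "bij_betw orbit_pt (pt x ` Bl j) (pX x ` Bl j)"
 unfolding bij_betw_def
proof
 show "orbit_pt ` pt x ` Bl j = pX x ` Bl j"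
  unfolding image_image by (rule image_cong[OF refl]) (simp add: orbit_pt[OF x Bl_B])
 show "inj_on orbit_pt (pt x ` Bl j)"
 proof (rule inj_onI)
  fix w w' assume "w \<in> pt x ` Bl j" "w' \<in> pt x ` Bl j" and eq: "orbit_pt w = orbit_pt w'"
  then obtain b b' where b: "b \<in> B" "b' \<in> B" "w = pt x b" "w' = pt x b'" using Bl_B by blast
  then obtain s where s: "s \<in> stab x" "b' = mv s b" using eq using qc_eq[OF x b(1,2)] by (auto simp: orbit_pt x pX_def)
  have sG: "s \<in> carrier G" and "a s x = x" using s by (auto simp: stab_def)
  then show "w = w'" using a_inv(1)[OF sG x]
   using x b gpart_in[OF b(1)] by (simp add: s(2) pt_def parts_mv inv_mult_group a_mult)
 qed
qed

lemma Th_measurable: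
 assumes f: "f \<in> borel_measurable (W j)" shows "Th j f \<in> borel_measurable N"
 unfolding fibred.measurable_iff[OF N_fibred]
proof
 fix gk :: "'g \<times> nat" assume "gk \<in> carrier G \<times> UNIV"
 then obtain g k where g: "gk = (g, k)" "g \<in> carrier G" by auto
 show "(%x. Th j f (pN x gk)) \<in> borel_measurable M"
 proof (cases "k \<in> Jix j")
  case True
  then have "(%x. f (pX x (mv (inv g) (rp k)))) \<in> borel_measurable M"
   using mv_in[OF inv_closed[OF g(2)] rp_in, of k]
   using f fibred.measurable_iff[OF W_fibred, of f j borel] by (simp add: Jix_def Bl_def) (simp add: mv_def)
  then show ?thesis by (rule measurable_cong[THEN iffD2, rotated]) (simp add: g pN_def Th_point True)
 next
  case False
  then show ?thesis by (simp add: Th_def g pN_def)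
 qed
qed

lemma lift_measurable:
 assumes F: "F \<in> borel_measurable N" and b: "b \<in> B" shows "(%x. lift F x b) \<in> borel_measurable M" using gpart_in[OF b]
  using F fibred.measurable_iff[OF N_fibred, of F borel] by (simp add: lift_def pN_def)

lemma \<Lambda>_measurable:
 assumes F: "F \<in> borel_measurable N" shows "\<Lambda> j F \<in> borel_measurable (W j)"
 unfolding fibred.measurable_iff[OF W_fibred]
proof
 fix b assume b: "b \<in> Bl j"
 show "(%x. \<Lambda> j F (pX x b)) \<in> borel_measurable M" using lift_measurable[OF F Bl_B[OF b]]
  by (rule measurable_cong[THEN iffD2, rotated]) (simp add: \<Lambda>_pX b)
qed

lemma Th_nn_integral:
 assumes f: "f \<in> borel_measurable (W j)"
 shows "nn_integral N (%w. nsq (Th j f w)) = nn_integral (W j) (%v. nsq (f v))"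
proof -
 let ?ph = "%w. nsq (Th j f w)"
 let ?\<psi> = "%v. nsq (f v)"
 have "nn_integral N (%w. ?ph w) = nn_integral M (%x. (nn_integral (count_space (pN x ` (carrier G \<times> UNIV))) (%w. ?ph w)))"
  by (rule fibred.nn_integral[OF N_fibred]) (use Th_measurable[OF f] in simp)
 also have "... = nn_integral M (%x. (nn_integral (count_space (pX x ` Bl j)) (%v. ?\<psi> v)))"
 proof (rule nn_integral_cong)
  fix x assume x: "x \<in> space M"
  have "nn_integral (count_space (pN x ` (carrier G \<times> UNIV))) (%w. ?ph w) = nn_integral (count_space (pt x ` Bl j)) (%w. ?\<psi> (orbit_pt w))"
   by (subst (1 2) nn_integral_count_space_indicator, simp, simp, rule nn_integral_cong)
    (auto simp: pt_image[OF x] Th_def split: split_indicator)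
  also have "... = nn_integral (count_space (pX x ` Bl j)) (%v. ?\<psi> v)"
   by (rule nn_integral_bij_count_space[OF fibre_bij[OF x]])
  finally show "nn_integral (count_space (pN x ` (carrier G \<times> UNIV))) (%w. ?ph w) = ..." .
 qed
 also have "... = nn_integral (W j) (%v. ?\<psi> v)"
  by (rule fibred.nn_integral[OF W_fibred, symmetric]) (use f in simp)
 finally show ?thesis .
qed

lemma Th_L2: assumes "f \<in> L2 (W j)" shows "Th j f \<in> L2 N"
 using Th_nn_integral[of f j] Th_measurable[of f j] assms L2_measurable[OF assms] by (simp add: L2_iff_nn_integral)

lemma Th_norm: assumes "f \<in> L2 (W j)" shows "L2_norm N (Th j f) = L2_norm (W j) f"
 by (rule L2_norm_eqI[OF Th_L2[OF assms] assms Th_nn_integral[OF L2_measurable[OF assms]]])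

lemma L2_of_Th: assumes "Th j f \<in> L2 N" shows "f \<in> L2 (W j)"
proof -
 have "(%x. f (pX x b)) \<in> borel_measurable M" if b: "b \<in> Bl j" for b
  using lift_measurable[OF L2_measurable[OF assms] Bl_B[OF b]]
  by (rule measurable_cong[THEN iffD1, rotated]) (use b in \<open>simp add: lift_Th Bl_def\<close>)
 then have m: "f \<in> borel_measurable (W j)" unfolding fibred.measurable_iff[OF W_fibred] by blast
 show ?thesis using assms Th_nn_integral[OF m] Th_measurable[OF m] m by (simp add: L2_iff_nn_integral)
qed

lemma Th_eq_L2:
 assumes "F \<in> L2 N" "\<And>w. w \<in> space N ==> Th j f w = F w" shows "f \<in> L2 (W j)"
proof (rule L2_of_Th)
 have "Th j f \<in> borel_measurable N"
  using L2_measurable[OF assms(1)] by (rule measurable_cong[THEN iffD2, rotated]) (rule assms(2))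
 moreover have "AE w in N. F w = Th j f w" using assms(2) by simp
 ultimately show "Th j f \<in> L2 N" by (rule L2_cong_AE[OF assms(1)])
qed

lemma \<Lambda>_L2:
 assumes F: "F \<in> L2 N" shows "\<Lambda> j F \<in> L2 (W j)"
proof -
 have m: "\<Lambda> j F \<in> borel_measurable (W j)" by (rule \<Lambda>_measurable[OF L2_measurable[OF F]])
 have "nn_integral N (%w. nsq (Th j (\<Lambda> j F) w)) \<le> nn_integral N (%w. nsq (F w))"
  by (rule nn_integral_mono) (simp add: Th_\<Lambda>)
 also have "... < \<infinity>" using F L2_measurable[OF F] by (simp add: L2_iff_nn_integral)
 finally show ?thesis unfolding Th_nn_integral[OF m] by (simp add: L2_iff_nn_integral m)
qed

text \<open>Fibres are countable and permutations finitely many, so almost everywhere for each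
  permutation becomes a pointwise condition on almost every fibre, to which the algebra on
  \<open>B\<close> applies.\<close>

lemma chains_iff_AE: "f \<in> l2_chains Xi j \<longleftrightarrow> f \<in> L2 (W j) \<and> (AE x in M. antisym_on j (lift (Th j f) x))"
proof -
 let ?P = "{pm. pm permutes {..<Suc j}}"
 let ?A = "%pm x. \<forall>b\<in>Bl j. f (pX x (permute_list pm b)) = of_int (sign pm) * f (pX x b)"
 have "(AE v in W j. f (fst v, permute_list pm (snd v)) = of_int (sign pm) * f v) \<longleftrightarrow> (AE x in M. ?A pm x)"
  if p: "pm permutes {..<Suc j}" for pm
   using p unfolding fibred.AE_iff[OF W_fibred] by (simp add: pX_def Bl_def cl_def permute_list_map)
 then have "(\<forall>pm. pm permutes {..<Suc j} --> (AE v in W j. f (fst v, permute_list pm (snd v)) = of_int (sign pm) * f v))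
   \<longleftrightarrow> (\<forall>pm\<in>?P. AE x in M. ?A pm x)" by simp
 also have "... \<longleftrightarrow> (AE x in M. \<forall>pm\<in>?P. ?A pm x)"
  by (rule AE_finite_all[symmetric]) (simp add: finite_permutations)
 finally show ?thesis using permute_B by (auto simp: lift_Th Bl_def antisym_on_def l2_chains_def)
qed

lemma boundary_pX:
 assumes x: "x \<in> space M" and b: "b \<in> Bl j"
 shows "l2_boundary Xi (Suc j) f (pX x b) = kop face (lift (Th (Suc j) f) x) b"
proof -
 have "l2_boundary Xi (Suc j) f (pX x b) = kop face (%b. f (x, qc x b)) b"
  using quotient_boundary[OF stab_subgroup[OF x], of b j "%vs. f (x, vs)"] b
  by (simp add: l2_boundary_def pX_def fibre_Xi x Bl_def)
 also have "... = kop face (lift (Th (Suc j) f) x) b" unfolding kop_face(1)[OF Bl_B[OF b]] using x b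
  by (intro sum.cong refl) (simp add: lift_Th Bl_def pX_def)
 finally show ?thesis .
qed

text \<open>Identifies the boundary with a kernel operator; its boundedness on square integrable
  functions follows.\<close>

lemma Th_boundary:
 assumes "w \<in> space N" shows "Th j (l2_boundary Xi (Suc j) u) w = Op face (Th (Suc j) u) w"
proof (rule N_eqI[OF assms])
 fix x b assume x: "x \<in> space M" and b: "b \<in> B"
 show "lift (Th j (l2_boundary Xi (Suc j) u)) x b = lift (Op face (Th (Suc j) u)) x b"
 proof (cases "length b = Suc j")
  case True
  then show ?thesis using x b boundary_pX[OF x, of b j u] by (simp add: lift_Th lift_Op[OF kernel_face] Bl_def)
 next
  case False
  have "kop face (lift (Th (Suc j) u) x) b = 0"
   unfolding kop_face(1)[OF b] by (rule sum.neutral) (use x False in \<open>simp add: lift_Th\<close>)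
  then show ?thesis using x b False by (simp add: lift_Th lift_Op[OF kernel_face])
 qed
next
 fix w assume "w \<in> space N" "snd w \<ge> m"
 then show "Th j (l2_boundary Xi (Suc j) u) w = Op face (Th (Suc j) u) w"
  by (simp add: Th_big) (simp add: Op_def split_beta)
qed

lemma boundary_L2: assumes "u \<in> L2 (W (Suc j))" shows "l2_boundary Xi (Suc j) u \<in> L2 (W j)"
 by (rule Th_eq_L2[OF Op_L2[OF kernel_face Th_L2[OF assms]] Th_boundary])

lemma cycles_iff_AE: "f \<in> l2_cycles Xi i \<longleftrightarrow> f \<in> L2 (W i) \<and> (AE x in M. cycle (lift (Th i f) x))"
proof -
 have "(i = 0 \<or> (AE v in W (i - 1). l2_boundary Xi i f v = 0))
   \<longleftrightarrow> (AE x in M. \<forall>b\<in>B. length b = i --> kop face (lift (Th i f) x) b = 0)"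
 proof (cases i)
  case 0
  then show ?thesis using B_D(2) by auto
 next
  case (Suc j)
  have "(AE v in W j. l2_boundary Xi (Suc j) f v = 0) \<longleftrightarrow> (AE x in M. \<forall>b\<in>Bl j. kop face (lift (Th (Suc j) f) x) b = 0)"
   unfolding fibred.AE_iff[OF W_fibred] by (rule AE_cong) (simp add: boundary_pX)
  also have "... \<longleftrightarrow> (AE x in M. \<forall>b\<in>B. length b = i --> kop face (lift (Th i f) x) b = 0)"
   by (rule) (auto simp: Bl_def Suc)
  finally show ?thesis unfolding Suc diff_Suc_1 by simp
 qed
 then show ?thesis unfolding l2_cycles_def cycle_def by (auto simp: chains_iff_AE)
qed

lemma cycles_L2: "f \<in> l2_cycles Xi i ==> f \<in> L2 (W i)" by (simp add: cycles_iff_AE)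

lemma cycles_lin:
 assumes "f \<in> l2_cycles Xi i" "g \<in> l2_cycles Xi i" shows "(%v. f v + c * g v) \<in> l2_cycles Xi i"
using assms cycle_lin L2_lin by (auto simp: cycles_iff_AE Th_lin lift_lin)

lemma chains_lin_AE:
 assumes "f \<in> l2_chains Xi j" "g \<in> l2_chains Xi j" shows "(%v. f v + c * g v) \<in> l2_chains Xi j"
using assms antisym_lin L2_lin by (auto simp: chains_iff_AE Th_lin lift_lin)

lemma lift_boundary: "x \<in> space M ==> b \<in> B ==> lift (Th j (l2_boundary Xi (Suc j) u)) x b = kop face (lift (Th (Suc j) u) x) b"
proof -
 assume x: "x \<in> space M" and b: "b \<in> B"
 show ?thesis using in_space_N[OF x inv_closed[OF gpart_in[OF b]]] using lift_Op[OF kernel_face x b] by (simp add: pt_def lift_pt Th_boundary)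
qed

lemma antisym_cong: "(\<And>b. b \<in> B ==> h b = h' b) ==> antisym_on j h \<longleftrightarrow> antisym_on j h'"
 unfolding antisym_on_def using permute_B by auto

lemma boundary_cycle: assumes u: "u \<in> l2_chains Xi (Suc i)" shows "l2_boundary Xi (Suc i) u \<in> l2_cycles Xi i"
 unfolding cycles_iff_AE
proof
 show "l2_boundary Xi (Suc i) u \<in> L2 (W i)" by (rule boundary_L2) (use u in \<open>simp add: chains_iff_AE\<close>)
 have "AE x in M. antisym_on (Suc i) (lift (Th (Suc i) u) x)" using u by (simp add: chains_iff_AE)
 then show "AE x in M. cycle (lift (Th i (l2_boundary Xi (Suc i) u)) x)"
 proof (rule AE_mp, intro AE_I2 impI)
  fix x assume x: "x \<in> space M" and as: "antisym_on (Suc i) (lift (Th (Suc i) u) x)"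
  let ?h = "lift (Th (Suc i) u) x" and ?h' = "lift (Th i (l2_boundary Xi (Suc i) u)) x"
  have eq: "?h' b = kop face ?h b" if "b \<in> B" for b by (rule lift_boundary[OF x that])
  have "antisym_on i ?h'" using antisym_face[OF as] antisym_cong[of ?h' "kop face ?h"] eq by simp
  moreover have "kop face ?h' b = 0" if b: "b \<in> B" "length b = i" for b
  proof -
   have "kop face ?h' b = kop face (kop face ?h) b" by (rule kop_cong) (rule eq)
   then show ?thesis using face_face[OF as b] by simp
  qed
  ultimately show "cycle ?h'" by (simp add: cycle_def)
 qed
qed

lemma harm_harmonic:
 assumes "F \<in> harm" shows "AE x in M. harmonic i (lift F x) \<and> (\<forall>b\<in>B. length b \<noteq> Suc i --> lift F x b = 0)"
proof -
 have "AE w in N. F w = cut F w" "AE w in N. Op (eqs i) F w = (%w. 0) w" using assms by (auto simp: harm_def)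
 from this[THEN AE_lift] show ?thesis
 proof (rule AE_mp[OF AE_conjI], intro AE_I2 impI)
  fix x assume x: "x \<in> space M"
  assume *: "(\<forall>b\<in>B. lift F x b = lift (cut F) x b) \<and> (\<forall>b\<in>B. lift (Op (eqs i) F) x b = lift (%w. 0) x b)"
  have z: "lift F x b = 0" if "b \<in> B" "length b \<noteq> Suc i" for b using * that by (metis ipart_Jix lift_cut)
  have "kop (eqs i) (lift F x) b = 0" if b: "b \<in> B" for b
   using * b lift_Op[OF E x b, of F] by (simp add: lift_def)
  then show "harmonic i (lift F x) \<and> (\<forall>b\<in>B. length b \<noteq> Suc i --> lift F x b = 0)"
   using eqs_iff_harmonic[of i "lift F x"] z by blast
 qed
qed

lemma harm_cycle:
 assumes F: "F \<in> harm" shows "\<Lambda> i F \<in> l2_cycles Xi i" "AE w in N. Th i (\<Lambda> i F) w = F w"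
proof -
 have L: "F \<in> L2 N" "AE w in N. F w = cut F w" using F by (auto simp: harm_def)
 with L(2) show eq: "AE w in N. Th i (\<Lambda> i F) w = F w" by (auto simp: Th_\<Lambda> cut_def)
 have "AE x in M. cycle (lift (Th i (\<Lambda> i F)) x)" using harm_harmonic[OF F] AE_lift[OF eq]
 proof (rule AE_mp[OF AE_conjI], intro AE_I2 impI)
  fix x assume *: "(harmonic i (lift F x) \<and> (\<forall>b\<in>B. length b \<noteq> Suc i --> lift F x b = 0))
    \<and> (\<forall>b\<in>B. lift (Th i (\<Lambda> i F)) x b = lift F x b)"
  have "cycle (lift F x)" using * harmonic_cycle by blast
  moreover have "antisym_on i (lift (Th i (\<Lambda> i F)) x) \<longleftrightarrow> antisym_on i (lift F x)" using * by (intro antisym_cong) blast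
  moreover have "kop face (lift (Th i (\<Lambda> i F)) x) b = kop face (lift F x) b" for b using * by (intro kop_cong) blast
  ultimately show "cycle (lift (Th i (\<Lambda> i F)) x)" by (simp add: cycle_def)
 qed
 then show "\<Lambda> i F \<in> l2_cycles Xi i" using \<Lambda>_L2[OF L(1)] by (simp add: cycles_iff_AE)
qed

end

section \<open>Projecting cycles to harmonic chains\<close>

lemma L2_norm_leI:
 assumes "f \<in> L2 M1" "g \<in> L2 M2"
  and "nn_integral M1 (%v. nsq (f v)) \<le> nn_integral M2 (%v. nsq (g v))"
 shows "L2_norm M1 f \<le> L2_norm M2 g"
proof -
 have "ennreal ((L2_norm M1 f)^2) \<le> ennreal ((L2_norm M2 g)^2)"
  using assms(3) by (simp only: L2_norm_nn_integral[OF assms(1)] L2_norm_nn_integral[OF assms(2)])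
 then show ?thesis by simp
qed

context pmp_action begin

lemma bisection_point:
 assumes ph: "ph \<in> bisections R" and yx: "(y, x) \<in> ph"
 shows "y \<in> space M" "x \<in> space M" "\<exists>g\<in>carrier G. a g x = y"
proof -
 have *: "(y, x) \<in> space R" using ph sets.sets_into_space using yx by (auto simp: bisections_def)
 then show "y \<in> space M" "x \<in> space M" using space_RD by auto
 obtain g where "g \<in> carrier G" "x = a g y" using * by (auto simp: space_R_iff)
 then show "\<exists>g\<in>carrier G. a g x = y" using \<open>y \<in> space M\<close> a_inv(1) by blast
qed

lemma bisection_unique:
 assumes ph: "ph \<in> bisections R"
 shows "(y, x) \<in> ph ==> (y', x) \<in> ph ==> y = y'" "(y, x) \<in> ph ==> (y, x') \<in> ph ==> x = x'"
proof -
 have inj: "inj_on fst ph" "inj_on snd ph" using ph by (auto simp: bisections_def)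
 show "y = y'" if "(y, x) \<in> ph" "(y', x) \<in> ph" using inj_onD[OF inj(2) _ that] by simp
 show "x = x'" if "(y, x) \<in> ph" "(y, x') \<in> ph" using inj_onD[OF inj(1) _ that] by simp
qed

lemma bisection_operator_at:
 assumes ph: "ph \<in> bisections R"
 shows "(y, anchor v) \<in> ph ==> bisection_operator anchor tr ph f v = f (tr (anchor v, y) v)"
  and "(\<And>y. (y, anchor v) \<notin> ph) ==> bisection_operator anchor tr ph f v = 0"
proof -
 assume yx: "(y, anchor v) \<in> ph"
 have "(THE h. h \<in> ph \<and> snd h = anchor v) = (y, anchor v)"
 proof (rule the_equality)
  fix h assume "h \<in> ph \<and> snd h = anchor v"
  then show "h = (y, anchor v)" using bisection_unique(1)[OF ph _ yx, of "fst h"] by (cases h) auto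
 qed (use yx in simp)
 moreover have "\<exists>h\<in>ph. snd h = anchor v" using yx by force
 ultimately show "bisection_operator anchor tr ph f v = f (tr (anchor v, y) v)"
  by (simp add: bisection_operator_def)
next
 assume "\<And>y. (y, anchor v) \<notin> ph"
 then show "bisection_operator anchor tr ph f v = 0" by (auto simp: bisection_operator_def)
qed

lemma left_mult_at:
 assumes ph: "ph \<in> bisections R"
 shows "(y, x) \<in> ph ==> left_mult ph f (u, x) = f (u, y)"
  and "(\<And>y. (y, x) \<notin> ph) ==> left_mult ph f (u, x) = 0"
proof -
 show "left_mult ph f (u, x) = f (u, y)" if "(y, x) \<in> ph"
  unfolding left_mult_def using bisection_operator_at(1)[OF ph, where anchor=snd and v="(u, x)"] that by simp
 show "left_mult ph f (u, x) = 0" if "\<And>y. (y, x) \<notin> ph"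
  unfolding left_mult_def using bisection_operator_at(2)[OF ph, where anchor=snd and v="(u, x)"] that by simp
qed

lemma left_mult_lin: "left_mult ph (%v. f v + c * g v) = (%v. left_mult ph f v + c * left_mult ph g v)"
 by (simp add: left_mult_def bisection_operator_def fun_eq_iff)

text \<open>The base is covered by countably many measurable pieces: one for each group element that
  describes the bisection there, and the remainder, where the result is 0.\<close>

lemma left_mult_measurable:
 assumes ph: "ph \<in> bisections R" and f: "f \<in> borel_measurable R"
 shows "left_mult ph f \<in> borel_measurable R" unfolding fibred.measurable_iff[OF R_fibred_T]
proof
 interpret T: fibred M "carrier G" pT R by (rule R_fibred_T)
 fix g assume g: "g \<in> carrier G"
 let ?A = "%h. {x \<in> space M. pT x h \<in> ph}"
 have A: "?A h \<in> sets M" if "h \<in> carrier G" for h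
  using ph that unfolding bisections_def T.sets T.fsets_def by blast
 let ?C = "insert (space M - (\<Union>h\<in>carrier G. ?A h)) (?A ` carrier G)"
 show "(%x. left_mult ph f (pT x g)) \<in> borel_measurable M"
 proof (rule measurable_piecewise_restrict[of ?C])
  show "countable ?C" using countable_carrier by simp
  show "space M \<subseteq> \<Union>?C" by auto
  have "(\<Union>h\<in>carrier G. ?A h) \<in> sets M" using A by (intro sets.countable_UN'[OF countable_carrier]) auto
  then show "\<Omega> \<inter> space M \<in> sets M" if "\<Omega> \<in> ?C" for \<Omega> using that A by auto
  fix \<Omega> assume "\<Omega> \<in> ?C"
  then consider "\<Omega> = space M - (\<Union>h\<in>carrier G. ?A h)" | h where "h \<in> carrier G" "\<Omega> = ?A h" by blast
  then show "(%x. left_mult ph f (pT x g)) \<in> borel_measurable (restrict_space M \<Omega>)"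
  proof cases
   case 1
   have "left_mult ph f (pT x g) = 0" if "x \<in> space (restrict_space M \<Omega>)" for x
   proof -
    have x: "x \<in> space M" "\<And>h. h \<in> carrier G ==> pT x h \<notin> ph" using that 1 by (auto simp: space_restrict_space)
    have "(y, x) \<notin> ph" for y using bisection_point(3)[OF ph, of y x] x(2) by (auto simp: pT_def)
    then show ?thesis unfolding pT_def by (rule left_mult_at(2)[OF ph])
   qed
   then show ?thesis by (subst measurable_cong[where g="%_. 0"]) auto
  next
   case 2
   have gh: "g \<otimes> inv h \<in> carrier G" using g 2(1) by simp
   have "left_mult ph f (pT x g) = f (pT (a h x) (g \<otimes> inv h))" if "x \<in> space (restrict_space M \<Omega>)" for x
   proof -
    have x: "x \<in> space M" "(a h x, x) \<in> ph" using that 2 by (auto simp: space_restrict_space pT_def)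
    then show ?thesis
     using g 2(1) left_mult_at(1)[OF ph x(2), of f "a g x"] by (simp add: pT_def a_mult a_in)
   qed
   moreover have "(%x. f (pT (a h x) (g \<otimes> inv h))) \<in> borel_measurable M"
    using measurable_compose[OF a_measurable[OF 2(1)], of "%x. f (pT x (g \<otimes> inv h))" borel]
     f T.measurable_iff[of f borel] gh by blast
   ultimately show ?thesis
    by (subst measurable_cong[where g="%x. f (pT (a h x) (g \<otimes> inv h))"]) (auto intro: measurable_restrict_space1)
  qed
 qed
qed

text \<open>On each source fibre the operator copies values along an injective partial map and puts
  0 elsewhere.\<close>

lemma left_mult_contraction:
 assumes ph: "ph \<in> bisections R" and f: "f \<in> borel_measurable R"
 shows "nn_integral R (%v. nsq (left_mult ph f v)) \<le> nn_integral R (%v. nsq (f v))"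
proof -
 let ?F = "%v. nsq (f v)"
 let ?L = "%v. nsq (left_mult ph f v)"
 have "nn_integral R (%v. ?L v) = nn_integral M (%u. (nn_integral (count_space (pS u ` carrier G)) (%v. ?L v)))"
  by (rule fibred.nn_integral[OF R_fibred_S]) (use left_mult_measurable[OF ph f] in simp)
 also have "... \<le> nn_integral M (%u. (nn_integral (count_space (pS u ` carrier G)) (%v. ?F v)))"
 proof (rule nn_integral_mono)
  fix u assume u: "u \<in> space M"
  let ?A = "{v \<in> pS u ` carrier G. \<exists>y. (y, snd v) \<in> ph}"
  let ?\<psi> = "%v. (u, THE y. (y, snd v) \<in> ph)"
  have the: "(THE y. (y, x) \<in> ph) = y" if "(y, x) \<in> ph" for x y
   using that bisection_unique(1)[OF ph] by blast
  have fst: "fst v = u" if "v \<in> pS u ` carrier G" for v using that by (auto simp: pS_def)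
  have "nn_integral (count_space (pS u ` carrier G)) (%v. ?L v) = nn_integral (count_space ?A) (%v. ?F (?\<psi> v))"
  proof (subst (1 2) nn_integral_count_space_indicator, simp, simp, rule nn_integral_cong)
   fix v :: "'x \<times> 'x"
   have "?L v = ?F (?\<psi> v)" if vA: "v \<in> ?A"
   proof -
    obtain y where y: "(y, snd v) \<in> ph" using vA by blast
    have "left_mult ph f (u, snd v) = f (u, y)" by (rule left_mult_at(1)[OF ph y])
    moreover have "v = (u, snd v)" using fst[of v] vA by auto
    ultimately show ?thesis by (simp only: the[OF y])
   qed
   moreover have "?L v = 0" if "v \<in> pS u ` carrier G" "v \<notin> ?A"
   proof -
    have "left_mult ph f (fst v, snd v) = 0" by (rule left_mult_at(2)[OF ph]) (use that in blast)
    then show ?thesis by simp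
   qed
   ultimately show "?L v * indicator (pS u ` carrier G) v = ?F (?\<psi> v) * indicator ?A v"
    by (auto split: split_indicator)
  qed
  also have "... = nn_integral (count_space (?\<psi> ` ?A)) (%v. ?F v)"
  proof (rule nn_integral_bij_count_space)
   have "inj_on ?\<psi> ?A"
   proof (rule inj_onI)
    fix v w assume v: "v \<in> ?A" and w: "w \<in> ?A" and eq: "?\<psi> v = ?\<psi> w"
    obtain y where y: "(y, snd v) \<in> ph" using v by blast
    obtain z where z: "(z, snd w) \<in> ph" using w by blast
    have "snd v = snd w" using eq using bisection_unique(2)[OF ph y] z by (simp add: the[OF y] the[OF z])
    then show "v = w" using fst v w by (metis (no_types, lifting) mem_Collect_eq prod_eqI)
   qed
   then show "bij_betw ?\<psi> ?A (?\<psi> ` ?A)" by (rule inj_on_imp_bij_betw)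
  qed
  also have "... \<le> nn_integral (count_space (pS u ` carrier G)) (%v. ?F v)"
  proof -
   have sub: "?\<psi> ` ?A \<subseteq> pS u ` carrier G"
   proof
    fix w assume "w \<in> ?\<psi> ` ?A"
    then obtain g y where g: "g \<in> carrier G" "(y, a g u) \<in> ph" "w = (u, y)"
     using the by (auto simp: pS_def)
    obtain h where h: "h \<in> carrier G" "a h (a g u) = y" using bisection_point(3)[OF ph g(2)] by blast
    have "y = a (h \<otimes> g) u" using h g u by (simp add: a_mult)
    then show "w \<in> pS u ` carrier G" using g h by (auto simp: pS_def)
   qed
   show ?thesis by (subst (1 2) nn_integral_count_space_indicator, simp, simp, rule nn_integral_mono)
     (use sub in \<open>auto split: split_indicator\<close>)
  qed
  finally show "nn_integral (count_space (pS u ` carrier G)) (%v. ?L v) \<le> nn_integral (count_space (pS u ` carrier G)) (%v. ?F v)" .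
 qed
 also have "... = nn_integral R (%v. ?F v)"
  by (rule fibred.nn_integral[OF R_fibred_S, symmetric]) (use f in simp)
 finally show ?thesis .
qed

definition diag :: "('x \<times> 'x) set => (('x \<times> 'x) \<times> nat => complex) => ('x \<times> 'x) \<times> nat => complex" where
 "diag ph F = diagonal_op (left_mult ph) F"

lemma diag_slice: "(%v. diag ph F (v, k)) = left_mult ph (%v. F (v, k))"
 by (simp add: diag_def diagonal_op_def)

lemma diag_lin: "diag ph (%w. F w + c * F' w) = (%w. diag ph F w + c * diag ph F' w)"
 by (simp add: diag_def diagonal_op_def left_mult_lin fun_eq_iff)

lemma diag_L2:
 assumes ph: "ph \<in> bisections R" and F: "F \<in> L2 N"
 shows "diag ph F \<in> L2 N" "L2_norm N (diag ph F) \<le> L2_norm N F"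
proof -
 have Fm: "F \<in> borel_measurable N" by (rule L2_measurable[OF F])
 then have Fk: "(%v. F (v, k)) \<in> borel_measurable R" for k unfolding N_measurable_iff by blast
 have m: "diag ph F \<in> borel_measurable N"
  unfolding N_measurable_iff diag_slice using left_mult_measurable[OF ph Fk] by blast
 have "nn_integral N (%w. nsq (diag ph F w)) = (\<Sum>k. \<integral>\<^sup>+v. nsq (diag ph F (v, k)) \<partial>R)"
  by (rule N_nn_integral_suminf) (use m in simp)
 also have "... = (\<Sum>k. \<integral>\<^sup>+v. nsq (left_mult ph (%v. F (v, k)) v) \<partial>R)" by (simp add: diag_def diagonal_op_def)
 also have "... \<le> (\<Sum>k. \<integral>\<^sup>+v. nsq (F (v, k)) \<partial>R)" by (intro suminf_le left_mult_contraction[OF ph Fk]) auto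
 also have "... = nn_integral N (%w. nsq (F w))" by (rule N_nn_integral_suminf[symmetric]) (use Fm in simp)
 finally have le: "nn_integral N (%w. nsq (diag ph F w)) \<le> nn_integral N (%w. nsq (F w))" .
 then show 1: "diag ph F \<in> L2 N" using F m Fm by (auto simp: L2_iff_nn_integral)
 show "L2_norm N (diag ph F) \<le> L2_norm N F" by (rule L2_norm_leI[OF 1 F le])
qed

end

context orbit_complex begin

text \<open>The two operators change different coordinates; therefore all kernel operators commute
  with bisections.\<close>

lemma rho_left_mult:
 assumes "ph \<in> bisections R" shows "rho g (left_mult ph f) = left_mult ph (rho g f)"
proof
 fix v :: "'x \<times> 'x"
 obtain u x where v: "v = (u, x)" by (metis surj_pair)
 show "rho g (left_mult ph f) v = left_mult ph (rho g f) v"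
 proof (cases "\<exists>y. (y, x) \<in> ph")
  case True
  then obtain y where "(y, x) \<in> ph" by blast
  then show ?thesis using left_mult_at(1)[OF assms] by (simp add: v rho_def)
 next
  case False
  then show ?thesis using left_mult_at(2)[OF assms, of x] by (simp add: v rho_def)
 qed
qed

lemma lift_diag:
 assumes ph: "ph \<in> bisections R" and x: "x \<in> space M" and b: "b \<in> B"
 shows "(y, x) \<in> ph ==> g \<in> carrier G ==> a g x = y ==> lift (diag ph F) x b = lift F y (mv g b)"
  and "(\<And>y. (y, x) \<notin> ph) ==> lift (diag ph F) x b = 0"
proof -
 assume yx: "(y, x) \<in> ph" and g: "g \<in> carrier G" "a g x = y"
 have "lift (diag ph F) x b = F ((a (inv (gpart b)) x, y), ipart b)"
  unfolding lift_def diag_def diagonal_op_def using left_mult_at(1)[OF ph yx] by simp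
 also have "a (inv (gpart b)) x = a (inv (gpart (mv g b))) y"
  using g x b gpart_in[OF b] by (simp add: parts_mv inv_mult_group a_mult a_in flip: g(2))
 finally show "lift (diag ph F) x b = lift F y (mv g b)" using g b by (simp add: lift_def parts_mv)
next
 assume "\<And>y. (y, x) \<notin> ph"
 then show "lift (diag ph F) x b = 0"
  unfolding lift_def diag_def diagonal_op_def using left_mult_at(2)[OF ph, of x] by simp
qed

lemma Op_diag:
 assumes ph: "ph \<in> bisections R" and k: "kernel k" and w: "w \<in> space N"
 shows "Op k (diag ph F) w = diag ph (Op k F) w"
by (fastforce simp: Op_def split_beta diag_def diagonal_op_def left_mult_def bisection_operator_def)

lemma Op_cong: assumes "\<And>w. w \<in> space N ==> F w = F' w" "kernel k" "w \<in> space N" shows "Op k F w = Op k F' w"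
proof (rule Op_eqI[OF assms(3)])
 fix x b assume x: "x \<in> space M" and b: "b \<in> B"
 have "lift F x b' = lift F' x b'" if "b' \<in> B" for b'
  using assms(1) in_space_N[OF x inv_closed[OF gpart_in[OF that]]] by (simp add: lift_def)
 then show "lift (Op k F) x b = lift (Op k F') x b" unfolding lift_Op[OF assms(2) x b] by (rule kop_cong)
qed

lemma pow_diag:
 assumes ph: "ph \<in> bisections R"
 shows "w \<in> space N ==> (T ^^ n) (diag ph F) w = diag ph ((T ^^ n) F) w"
proof (induction n arbitrary: w)
 case (Suc n)
 have "(T ^^ Suc n) (diag ph F) w = T (diag ph ((T ^^ n) F)) w"
  unfolding funpow.simps comp_def by (rule Op_cong[OF Suc.IH kernel_T Suc.prems])
 also have "... = diag ph (T ((T ^^ n) F)) w" by (rule Op_diag[OF ph kernel_T Suc.prems])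
 finally show ?case by simp
qed simp

lemma proj_diag:
 assumes ph: "ph \<in> bisections R" and F: "F \<in> L2 N"
 shows "AE w in N. con.proj (diag ph F) w = diag ph (con.proj F) w"
proof (rule con.proj_unique)
 note p = con.proj_L2[OF F]
 show "diag ph F \<in> L2 N" "diag ph (con.proj F) \<in> L2 N" by (intro diag_L2 ph F p)+
 show "(%k. L2_norm N (%v. (T ^^ (2*k)) (diag ph F) v - diag ph (con.proj F) v)) \<longlonglongrightarrow> 0"
 proof (rule tendsto_sandwich[OF _ _ tendsto_const con.proj_lim[OF F]])
  show "\<forall>\<^sub>F k in sequentially. L2_norm N (%v. (T ^^ (2*k)) (diag ph F) v - diag ph (con.proj F) v)
    \<le> L2_norm N (%v. (T ^^ (2*k)) F v - con.proj F v)"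
  proof (intro always_eventually allI)
   fix k
   let ?F = "%v. (T ^^ (2*k)) F v + (-1) * con.proj F v"
   have L: "?F \<in> L2 N" by (intro L2_lin con.pow_L2 F p)
   have "L2_norm N (%v. (T ^^ (2*k)) (diag ph F) v - diag ph (con.proj F) v) = L2_norm N (diag ph ?F)"
   proof (rule L2_norm_cong_AE)
    show "(%v. (T ^^ (2*k)) (diag ph F) v - diag ph (con.proj F) v) \<in> L2 N"
     by (intro L2_diff con.pow_L2 diag_L2 ph F p)
    show "diag ph ?F \<in> L2 N" by (intro diag_L2 ph L)
    show "AE v in N. (T ^^ (2*k)) (diag ph F) v - diag ph (con.proj F) v = diag ph ?F v"
     unfolding diag_lin by (rule) (simp add: pow_diag[OF ph])
   qed
   also have "... \<le> L2_norm N ?F" by (rule diag_L2(2)[OF ph L])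
   finally show "L2_norm N (%v. (T ^^ (2*k)) (diag ph F) v - diag ph (con.proj F) v)
    \<le> L2_norm N (%v. (T ^^ (2*k)) F v - con.proj F v)" by simp
  qed
 qed simp
qed

lemma act_orbit:
 assumes x: "x \<in> space M" and g: "g \<in> carrier G" and v: "v \<in> V"
 shows "act g ` q (stab x) v = q (stab (a g x)) (act g v)"
proof (intro Set.set_eqI iffI)
 fix w assume "w \<in> act g ` q (stab x) v"
 then obtain s where s: "s \<in> carrier G" "a s x = x" "w = act g (act s v)" by (auto simp: q_eq stab_def)
 have "w = act (g \<otimes> s \<otimes> inv g) (act g v)" using s g v by (simp add: act_mult[symmetric] m_assoc)
 moreover have "g \<otimes> s \<otimes> inv g \<in> stab (a g x)" using s g x by (simp add: stab_def a_mult a_in)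
 ultimately show "w \<in> q (stab (a g x)) (act g v)" by (auto simp: q_eq)
next
 fix w assume "w \<in> q (stab (a g x)) (act g v)"
 then obtain t where t: "t \<in> carrier G" "a t (a g x) = a g x" "w = act t (act g v)" by (auto simp: q_eq stab_def)
 have "g \<otimes> (inv g \<otimes> (t \<otimes> g)) = t \<otimes> g" using g t(1) by (simp add: m_assoc[symmetric])
 then have "w = act g (act (inv g \<otimes> (t \<otimes> g)) v)" using t g v by (simp add: act_mult[symmetric])
 moreover have "inv g \<otimes> (t \<otimes> g) \<in> stab x" using t g x by (simp add: stab_def a_mult)
 ultimately show "w \<in> act g ` q (stab x) v" by (auto simp: q_eq)
qed

lemma simplex_op_at:
 assumes ph: "ph \<in> bisections R" and x: "x \<in> space M" and b: "b \<in> B"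
 shows "(y, x) \<in> ph ==> \<exists>g\<in>carrier G. a g x = y \<and> simplex_op Xi ph f (pX x b) = f (pX y (mv g b))"
  and "(\<And>y. (y, x) \<notin> ph) ==> simplex_op Xi ph f (pX x b) = 0"
proof -
 assume yx: "(y, x) \<in> ph"
 define g where "g = (SOME g. g \<in> carrier G \<and> a g x = y)"
 have "g \<in> carrier G \<and> a g x = y"
  unfolding g_def by (rule someI_ex) (use bisection_point(3)[OF ph yx] in blast)
 then have g: "g \<in> carrier G" "a g x = y" by auto
 have tr: "translate Xi (x, y) = (`) (act g)" by (simp add: isotropy_quotient_def g_def)
 have "simplex_op Xi ph f (pX x b) = f (y, map (translate Xi (x, y)) (qc x b))"
  using bisection_operator_at(1)[OF ph, of y fst "pX x b"] yx by (simp add: simplex_op_def pX_def)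
 also have "map (translate Xi (x, y)) (qc x b) = qc y (mv g b)"
  using act_orbit[OF x g(1)] B_vertex[OF b] g(2) by (simp add: tr cl_def mv_def)
 finally show "\<exists>g\<in>carrier G. a g x = y \<and> simplex_op Xi ph f (pX x b) = f (pX y (mv g b))"
  using g by (auto simp: pX_def)
next
 assume "\<And>y. (y, x) \<notin> ph"
 then show "simplex_op Xi ph f (pX x b) = 0"
  using bisection_operator_at(2)[OF ph, of fst "pX x b"] by (simp add: simplex_op_def pX_def)
qed

text \<open>\<open>Th\<close> intertwines the two actions of bisections: both take the value over
  \<open>x\<close> from the translate of the simplex over the other end of the bisection,
  independently of the group element that realizes it.\<close>

lemma Th_simplex_op:
 assumes ph: "ph \<in> bisections R" and w: "w \<in> space N"
 shows "Th j (simplex_op Xi ph f) w = diag ph (Th j f) w"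
proof (rule N_eqI[OF w])
 fix x b assume x: "x \<in> space M" and b: "b \<in> B"
 have len: "length (mv g b) = length b" for g by (simp add: mv_def)
 show "lift (Th j (simplex_op Xi ph f)) x b = lift (diag ph (Th j f)) x b"
 proof (cases "\<exists>y. (y, x) \<in> ph")
  case True
  then obtain y where yx: "(y, x) \<in> ph" by blast
  obtain g where g: "g \<in> carrier G" "a g x = y" "simplex_op Xi ph f (pX x b) = f (pX y (mv g b))"
   using simplex_op_at(1)[OF ph x b yx] by blast
  show ?thesis
   using lift_diag(1)[OF ph x b yx g(1,2)] x b g(3) bisection_point(1)[OF ph yx] mv_in[OF g(1) b]
   by (simp add: lift_Th len)
 next
  case False
  then show ?thesis using lift_diag(2)[OF ph x b] simplex_op_at(2)[OF ph x b] x b by (simp add: lift_Th)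
 qed
next
 fix w assume "w \<in> space N" and "m \<le> snd w"
 then have "Th j f' (v, snd w) = 0" for f' v by (simp add: Th_big)
 then show "Th j (simplex_op Xi ph f) w = diag ph (Th j f) w"
  by (cases w) (simp add: diag_def diagonal_op_def left_mult_def bisection_operator_def)
qed

lemma cycle_cong: assumes "\<And>b. b \<in> B ==> h b = h' b" shows "cycle h \<longleftrightarrow> cycle h'"
proof -
 have "kop face h b = kop face h' b" for b using assms by (rule kop_cong)
 then show ?thesis using antisym_cong[of h h' i] assms by (simp add: cycle_def)
qed

text \<open>Needed because a bisection fetches the chain over \<open>x\<close> from the fibre over
  another point of the orbit.\<close>

lemma AE_translate:
 assumes "AE x in M. P x" shows "AE x in M. \<forall>g\<in>carrier G. P (a g x)"
proof -
 have "AE x in M. P (a g x)" if g: "g \<in> carrier G" for g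
  by (rule AE_distrD[OF a_measurable[OF g]]) (simp only: a_distr[OF g] assms)
 then show ?thesis by (subst AE_ball_countable) (auto simp: countable_carrier)
qed

lemma simplex_op_cycles:
 assumes ph: "ph \<in> bisections R" and f: "f \<in> l2_cycles Xi i"
 shows "simplex_op Xi ph f \<in> l2_cycles Xi i" unfolding cycles_iff_AE
proof
 note fL = Th_L2[OF cycles_L2[OF f]]
 show "simplex_op Xi ph f \<in> L2 (W i)" by (rule Th_eq_L2[OF diag_L2(1)[OF ph fL] Th_simplex_op[OF ph]])
 have "AE x in M. \<forall>g\<in>carrier G. cycle (lift (Th i f) (a g x))"
  using f by (intro AE_translate) (simp add: cycles_iff_AE)
 then show "AE x in M. cycle (lift (Th i (simplex_op Xi ph f)) x)"
 proof (rule AE_mp, intro AE_I2 impI)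
  fix x assume x: "x \<in> space M" and c: "\<forall>g\<in>carrier G. cycle (lift (Th i f) (a g x))"
  let ?h = "lift (Th i (simplex_op Xi ph f)) x"
  have eq: "?h b = lift (diag ph (Th i f)) x b" if "b \<in> B" for b
   using Th_simplex_op[OF ph] in_space_N[OF x inv_closed[OF gpart_in[OF that]]] by (simp add: lift_def)
  show "cycle ?h"
  proof (cases "\<exists>y. (y, x) \<in> ph")
   case True
   then obtain y where yx: "(y, x) \<in> ph" by blast
   obtain g where g: "g \<in> carrier G" "a g x = y" using bisection_point(3)[OF ph yx] by blast
   have "cycle ?h \<longleftrightarrow> cycle (%b. lift (Th i f) y (mv g b))"
    by (rule cycle_cong) (simp add: eq lift_diag(1)[OF ph x _ yx g])
   moreover have "cycle (lift (Th i f) y)" using c g by auto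
   ultimately show ?thesis using cycle_mv[OF g(1)] by blast
  next
   case False
   have "cycle ?h \<longleftrightarrow> cycle (%b. 0)" by (rule cycle_cong) (use False in \<open>simp add: eq lift_diag(2)[OF ph x]\<close>)
   then show ?thesis by (simp add: cycle_def antisym_on_def kop_zero)
  qed
 qed
qed

text \<open>The harmonic part of a cycle. It will vanish on boundaries and carry the quotient norm,
  and so realizes the reduced homology inside the direct sum.\<close>

definition emb :: "('x \<times> 'v set list => complex) => ('x \<times> 'x) \<times> nat => complex" where
 "emb f = con.proj (Th i f)"

lemma emb_harm: "f \<in> L2 (W i) ==> emb f \<in> harm" unfolding emb_def by (intro proj_harm Th_L2)

lemma harm_L2: "F \<in> harm ==> F \<in> L2 N" by (simp add: harm_def)

text \<open>By \<open>laplace_cycle\<close>, \<open>T\<close> changes a cycle by the boundary of an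
  antisymmetric square integrable chain, so it does not change the homology class.\<close>

lemma T_cycle:
 assumes f: "f \<in> l2_cycles Xi i"
 shows "\<exists>u\<in>l2_chains Xi (Suc i). AE w in N. T (Th i f) w = Th i f w - Op face (Th (Suc i) u) w"
proof -
 note fL = Th_L2[OF cycles_L2[OF f]]
 \<comment> \<open>The factorial from \<open>laplace_cycle\<close> divided by the constant in
   \<open>T\<close>.\<close>
 define c :: complex where "c = fact (Suc (Suc i)) / of_real (Cst i)"
 define Q where "Q w = c * Op alt (Op (ktr face) (Th i f)) w" for w
 have Q: "Q \<in> L2 N" unfolding Q_def by (intro L2_scale Op_L2 kernel_alt kernel_tr kernel_face fL)
 define u where "u = \<Lambda> (Suc i) Q"
 let ?D = "%x. kop alt (kop (ktr face) (lift (Th i f) x))"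
 have h0: "lift (Th i f) x b = 0" if "x \<in> space M" "b \<in> B" "length b \<noteq> Suc i" for x b
  using that by (simp add: lift_Th)
 have lQ: "lift Q x b = c * ?D x b" if x: "x \<in> space M" and b: "b \<in> B" for x b
 proof -
  have "lift Q x b = c * lift (Op alt (Op (ktr face) (Th i f))) x b" by (simp add: lift_def Q_def)
  also have "... = c * kop alt (lift (Op (ktr face) (Th i f)) x) b" by (simp add: lift_Op[OF kernel_alt x b])
  also have "kop alt (lift (Op (ktr face) (Th i f)) x) b = ?D x b"
   by (rule kop_cong) (rule lift_Op[OF kernel_tr[OF kernel_face] x])
  finally show ?thesis .
 qed
 have lu: "lift (Th (Suc i) u) x b = c * ?D x b" if x: "x \<in> space M" and b: "b \<in> B" for x b
 proof (cases "length b = Suc (Suc i)")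
  case True
  then show ?thesis using x b by (simp add: lift_Th u_def \<Lambda>_pX Bl_def lQ)
 next
  case False
  then have "?D x b = 0" using x b by (intro coface_outside[of i]) (auto simp: h0)
  then show ?thesis using False x b by (simp add: lift_Th)
 qed
 have "u \<in> l2_chains Xi (Suc i)" unfolding chains_iff_AE
 proof
  show "u \<in> L2 (W (Suc i))" unfolding u_def by (rule \<Lambda>_L2[OF Q])
  show "AE x in M. antisym_on (Suc i) (lift (Th (Suc i) u) x)"
  proof (rule AE_I2)
   fix x assume x: "x \<in> space M"
   have "antisym_on (Suc i) (lift (Th (Suc i) u) x) \<longleftrightarrow> antisym_on (Suc i) (%b. c * ?D x b)"
    by (rule antisym_cong) (rule lu[OF x])
   then show "antisym_on (Suc i) (lift (Th (Suc i) u) x)"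
    using coface_antisym[of "lift (Th i f) x"] by (simp add: antisym_on_def)
  qed
 qed
 moreover have "AE w in N. T (Th i f) w = Th i f w - Op face (Th (Suc i) u) w"
 proof (rule AE_of_lift)
  have "AE x in M. cycle (lift (Th i f) x)" using f by (simp add: cycles_iff_AE)
  then show "AE x in M. \<forall>b\<in>B. lift (T (Th i f)) x b = lift (%w. Th i f w - Op face (Th (Suc i) u) w) x b"
  proof (rule AE_mp, intro AE_I2 impI ballI)
   fix x b assume x: "x \<in> space M" and c: "cycle (lift (Th i f) x)" and b: "b \<in> B"
   let ?h = "lift (Th i f) x"
   have "lift (T (Th i f)) x b = ?h b - kop kL ?h b / of_real (Cst i)"
    using h0[OF x b] by (auto simp: lift_Op[OF kernel_T x b] kop_T[OF b] ipart_Jix[OF b])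
   also have "kop kL ?h b = fact (Suc (Suc i)) * kop face (?D x) b"
    by (rule laplace_cycle[OF h0[OF x] c b])
   also have "?h b - fact (Suc (Suc i)) * kop face (?D x) b / of_real (Cst i) = ?h b - c * kop face (?D x) b"
    by (simp add: c_def)
   also have "c * kop face (?D x) b = kop face (lift (Th (Suc i) u) x) b"
    by (subst kop_scale[symmetric]) (rule kop_cong, rule lu[OF x, symmetric])
   also have "... = lift (Op face (Th (Suc i) u)) x b" by (rule lift_Op[OF kernel_face x b, symmetric])
   finally show "lift (T (Th i f)) x b = lift (%w. Th i f w - Op face (Th (Suc i) u) w) x b"
    by (simp add: lift_def)
  qed
  show "T (Th i f) w = Th i f w - Op face (Th (Suc i) u) w" if "m \<le> snd w" for w
   using that by (simp add: Th_big) (simp add: Op_def split_beta)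
 qed
 ultimately show ?thesis by blast
qed

lemma pow_cycle:
 assumes f: "f \<in> l2_cycles Xi i"
 shows "\<exists>u\<in>l2_chains Xi (Suc i). AE w in N. (T ^^ n) (Th i f) w = Th i (%v. f v - l2_boundary Xi (Suc i) u v) w"
proof (induction n)
 case 0
 have "(%v. 0) \<in> l2_chains Xi (Suc i)" by (simp add: l2_chains_def L2_zero)
 moreover have "l2_boundary Xi (Suc i) (%v. 0) = (%v. 0)"
  by (auto simp: l2_boundary_def simplicial_boundary_def)
 ultimately show ?case by (intro bexI[of _ "%v. 0"]) auto
next
 case (Suc n)
 then obtain u where u: "u \<in> l2_chains Xi (Suc i)"
  "AE w in N. (T ^^ n) (Th i f) w = Th i (%v. f v - l2_boundary Xi (Suc i) u v) w" by blast
 let ?f = "%v. f v - l2_boundary Xi (Suc i) u v"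
 have f': "?f \<in> l2_cycles Xi i" using cycles_lin[OF f boundary_cycle[OF u(1)], of "-1"] by simp
 obtain u' where u': "u' \<in> l2_chains Xi (Suc i)"
  "AE w in N. T (Th i ?f) w = Th i ?f w - Op face (Th (Suc i) u') w" using T_cycle[OF f'] by blast
 have "AE w in N. T ((T ^^ n) (Th i f)) w = T (Th i ?f) w"
  by (intro Op_cong_AE kernel_T con.pow_L2 Th_L2 cycles_L2 f f' u(2))
 with u'(2) have e': "AE w in N. (T ^^ Suc n) (Th i f) w = Th i ?f w - Op face (Th (Suc i) u') w" by auto
 have e: "Th i ?f w - Op face (Th (Suc i) u') w
   = Th i (%v. f v - l2_boundary Xi (Suc i) (%v. u v + 1 * u' v) v) w" if "w \<in> space N" for w
  using that unfolding Th_diff by (simp add: Th_boundary Th_lin[where c=1, simplified] Op_lin[where c=1, simplified])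
 show ?case using e' using chains_lin_AE[OF u(1) u'(1), of 1] by (auto simp: e)
qed

lemma proj_norm_le: assumes F: "F \<in> L2 N" shows "L2_norm N (con.proj F) \<le> L2_norm N F"
proof (rule LIMSEQ_le_const2)
 show "(%k. L2_norm N ((T ^^ (2*k)) F)) \<longlonglongrightarrow> L2_norm N (con.proj F)"
  by (intro L2_norm_tendsto con.pow_L2 con.proj_L2 con.proj_lim F)
 show "\<exists>N'. \<forall>k\<ge>N'. L2_norm N ((T ^^ (2*k)) F) \<le> L2_norm N F" using con.pow_contr[OF F] by blast
qed

text \<open>The counterpart on the relation of \<open>orthogonal_to_boundaries\<close>: on the
  antisymmetric chain \<open>u\<close> the kernel \<open>alt\<close> is a scalar, and on the other
  side it meets the coboundary condition of \<open>H\<close>.\<close>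

lemma inner_boundary:
 assumes u: "u \<in> l2_chains Xi (Suc i)" and H: "H \<in> harm"
 shows "L2_inner N (Op face (Th (Suc i) u)) H = 0"
proof -
 let ?U = "Th (Suc i) u" and ?X = "Op (ktr face) H"
 have U: "?U \<in> L2 N" using u by (intro Th_L2) (simp add: chains_iff_AE)
 note HL = harm_L2[OF H]
 have X: "?X \<in> L2 N" by (intro Op_L2 kernel_tr kernel_face HL)
 have "L2_inner N (Op face ?U) H = L2_inner N ?U ?X" by (rule Op_adjoint[OF kernel_face U HL])
 moreover have "fact (Suc (Suc i)) * L2_inner N ?U ?X = L2_inner N (%w. fact (Suc (Suc i)) * ?U w) ?X"
  by (rule L2_inner_scale[symmetric, OF U X])
 moreover have "L2_inner N (%w. fact (Suc (Suc i)) * ?U w) ?X = L2_inner N (Op alt ?U) ?X"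
 proof (rule L2_inner_cong_AE)
  show "AE w in N. fact (Suc (Suc i)) * ?U w = Op alt ?U w"
  proof (rule AE_of_lift)
   have "AE x in M. antisym_on (Suc i) (lift ?U x)" using u by (simp add: chains_iff_AE)
   then show "AE x in M. \<forall>b\<in>B. lift (%w. fact (Suc (Suc i)) * ?U w) x b = lift (Op alt ?U) x b"
   proof (rule AE_mp, intro AE_I2 impI ballI)
    fix x b assume x: "x \<in> space M" and as: "antisym_on (Suc i) (lift ?U x)" and b: "b \<in> B"
    have "kop alt (lift ?U x) b = fact (Suc (Suc i)) * lift ?U x b"
    proof (cases "length b = Suc (Suc i)")
     case True
     then show ?thesis using as b unfolding antisym_alt by blast
    next
     case False
     have "kop alt (lift ?U x) b = 0"
      unfolding kop_alt[OF b] by (rule) (use permute_B[OF b] False x in \<open>auto simp: lift_Th\<close>)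
     then show ?thesis using False x b by (simp add: lift_Th)
    qed
    then show "lift (%w. fact (Suc (Suc i)) * ?U w) x b = lift (Op alt ?U) x b"
     unfolding lift_Op[OF kernel_alt x b] by (simp add: lift_def)
   qed
   show "fact (Suc (Suc i)) * ?U w = Op alt ?U w" if "m \<le> snd w" for w
    using that by (simp add: Th_big) (simp add: Op_def split_beta)
  qed
 qed (auto intro: L2_scale Op_L2 kernel_alt U X)
 moreover have "L2_inner N (Op alt ?U) ?X = L2_inner N ?U (Op (ktr alt) ?X)" by (rule Op_adjoint[OF kernel_alt U X])
 moreover have "L2_inner N ?U (Op (ktr alt) ?X) = L2_inner N ?U (%w. 0)"
 proof (rule L2_inner_cong_AE)
  show "AE w in N. Op (ktr alt) ?X w = 0"
  proof (rule AE_of_lift)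
   show "AE x in M. \<forall>b\<in>B. lift (Op (ktr alt) ?X) x b = lift (%w. 0) x b" using harm_harmonic[OF H]
   proof (rule AE_mp, intro AE_I2 impI ballI)
    fix x b assume x: "x \<in> space M" and b: "b \<in> B"
     and h: "harmonic i (lift H x) \<and> (\<forall>b\<in>B. length b \<noteq> Suc i --> lift H x b = 0)"
    have "lift (Op (ktr alt) ?X) x b = kop alt (lift ?X x) b"
     by (simp add: lift_Op[OF kernel_tr[OF kernel_alt] x b] alt_transpose b)
    also have "... = kop alt (kop (ktr face) (lift H x)) b"
     by (rule kop_cong) (rule lift_Op[OF kernel_tr[OF kernel_face] x])
    finally show "lift (Op (ktr alt) ?X) x b = lift (%w. 0) x b"
     using h b coface_outside[of i "lift H x" b] by (auto simp: harmonic_def lift_def)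
   qed
  qed (simp add: Op_def split_beta)
 qed (auto intro: Op_L2 kernel_tr kernel_alt U X L2_zero)
 ultimately show ?thesis by (simp del: fact_Suc)
qed

lemma boundaries_L2: "g \<in> l2_boundaries Xi i ==> g \<in> L2 (W i)" by (simp add: l2_boundaries_def L2_closure_def)

text \<open>Were the harmonic part nonzero, a boundary closer to \<open>g\<close> than the norm of
  this part, and orthogonal to it, would contradict the Cauchy-Schwarz inequality.\<close>

lemma emb_boundary:
 assumes g: "g \<in> l2_boundaries Xi i" shows "AE w in N. emb g w = 0"
proof -
 note gL = boundaries_L2[OF g]
 note H = emb_harm[OF gL]
 note HL = harm_L2[OF H]
 have "L2_inner N (%v. Th i g v - emb g v) (emb g) = 0"
  unfolding emb_def by (rule con.proj_orthogonal[OF Th_L2[OF gL] _ T_harm])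
   (use HL H in \<open>simp_all add: emb_def\<close>)
 then have sq: "L2_inner N (Th i g) (emb g) = of_real ((L2_norm N (emb g))^2)"
  by (simp add: L2_inner_diff Th_L2 gL HL L2_inner_self)
 have "L2_norm N (emb g) = 0"
 proof (rule ccontr)
  assume "L2_norm N (emb g) \<noteq> 0"
  then have pos: "0 < L2_norm N (emb g)" using L2_norm_nonneg[of N "emb g"] by linarith
  then obtain u where u: "u \<in> l2_chains Xi (Suc i)"
   and d: "L2_norm (W i) (%v. g v - l2_boundary Xi (Suc i) u v) < L2_norm N (emb g)"
   using g unfolding l2_boundaries_def L2_closure_def by blast
  have bL: "l2_boundary Xi (Suc i) u \<in> L2 (W i)" by (rule cycles_L2[OF boundary_cycle[OF u]])
  let ?d = "%v. g v - l2_boundary Xi (Suc i) u v"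
  have dL: "?d \<in> L2 (W i)" by (rule L2_diff[OF gL bL])
  have "L2_inner N (Th i (l2_boundary Xi (Suc i) u)) (emb g) = L2_inner N (Op face (Th (Suc i) u)) (emb g)"
   using u by (intro L2_inner_cong_AE Th_L2 bL HL Op_L2 kernel_face) (auto simp: Th_boundary chains_iff_AE)
  then have "L2_inner N (Th i (l2_boundary Xi (Suc i) u)) (emb g) = 0" by (simp add: inner_boundary[OF u H])
  then have "(L2_norm N (emb g))^2 = cmod (L2_inner N (Th i ?d) (emb g))" by (simp add: Th_diff sq L2_inner_diff Th_L2 gL bL HL norm_power)
  also have "... \<le> L2_norm N (Th i ?d) * L2_norm N (emb g)" by (rule L2_Cauchy_Schwarz[OF Th_L2[OF dL] HL])
  also have "... < L2_norm N (emb g) * L2_norm N (emb g)" using d pos by (simp add: Th_norm[OF dL])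
  finally show False by (simp add: power2_eq_square)
 qed
 then show ?thesis by (simp add: L2_norm_eq_0_iff HL)
qed

lemma emb_lin:
 assumes "f \<in> L2 (W i)" "g \<in> L2 (W i)"
 shows "AE v in N. emb (%w. f w + c * g w) v = emb f v + c * emb g v"
 unfolding emb_def Th_lin by (intro con.proj_lin Th_L2 assms)

text \<open>Upper bound: \<open>emb\<close> is contractive and vanishes on boundaries. Lower bound:
  each power of \<open>T\<close> applied to the cycle is the cycle minus a boundary, and the norms
  of the even powers tend to that of \<open>emb f\<close>.\<close>

lemma emb_norm:
 assumes f: "f \<in> l2_cycles Xi i"
 shows "L2_norm N (emb f) = (INF g\<in>l2_boundaries Xi i. L2_norm (W i) (%v. f v - g v))"
proof (rule cInf_eq[symmetric])
 note fL = cycles_L2[OF f]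
 fix r assume "r \<in> (%g. L2_norm (W i) (%v. f v - g v)) ` l2_boundaries Xi i"
 then obtain g where g: "g \<in> l2_boundaries Xi i" "r = L2_norm (W i) (%v. f v - g v)" by blast
 note gL = boundaries_L2[OF g(1)]
 have d: "(%v. f v - g v) \<in> L2 (W i)" by (rule L2_diff[OF fL gL])
 have "AE v in N. emb (%v. f v + (-1) * g v) v = emb f v + (-1) * emb g v" by (rule emb_lin[OF fL gL])
 with emb_boundary[OF g(1)] have "AE v in N. emb f v = emb (%v. f v - g v) v" by auto
 then have "L2_norm N (emb f) = L2_norm N (emb (%v. f v - g v))"
  by (intro L2_norm_cong_AE harm_L2 emb_harm fL d)
 also have "... \<le> L2_norm N (Th i (%v. f v - g v))" unfolding emb_def by (rule proj_norm_le[OF Th_L2[OF d]])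
 finally show "L2_norm N (emb f) \<le> r" by (simp add: g(2) Th_norm[OF d])
next
 note fL = cycles_L2[OF f]
 fix r assume r: "\<And>s. s \<in> (%g. L2_norm (W i) (%v. f v - g v)) ` l2_boundaries Xi i ==> r \<le> s"
 show "r \<le> L2_norm N (emb f)"
 proof (rule LIMSEQ_le_const)
  show "(%k. L2_norm N ((T ^^ (2*k)) (Th i f))) \<longlonglongrightarrow> L2_norm N (emb f)"
   unfolding emb_def by (intro L2_norm_tendsto con.pow_L2 con.proj_L2 con.proj_lim Th_L2 fL)
  have "r \<le> L2_norm N ((T ^^ (2*k)) (Th i f))" for k
  proof -
   obtain u where u: "u \<in> l2_chains Xi (Suc i)"
    "AE w in N. (T ^^ (2*k)) (Th i f) w = Th i (%v. f v - l2_boundary Xi (Suc i) u v) w"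
    using pow_cycle[OF f] by blast
   let ?g = "l2_boundary Xi (Suc i) u"
   have gL: "?g \<in> L2 (W i)" by (rule cycles_L2[OF boundary_cycle[OF u(1)]])
   have d: "(%v. f v - ?g v) \<in> L2 (W i)" by (rule L2_diff[OF fL gL])
   have "?g \<in> l2_boundaries Xi i" unfolding l2_boundaries_def L2_closure_def
   proof (intro CollectI conjI allI impI gL)
    fix \<epsilon> :: real assume "0 < \<epsilon>"
    then show "\<exists>h\<in>l2_boundary Xi (Suc i) ` l2_chains Xi (Suc i). L2_norm (W i) (%v. ?g v - h v) < \<epsilon>"
     using u(1) by (intro bexI[of _ ?g]) (auto simp: L2_norm_def)
   qed
   then have "r \<le> L2_norm (W i) (%v. f v - ?g v)" by (intro r) blast
   also have "... = L2_norm N (Th i (%v. f v - ?g v))" by (rule Th_norm[OF d, symmetric])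
   also have "... = L2_norm N ((T ^^ (2*k)) (Th i f))"
    by (intro L2_norm_cong_AE con.pow_L2 Th_L2 fL d AE_symmetric[OF u(2)])
   finally show ?thesis .
  qed
  then show "\<exists>N'. \<forall>k\<ge>N'. r \<le> L2_norm N ((T ^^ (2*k)) (Th i f))" by blast
 qed
qed

lemma emb_onto:
 assumes F: "F \<in> harm" shows "\<exists>g\<in>l2_cycles Xi i. AE w in N. emb g w = F w"
proof -
 note c = harm_cycle[OF F]
 have "AE w in N. con.proj (Th i (\<Lambda> i F)) w = con.proj F w"
  by (intro con.proj_cong_AE Th_L2 cycles_L2 c harm_L2 F)
 with proj_harm_id[OF F] have "AE w in N. emb (\<Lambda> i F) w = F w" unfolding emb_def by auto
 then show ?thesis using c(1) by blast
qed

text \<open>Elements of the double commutant therefore commute with right translations, and so with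
  the equations of harmonic chains.\<close>

lemma rho_commutant: assumes g: "g \<in> carrier G" shows "rho g \<in> commutant R (left_mult ` bisections R)"
proof -
 have "L2_operator R (rho g)" unfolding L2_operator_def
 proof (intro conjI ballI allI)
  show "\<exists>C. \<forall>f\<in>L2 R. L2_norm R (rho g f) \<le> C * L2_norm R f" by (rule exI[of _ 1]) (simp add: rho_L2[OF g])
  show "rho g f \<in> L2 R" if "f \<in> L2 R" for f by (rule rho_L2(1)[OF g that])
 qed (simp add: rho_def split_beta)
 then show ?thesis unfolding commutant_def using rho_left_mult by auto
qed

lemma L2_operator_null:
 assumes X: "L2_operator R X" and f: "f \<in> L2 R" "AE v in R. f v = 0" shows "AE v in R. X f v = 0"
proof -
 obtain C where C: "\<forall>f\<in>L2 R. L2_norm R (X f) \<le> C * L2_norm R f" using X by (auto simp: L2_operator_def)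
 have XL: "X f \<in> L2 R" using X f by (simp add: L2_operator_def)
 have "L2_norm R f = 0" using f by (simp add: L2_norm_eq_0_iff)
 then have "L2_norm R (X f) \<le> 0" using C f(1) by auto
 then show ?thesis using L2_norm_nonneg[of R "X f"] by (simp add: L2_norm_eq_0_iff XL)
qed

lemma L2_operator_sum:
 assumes X: "L2_operator R X" and A: "finite A" "\<And>b. b \<in> A ==> f b \<in> L2 R"
 shows "AE v in R. X (%w. \<Sum>b\<in>A. c b * f b w) v = (\<Sum>b\<in>A. c b * X (f b) v)" using A
proof (induction A rule: finite_induct)
 case empty
 then show ?case using L2_operator_null[OF X L2_zero] by simp
next
 case (insert b A)
 let ?s = "%w. \<Sum>b\<in>A. c b * f b w"
 have s: "?s \<in> L2 R" using insert.prems by (intro L2_sum L2_scale) auto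
 have "AE v in R. X (%w. ?s w + c b * f b w) v = X ?s v + c b * X (f b) v"
  using X s insert.prems by (simp add: L2_operator_def)
 moreover have "AE v in R. X ?s v = (\<Sum>b\<in>A. c b * X (f b) v)" using insert by auto
 ultimately show ?case by eventually_elim (use insert.hyps in \<open>simp add: add.commute\<close>)
qed

lemma diagonal_op_L2:
 assumes X: "L2_operator R X" and F: "F \<in> L2 N" shows "diagonal_op X F \<in> L2 N"
proof -
 obtain C where "\<forall>f\<in>L2 R. L2_norm R (X f) \<le> C * L2_norm R f" using X by (auto simp: L2_operator_def)
 then have C: "\<And>f. f \<in> L2 R ==> L2_norm R (X f) \<le> C * L2_norm R f" by blast
 have XL: "X (%v. F (v, k)) \<in> L2 R" for k using X L2_slice[OF F] by (simp add: L2_operator_def)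
 have sl: "(%v. diagonal_op X F (v, k)) = X (%v. F (v, k))" for k by (simp add: diagonal_op_def)
 have m: "diagonal_op X F \<in> borel_measurable N"
  unfolding N_measurable_iff sl using L2_measurable[OF XL] by blast
 have "nn_integral N (%w. nsq (diagonal_op X F w)) = (\<Sum>k. \<integral>\<^sup>+v. nsq (diagonal_op X F (v, k)) \<partial>R)"
  by (rule N_nn_integral_suminf) (use m in simp)
 also have "... = (\<Sum>k. ennreal ((L2_norm R (X (%v. F (v, k))))^2))"
  by (intro suminf_cong) (simp add: L2_norm_nn_integral[OF XL], simp add: diagonal_op_def)
 also have "... \<le> (\<Sum>k. ennreal (C^2) * ennreal ((L2_norm R (%v. F (v, k)))^2))"
 proof (rule suminf_le)
  fix k
  have "(L2_norm R (X (%v. F (v, k))))^2 \<le> (C * L2_norm R (%v. F (v, k)))^2"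
   by (rule power_mono[OF C[OF L2_slice[OF F]]]) simp
  then show "ennreal ((L2_norm R (X (%v. F (v, k))))^2) \<le> ennreal (C^2) * ennreal ((L2_norm R (%v. F (v, k)))^2)"
   by (simp add: ennreal_mult[symmetric] power_mult_distrib)
 qed auto
 also have "... = ennreal (C^2) * ennreal ((L2_norm N F)^2)" by (simp add: L2_norm_slices[OF F])
 also have "... < \<infinity>" by (simp add: ennreal_mult_less_top)
 finally show ?thesis by (simp add: L2_iff_nn_integral m)
qed

lemma Op_slice:
 "j < m ==> (%v. Op k F (v, j)) = (%v. \<Sum>b'\<in>supp k (rp j). of_real (k (rp j) b') * rho (gpart b') (%v. F (v, ipart b')) v)"
 by (auto simp: Op_def rho_def)

text \<open>Each row of \<open>Op (eqs i)\<close> is a finite combination of right translations of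
  slices, so an element of the algebra passes through it; finiteness matters because linearity and
  commutation hold only up to null sets.\<close>

lemma algebra_harm:
 assumes X: "X \<in> rel_algebra R" and F: "F \<in> harm" shows "diagonal_op X F \<in> harm"
proof -
 have op: "L2_operator R X" and comm: "\<And>g f. g \<in> carrier G ==> f \<in> L2 R ==> AE v in R. X (rho g f) v = rho g (X f) v"
  using X rho_commutant unfolding rel_algebra_def commutant_def[of R "commutant _ _"] by auto
 have FL: "F \<in> L2 N" and Fc: "AE w in N. F w = cut F w" and FE: "AE w in N. Op (eqs i) F w = 0"
  using F by (auto simp: harm_def)
 have Fk: "(%v. F (v, k)) \<in> L2 R" for k by (rule L2_slice[OF FL])
 have "AE w in N. diagonal_op X F w = cut (diagonal_op X F) w" unfolding AE_N_slices
 proof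
  fix k
  show "AE v in R. diagonal_op X F (v, k) = cut (diagonal_op X F) (v, k)"
  proof (cases "k \<in> Jix i")
   case False
   have "AE v in R. F (v, k) = 0" using spec[OF Fc[unfolded AE_N_slices], of k] False by (simp add: cut_def)
   then have "AE v in R. X (%v. F (v, k)) v = 0" by (rule L2_operator_null[OF op Fk])
   then show ?thesis by (simp add: cut_def diagonal_op_def)
  qed (simp add: cut_def)
 qed
 moreover have "AE w in N. Op (eqs i) (diagonal_op X F) w = 0" unfolding AE_N_slices
 proof
  fix j
  show "AE v in R. Op (eqs i) (diagonal_op X F) (v, j) = 0"
  proof (cases "j < m")
   case True
   let ?S = "supp (eqs i) (rp j)"
   have fin: "finite ?S" by (rule finite_supp[OF E rp_in[OF True]])
   have SB: "b' \<in> B" if "b' \<in> ?S" for b' using that supp_subset by blast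
   let ?f = "%b'. rho (gpart b') (%v. F (v, ipart b'))"
   have fL: "?f b' \<in> L2 R" if "b' \<in> ?S" for b' using rho_L2(1)[OF gpart_in[OF SB[OF that]] Fk] .
   have "AE v in R. Op (eqs i) F (v, j) = 0" using FE unfolding AE_N_slices by blast
   moreover have "(%v. Op (eqs i) F (v, j)) \<in> L2 R" by (rule L2_slice[OF Op_L2[OF E FL]])
   ultimately have "AE v in R. X (%v. Op (eqs i) F (v, j)) v = 0" by (intro L2_operator_null[OF op])
   moreover have "AE v in R. X (%v. Op (eqs i) F (v, j)) v = (\<Sum>b'\<in>?S. of_real (eqs i (rp j) b') * X (?f b') v)"
    unfolding Op_slice[OF True] by (rule L2_operator_sum[OF op fin fL])
   moreover have "AE v in R. \<forall>b'\<in>?S. X (?f b') v = rho (gpart b') (X (%v. F (v, ipart b'))) v"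
    using comm gpart_in SB Fk by (intro AE_finite_allI fin) auto
   ultimately show ?thesis
   proof eventually_elim
    case (elim v)
    have "Op (eqs i) (diagonal_op X F) (v, j)
      = (\<Sum>b'\<in>?S. of_real (eqs i (rp j) b') * rho (gpart b') (X (%v. F (v, ipart b'))) v)"
     using fun_cong[OF Op_slice[OF True, of "eqs i" "diagonal_op X F"], of v] by (simp add: diagonal_op_def)
    also have "... = (\<Sum>b'\<in>?S. of_real (eqs i (rp j) b') * X (?f b') v)" using elim(3) by simp
    finally show ?case using elim(1,2) by simp
   qed
  qed (simp add: Op_def split_beta)
 qed
 ultimately show ?thesis using diagonal_op_L2[OF op FL] by (simp add: harm_def)
qed

lemma emb_module: "module_embedding R (W i) (simplex_op Xi) (l2_cycles Xi i) (l2_boundaries Xi i) emb"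
 unfolding module_embedding_def
proof (intro conjI ballI allI)
 fix f assume f: "f \<in> l2_cycles Xi i"
 note fL = cycles_L2[OF f]
 show "emb f \<in> L2 N" by (rule harm_L2[OF emb_harm[OF fL]])
 show "L2_norm N (emb f) = (INF g\<in>l2_boundaries Xi i. L2_norm (W i) (%v. f v - g v))" by (rule emb_norm[OF f])
 show "AE v in N. emb (%w. f w + c * g w) v = emb f v + c * emb g v" if "g \<in> l2_cycles Xi i" for g c
  by (rule emb_lin[OF fL cycles_L2[OF that]])
 show "AE v in N. emb (simplex_op Xi ph f) v = diagonal_op (left_mult ph) (emb f) v" if ph: "ph \<in> bisections R" for ph
 proof -
  have "AE w in N. con.proj (Th i (simplex_op Xi ph f)) w = con.proj (diag ph (Th i f)) w"
   by (intro con.proj_cong_AE Th_L2 cycles_L2 simplex_op_cycles f diag_L2) (auto intro!: Th_simplex_op ph)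
  moreover have "AE w in N. con.proj (diag ph (Th i f)) w = diag ph (emb f) w"
   unfolding emb_def by (rule proj_diag[OF ph Th_L2[OF fL]])
  ultimately show ?thesis unfolding emb_def diag_def by auto
 qed
 show "\<exists>g\<in>l2_cycles Xi i. AE v in N. emb g v = diagonal_op X (emb f) v" if "X \<in> rel_algebra R" for X
  by (rule emb_onto[OF algebra_harm[OF that emb_harm[OF fL]]])
qed

lemma emb_projection: "orthogonal_projection_onto N (emb ` l2_cycles Xi i) con.proj"
 unfolding orthogonal_projection_onto_def
proof (intro ballI conjI)
 fix F assume F: "F \<in> L2 N"
 show "con.proj F \<in> L2 N" by (rule con.proj_L2[OF F])
 obtain g where "g \<in> l2_cycles Xi i" "AE w in N. emb g w = con.proj F w"
  using emb_onto[OF proj_harm[OF F]] by blast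
 then show "\<exists>E\<in>emb ` l2_cycles Xi i. AE v in N. con.proj F v = E v" using AE_symmetric by blast
 fix E assume "E \<in> emb ` l2_cycles Xi i"
 then have "E \<in> harm" using emb_harm[OF cycles_L2] by blast
 then show "L2_inner N (%v. F v - con.proj F v) E = 0" by (intro con.proj_orthogonal F T_harm harm_L2)
qed

theorem l2_betti_harmonic: "l2_betti i Xi R = ennreal (\<Sum>j\<in>Jix i. (L2_norm N (con.proj (e j)))^2)"
proof -
 have "l2_betti i Xi R = (\<Sum>k. ennreal ((L2_norm N (con.proj (e k)))^2))" unfolding l2_betti_def
 proof (rule rel_dim_eq[OF _ _ emb_module emb_projection])
  show "(%v. f v + c * f' v) \<in> l2_cycles Xi i" if "f \<in> l2_cycles Xi i" "f' \<in> l2_cycles Xi i" for f f' c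
   by (rule cycles_lin[OF that])
  show "simplex_op Xi (graph_of g A) f \<in> l2_cycles Xi i" if "g \<in> carrier G" "A \<in> sets M" "f \<in> l2_cycles Xi i" for g A f
   using that by (intro simplex_op_cycles graph_of_bisection)
 qed
 also have "... = ennreal (\<Sum>j\<in>Jix i. (L2_norm N (con.proj (e j)))^2)" by (rule proj_trace(1))
 finally show ?thesis .
qed

end

section \<open>The approximation theorem\<close>

context orbit_complex begin

lemma trace_sum_divide: "trace_sum k j (%\<gamma>. ph \<gamma> / c) = trace_sum k j ph / c"
 by (simp add: trace_sum_def sum_divide_distrib)

lemma trace_sum_tendsto:
 assumes "\<And>\<gamma>. \<gamma> \<in> carrier G ==> ((%n. ph n \<gamma>) \<longlongrightarrow> \<psi> \<gamma>) \<U>"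
 shows "((%n. trace_sum k j (ph n)) \<longlongrightarrow> trace_sum k j \<psi>) \<U>"
 unfolding trace_sum_def by (intro tendsto_sum tendsto_mult tendsto_const assms) (simp add: fixers_def)

text \<open>The number of \<open>i\<close>-simplices is the index times \<open>card (Jix i)\<close>,
  so after division by the index the error no longer depends on the subgroup.\<close>

lemma betti_trace_bound:
 assumes S: "subgroup S G" "finite (lcosets S)"
  and approx: "\<And>(Q :: 'v set list set) A S. integral_psd (Cst i) Q A ==> onbasis Q (integral_psd.ker Q A) S ==>
   cmod (op_trace Q (contracted_op (Cst i) Q A ^^ (2*k)) - of_nat (card S)) \<le> \<eta> * real (card Q)"
 shows "\<bar>(\<Sum>j\<in>Jix i. trace_sum (kpow kT (2*k)) j (%\<gamma>. real (card {y \<in> lcosets S. \<gamma> <# y = y}) / real (card (lcosets S))))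
   - real (betti i (quotient_complex G S \<Sigma> act)) / real (card (lcosets S))\<bar> \<le> \<eta> * real (card (Jix i))"
proof -
 interpret sq: simplicial_quotient G \<Sigma> act rp m i S by (intro simplicial_quotient.intro simplicial_degree_axioms simplicial_quotient_axioms.intro S)
 let ?c = "real (card (lcosets S))" and ?K = "quotient_complex G S \<Sigma> act"
 let ?t = "\<Sum>j\<in>Jix i. trace_sum (kpow kT (2*k)) j (%\<gamma>. real (card {y \<in> lcosets S. \<gamma> <# y = y}))"
 have "lcosets S \<noteq> {}" by (auto simp: LCOSETS_def)
 then have c: "0 < ?c" using S(2) by auto
 obtain S' where S': "onbasis sq.Q (integral_psd.ker sq.Q (sq.kmat kL)) S'" "betti i ?K = card S'"
  using sq.betti_harmonic by blast
 have "cmod (of_real ?t - of_nat (betti i ?K)) \<le> \<eta> * real (card sq.Q)"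
  using approx[OF sq.integral_psd_quotient S'(1)] unfolding sq.contracted_trace S'(2) .
 also have "of_real ?t - of_nat (betti i ?K) = complex_of_real (?t - real (betti i ?K))" by simp
 finally have "\<bar>?t - real (betti i ?K)\<bar> \<le> \<eta> * (?c * real (card (Jix i)))"
  by (simp only: norm_of_real sq.card_Q of_nat_mult)
 then have "\<bar>?t - real (betti i ?K)\<bar> / ?c \<le> \<eta> * real (card (Jix i))"
  using c by (simp add: divide_le_eq mult_ac)
 moreover have "\<bar>?t / ?c - real (betti i ?K) / ?c\<bar> = \<bar>?t - real (betti i ?K)\<bar> / ?c" by (simp add: diff_divide_distrib[symmetric])
 ultimately show ?thesis unfolding trace_sum_divide sum_divide_distrib[symmetric] by simp
qed

text \<open>One exponent makes the traces close to the dimensions on the relation and on every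
  finite quotient. For this exponent both traces are finite sums of fixed point densities, which
  converge along the ultrafilter.\<close>

theorem betti_limit:
 fixes H :: "nat => 'g set"
 assumes H: "\<And>n. subgroup (H n) G" "\<And>n. finite (lcosets (H n))"
  and fix_points: "\<And>g. g \<in> carrier G ==>
   ((%n. real (card {y \<in> lcosets (H n). g <# y = y}) / real (card (lcosets (H n))))
    \<longlongrightarrow> measure M {x \<in> space M. a g x = x}) \<U>"
 shows "((%n. real (betti i (quotient_complex G (H n) \<Sigma> act)) / real (card (lcosets (H n))))
  \<longlongrightarrow> (\<Sum>j\<in>Jix i. (L2_norm N (con.proj (e j)))^2)) \<U>"
proof (rule tendstoI)
 fix \<epsilon> :: real assume \<epsilon>: "0 < \<epsilon>"
 let ?L = "\<Sum>j\<in>Jix i. (L2_norm N (con.proj (e j)))^2"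
 let ?b = "%n. real (betti i (quotient_complex G (H n) \<Sigma> act)) / real (card (lcosets (H n)))"
 let ?t = "%k n. \<Sum>j\<in>Jix i. trace_sum (kpow kT (2*k)) j (%\<gamma>. real (card {y \<in> lcosets (H n). \<gamma> <# y = y}) / real (card (lcosets (H n))))"
 let ?u = "%k. \<Sum>j\<in>Jix i. trace_sum (kpow kT (2*k)) j (%\<gamma>. measure M {x \<in> space M. a \<gamma> x = x})"
 define \<eta> where "\<eta> = \<epsilon> / (3 * (real (card (Jix i)) + 1))"
 have \<eta>: "0 < \<eta>" using \<epsilon> by (simp add: \<eta>_def)
 have \<eta>d: "\<eta> * real (card (Jix i)) \<le> \<epsilon> / 3" using \<eta> by (simp add: \<eta>_def field_simps)
 have "\<forall>\<^sub>F k in sequentially. dist (?u k) ?L < \<epsilon> / 3" using \<epsilon> by (intro tendstoD[OF proj_trace(2)]) simp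
 then obtain K where K: "\<And>k. K \<le> k ==> dist (?u k) ?L < \<epsilon> / 3" by (auto simp: eventually_sequentially)
 obtain k where k: "\<And>(Q :: 'v set list set) A S. integral_psd (Cst i) Q A ==> onbasis Q (integral_psd.ker Q A) S ==>
   cmod (op_trace Q (contracted_op (Cst i) Q A ^^ (2*k)) - of_nat (card S)) \<le> \<eta> * real (card Q)" and "K \<le> k"
  by (rule kernel_dimension_approximation[OF C1 \<eta>, of K]) blast
 have "\<forall>\<^sub>F n in \<U>. dist (?t k n) (?u k) < \<epsilon> / 3"
  using \<epsilon> by (intro tendstoD tendsto_sum trace_sum_tendsto fix_points) auto
 then show "\<forall>\<^sub>F n in \<U>. dist (?b n) ?L < \<epsilon>"
 proof eventually_elim
  case (elim n)
  have "\<bar>?t k n - ?b n\<bar> \<le> \<eta> * real (card (Jix i))" by (rule betti_trace_bound[OF H k])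
  then show ?case using elim K[OF \<open>K \<le> k\<close>] \<eta>d unfolding dist_real_def by linarith
 qed
qed

end

text \<open>Elements are words in the generators and their inverses. Finite generation is used
  through countability, which makes the fibres of the orbit relation countable.\<close>

lemma (in group) countable_generate:
 assumes S: "countable S" "S \<subseteq> carrier G" shows "countable (generate G S)"
proof -
 let ?T = "S \<union> m_inv G ` S"
 let ?p = "%xs. foldr (\<otimes>) xs \<one>"
 have T: "?T \<subseteq> carrier G" using S(2) by auto
 have closed: "?p xs \<in> carrier G" if "set xs \<subseteq> ?T" for xs using that T by (induction xs) auto
 have app: "?p (xs @ ys) = ?p xs \<otimes> ?p ys" if "set xs \<subseteq> ?T" "set ys \<subseteq> ?T" for xs ys using that(1)
 proof (induction xs)
  case Nil
  then show ?case using closed[OF that(2)] by simp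
 next
  case (Cons x xs)
  show ?case using T using Cons closed[of xs] closed[OF that(2)] by (auto simp: m_assoc)
 qed
 have "\<exists>xs\<in>lists ?T. g = ?p xs" if "g \<in> generate G S" for g using that
 proof (induction rule: generate.induct)
  case one
  show ?case by (rule bexI[of _ "[]"]) auto
 next
  case (incl h)
  then show ?case using S(2) by (intro bexI[of _ "[h]"]) auto
 next
  case (inv h)
  then show ?case using S(2) by (intro bexI[of _ "[inv h]"]) auto
 next
  case (eng h1 h2)
  then obtain xs ys where l: "xs \<in> lists ?T" "ys \<in> lists ?T" and h: "h1 = ?p xs" "h2 = ?p ys" by blast
  have "set xs \<subseteq> ?T" "set ys \<subseteq> ?T" using l by auto
  then show ?case unfolding h using l by (intro bexI[of _ "xs @ ys"]) (simp_all only: app append_in_lists_conv)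
 qed
 then have "generate G S \<subseteq> ?p ` lists ?T" by blast
 moreover have "countable (?p ` lists ?T)" using S(1) by simp
 ultimately show ?thesis by (rule countable_subset)
qed

theorem corollary1p11:
  fixes G :: "('g, 'm) monoid_scheme"
    and H :: "nat \<Rightarrow> 'g set"
    and \<U> :: "nat filter"
    and \<Sigma> :: "'v set set"
    and act :: "'g \<Rightarrow> 'v \<Rightarrow> 'v"
    and i :: nat
  assumes "group G"
    and "\<exists>S. finite S \<and> S \<subseteq> carrier G \<and> generate G S = carrier G"
    and "\<And>n. subgroup (H n) G"
    and "\<And>n. finite (lcosets\<^bsub>G\<^esub> (H n))"
    and "nonprincipal_ultrafilter \<U>"
    and "abstract_complex \<Sigma>"
    and "simplicial_action G \<Sigma> act"
    and "free_action G \<Sigma> act"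
    and "cocompact_action G \<Sigma> act"
    and "quotient_is_complex G \<Sigma> act"
  shows "((\<lambda>n. ennreal (real (betti i (quotient_complex G (H n) \<Sigma> act)) / real (card (lcosets\<^bsub>G\<^esub> (H n)))))
      \<longlongrightarrow> l2_betti i
            (isotropy_quotient G (loeb_measure G H \<U>) (ultra_action G H \<U>) \<Sigma> act)
            (orbit_relation_measure G (loeb_measure G H \<U>) (ultra_action G H \<U>))) \<U>"
proof -
 let ?M = "loeb_measure G H \<U>" and ?a = "ultra_action G H \<U>"
 interpret group G by fact
 interpret cs: coset_sequence G H \<U> by (intro coset_sequence.intro coset_sequence_axioms.intro assms)
 obtain S where S: "finite S" "S \<subseteq> carrier G" "generate G S = carrier G" using assms(2) by blast
 have pmp: "pmp_action G ?M ?a"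
 proof
  show "countable (carrier G)" using countable_generate[of S] S by (simp add: countable_finite)
  show "{x \<in> space ?M. ?a g x = x} \<in> sets ?M" if "g \<in> carrier G" for g
   using cs.fix_sets[OF that] by (simp only: cs.space_loeb)
 qed (simp_all add: cs.emeasure_loeb_space[unfolded cs.space_loeb] cs.space_loeb cs.act_in cs.act_mult cs.act_one cs.act_measurable cs.act_distr)
 have "\<exists>rp m. orbit_complex G \<Sigma> act rp m ?M ?a"
 proof -
  interpret free_simplicial G \<Sigma> act by unfold_locales (fact assms)+
  obtain rp m where "free_gset G B mv rp m" by (rule reps_exist[OF assms(9)])
  then interpret free_gset G B mv rp m .
  interpret pmp_action G ?M ?a by (rule pmp)
  have "orbit_complex G \<Sigma> act rp m ?M ?a" by unfold_locales
  then show ?thesis by blast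
 qed
 then obtain rp m where oc: "orbit_complex G \<Sigma> act rp m ?M ?a" by blast
 interpret orbit_complex G \<Sigma> act rp m i ?M ?a by (rule oc)
 have "((%n. real (betti i (quotient_complex G (H n) \<Sigma> act)) / real (card (lcosets\<^bsub>G\<^esub> (H n))))
  \<longlongrightarrow> (\<Sum>j\<in>Jix i. (L2_norm N (con.proj (e j)))^2)) \<U>"
  using cs.fix_measure by (intro betti_limit assms(3,4)) (simp only: cs.space_loeb)
 from tendsto_ennrealI[OF this] show ?thesis by (simp only: l2_betti_harmonic)
qed

end
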